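(* Let $\mathcal C$ be a relative $\mathcal G$-Hermitian-spherical category over $\Bbbk$ with singular set $\mathcal X$, where $\mathcal X$ contains all elements of $\mathcal G$ of order $2$ and $3$. Then $\mathcal C$ determines $\mathcal G$-LW data $(\mathcal G,\mathcal X,(I_g)_{g\in\mathcal G},\delta,\mathsf b,\mathsf d,N,\beta,\gamma)$ as follows. Let $(V_i)_{i\in I}$ be a family of representatives of the isomorphism classes of generic simple objects and let $(w_i)_i$, $(\mathsf y^{ijk}_n)$ be Hermitian basic data for $\mathcal C$ (which exist under this hypothesis). Then $I_g=\{i\in I:V_i\in\mathcal C_g\}$; $\delta_{ijk}=\dim_\Bbbk\mathrm{Hom}_{\mathcal C}(\mathbb I,V_i\otimes V_j\otimes V_k)$; $\mathsf b(i)=\mathsf b(V_i)$ and $\mathsf d(i)=\mathsf d(V_i)$ come from the relative spherical structure; $\beta$ is defined by $w_i^\dagger=\beta(i)w_i^{-1}$; $\gamma^n_{i,j,k}=(\mathsf y_n^{ijk}\mid\mathsf y_n^{ijk})$; and $N$ is the family of modified $6j$-symbols of $\mathcal C$ defined by the tetrahedral graph.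
   Context: Let $\Bbbk$ be a field with involutive automorphism $x\mapsto\bar x$. **Hermitian pivotal.** A tensor $\Bbbk$-category has $\Bbbk$-linear homs, bilinear $\circ,\otimes$, and $\Bbbk\cong\mathrm{End}(\mathbb I)$. It is pivotal if every $V$ has a dual $V^*$ and morphisms $\mathrm{coev}_V:\mathbb I\to V\otimes V^*$, $\mathrm{ev}_V:V^*\otimes V\to\mathbb I$, $\widetilde{\mathrm{coev}}_V:\mathbb I\to V^*\otimes V$, $\widetilde{\mathrm{ev}}_V:V\otimes V^*\to\mathbb I$ with the usual compatibilities; $\phi_V:V\to V^{**}$ is the pivotal isomorphism. It is Hermitian pivotal if there are bijections $f\mapsto f^\dagger$, $\mathrm{Hom}(V,W)\to\mathrm{Hom}(W,V)$, with $(\mu f+\lambda g)^\dagger=\bar\mu f^\dagger+\bar\lambda g^\dagger$, $(f\otimes g)^\dagger=f^\dagger\otimes g^\dagger$, $(fg)^\dagger=g^\dagger f^\dagger$, $\mathrm{coev}_V^\dagger=\widetilde{\mathrm{ev}}_V$, $\mathrm{ev}_V^\dagger=\widetilde{\mathrm{coev}}_V$, $\widetilde{\mathrm{coev}}_V^\dagger=\mathrm{ev}_V$, $\widetilde{\mathrm{ev}}_V^\dagger=\mathrm{coev}_V$ and $f^{\dagger\dagger}=f$. **m-trace.** An m-trace on the full subcategory $\mathsf{Proj}$ of projective objects is a family of linear maps $\mathsf t_V:\mathrm{End}(V)\to\Bbbk$ with $\mathsf t_V(gf)=\mathsf t_U(fg)$ for $f:V\to U$, $g:U\to V$, and $\mathsf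 t_{U\otimes W}(f)=\mathsf t_U((\mathrm{Id}_U\otimes\widetilde{\mathrm{ev}}_W)(f\otimes\mathrm{Id})(\mathrm{Id}_U\otimes\mathrm{coev}_W))$, $\mathsf t_{W\otimes U}(f)=\mathsf t_U((\mathrm{ev}_W\otimes\mathrm{Id}_U)(\mathrm{Id}\otimes f)(\widetilde{\mathrm{coev}}_W\otimes\mathrm{Id}_U))$ for $U\in\mathsf{Proj}$ and any $W$. It is real if $\mathsf t(f^\dagger)=\overline{\mathsf t(f)}$. **Relative Hermitian-spherical.** $\mathcal C$ is $\mathcal G$-graded ($\mathcal G$ abelian) if $\mathcal C=\bigoplus_g\mathcal C_g$ with non-empty full subcategories, $\mathbb I\in\mathcal C_0$, $\mathcal C_g\otimes\mathcal C_{g'}\subset\mathcal C_{g+g'}$, and no non-zero morphisms between different degrees. $\mathcal X\subset\mathcal G$ is symmetric if $-\mathcal X=\mathcal X$ and small if no finite union of translates of $\mathcal X$ covers $\mathcal G$. A relative $\mathcal G$-spherical category is a $\Bbbk$-linear pivotal $\mathcal G$-graded category with a small symmetric $\mathcal X$ such that for $g\notin\mathcal X$ all objects of $\mathcal C_g$ are semisimple and $\mathcal C_g$ has finitely many isomorphism classes of simple objects (simple objects in such degrees are called generic; $\mathsf A$ is their class), with an m-trace on $\mathsf{Proj}$ such that $\mathsf d(V)=\mathsf t_V(\mathrm{Id}_V)$ defines a map $\mathsf A\to\Bbbk^*$, and a map $\mathsf b:\mathsf A\to\Bbbk^*$, invariant under isomorphism and duality, with $\mathsf b(V)=\sum_{V_1\in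 irr(\mathcal C_{g_1}),V_2\in irr(\mathcal C_{g_2})}\mathsf b(V_1)\mathsf b(V_2)\dim\mathrm{Hom}(V,V_1\otimes V_2)$ for $g_1,g_2,g_1+g_2\notin\mathcal X$ and $V\in\mathsf A\cap\mathcal C_{g_1+g_2}$, where $irr(\mathcal C_{g})$ is a set of representatives of the isomorphism classes of simple objects of $\mathcal C_g$. It is relative $\mathcal G$-Hermitian-spherical if it is also Hermitian pivotal and the m-trace is real. **Hermitian basic data.** $*$ is the involution of $I$ with $V_{i^*}\simeq V_i^*$. Basic data are isomorphisms $w_i:V_i\to V_{i^*}^*$ with $w_{i^*}=(w_i)^*\circ\phi_{V_{i^*}}$. Put $\mathcal H^{ijk}=\mathrm{Hom}(\mathbb I,V_i\otimes V_j\otimes V_k)$, with pairing $\Theta_{ijk}:\mathcal H^{k^*j^*i^*}\otimes\mathcal H^{ijk}\to\Bbbk$, $\Theta_{ijk}(y',y)=\mathsf t_{V_i\otimes V_j\otimes V_k}(y\,(y')^*(w_i\otimes w_j\otimes w_k))$, Hermitian form $(y_1\mid y_2)=\mathsf t_{V_i\otimes V_j\otimes V_k}(y_2y_1^\dagger)$, and $\mathrm{rot}_{ijk}:\mathcal H^{ijk}\to\mathcal H^{jki}$, $y\mapsto(\mathrm{ev}_{V_i}\otimes\mathrm{Id})(\mathrm{Id}_{V_i^*}\otimes y\otimes\mathrm{Id}_{V_i})\widetilde{\mathrm{coev}}_{V_i}$. Hermitian basic data are basic data together with bases $(\mathsf y_n^{ijk})_{1\le n\le\delta_{ijk}}$ of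 the $\mathcal H^{ijk}$ such that $\Theta_{ijk}(\mathsf y_m^{k^*j^*i^*},\mathsf y_n^{ijk})=\delta_{m,n}$, the basis is orthogonal for $(\cdot\mid\cdot)$ with $(\mathsf y_n^{ijk}\mid\mathsf y_n^{ijk})\in\Bbbk^*$, and $\mathrm{rot}_{ijk}(\mathsf y_n^{ijk})=\mathsf y_n^{jki}$. **Modified $6j$-symbols.** $N^{j_1j_2j_3}_{j_4j_5j_6}(^{a_1a_2}_{a_3a_4})$ is the m-trace evaluation of the spherical tetrahedral graph whose four vertices, with clockwise inward labels $(j_1,j_2,j_3^* ),(j_3,j_4,j_5^* ),(j_5,j_6^*,j_1^* ),(j_6,j_4^*,j_2^* )$, are colored by $\mathsf y_{a_1}^{j_1j_2j_3^*},\mathsf y_{a_2}^{j_3j_4j_5^*},\mathsf y_{a_3}^{j_5j_6^*j_1^*},\mathsf y_{a_4}^{j_6j_4^*j_2^*}$, edges being contracted with the pairings $\omega_j=\mathrm{ev}_{V_j}(w_{j^*}\otimes\mathrm{Id}_{V_j}):V_{j^*}\otimes V_j\to\mathbb I$. Explicitly $N=\Theta_{j_3j_4j_5^*}(z,\mathsf y_{a_2}^{j_3j_4j_5^*})$, where $z\in\mathcal H^{j_5j_4^*j_3^*}$ is obtained from $(\mathrm{Id}_{V_{j_5}\otimes V_{j_6^*}}\otimes\mathsf y_{a_4}^{j_6j_4^*j_2^*}\otimes\mathrm{Id}_{V_{j_1^*}})\mathsf y_{a_3}^{j_5j_6^*j_1^*}\otimes\mathsf y_{a_1}^{j_1j_2j_3^*}$,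 with values in $V_{j_5}\otimes V_{j_6^*}\otimes V_{j_6}\otimes V_{j_4^*}\otimes V_{j_2^*}\otimes V_{j_1^*}\otimes V_{j_1}\otimes V_{j_2}\otimes V_{j_3^*}$, by applying $\omega_{j_6}$, $\omega_{j_1}$, and then $\omega_{j_2}$ to the adjacent factors. By convention $\mathsf y_n^{ijk}=0$ for $n>\delta_{ijk}$, so $N=0$ if some $a_l$ exceeds the dimension of the corresponding space. **$\mathcal G$-LW data**: (1) an abelian group $\mathcal G$; (2) a symmetric small $\mathcal X\subset\mathcal G$; (3) sets $I_g$, $g\in\mathcal G\setminus\mathcal X$ ($|j|=g$ for $j\in I_g$); (4) an involution $*$ on $\mathsf A=\bigsqcup I_g$ (here $\mathsf A$ denotes the set of labels) with $I_g^*=I_{-g}$; (5) $\delta:\mathsf A^3\to\mathbb N$ with $\delta_{ijk}=\delta_{jki}=\delta_{k^*j^*i^*}$ and $\delta_{ijk}=0$ unless $|i|+|j|+|k|=0$; (6) $\mathsf d,\mathsf b:\mathsf A\to\Bbbk^*$ with $\overline{\mathsf b}=\mathsf b$, $\overline{\mathsf d}=\mathsf d$, $\mathsf b(i^* )=\mathsf b(i)$, $\mathsf d(i^* )=\mathsf d(i)$, and $\mathsf b(j)=\sum_{j_1\in I_{g_1},j_2\in I_{g_2}}\mathsf b(j_1)\mathsf b(j_2)\delta_{j^*j_1j_2}$ for $j\in I_g$ when $g=g_1+g_2$ and $g,g_1,g_2\notin\mathcal X$; (7) $\beta:\mathsf A\to\Bbbk^*$ and $\gamma^n_{i,j,k}\in\Bbbk^*$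 ($1\le n\le\delta_{ijk}$) with $\overline\gamma=\gamma$, $\overline\beta=\beta$, $\beta(i^* )=\beta(i)$, $\gamma^n_{i,j,k}\gamma^n_{k^*,j^*,i^*}\beta(i)\beta(j)\beta(k)=1$; (8) $N:\mathsf A^6\times(\mathbb N^* )^4\to\Bbbk$ with $N^{j_1j_2j_3}_{j_4j_5j_6}(^{a_1a_2}_{a_3a_4})=0$ unless $1\le a_1\le\delta_{j_1j_2j_3^*}$, $1\le a_2\le\delta_{j_3j_4j_5^*}$, $1\le a_3\le\delta_{j_5j_6^*j_1^*}$, $1\le a_4\le\delta_{j_6j_4^*j_2^*}$; such that (a) $N^{j_1 j_2 j_3}_{j_4 j_5 j_6}(^{a_1a_2}_{a_3a_4})= N^{j_2 j_3^*j_1^* }_{j_5 j_6j_4 }(^{a_1a_3}_{a_4a_2})= N^{j_3 j_4 j_5}_{j_6^* j_1 j_2^*}(^{a_2a_3}_{a_1a_4})$; (b) $\sum_{j,c_1,c_2,c_3}\mathsf d(j)N^{j_1 j_2 j_5}_{j_3 j_6 j}(^{a_1a_2}_{c_1c_2}) N^{j_1 j j_6}_{j_4 j_0 j_7}(^{c_1a_3}_{a_0c_3})N^{j_2 j_3 j}_{j_4 j_7 j_8}(^{c_2c_3}_{a_4a_5})=\sum_{c_4}N^{j_5 j_3 j_6}_{j_4 j_0 j_8}(^{a_2a_3}_{c_4a_5})N^{j_1 j_2 j_5}_{j_8 j_0 j_7}(^{a_1c_4}_{a_0a_4})$; (c) $\sum_{n,a_3,a_4}\mathsf d(n)N^{i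 j p}_{l m n}(^{a_1a_2}_{a_3a_4})N^{k j^* i}_{n m l}(^{a'_1a_3}_{a'_2a_4})=\delta_{k,p}\delta_{a_1,a_1'}\delta_{a_2,a_2'}/\mathsf d(k)$; (d) $\overline{N^{j_1 j_2 j_3}_{j_4j_5j_6}(^{a_1a_2}_{a_3a_4})}=N^{j_2^* j_1^* j_3^*}_{j_5j_4j_6}(^{a_1a_2}_{a_4a_3})\gamma^{a_1}_{j_1,j_2,j_3^*}\gamma^{a_2}_{j_3,j_4,j_5^*}\gamma^{a_3}_{j_1^*,j_5,j_6^*}\gamma^{a_4}_{j_2^*,j_6,j_4^*}\prod_{i=1}^6\beta(j_i)$.
   Formalization: b is assumed real; identities (b) and (c) are stated only when |j2|+|j3|, resp. |j|+|l|, is not in X, and (c) only for a1, a2 within their ranges; existence of Hermitian basic data is shown when 0 lies in X and c + bar c is not identically zero. *)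

theory Defs
  imports Complex_Main
begin

section \<open>Strict tensor categories and pivotal structures\<close>

text \<open>
  A linear category over \<open>'k\<close> has the type \<open>'o\<close> as its objects. Its morphism spaces are subspaces of one
  ambient vector space \<open>'m\<close>; every linear category has this form, e.g. with \<open>'m\<close> the direct sum of
  all its Hom-spaces. Composition, tensor product and dagger are total functions on \<open>'m\<close> that are
  constrained only on arguments taken from the Hom-spaces concerned.
\<close>

record ('k, 'o, 'm) tensor_cat =
  Hom :: "'o \<Rightarrow> 'o \<Rightarrow> 'm set"
  Id :: "'o \<Rightarrow> 'm"
  comp :: "'m \<Rightarrow> 'm \<Rightarrow> 'm"  (infixr "\<cdot>\<index>" 70)
  smult :: "'k \<Rightarrow> 'm \<Rightarrow> 'm"
  unit_obj :: "'o"  ("\<I>\<index>")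
  tensor_obj :: "'o \<Rightarrow> 'o \<Rightarrow> 'o"  (infixr "\<odot>\<index>" 75)
  tensor_mor :: "'m \<Rightarrow> 'm \<Rightarrow> 'm"  (infixr "\<otimes>\<index>" 75)

record ('k, 'o, 'm) pivotal_cat = "('k, 'o, 'm) tensor_cat" +
  dual :: "'o \<Rightarrow> 'o"
  coev :: "'o \<Rightarrow> 'm"
  ev :: "'o \<Rightarrow> 'm"
  tcoev :: "'o \<Rightarrow> 'm"
  tev :: "'o \<Rightarrow> 'm"

locale tensor_category =
  fixes C :: "('k::field, 'o, 'm::ab_group_add, 'z) tensor_cat_scheme" (structure)
  assumes vector_space: "vector_space (smult C)"
    and Hom_subspace: "module.subspace (smult C) (Hom C A B)"
    and Id_in: "Id C A \<in> Hom C A A"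
    and comp_in: "\<lbrakk>g \<in> Hom C B D; f \<in> Hom C A B\<rbrakk> \<Longrightarrow> g \<cdot> f \<in> Hom C A D"
    and comp_assoc: "\<lbrakk>h \<in> Hom C D E; g \<in> Hom C B D; f \<in> Hom C A B\<rbrakk> \<Longrightarrow> (h \<cdot> g) \<cdot> f = h \<cdot> (g \<cdot> f)"
    and Id_comp: "f \<in> Hom C A B \<Longrightarrow> Id C B \<cdot> f = f"
    and comp_Id: "f \<in> Hom C A B \<Longrightarrow> f \<cdot> Id C A = f"
    and comp_add_left:
      "\<lbrakk>g \<in> Hom C B D; g' \<in> Hom C B D; f \<in> Hom C A B\<rbrakk> \<Longrightarrow> (g + g') \<cdot> f = (g \<cdot> f) + (g' \<cdot> f)"
    and comp_add_right:
      "\<lbrakk>g \<in> Hom C B D; f \<in> Hom C A B; f' \<in> Hom C A B\<rbrakk> \<Longrightarrow> g \<cdot> (f + f') = (g \<cdot> f) + (g \<cdot> f')"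
    and comp_smult_left:
      "\<lbrakk>g \<in> Hom C B D; f \<in> Hom C A B\<rbrakk> \<Longrightarrow> smult C c g \<cdot> f = smult C c (g \<cdot> f)"
    and comp_smult_right:
      "\<lbrakk>g \<in> Hom C B D; f \<in> Hom C A B\<rbrakk> \<Longrightarrow> g \<cdot> smult C c f = smult C c (g \<cdot> f)"
    and tensor_in:
      "\<lbrakk>f \<in> Hom C A B; g \<in> Hom C D E\<rbrakk> \<Longrightarrow> f \<otimes> g \<in> Hom C (A \<odot> D) (B \<odot> E)"
    and tensor_Id: "Id C A \<otimes> Id C B = Id C (A \<odot> B)"
    and tensor_comp:
      "\<lbrakk>f' \<in> Hom C B B'; f \<in> Hom C A B; g' \<in> Hom C E E'; g \<in> Hom C D E\<rbrakk>
        \<Longrightarrow> (f' \<otimes> g') \<cdot> (f \<otimes> g) = (f' \<cdot> f) \<otimes> (g' \<cdot> g)"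
    and tensor_add_left:
      "\<lbrakk>f \<in> Hom C A B; f' \<in> Hom C A B; g \<in> Hom C D E\<rbrakk> \<Longrightarrow> (f + f') \<otimes> g = (f \<otimes> g) + (f' \<otimes> g)"
    and tensor_add_right:
      "\<lbrakk>f \<in> Hom C A B; g \<in> Hom C D E; g' \<in> Hom C D E\<rbrakk> \<Longrightarrow> f \<otimes> (g + g') = (f \<otimes> g) + (f \<otimes> g')"
    and tensor_smult_left:
      "\<lbrakk>f \<in> Hom C A B; g \<in> Hom C D E\<rbrakk> \<Longrightarrow> smult C c f \<otimes> g = smult C c (f \<otimes> g)"
    and tensor_smult_right:
      "\<lbrakk>f \<in> Hom C A B; g \<in> Hom C D E\<rbrakk> \<Longrightarrow> f \<otimes> smult C c g = smult C c (f \<otimes> g)"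
    and tensor_obj_assoc: "(A \<odot> B) \<odot> D = A \<odot> (B \<odot> D)"
    and unit_tensor_obj: "\<I> \<odot> A = A"
    and tensor_obj_unit: "A \<odot> \<I> = A"
    and tensor_assoc:
      "\<lbrakk>f \<in> Hom C A A'; g \<in> Hom C B B'; h \<in> Hom C D D'\<rbrakk> \<Longrightarrow> (f \<otimes> g) \<otimes> h = f \<otimes> (g \<otimes> h)"
    and unit_tensor: "f \<in> Hom C A B \<Longrightarrow> Id C \<I> \<otimes> f = f"
    and tensor_unit: "f \<in> Hom C A B \<Longrightarrow> f \<otimes> Id C \<I> = f"
    and End_unit: "f \<in> Hom C \<I> \<I> \<Longrightarrow> \<exists>!c. f = smult C c (Id C \<I>)"

context
  fixes C :: "('k::field, 'o, 'm::ab_group_add, 'z) tensor_cat_scheme" (structure)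
begin

definition hom_dim :: "'o \<Rightarrow> 'o \<Rightarrow> nat" where
  "hom_dim A B = vector_space.dim (smult C) (Hom C A B)"

definition inverse_pair :: "'o \<Rightarrow> 'o \<Rightarrow> 'm \<Rightarrow> 'm \<Rightarrow> bool" where
  "inverse_pair A B f g \<longleftrightarrow>
     f \<in> Hom C A B \<and> g \<in> Hom C B A \<and> g \<cdot> f = Id C A \<and> f \<cdot> g = Id C B"

definition is_iso :: "'o \<Rightarrow> 'o \<Rightarrow> 'm \<Rightarrow> bool" where
  "is_iso A B f \<longleftrightarrow> (\<exists>g. inverse_pair A B f g)"

definition inv_mor :: "'o \<Rightarrow> 'o \<Rightarrow> 'm \<Rightarrow> 'm" where
  "inv_mor A B f = (THE g. inverse_pair A B f g)"

definition isomorphic :: "'o \<Rightarrow> 'o \<Rightarrow> bool" where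
  "isomorphic A B \<longleftrightarrow> (\<exists>f. is_iso A B f)"

definition direct_sum :: "'o \<Rightarrow> nat \<Rightarrow> (nat \<Rightarrow> 'o) \<Rightarrow> bool" where
  "direct_sum W n S \<longleftrightarrow>
     (\<exists>\<iota> \<pi>. (\<forall>l<n. \<iota> l \<in> Hom C (S l) W \<and> \<pi> l \<in> Hom C W (S l)) \<and>
        (\<forall>l<n. \<forall>m<n. \<pi> l \<cdot> \<iota> m = (if l = m then Id C (S l) else 0)) \<and>
        (\<Sum>l<n. \<iota> l \<cdot> \<pi> l) = Id C W)"

text \<open>Simple means that \<open>'k \<rightarrow> End(V)\<close> is an isomorphism; there is no assumption that \<open>C\<close> is abelian.\<close>

definition simple_obj :: "'o \<Rightarrow> bool" where
  "simple_obj V \<longleftrightarrow> (\<forall>f\<in>Hom C V V. \<exists>!c. f = smult C c (Id C V))"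

definition epi :: "'o \<Rightarrow> 'o \<Rightarrow> 'm \<Rightarrow> bool" where
  "epi A B p \<longleftrightarrow> p \<in> Hom C A B \<and>
     (\<forall>D. \<forall>u\<in>Hom C B D. \<forall>v\<in>Hom C B D. u \<cdot> p = v \<cdot> p \<longrightarrow> u = v)"

definition projective :: "'o \<Rightarrow> bool" where
  "projective P \<longleftrightarrow>
     (\<forall>A B p f. epi A B p \<and> f \<in> Hom C P B \<longrightarrow> (\<exists>h\<in>Hom C P A. p \<cdot> h = f))"

end

context
  fixes C :: "('k::field, 'o, 'm::ab_group_add, 'z) pivotal_cat_scheme" (structure)
begin

text \<open>
  For \<open>f : U \<rightarrow> V\<close>, the dual \<open>f\<^sup>* : V\<^sup>* \<rightarrow> U\<^sup>*\<close>, computed with the left and with the right duality, and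
  likewise the canonical isomorphism \<open>V\<^sup>* \<otimes> U\<^sup>* \<rightarrow> (U \<otimes> V)\<^sup>*\<close>. Pivotality says that the two
  computations agree.
\<close>

definition dual_mor :: "'o \<Rightarrow> 'o \<Rightarrow> 'm \<Rightarrow> 'm" where
  "dual_mor U V f =
     (ev C V \<otimes> Id C (dual C U)) \<cdot> (Id C (dual C V) \<otimes> f \<otimes> Id C (dual C U)) \<cdot>
     (Id C (dual C V) \<otimes> coev C U)"

definition dual_mor_right :: "'o \<Rightarrow> 'o \<Rightarrow> 'm \<Rightarrow> 'm" where
  "dual_mor_right U V f =
     (Id C (dual C U) \<otimes> tev C V) \<cdot> (Id C (dual C U) \<otimes> f \<otimes> Id C (dual C V)) \<cdot>
     (tcoev C U \<otimes> Id C (dual C V))"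

definition dual_tensor :: "'o \<Rightarrow> 'o \<Rightarrow> 'm" where
  "dual_tensor U V =
     (ev C V \<otimes> Id C (dual C (U \<odot> V))) \<cdot>
     (Id C (dual C V) \<otimes> ev C U \<otimes> Id C (V \<odot> dual C (U \<odot> V))) \<cdot>
     (Id C (dual C V \<odot> dual C U) \<otimes> coev C (U \<odot> V))"

definition dual_tensor_right :: "'o \<Rightarrow> 'o \<Rightarrow> 'm" where
  "dual_tensor_right U V =
     (Id C (dual C (U \<odot> V)) \<otimes> tev C U) \<cdot>
     (Id C (dual C (U \<odot> V) \<odot> U) \<otimes> tev C V \<otimes> Id C (dual C U)) \<cdot>
     (tcoev C (U \<odot> V) \<otimes> Id C (dual C V \<odot> dual C U))"

definition piv :: "'o \<Rightarrow> 'm" where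
  "piv V = (tev C V \<otimes> Id C (dual C (dual C V))) \<cdot> (Id C V \<otimes> coev C (dual C V))"

definition m_trace :: "('o \<Rightarrow> 'm \<Rightarrow> 'k) \<Rightarrow> bool" where
  "m_trace t \<longleftrightarrow>
     (\<forall>V f g c. projective C V \<and> f \<in> Hom C V V \<and> g \<in> Hom C V V \<longrightarrow>
        t V (f + g) = t V f + t V g \<and> t V (smult C c f) = c * t V f) \<and>
     (\<forall>U V f g. projective C U \<and> projective C V \<and> f \<in> Hom C V U \<and> g \<in> Hom C U V \<longrightarrow>
        t V (g \<cdot> f) = t U (f \<cdot> g)) \<and>
     (\<forall>U W f. projective C U \<and> f \<in> Hom C (U \<odot> W) (U \<odot> W) \<longrightarrow>
        t (U \<odot> W) f =
          t U ((Id C U \<otimes> tev C W) \<cdot> (f \<otimes> Id C (dual C W)) \<cdot> (Id C U \<otimes> coev C W))) \<and>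
     (\<forall>U W f. projective C U \<and> f \<in> Hom C (W \<odot> U) (W \<odot> U) \<longrightarrow>
        t (W \<odot> U) f =
          t U ((ev C W \<otimes> Id C U) \<cdot> (Id C (dual C W) \<otimes> f) \<cdot> (tcoev C W \<otimes> Id C U)))"

end

locale pivotal_category = tensor_category C
  for C :: "('k::field, 'o, 'm::ab_group_add, 'z) pivotal_cat_scheme" (structure) +
  assumes coev_in: "coev C V \<in> Hom C \<I> (V \<odot> dual C V)"
    and ev_in: "ev C V \<in> Hom C (dual C V \<odot> V) \<I>"
    and tcoev_in: "tcoev C V \<in> Hom C \<I> (dual C V \<odot> V)"
    and tev_in: "tev C V \<in> Hom C (V \<odot> dual C V) \<I>"
    and zigzag: "(Id C V \<otimes> ev C V) \<cdot> (coev C V \<otimes> Id C V) = Id C V"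
    and zigzag_dual:
      "(ev C V \<otimes> Id C (dual C V)) \<cdot> (Id C (dual C V) \<otimes> coev C V) = Id C (dual C V)"
    and tzigzag: "(tev C V \<otimes> Id C V) \<cdot> (Id C V \<otimes> tcoev C V) = Id C V"
    and tzigzag_dual:
      "(Id C (dual C V) \<otimes> tev C V) \<cdot> (tcoev C V \<otimes> Id C (dual C V)) = Id C (dual C V)"
    and dual_mor_left_right: "f \<in> Hom C U V \<Longrightarrow> dual_mor C U V f = dual_mor_right C U V f"
    and dual_tensor_left_right: "dual_tensor C U V = dual_tensor_right C U V"

locale field_involution =
  fixes bar :: "'k::field \<Rightarrow> 'k"
  assumes bar_add: "bar (x + y) = bar x + bar y"
    and bar_mult: "bar (x * y) = bar x * bar y"
    and bar_one: "bar 1 = 1"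
    and bar_bar: "bar (bar x) = x"

locale hermitian_pivotal_category = field_involution bar + pivotal_category C
  for bar :: "'k::field \<Rightarrow> 'k"
    and C :: "('k, 'o, 'm::ab_group_add, 'z) pivotal_cat_scheme" (structure) +
  fixes dag :: "'m \<Rightarrow> 'm"
  assumes dag_bij: "bij_betw dag (Hom C A B) (Hom C B A)"
    and dag_linear: "\<lbrakk>f \<in> Hom C A B; g \<in> Hom C A B\<rbrakk> \<Longrightarrow>
      dag (smult C \<mu> f + smult C \<kappa> g) = smult C (bar \<mu>) (dag f) + smult C (bar \<kappa>) (dag g)"
    and dag_tensor: "\<lbrakk>f \<in> Hom C A B; g \<in> Hom C D E\<rbrakk> \<Longrightarrow> dag (f \<otimes> g) = dag f \<otimes> dag g"
    and dag_comp: "\<lbrakk>f \<in> Hom C B D; g \<in> Hom C A B\<rbrakk> \<Longrightarrow> dag (f \<cdot> g) = dag g \<cdot> dag f"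
    and dag_coev: "dag (coev C V) = tev C V"
    and dag_ev: "dag (ev C V) = tcoev C V"
    and dag_tcoev: "dag (tcoev C V) = ev C V"
    and dag_tev: "dag (tev C V) = coev C V"
    and dag_dag: "f \<in> Hom C A B \<Longrightarrow> dag (dag f) = f"


section \<open>Relative spherical categories\<close>

definition symmetric_subset :: "'g::ab_group_add set \<Rightarrow> bool" where
  "symmetric_subset X \<longleftrightarrow> uminus ` X = X"

definition small_subset :: "'g::ab_group_add set \<Rightarrow> bool" where
  "small_subset X \<longleftrightarrow> (\<forall>T. finite T \<longrightarrow> (\<Union>t\<in>T. (\<lambda>x. t + x) ` X) \<noteq> UNIV)"

text \<open>
  \<open>Deg C g\<close> is the class of objects of \<open>C\<^sub>g\<close>, \<open>Sing C\<close> the singular set, \<open>tr C\<close> the m-trace and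
  \<open>bmap C\<close> the map \<open>b\<close>. The latter two are meaningful on projective objects and on generic simple
  objects, respectively.
\<close>

record ('k, 'o, 'm, 'g) relative_cat = "('k, 'o, 'm) pivotal_cat" +
  Deg :: "'g \<Rightarrow> 'o set"
  Sing :: "'g set"
  tr :: "'o \<Rightarrow> 'm \<Rightarrow> 'k"
  bmap :: "'o \<Rightarrow> 'k"

context
  fixes C :: "('k::field, 'o, 'm::ab_group_add, 'g::ab_group_add, 'z) relative_cat_scheme" (structure)
begin

definition graded :: bool where
  "graded \<longleftrightarrow>
     (\<forall>g. Deg C g \<noteq> {}) \<and>
     \<I> \<in> Deg C 0 \<and>
     (\<forall>g h. \<forall>V\<in>Deg C g. \<forall>W\<in>Deg C h. V \<odot> W \<in> Deg C (g + h)) \<and>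
     (\<forall>g h. \<forall>V\<in>Deg C g. \<forall>W\<in>Deg C h. g \<noteq> h \<longrightarrow> Hom C V W = {0}) \<and>
     (\<forall>V. \<exists>n S. (\<forall>l<n. \<exists>g. S l \<in> Deg C g) \<and> direct_sum C V n S)"

definition generic :: "'o \<Rightarrow> bool" where
  "generic V \<longleftrightarrow> simple_obj C V \<and> (\<exists>g. g \<notin> Sing C \<and> V \<in> Deg C g)"

definition irr_representatives :: "'g \<Rightarrow> 'o set \<Rightarrow> bool" where
  "irr_representatives g R \<longleftrightarrow>
     R \<subseteq> {V \<in> Deg C g. simple_obj C V} \<and>
     (\<forall>V\<in>Deg C g. simple_obj C V \<longrightarrow> (\<exists>!R\<^sub>0. R\<^sub>0 \<in> R \<and> isomorphic C V R\<^sub>0))"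

definition mdim :: "'o \<Rightarrow> 'k" where
  "mdim V = tr C V (Id C V)"

end

text \<open>
  \<open>C\<close> need not be abelian, so Schur's lemma is not automatic: semisimplicity of \<open>C\<^sub>g\<close> means that every
  object of \<open>C\<^sub>g\<close> is a finite direct sum of simple objects of \<open>C\<^sub>g\<close> and that there are no non-zero
  morphisms between non-isomorphic simple ones.
\<close>

locale relative_spherical_category = pivotal_category C
  for C :: "('k::field, 'o, 'm::ab_group_add, 'g::ab_group_add, 'z) relative_cat_scheme" (structure) +
  assumes graded: "graded C"
    and Sing_symmetric: "symmetric_subset (Sing C)"
    and Sing_small: "small_subset (Sing C)"
    and generic_semisimple: "\<lbrakk>g \<notin> Sing C; V \<in> Deg C g\<rbrakk> \<Longrightarrow>
      \<exists>n S. (\<forall>l<n. S l \<in> Deg C g \<and> simple_obj C (S l)) \<and> direct_sum C V n S"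
    and generic_schur: "\<lbrakk>g \<notin> Sing C; V \<in> Deg C g; W \<in> Deg C g; simple_obj C V; simple_obj C W;
        \<not> isomorphic C V W\<rbrakk> \<Longrightarrow> Hom C V W = {0}"
    and generic_finite: "g \<notin> Sing C \<Longrightarrow> \<exists>R. finite R \<and> irr_representatives C g R"
    and m_trace: "m_trace C (tr C)"
    and mdim_map: "generic C V \<Longrightarrow> projective C V \<and> mdim C V \<noteq> 0"
    and bmap_nonzero: "generic C V \<Longrightarrow> bmap C V \<noteq> 0"
    and bmap_iso: "\<lbrakk>generic C V; generic C W; isomorphic C V W\<rbrakk> \<Longrightarrow> bmap C V = bmap C W"
    and bmap_dual: "\<lbrakk>generic C V; generic C W; isomorphic C W (dual C V)\<rbrakk> \<Longrightarrow> bmap C V = bmap C W"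
    and bmap_sum: "\<lbrakk>g\<^sub>1 \<notin> Sing C; g\<^sub>2 \<notin> Sing C; g\<^sub>1 + g\<^sub>2 \<notin> Sing C;
        generic C V; V \<in> Deg C (g\<^sub>1 + g\<^sub>2);
        irr_representatives C g\<^sub>1 R\<^sub>1; irr_representatives C g\<^sub>2 R\<^sub>2\<rbrakk> \<Longrightarrow>
      bmap C V = (\<Sum>V\<^sub>1\<in>R\<^sub>1. \<Sum>V\<^sub>2\<in>R\<^sub>2. bmap C V\<^sub>1 * bmap C V\<^sub>2 * of_nat (hom_dim C V (V\<^sub>1 \<odot> V\<^sub>2)))"

locale relative_hermitian_spherical_category =
  hermitian_pivotal_category bar C dag + relative_spherical_category C
  for bar :: "'k::field \<Rightarrow> 'k"
    and C :: "('k, 'o, 'm::ab_group_add, 'g::ab_group_add, 'z) relative_cat_scheme" (structure)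
    and dag :: "'m \<Rightarrow> 'm" +
  assumes tr_real: "\<lbrakk>projective C V; f \<in> Hom C V V\<rbrakk> \<Longrightarrow> tr C V (dag f) = bar (tr C V f)"


section \<open>Hermitian basic data and modified \<open>6j\<close>-symbols\<close>

context
  fixes C :: "('k::field, 'o, 'm::ab_group_add, 'g::ab_group_add, 'z) relative_cat_scheme" (structure)
    and I :: "'i set" and V :: "'i \<Rightarrow> 'o"
begin

definition generic_representatives :: bool where
  "generic_representatives \<longleftrightarrow>
     (\<forall>i\<in>I. generic C (V i)) \<and>
     (\<forall>U. generic C U \<longrightarrow> (\<exists>!i. i \<in> I \<and> isomorphic C U (V i)))"

definition dual_label :: "'i \<Rightarrow> 'i"  ("_\<^sup>\<star>" [1000] 1000) where
  "i\<^sup>\<star> = (THE j. j \<in> I \<and> isomorphic C (V j) (dual C (V i)))"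

abbreviation triple :: "'i \<Rightarrow> 'i \<Rightarrow> 'i \<Rightarrow> 'o" where
  "triple i j k \<equiv> V i \<odot> V j \<odot> V k"

definition mult_space :: "'i \<Rightarrow> 'i \<Rightarrow> 'i \<Rightarrow> 'm set" where
  "mult_space i j k = Hom C \<I> (triple i j k)"

definition mult_dim :: "'i \<Rightarrow> 'i \<Rightarrow> 'i \<Rightarrow> nat" where
  "mult_dim i j k = vector_space.dim (smult C) (mult_space i j k)"

definition basic_data :: "('i \<Rightarrow> 'm) \<Rightarrow> bool" where
  "basic_data w \<longleftrightarrow>
     (\<forall>i\<in>I. is_iso C (V i) (dual C (V (i\<^sup>\<star>))) (w i) \<and>
        w (i\<^sup>\<star>) = dual_mor C (V i) (dual C (V (i\<^sup>\<star>))) (w i) \<cdot> piv C (V (i\<^sup>\<star>)))"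

text \<open>
  \<open>y'\<^sup>* (w\<^sub>i \<otimes> w\<^sub>j \<otimes> w\<^sub>k)\<close> needs the canonical isomorphisms from \<open>V\<^sub>1\<^sup>* \<otimes> V\<^sub>2\<^sup>* \<otimes> V\<^sub>3\<^sup>*\<close> to
  \<open>(V\<^sub>3 \<otimes> V\<^sub>2 \<otimes> V\<^sub>1)\<^sup>*\<close> and from \<open>\<I>\<^sup>*\<close> to \<open>\<I>\<close>; since \<open>\<I>\<^sup>* \<otimes> \<I> = \<I>\<^sup>*\<close>, the latter is \<open>ev\<close>.
\<close>

definition Theta :: "('i \<Rightarrow> 'm) \<Rightarrow> 'i \<Rightarrow> 'i \<Rightarrow> 'i \<Rightarrow> 'm \<Rightarrow> 'm \<Rightarrow> 'k" where
  "Theta w i j k y' y =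
     tr C (triple i j k)
       (y \<cdot> ev C \<I> \<cdot> dual_mor C \<I> (triple (k\<^sup>\<star>) (j\<^sup>\<star>) (i\<^sup>\<star>)) y' \<cdot>
        dual_tensor C (V (k\<^sup>\<star>) \<odot> V (j\<^sup>\<star>)) (V (i\<^sup>\<star>)) \<cdot>
        (Id C (dual C (V (i\<^sup>\<star>))) \<otimes> dual_tensor C (V (k\<^sup>\<star>)) (V (j\<^sup>\<star>))) \<cdot>
        (w i \<otimes> w j \<otimes> w k))"

definition herm_form :: "('m \<Rightarrow> 'm) \<Rightarrow> 'i \<Rightarrow> 'i \<Rightarrow> 'i \<Rightarrow> 'm \<Rightarrow> 'm \<Rightarrow> 'k" where
  "herm_form dag i j k y\<^sub>1 y\<^sub>2 = tr C (triple i j k) (y\<^sub>2 \<cdot> dag y\<^sub>1)"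

definition rot :: "'i \<Rightarrow> 'i \<Rightarrow> 'i \<Rightarrow> 'm \<Rightarrow> 'm" where
  "rot i j k y =
     (ev C (V i) \<otimes> Id C (triple j k i)) \<cdot> (Id C (dual C (V i)) \<otimes> y \<otimes> Id C (V i)) \<cdot> tcoev C (V i)"

definition basis_family :: "'m set \<Rightarrow> nat \<Rightarrow> (nat \<Rightarrow> 'm) \<Rightarrow> bool" where
  "basis_family H n u \<longleftrightarrow>
     inj_on u {1..n} \<and> \<not> module.dependent (smult C) (u ` {1..n}) \<and>
     module.span (smult C) (u ` {1..n}) = H"

definition hermitian_basic_data ::
    "('m \<Rightarrow> 'm) \<Rightarrow> ('i \<Rightarrow> 'm) \<Rightarrow> ('i \<Rightarrow> 'i \<Rightarrow> 'i \<Rightarrow> nat \<Rightarrow> 'm) \<Rightarrow> bool" where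
  "hermitian_basic_data dag w y \<longleftrightarrow>
     basic_data w \<and>
     (\<forall>i\<in>I. \<forall>j\<in>I. \<forall>k\<in>I.
        basis_family (mult_space i j k) (mult_dim i j k) (y i j k) \<and>
        (\<forall>m\<in>{1..mult_dim (k\<^sup>\<star>) (j\<^sup>\<star>) (i\<^sup>\<star>)}. \<forall>n\<in>{1..mult_dim i j k}.
           Theta w i j k (y (k\<^sup>\<star>) (j\<^sup>\<star>) (i\<^sup>\<star>) m) (y i j k n) = (if m = n then 1 else 0)) \<and>
        (\<forall>m\<in>{1..mult_dim i j k}. \<forall>n\<in>{1..mult_dim i j k}.
           m \<noteq> n \<longrightarrow> herm_form dag i j k (y i j k m) (y i j k n) = 0) \<and>
        (\<forall>n\<in>{1..mult_dim i j k}. herm_form dag i j k (y i j k n) (y i j k n) \<noteq> 0) \<and>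
        (\<forall>n\<in>{1..mult_dim i j k}. rot i j k (y i j k n) = y j k i n))"

definition beta :: "('m \<Rightarrow> 'm) \<Rightarrow> ('i \<Rightarrow> 'm) \<Rightarrow> 'i \<Rightarrow> 'k" where
  "beta dag w i =
     (THE c. dag (w i) = smult C c (inv_mor C (V i) (dual C (V (i\<^sup>\<star>))) (w i)))"

definition vertex :: "('i \<Rightarrow> 'i \<Rightarrow> 'i \<Rightarrow> nat \<Rightarrow> 'm) \<Rightarrow> 'i \<Rightarrow> 'i \<Rightarrow> 'i \<Rightarrow> nat \<Rightarrow> 'm" where
  "vertex y i j k n = (if n \<in> {1..mult_dim i j k} then y i j k n else 0)"

definition gamma ::
    "('m \<Rightarrow> 'm) \<Rightarrow> ('i \<Rightarrow> 'i \<Rightarrow> 'i \<Rightarrow> nat \<Rightarrow> 'm) \<Rightarrow> 'i \<Rightarrow> 'i \<Rightarrow> 'i \<Rightarrow> nat \<Rightarrow> 'k" where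
  "gamma dag y i j k n = herm_form dag i j k (vertex y i j k n) (vertex y i j k n)"

definition edge :: "('i \<Rightarrow> 'm) \<Rightarrow> 'i \<Rightarrow> 'm" where
  "edge w j = ev C (V j) \<cdot> (w (j\<^sup>\<star>) \<otimes> Id C (V j))"

definition sixj :: "('i \<Rightarrow> 'm) \<Rightarrow> ('i \<Rightarrow> 'i \<Rightarrow> 'i \<Rightarrow> nat \<Rightarrow> 'm) \<Rightarrow>
    'i \<Rightarrow> 'i \<Rightarrow> 'i \<Rightarrow> 'i \<Rightarrow> 'i \<Rightarrow> 'i \<Rightarrow> nat \<Rightarrow> nat \<Rightarrow> nat \<Rightarrow> nat \<Rightarrow> 'k" where
  "sixj w y j\<^sub>1 j\<^sub>2 j\<^sub>3 j\<^sub>4 j\<^sub>5 j\<^sub>6 a\<^sub>1 a\<^sub>2 a\<^sub>3 a\<^sub>4 =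
    (let
       id = (\<lambda>j. Id C (V j));
       u = ((Id C (V j\<^sub>5 \<odot> V (j\<^sub>6\<^sup>\<star>)) \<otimes> vertex y j\<^sub>6 (j\<^sub>4\<^sup>\<star>) (j\<^sub>2\<^sup>\<star>) a\<^sub>4 \<otimes> id (j\<^sub>1\<^sup>\<star>)) \<cdot>
              vertex y j\<^sub>5 (j\<^sub>6\<^sup>\<star>) (j\<^sub>1\<^sup>\<star>) a\<^sub>3)
            \<otimes> vertex y j\<^sub>1 j\<^sub>2 (j\<^sub>3\<^sup>\<star>) a\<^sub>1;
       u\<^sub>6 = (id j\<^sub>5 \<otimes> edge w j\<^sub>6 \<otimes> id (j\<^sub>4\<^sup>\<star>) \<otimes> id (j\<^sub>2\<^sup>\<star>) \<otimes> id (j\<^sub>1\<^sup>\<star>) \<otimes> id j\<^sub>1 \<otimes> id j\<^sub>2 \<otimes> id (j\<^sub>3\<^sup>\<star>)) \<cdot> u;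
       u\<^sub>1 = (id j\<^sub>5 \<otimes> id (j\<^sub>4\<^sup>\<star>) \<otimes> id (j\<^sub>2\<^sup>\<star>) \<otimes> edge w j\<^sub>1 \<otimes> id j\<^sub>2 \<otimes> id (j\<^sub>3\<^sup>\<star>)) \<cdot> u\<^sub>6;
       z = (id j\<^sub>5 \<otimes> id (j\<^sub>4\<^sup>\<star>) \<otimes> edge w j\<^sub>2 \<otimes> id (j\<^sub>3\<^sup>\<star>)) \<cdot> u\<^sub>1
     in Theta w j\<^sub>3 j\<^sub>4 (j\<^sub>5\<^sup>\<star>) z (vertex y j\<^sub>3 j\<^sub>4 (j\<^sub>5\<^sup>\<star>) a\<^sub>2))"

end


section \<open>LW data\<close>

definition labels :: "'g set \<Rightarrow> ('g \<Rightarrow> 'i set) \<Rightarrow> 'i set" where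
  "labels X I = (\<Union>g\<in>- X. I g)"

text \<open>
  The group is the type \<open>'g\<close>; only the values \<open>I g\<close> with \<open>g \<notin> X\<close> are used, and they are finite, as the
  sums over labels require. The function \<open>N j\<^sub>1 \<dots> j\<^sub>6 a\<^sub>1 \<dots> a\<^sub>4\<close> is extended by \<open>0\<close> to multiplicity
  indices equal to \<open>0\<close>; \<open>\<gamma> i j k n\<close> is relevant only for \<open>1 \<le> n \<le> \<delta> i j k\<close>.

  In \<open>N_pentagon\<close> the summation label \<open>j\<close> has degree \<open>|j\<^sub>2| + |j\<^sub>3|\<close> in all non-zero terms, and in
  \<open>N_orthogonal\<close> the label \<open>n\<close> has degree \<open>|j| + |l|\<close>. The sums therefore run over the labels of that
  degree, a set that is part of the data only if the degree is not in \<open>X\<close>. In \<open>N_orthogonal\<close> the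
  indices \<open>a\<^sub>1\<close>, \<open>a\<^sub>2\<close> number basis vectors; outside of their ranges the left-hand side vanishes.
\<close>

locale LW_data = field_involution bar
  for bar :: "'k::field \<Rightarrow> 'k" +
  fixes X :: "'g::ab_group_add set"
    and I :: "'g \<Rightarrow> 'i set"
    and star :: "'i \<Rightarrow> 'i"  ("_\<^sup>\<star>" [1000] 1000)
    and \<delta> :: "'i \<Rightarrow> 'i \<Rightarrow> 'i \<Rightarrow> nat"
    and b d :: "'i \<Rightarrow> 'k"
    and N :: "'i \<Rightarrow> 'i \<Rightarrow> 'i \<Rightarrow> 'i \<Rightarrow> 'i \<Rightarrow> 'i \<Rightarrow> nat \<Rightarrow> nat \<Rightarrow> nat \<Rightarrow> nat \<Rightarrow> 'k"
    and \<beta> :: "'i \<Rightarrow> 'k"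
    and \<gamma> :: "'i \<Rightarrow> 'i \<Rightarrow> 'i \<Rightarrow> nat \<Rightarrow> 'k"
  assumes X_symmetric: "symmetric_subset X"
    and X_small: "small_subset X"
    and I_finite: "g \<notin> X \<Longrightarrow> finite (I g)"
    and I_disjoint: "\<lbrakk>g \<notin> X; h \<notin> X; g \<noteq> h\<rbrakk> \<Longrightarrow> I g \<inter> I h = {}"
    and star_involution: "i \<in> labels X I \<Longrightarrow> (i\<^sup>\<star>)\<^sup>\<star> = i"
    and star_degree: "g \<notin> X \<Longrightarrow> star ` I g = I (- g)"
    and \<delta>_rot: "\<lbrakk>i \<in> labels X I; j \<in> labels X I; k \<in> labels X I\<rbrakk> \<Longrightarrow> \<delta> i j k = \<delta> j k i"
    and \<delta>_star:
      "\<lbrakk>i \<in> labels X I; j \<in> labels X I; k \<in> labels X I\<rbrakk> \<Longrightarrow> \<delta> i j k = \<delta> (k\<^sup>\<star>) (j\<^sup>\<star>) (i\<^sup>\<star>)"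
    and \<delta>_degree: "\<lbrakk>f \<notin> X; g \<notin> X; h \<notin> X; i \<in> I f; j \<in> I g; k \<in> I h; f + g + h \<noteq> 0\<rbrakk> \<Longrightarrow>
      \<delta> i j k = 0"
    and d_nonzero: "i \<in> labels X I \<Longrightarrow> d i \<noteq> 0"
    and d_real: "i \<in> labels X I \<Longrightarrow> bar (d i) = d i"
    and d_star: "i \<in> labels X I \<Longrightarrow> d (i\<^sup>\<star>) = d i"
    and b_nonzero: "i \<in> labels X I \<Longrightarrow> b i \<noteq> 0"
    and b_real: "i \<in> labels X I \<Longrightarrow> bar (b i) = b i"
    and b_star: "i \<in> labels X I \<Longrightarrow> b (i\<^sup>\<star>) = b i"
    and b_sum: "\<lbrakk>g\<^sub>1 \<notin> X; g\<^sub>2 \<notin> X; g\<^sub>1 + g\<^sub>2 \<notin> X; j \<in> I (g\<^sub>1 + g\<^sub>2)\<rbrakk> \<Longrightarrow>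
      b j = (\<Sum>j\<^sub>1\<in>I g\<^sub>1. \<Sum>j\<^sub>2\<in>I g\<^sub>2. b j\<^sub>1 * b j\<^sub>2 * of_nat (\<delta> (j\<^sup>\<star>) j\<^sub>1 j\<^sub>2))"
    and \<beta>_nonzero: "i \<in> labels X I \<Longrightarrow> \<beta> i \<noteq> 0"
    and \<beta>_real: "i \<in> labels X I \<Longrightarrow> bar (\<beta> i) = \<beta> i"
    and \<beta>_star: "i \<in> labels X I \<Longrightarrow> \<beta> (i\<^sup>\<star>) = \<beta> i"
    and \<gamma>_nonzero: "\<lbrakk>i \<in> labels X I; j \<in> labels X I; k \<in> labels X I; n \<in> {1..\<delta> i j k}\<rbrakk> \<Longrightarrow>
      \<gamma> i j k n \<noteq> 0"
    and \<gamma>_real: "\<lbrakk>i \<in> labels X I; j \<in> labels X I; k \<in> labels X I; n \<in> {1..\<delta> i j k}\<rbrakk> \<Longrightarrow>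
      bar (\<gamma> i j k n) = \<gamma> i j k n"
    and \<gamma>_\<beta>: "\<lbrakk>i \<in> labels X I; j \<in> labels X I; k \<in> labels X I; n \<in> {1..\<delta> i j k}\<rbrakk> \<Longrightarrow>
      \<gamma> i j k n * \<gamma> (k\<^sup>\<star>) (j\<^sup>\<star>) (i\<^sup>\<star>) n * \<beta> i * \<beta> j * \<beta> k = 1"
    and N_zero: "\<lbrakk>{j\<^sub>1, j\<^sub>2, j\<^sub>3, j\<^sub>4, j\<^sub>5, j\<^sub>6} \<subseteq> labels X I;
        \<not> (a\<^sub>1 \<in> {1..\<delta> j\<^sub>1 j\<^sub>2 (j\<^sub>3\<^sup>\<star>)} \<and> a\<^sub>2 \<in> {1..\<delta> j\<^sub>3 j\<^sub>4 (j\<^sub>5\<^sup>\<star>)} \<and>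
           a\<^sub>3 \<in> {1..\<delta> j\<^sub>5 (j\<^sub>6\<^sup>\<star>) (j\<^sub>1\<^sup>\<star>)} \<and> a\<^sub>4 \<in> {1..\<delta> j\<^sub>6 (j\<^sub>4\<^sup>\<star>) (j\<^sub>2\<^sup>\<star>)})\<rbrakk> \<Longrightarrow>
      N j\<^sub>1 j\<^sub>2 j\<^sub>3 j\<^sub>4 j\<^sub>5 j\<^sub>6 a\<^sub>1 a\<^sub>2 a\<^sub>3 a\<^sub>4 = 0"
    and N_symmetric\<^sub>1: "{j\<^sub>1, j\<^sub>2, j\<^sub>3, j\<^sub>4, j\<^sub>5, j\<^sub>6} \<subseteq> labels X I \<Longrightarrow>
      N j\<^sub>1 j\<^sub>2 j\<^sub>3 j\<^sub>4 j\<^sub>5 j\<^sub>6 a\<^sub>1 a\<^sub>2 a\<^sub>3 a\<^sub>4 = N j\<^sub>2 (j\<^sub>3\<^sup>\<star>) (j\<^sub>1\<^sup>\<star>) j\<^sub>5 j\<^sub>6 j\<^sub>4 a\<^sub>1 a\<^sub>3 a\<^sub>4 a\<^sub>2"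
    and N_symmetric\<^sub>2: "{j\<^sub>1, j\<^sub>2, j\<^sub>3, j\<^sub>4, j\<^sub>5, j\<^sub>6} \<subseteq> labels X I \<Longrightarrow>
      N j\<^sub>1 j\<^sub>2 j\<^sub>3 j\<^sub>4 j\<^sub>5 j\<^sub>6 a\<^sub>1 a\<^sub>2 a\<^sub>3 a\<^sub>4 = N j\<^sub>3 j\<^sub>4 j\<^sub>5 (j\<^sub>6\<^sup>\<star>) j\<^sub>1 (j\<^sub>2\<^sup>\<star>) a\<^sub>2 a\<^sub>3 a\<^sub>1 a\<^sub>4"
    and N_pentagon: "\<lbrakk>{j\<^sub>0, j\<^sub>1, j\<^sub>2, j\<^sub>3, j\<^sub>4, j\<^sub>5, j\<^sub>6, j\<^sub>7, j\<^sub>8} \<subseteq> labels X I;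
        g\<^sub>2 \<notin> X; g\<^sub>3 \<notin> X; j\<^sub>2 \<in> I g\<^sub>2; j\<^sub>3 \<in> I g\<^sub>3; g\<^sub>2 + g\<^sub>3 \<notin> X\<rbrakk> \<Longrightarrow>
      (\<Sum>j\<in>I (g\<^sub>2 + g\<^sub>3).
         \<Sum>c\<^sub>1\<in>{1..\<delta> j\<^sub>6 (j\<^sup>\<star>) (j\<^sub>1\<^sup>\<star>)}. \<Sum>c\<^sub>2\<in>{1..\<delta> j (j\<^sub>3\<^sup>\<star>) (j\<^sub>2\<^sup>\<star>)}. \<Sum>c\<^sub>3\<in>{1..\<delta> j\<^sub>7 (j\<^sub>4\<^sup>\<star>) (j\<^sup>\<star>)}.
           d j * N j\<^sub>1 j\<^sub>2 j\<^sub>5 j\<^sub>3 j\<^sub>6 j a\<^sub>1 a\<^sub>2 c\<^sub>1 c\<^sub>2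
               * N j\<^sub>1 j j\<^sub>6 j\<^sub>4 j\<^sub>0 j\<^sub>7 c\<^sub>1 a\<^sub>3 a\<^sub>0 c\<^sub>3
               * N j\<^sub>2 j\<^sub>3 j j\<^sub>4 j\<^sub>7 j\<^sub>8 c\<^sub>2 c\<^sub>3 a\<^sub>4 a\<^sub>5)
      = (\<Sum>c\<^sub>4\<in>{1..\<delta> j\<^sub>0 (j\<^sub>8\<^sup>\<star>) (j\<^sub>5\<^sup>\<star>)}.
           N j\<^sub>5 j\<^sub>3 j\<^sub>6 j\<^sub>4 j\<^sub>0 j\<^sub>8 a\<^sub>2 a\<^sub>3 c\<^sub>4 a\<^sub>5 * N j\<^sub>1 j\<^sub>2 j\<^sub>5 j\<^sub>8 j\<^sub>0 j\<^sub>7 a\<^sub>1 c\<^sub>4 a\<^sub>0 a\<^sub>4)"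
    and N_orthogonal: "\<lbrakk>{i, j, k, l, m, p} \<subseteq> labels X I;
        g \<notin> X; h \<notin> X; j \<in> I g; l \<in> I h; g + h \<notin> X;
        a\<^sub>1 \<in> {1..\<delta> i j (p\<^sup>\<star>)}; a\<^sub>2 \<in> {1..\<delta> p l (m\<^sup>\<star>)}\<rbrakk> \<Longrightarrow>
      (\<Sum>n\<in>I (g + h). \<Sum>a\<^sub>3\<in>{1..\<delta> m (n\<^sup>\<star>) (i\<^sup>\<star>)}. \<Sum>a\<^sub>4\<in>{1..\<delta> n (l\<^sup>\<star>) (j\<^sup>\<star>)}.
         d n * N i j p l m n a\<^sub>1 a\<^sub>2 a\<^sub>3 a\<^sub>4 * N k (j\<^sup>\<star>) i n m l a\<^sub>1' a\<^sub>3 a\<^sub>2' a\<^sub>4)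
      = (if k = p \<and> a\<^sub>1 = a\<^sub>1' \<and> a\<^sub>2 = a\<^sub>2' then 1 / d k else 0)"
    and N_bar: "{j\<^sub>1, j\<^sub>2, j\<^sub>3, j\<^sub>4, j\<^sub>5, j\<^sub>6} \<subseteq> labels X I \<Longrightarrow>
      bar (N j\<^sub>1 j\<^sub>2 j\<^sub>3 j\<^sub>4 j\<^sub>5 j\<^sub>6 a\<^sub>1 a\<^sub>2 a\<^sub>3 a\<^sub>4)
      = N (j\<^sub>2\<^sup>\<star>) (j\<^sub>1\<^sup>\<star>) (j\<^sub>3\<^sup>\<star>) j\<^sub>5 j\<^sub>4 j\<^sub>6 a\<^sub>1 a\<^sub>2 a\<^sub>4 a\<^sub>3
        * \<gamma> j\<^sub>1 j\<^sub>2 (j\<^sub>3\<^sup>\<star>) a\<^sub>1 * \<gamma> j\<^sub>3 j\<^sub>4 (j\<^sub>5\<^sup>\<star>) a\<^sub>2 * \<gamma> (j\<^sub>1\<^sup>\<star>) j\<^sub>5 (j\<^sub>6\<^sup>\<star>) a\<^sub>3 * \<gamma> (j\<^sub>2\<^sup>\<star>) j\<^sub>6 (j\<^sub>4\<^sup>\<star>) a\<^sub>4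
        * (\<beta> j\<^sub>1 * \<beta> j\<^sub>2 * \<beta> j\<^sub>3 * \<beta> j\<^sub>4 * \<beta> j\<^sub>5 * \<beta> j\<^sub>6)"

end

theory Submission
  imports Defs
begin

text \<open>
  The isomorphisms \<open>w i\<close> turn evaluations and coevaluations into caps \<open>V (i\<^sup>\<star>) \<odot> V i \<rightarrow> \<I>\<close> and cups
  \<open>\<I> \<rightarrow> V i \<odot> V (i\<^sup>\<star>)\<close>. The condition that basic data impose on \<open>w\<close> says that the left and the right
  evaluation give the same cap (\<open>cap_eq_tev\<close>). Hence a leg of a morphism may be bent to the left or to
  the right with the same cap, and since the m-trace is compatible with both partial traces, the trace
  of \<open>f \<bullet> g\<close> does not change when a leg of \<open>f\<close> and the opposite leg of \<open>g\<close> are bent (\<open>T_bend_right\<close>,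
  \<open>T_bend_left\<close>). Pivotality enters once more through the fact that bending all legs of a vector to
  the right or to the left gives the same functional (\<open>functional3_left\<close>); therefore rotation has
  order three.

  By bending, a vector of \<open>V i \<odot> V j \<odot> V (k\<^sup>\<star>)\<close> becomes a splitting \<open>V k \<rightarrow> V i \<odot> V j\<close> and a vector of
  \<open>V k \<odot> V (j\<^sup>\<star>) \<odot> V (i\<^sup>\<star>)\<close> a fusion \<open>V i \<odot> V j \<rightarrow> V k\<close>. The pairing \<open>\<Theta>\<close> is the trace of the fusion
  after the splitting (\<open>Theta_fuse_split\<close>), so Hermitian basic data provide bases \<open>S\<close> of the splittings
  and \<open>F\<close> of the fusions that are dual for the trace. The modified 6j-symbol is the trace of
  \<open>F \<bullet> (1 \<otimes> F) \<bullet> (S \<otimes> 1) \<bullet> S\<close> (\<open>sixj_eq\<close>), and the identities of LW data follow: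
  \<^item> The symmetries hold because the trace is cyclic and one leg of the tetrahedron may be bent around.
  \<^item> If \<open>|i| + |j|\<close> is generic, then the identity of \<open>V i \<odot> V j\<close> is the sum of the morphisms \<open>d k S F\<close>
    (\<open>completeness\<close>). Inserting this sum into a trace, together with the expansions of a morphism in
    the bases \<open>S\<close> and \<open>F\<close>, gives the pentagon identity and orthogonality.
  \<^item> Bending is a similitude of factor \<open>\<beta>\<close> for the Hermitian form, so the dagger of \<open>S\<close> is \<open>\<beta> \<gamma> F\<close>
    (\<open>adag_S\<close>). The dagger therefore turns the tetrahedron upside down, up to these factors.

  For the existence of Hermitian basic data, no label is equal to its dual since its degree is
  neither zero nor of order two. So \<open>w\<close> may be chosen freely on one label of every pair \<open>{i, i\<^sup>\<star>}\<close>, which determines it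
  on the other one; the condition is symmetric in the two labels by pivotality
  (\<open>dual_mor_piv_symmetric\<close>). The conditions on the bases connect the six triples that arise from
  \<open>(i, j, k)\<close> by rotation and by \<open>(i, j, k) \<mapsto> (k\<^sup>\<star>, j\<^sup>\<star>, i\<^sup>\<star>)\<close>. If the multiplicity space is not zero, the
  degrees add up to zero, and the six triples are distinct because no generic degree is zero or of
  order two or three. An orthogonal basis, which exists for a Hermitian form if some \<open>c + bar c\<close> is not
  zero (\<open>orthogonal_basis_exists\<close>), is chosen for one triple and transported to its rotations;
  the \<open>\<Theta>\<close>-dual basis is used for the other three triples. The dual basis is orthogonal, too, since up to
  norms it consists of the daggers of the basis, with bent legs (\<open>T_conj_vec\<close>), and the choices are
  consistent because \<open>\<Theta>\<close> is symmetric and invariant under rotation (\<open>Theta_sym\<close>, \<open>Theta_arot\<close>).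
\<close>

section \<open>Arrows with source and target\<close>

text \<open>
  Composition and tensor product of \<open>'m\<close> obey the axioms only relative to Hom-spaces. An arrow carries its
  source and target, so that composability of long diagrams is decided by rewriting. Tensor products with
  identities, the two whiskerings, suffice to build all diagrams.
\<close>
datatype ('o, 'm) arrow = Arrow (src: 'o) (mor: 'm) (tgt: 'o)

definition (in tensor_category) arr :: "('o, 'm) arrow \<Rightarrow> bool" where
  "arr f \<longleftrightarrow> mor f \<in> Hom C (src f) (tgt f)"

definition (in tensor_category) one :: "'o \<Rightarrow> ('o, 'm) arrow" where
  "one A = Arrow A (Id C A) A"

definition (in tensor_category) acomp :: "('o, 'm) arrow \<Rightarrow> ('o, 'm) arrow \<Rightarrow> ('o, 'm) arrow"
    (infixr "\<bullet>" 60) where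
  "g \<bullet> f = Arrow (src f) (mor g \<cdot> mor f) (tgt g)"

definition (in tensor_category) lwhisker :: "'o \<Rightarrow> ('o, 'm) arrow \<Rightarrow> ('o, 'm) arrow"
    (infixr "\<triangleright>" 65) where
  "P \<triangleright> f = Arrow (P \<odot> src f) (Id C P \<otimes> mor f) (P \<odot> tgt f)"

definition (in tensor_category) rwhisker :: "('o, 'm) arrow \<Rightarrow> 'o \<Rightarrow> ('o, 'm) arrow"
    (infixl "\<triangleleft>" 66) where
  "f \<triangleleft> Q = Arrow (src f \<odot> Q) (mor f \<otimes> Id C Q) (tgt f \<odot> Q)"

definition (in tensor_category) ascale :: "'k \<Rightarrow> ('o, 'm) arrow \<Rightarrow> ('o, 'm) arrow"
    (infixr "*\<^sub>a" 62) where
  "c *\<^sub>a f = Arrow (src f) (smult C c (mor f)) (tgt f)"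

context tensor_category
begin

sublocale vs: vector_space "smult C"
  by (rule vector_space)

abbreviation arrow_between :: "('o, 'm) arrow \<Rightarrow> 'o \<Rightarrow> 'o \<Rightarrow> bool"
    ("\<guillemotleft>_ : _ \<rightarrow> _\<guillemotright>") where
  "\<guillemotleft>f : A \<rightarrow> B\<guillemotright> \<equiv> arr f \<and> src f = A \<and> tgt f = B"

lemma src_simps [simp]:
  "src (one A) = A" "src (g \<bullet> f) = src f" "src (P \<triangleright> f) = P \<odot> src f"
  "src (f \<triangleleft> Q) = src f \<odot> Q" "src (c *\<^sub>a f) = src f"
  by (simp_all add: one_def acomp_def lwhisker_def rwhisker_def ascale_def)

lemma tgt_simps [simp]:
  "tgt (one A) = A" "tgt (g \<bullet> f) = tgt g" "tgt (P \<triangleright> f) = P \<odot> tgt f"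
  "tgt (f \<triangleleft> Q) = tgt f \<odot> Q" "tgt (c *\<^sub>a f) = tgt f"
  by (simp_all add: one_def acomp_def lwhisker_def rwhisker_def ascale_def)

lemma mor_one: "mor (one A) = Id C A"
  by (simp add: one_def)

lemma mor_acomp: "mor (g \<bullet> f) = mor g \<cdot> mor f"
  by (simp add: acomp_def)

lemma mor_lwhisker: "mor (P \<triangleright> f) = Id C P \<otimes> mor f"
  by (simp add: lwhisker_def)

lemma mor_rwhisker: "mor (f \<triangleleft> Q) = mor f \<otimes> Id C Q"
  by (simp add: rwhisker_def)

lemma mor_ascale: "mor (c *\<^sub>a f) = smult C c (mor f)"
  by (simp add: ascale_def)

lemmas mor_simps = mor_one mor_acomp mor_lwhisker mor_rwhisker mor_ascale

lemma arrow_eqI: "\<lbrakk>mor f = mor g; src f = src g; tgt f = tgt g\<rbrakk> \<Longrightarrow> f = g"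
  by (cases f; cases g) simp

lemma arr_Arrow [simp]: "arr (Arrow A m B) \<longleftrightarrow> m \<in> Hom C A B"
  by (simp add: arr_def)

lemma mor_in: "\<guillemotleft>f : A \<rightarrow> B\<guillemotright> \<Longrightarrow> mor f \<in> Hom C A B"
  by (auto simp: arr_def)

lemma Hom_add: "\<lbrakk>f \<in> Hom C A B; g \<in> Hom C A B\<rbrakk> \<Longrightarrow> f + g \<in> Hom C A B"
  by (rule vs.subspace_add[OF Hom_subspace])

lemma Hom_smult: "f \<in> Hom C A B \<Longrightarrow> smult C c f \<in> Hom C A B"
  by (rule vs.subspace_scale[OF Hom_subspace])

lemma Hom_zero: "0 \<in> Hom C A B"
  by (rule vs.subspace_0[OF Hom_subspace])

lemma Hom_sum: "(\<And>x. x \<in> S \<Longrightarrow> f x \<in> Hom C A B) \<Longrightarrow> (\<Sum>x\<in>S. f x) \<in> Hom C A B"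
  by (rule vs.subspace_sum[OF Hom_subspace])

lemma arr_one [simp]: "arr (one A)"
  by (simp add: one_def Id_in)

lemma arr_acomp [simp]: "\<lbrakk>arr g; arr f; src g = tgt f\<rbrakk> \<Longrightarrow> arr (g \<bullet> f)"
  by (auto simp: arr_def acomp_def comp_in)

lemma arr_lwhisker [simp]: "arr f \<Longrightarrow> arr (P \<triangleright> f)"
  by (auto simp: arr_def lwhisker_def tensor_in Id_in)

lemma arr_rwhisker [simp]: "arr f \<Longrightarrow> arr (f \<triangleleft> P)"
  by (auto simp: arr_def rwhisker_def tensor_in Id_in)

lemma arr_ascale [simp]: "arr f \<Longrightarrow> arr (c *\<^sub>a f)"
  by (auto simp: arr_def ascale_def Hom_smult)

declare tensor_obj_assoc [simp] unit_tensor_obj [simp] tensor_obj_unit [simp]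

lemma acomp_assoc:
  "\<lbrakk>arr h; arr g; arr f; src h = tgt g; src g = tgt f\<rbrakk> \<Longrightarrow> (h \<bullet> g) \<bullet> f = h \<bullet> (g \<bullet> f)"
  by (rule arrow_eqI) (auto simp: mor_simps arr_def intro: comp_assoc)

lemma one_acomp [simp]: "\<lbrakk>arr f; tgt f = A\<rbrakk> \<Longrightarrow> one A \<bullet> f = f"
  by (rule arrow_eqI) (auto simp: mor_simps arr_def intro: Id_comp)

lemma acomp_one [simp]: "\<lbrakk>arr f; src f = A\<rbrakk> \<Longrightarrow> f \<bullet> one A = f"
  by (rule arrow_eqI) (auto simp: mor_simps arr_def intro: comp_Id)

lemma lwhisker_one [simp]: "P \<triangleright> one A = one (P \<odot> A)"
  by (rule arrow_eqI) (auto simp: mor_simps tensor_Id)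

lemma rwhisker_one [simp]: "one A \<triangleleft> Q = one (A \<odot> Q)"
  by (rule arrow_eqI) (auto simp: mor_simps tensor_Id)

lemma unit_lwhisker [simp]: "arr f \<Longrightarrow> \<I> \<triangleright> f = f"
  by (rule arrow_eqI) (auto simp: mor_simps unit_tensor arr_def)

lemma unit_rwhisker [simp]: "arr f \<Longrightarrow> f \<triangleleft> \<I> = f"
  by (rule arrow_eqI) (auto simp: mor_simps tensor_unit arr_def)

lemma lwhisker_lwhisker [simp]: "arr f \<Longrightarrow> P \<triangleright> (Q \<triangleright> f) = (P \<odot> Q) \<triangleright> f"
  by (rule arrow_eqI)
    (auto simp: mor_simps arr_def tensor_assoc[OF Id_in Id_in, symmetric] tensor_Id)

lemma rwhisker_rwhisker [simp]: "arr f \<Longrightarrow> (f \<triangleleft> P) \<triangleleft> Q = f \<triangleleft> (P \<odot> Q)"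
  by (rule arrow_eqI)
    (auto simp: mor_simps arr_def tensor_assoc[OF _ Id_in Id_in] tensor_Id)

lemma lwhisker_rwhisker [simp]: "arr f \<Longrightarrow> (P \<triangleright> f) \<triangleleft> Q = P \<triangleright> (f \<triangleleft> Q)"
  by (rule arrow_eqI) (auto simp: mor_simps arr_def tensor_assoc[OF Id_in _ Id_in])

lemma lwhisker_acomp [simp]:
  "\<lbrakk>arr g; arr f; src g = tgt f\<rbrakk> \<Longrightarrow> P \<triangleright> (g \<bullet> f) = (P \<triangleright> g) \<bullet> (P \<triangleright> f)"
  by (rule arrow_eqI) (auto simp: mor_simps arr_def tensor_comp[OF Id_in Id_in] Id_comp[OF Id_in])

lemma rwhisker_acomp [simp]:
  "\<lbrakk>arr g; arr f; src g = tgt f\<rbrakk> \<Longrightarrow> (g \<bullet> f) \<triangleleft> Q = (g \<triangleleft> Q) \<bullet> (f \<triangleleft> Q)"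
  by (rule arrow_eqI) (auto simp: mor_simps arr_def tensor_comp[OF _ _ Id_in Id_in] Id_comp[OF Id_in])

lemma mor_tensor:
  assumes "arr f" "arr g"
  shows "mor f \<otimes> mor g = mor ((f \<triangleleft> tgt g) \<bullet> (src f \<triangleright> g))"
  using assms
  by (auto simp: mor_simps arr_def tensor_comp[OF _ Id_in Id_in] comp_Id Id_comp)

text \<open>Both sides are the tensor product of \<open>f\<close> and \<open>g\<close>.\<close>
lemma interchange:
  assumes "arr f" "arr g"
  shows "(f \<triangleleft> tgt g) \<bullet> (src f \<triangleright> g) = (tgt f \<triangleright> g) \<bullet> (f \<triangleleft> src g)"
  using assms
  by (intro arrow_eqI) (auto simp: mor_simps arr_def tensor_comp[OF _ Id_in Id_in]
    tensor_comp[OF Id_in _ _ Id_in] comp_Id Id_comp)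

lemma ascale_simps [simp]:
  "\<lbrakk>arr g; arr f; src g = tgt f\<rbrakk> \<Longrightarrow> (c *\<^sub>a g) \<bullet> f = c *\<^sub>a (g \<bullet> f)"
  "\<lbrakk>arr g; arr f; src g = tgt f\<rbrakk> \<Longrightarrow> g \<bullet> (c *\<^sub>a f) = c *\<^sub>a (g \<bullet> f)"
  "arr f \<Longrightarrow> P \<triangleright> (c *\<^sub>a f) = c *\<^sub>a (P \<triangleright> f)"
  "arr f \<Longrightarrow> (c *\<^sub>a f) \<triangleleft> Q = c *\<^sub>a (f \<triangleleft> Q)"
  "c *\<^sub>a (e *\<^sub>a f) = (c * e) *\<^sub>a f" "1 *\<^sub>a f = f"
  by (rule arrow_eqI; auto simp: mor_simps arr_def comp_smult_left comp_smult_right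
      tensor_smult_right[OF Id_in] tensor_smult_left[OF _ Id_in])+

lemma comp_sum_left:
  assumes "\<And>x. x \<in> S \<Longrightarrow> m x \<in> Hom C B D" "f \<in> Hom C A B"
  shows "(\<Sum>x\<in>S. m x) \<cdot> f = (\<Sum>x\<in>S. m x \<cdot> f)"
proof -
  have z: "0 \<cdot> f = 0" using comp_add_left[OF Hom_zero Hom_zero assms(2)] by simp
  have "(\<Sum>x\<in>S. m x) \<in> Hom C B D \<and> (\<Sum>x\<in>S. m x) \<cdot> f = (\<Sum>x\<in>S. m x \<cdot> f)"
    using assms(1)
  proof (induction S rule: infinite_finite_induct)
    case (insert x S)
    then show ?case using comp_add_left[OF _ _ assms(2), of "m x" D "sum m S"] by (simp add: Hom_add)
  qed (use z Hom_zero in simp_all)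
  then show ?thesis ..
qed

definition functional :: "'o \<Rightarrow> 'o \<Rightarrow> ('m \<Rightarrow> 'k) \<Rightarrow> bool" where
  "functional A B \<phi> \<longleftrightarrow>
    (\<forall>f\<in>Hom C A B. \<forall>g\<in>Hom C A B. \<forall>c. \<phi> (f + g) = \<phi> f + \<phi> g \<and> \<phi> (smult C c f) = c * \<phi> f)"

lemma functional_sum:
  assumes "functional A B \<phi>" "\<And>x. x \<in> S \<Longrightarrow> m x \<in> Hom C A B"
  shows "\<phi> (\<Sum>x\<in>S. smult C (c x) (m x)) = (\<Sum>x\<in>S. c x * \<phi> (m x))"
proof -
  have zero: "\<phi> 0 = 0"
  proof -
    have "\<phi> (smult C 0 0) = 0 * \<phi> 0"
      using assms(1) Hom_zero unfolding functional_def by blast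
    then show ?thesis by simp
  qed
  have "(\<Sum>x\<in>S. smult C (c x) (m x)) \<in> Hom C A B \<and>
    \<phi> (\<Sum>x\<in>S. smult C (c x) (m x)) = (\<Sum>x\<in>S. c x * \<phi> (m x))"
    using assms(2)
  proof (induction S rule: infinite_finite_induct)
    case (insert x S)
    then have m: "m x \<in> Hom C A B" and IH: "(\<Sum>x\<in>S. smult C (c x) (m x)) \<in> Hom C A B"
      "\<phi> (\<Sum>x\<in>S. smult C (c x) (m x)) = (\<Sum>x\<in>S. c x * \<phi> (m x))" by auto
    have "\<phi> (smult C (c x) (m x) + (\<Sum>x\<in>S. smult C (c x) (m x))) =
        \<phi> (smult C (c x) (m x)) + \<phi> (\<Sum>x\<in>S. smult C (c x) (m x))"
      and "\<phi> (smult C (c x) (m x)) = c x * \<phi> (m x)"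
      using assms(1) m IH(1) Hom_smult[OF m] unfolding functional_def by blast+
    then show ?case using insert.hyps IH m by (simp add: Hom_add Hom_smult)
  qed (auto simp: zero Hom_zero)
  then show ?thesis by simp
qed

end

section \<open>Dualities and bending\<close>

context tensor_category
begin

text \<open>Interchange for morphisms from or to the unit object, which disappears from the whiskerings.\<close>
lemma slide_cup_right:
  assumes "arr f" "arr u" "src u = \<I>"
  shows "(f \<triangleleft> tgt u) \<bullet> (src f \<triangleright> u) = (tgt f \<triangleright> u) \<bullet> f"
  using interchange[OF assms(1,2)] assms by simp

lemma slide_cap_right:
  assumes "arr f" "arr c" "tgt c = \<I>"
  shows "(tgt f \<triangleright> c) \<bullet> (f \<triangleleft> src c) = f \<bullet> (src f \<triangleright> c)"
  using interchange[OF assms(1,2)] assms by simp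

lemma slide_cup_left:
  assumes "arr f" "arr u" "src u = \<I>"
  shows "(tgt u \<triangleright> f) \<bullet> (u \<triangleleft> src f) = (u \<triangleleft> tgt f) \<bullet> f"
  using interchange[OF assms(2,1)] assms by simp

lemma slide_cap_left:
  assumes "arr f" "arr c" "tgt c = \<I>"
  shows "(c \<triangleleft> tgt f) \<bullet> (src c \<triangleright> f) = f \<bullet> (c \<triangleleft> src f)"
  using interchange[OF assms(2,1)] assms by simp

text \<open>The arrows \<open>c\<close> and \<open>u\<close> exhibit \<open>W\<close> as a right dual of \<open>V\<close>.\<close>
definition duality :: "'o \<Rightarrow> 'o \<Rightarrow> ('o, 'm) arrow \<Rightarrow> ('o, 'm) arrow \<Rightarrow> bool" where
  "duality V W c u \<longleftrightarrow> \<guillemotleft>c : V \<odot> W \<rightarrow> \<I>\<guillemotright> \<and> \<guillemotleft>u : \<I> \<rightarrow> W \<odot> V\<guillemotright> \<and>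
     (c \<triangleleft> V) \<bullet> (V \<triangleright> u) = one V \<and> (W \<triangleright> c) \<bullet> (u \<triangleleft> W) = one W"

definition bend_right :: "'o \<Rightarrow> ('o, 'm) arrow \<Rightarrow> 'o \<Rightarrow> ('o, 'm) arrow \<Rightarrow> ('o, 'm) arrow" where
  "bend_right W c B f = (B \<triangleright> c) \<bullet> (f \<triangleleft> W)"

definition unbend_right :: "'o \<Rightarrow> ('o, 'm) arrow \<Rightarrow> 'o \<Rightarrow> ('o, 'm) arrow \<Rightarrow> ('o, 'm) arrow" where
  "unbend_right V u A g = (g \<triangleleft> V) \<bullet> (A \<triangleright> u)"

definition bend_left :: "'o \<Rightarrow> ('o, 'm) arrow \<Rightarrow> 'o \<Rightarrow> ('o, 'm) arrow \<Rightarrow> ('o, 'm) arrow" where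
  "bend_left W c B f = (c \<triangleleft> B) \<bullet> (W \<triangleright> f)"

definition unbend_left :: "'o \<Rightarrow> ('o, 'm) arrow \<Rightarrow> 'o \<Rightarrow> ('o, 'm) arrow \<Rightarrow> ('o, 'm) arrow" where
  "unbend_left V u A g = (V \<triangleright> g) \<bullet> (u \<triangleleft> A)"

lemma dualityD:
  assumes "duality V W c u"
  shows "\<guillemotleft>c : V \<odot> W \<rightarrow> \<I>\<guillemotright>" "\<guillemotleft>u : \<I> \<rightarrow> W \<odot> V\<guillemotright>"
    "(c \<triangleleft> V) \<bullet> (V \<triangleright> u) = one V" "(W \<triangleright> c) \<bullet> (u \<triangleleft> W) = one W"
  using assms by (simp_all add: duality_def)

lemma bend_right_arr:
  assumes "duality V W c u" "\<guillemotleft>f : A \<rightarrow> B \<odot> V\<guillemotright>"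
  shows "\<guillemotleft>bend_right W c B f : A \<odot> W \<rightarrow> B\<guillemotright>"
  using assms dualityD[OF assms(1)] by (simp add: bend_right_def)

lemma unbend_right_arr:
  assumes "duality V W c u" "\<guillemotleft>g : A \<odot> W \<rightarrow> B\<guillemotright>"
  shows "\<guillemotleft>unbend_right V u A g : A \<rightarrow> B \<odot> V\<guillemotright>"
  using assms dualityD[OF assms(1)] by (simp add: unbend_right_def)

lemma bend_left_arr:
  assumes "duality W V c u" "\<guillemotleft>f : A \<rightarrow> V \<odot> B\<guillemotright>"
  shows "\<guillemotleft>bend_left W c B f : W \<odot> A \<rightarrow> B\<guillemotright>"
  using assms dualityD[OF assms(1)] by (simp add: bend_left_def tensor_obj_assoc[symmetric]
    del: tensor_obj_assoc)

lemma unbend_left_arr: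
  assumes "duality W V c u" "\<guillemotleft>g : W \<odot> A \<rightarrow> B\<guillemotright>"
  shows "\<guillemotleft>unbend_left V u A g : A \<rightarrow> V \<odot> B\<guillemotright>"
  using assms dualityD[OF assms(1)] by (simp add: unbend_left_def tensor_obj_assoc[symmetric]
    del: tensor_obj_assoc)

lemma unbend_bend_right:
  assumes d: "duality V W c u" and f: "\<guillemotleft>f : A \<rightarrow> B \<odot> V\<guillemotright>"
  shows "unbend_right V u A (bend_right W c B f) = f"
proof -
  note D = dualityD[OF d]
  have "unbend_right V u A (bend_right W c B f) =
      (B \<triangleright> (c \<triangleleft> V)) \<bullet> ((f \<triangleleft> tgt u) \<bullet> (src f \<triangleright> u))"
    using D f by (simp add: unbend_right_def bend_right_def acomp_assoc)
  also have "\<dots> = (B \<triangleright> (c \<triangleleft> V)) \<bullet> ((tgt f \<triangleright> u) \<bullet> f)"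
    using D f by (subst slide_cup_right) auto
  also have "\<dots> = (B \<triangleright> ((c \<triangleleft> V) \<bullet> (V \<triangleright> u))) \<bullet> f"
    using D(1,2) f by (simp add: acomp_assoc)
  also have "\<dots> = f" using f by (simp only: D(3)) simp
  finally show ?thesis .
qed

lemma bend_unbend_right:
  assumes d: "duality V W c u" and g: "\<guillemotleft>g : A \<odot> W \<rightarrow> B\<guillemotright>"
  shows "bend_right W c B (unbend_right V u A g) = g"
proof -
  note D = dualityD[OF d]
  have "bend_right W c B (unbend_right V u A g) =
      ((tgt g \<triangleright> c) \<bullet> (g \<triangleleft> src c)) \<bullet> (A \<triangleright> (u \<triangleleft> W))"
    using D g by (simp add: unbend_right_def bend_right_def acomp_assoc)
  also have "\<dots> = (g \<bullet> (src g \<triangleright> c)) \<bullet> (A \<triangleright> (u \<triangleleft> W))"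
    using D g by (subst slide_cap_right) auto
  also have "\<dots> = g \<bullet> (A \<triangleright> ((W \<triangleright> c) \<bullet> (u \<triangleleft> W)))"
    using D(1,2) g by (simp add: acomp_assoc)
  also have "\<dots> = g" using g by (simp only: D(4)) simp
  finally show ?thesis .
qed

lemma unbend_bend_left:
  assumes d: "duality W V c u" and f: "\<guillemotleft>f : A \<rightarrow> V \<odot> B\<guillemotright>"
  shows "unbend_left V u A (bend_left W c B f) = f"
proof -
  note D = dualityD[OF d]
  have "unbend_left V u A (bend_left W c B f) =
      (V \<triangleright> (c \<triangleleft> B)) \<bullet> ((tgt u \<triangleright> f) \<bullet> (u \<triangleleft> src f))"
    using D f by (simp add: unbend_left_def bend_left_def acomp_assoc)
  also have "\<dots> = (V \<triangleright> (c \<triangleleft> B)) \<bullet> ((u \<triangleleft> tgt f) \<bullet> f)"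
    using D f by (subst slide_cup_left) auto
  also have "\<dots> = (((V \<triangleright> c) \<bullet> (u \<triangleleft> V)) \<triangleleft> B) \<bullet> f"
    using D(1,2) f by (simp add: acomp_assoc)
  also have "\<dots> = f" using f by (simp only: D(4)) simp
  finally show ?thesis .
qed

lemma bend_unbend_left:
  assumes d: "duality W V c u" and g: "\<guillemotleft>g : W \<odot> A \<rightarrow> B\<guillemotright>"
  shows "bend_left W c B (unbend_left V u A g) = g"
proof -
  note D = dualityD[OF d]
  have "bend_left W c B (unbend_left V u A g) =
      ((c \<triangleleft> tgt g) \<bullet> (src c \<triangleright> g)) \<bullet> (W \<triangleright> (u \<triangleleft> A))"
    using D g by (simp add: unbend_left_def bend_left_def acomp_assoc)
  also have "\<dots> = (g \<bullet> (c \<triangleleft> src g)) \<bullet> (W \<triangleright> (u \<triangleleft> A))"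
    using D g by (subst slide_cap_left) auto
  also have "\<dots> = g \<bullet> (((c \<triangleleft> W) \<bullet> (W \<triangleright> u)) \<triangleleft> A)"
    using D(1,2) g by (simp add: acomp_assoc)
  also have "\<dots> = g" using g by (simp only: D(3)) simp
  finally show ?thesis .
qed

lemma bend_right_pre:
  assumes "duality V W c u" "\<guillemotleft>f : A \<rightarrow> B \<odot> V\<guillemotright>" "\<guillemotleft>h : A' \<rightarrow> A\<guillemotright>"
  shows "bend_right W c B (f \<bullet> h) = bend_right W c B f \<bullet> (h \<triangleleft> W)"
  using assms(2,3) dualityD[OF assms(1)] by (simp add: bend_right_def acomp_assoc)

lemma bend_left_pre:
  assumes "duality W V c u" "\<guillemotleft>f : A \<rightarrow> V \<odot> B\<guillemotright>" "\<guillemotleft>h : A' \<rightarrow> A\<guillemotright>"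
  shows "bend_left W c B (f \<bullet> h) = bend_left W c B f \<bullet> (W \<triangleright> h)"
  using assms(2,3) dualityD[OF assms(1)] by (simp add: bend_left_def acomp_assoc)

lemma bend_right_post:
  assumes "duality V W c u" "\<guillemotleft>f : A \<rightarrow> B \<odot> V\<guillemotright>" "\<guillemotleft>k : B \<rightarrow> B'\<guillemotright>"
  shows "bend_right W c B' ((k \<triangleleft> V) \<bullet> f) = k \<bullet> bend_right W c B f"
proof -
  note D = dualityD[OF assms(1)]
  have "bend_right W c B' ((k \<triangleleft> V) \<bullet> f) = ((tgt k \<triangleright> c) \<bullet> (k \<triangleleft> src c)) \<bullet> (f \<triangleleft> W)"
    using D(1,2) assms(2,3) by (simp add: bend_right_def acomp_assoc)
  also have "\<dots> = (k \<bullet> (src k \<triangleright> c)) \<bullet> (f \<triangleleft> W)"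
    using D assms(2,3) by (subst slide_cap_right) auto
  finally show ?thesis using D(1,2) assms(2,3) by (simp add: bend_right_def acomp_assoc)
qed

lemma bend_left_post:
  assumes "duality W V c u" "\<guillemotleft>f : A \<rightarrow> V \<odot> B\<guillemotright>" "\<guillemotleft>k : B \<rightarrow> B'\<guillemotright>"
  shows "bend_left W c B' ((V \<triangleright> k) \<bullet> f) = k \<bullet> bend_left W c B f"
proof -
  note D = dualityD[OF assms(1)]
  have "bend_left W c B' ((V \<triangleright> k) \<bullet> f) = ((c \<triangleleft> tgt k) \<bullet> (src c \<triangleright> k)) \<bullet> (W \<triangleright> f)"
    using D(1,2) assms(2,3) by (simp add: bend_left_def acomp_assoc)
  also have "\<dots> = (k \<bullet> (c \<triangleleft> src k)) \<bullet> (W \<triangleright> f)"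
    using D assms(2,3) by (subst slide_cap_left) auto
  finally show ?thesis using D(1,2) assms(2,3) by (simp add: bend_left_def acomp_assoc)
qed

lemma bend_right_lwhisker:
  assumes "duality V W c u" "\<guillemotleft>f : A \<rightarrow> B \<odot> V\<guillemotright>"
  shows "bend_right W c (P \<odot> B) (P \<triangleright> f) = P \<triangleright> bend_right W c B f"
  using assms(2) dualityD[OF assms(1)] by (simp add: bend_right_def)

lemma bend_left_rwhisker:
  assumes "duality W V c u" "\<guillemotleft>f : A \<rightarrow> V \<odot> B\<guillemotright>"
  shows "bend_left W c (B \<odot> P) (f \<triangleleft> P) = bend_left W c B f \<triangleleft> P"
  using assms(2) dualityD[OF assms(1)] by (simp add: bend_left_def)

lemma bend_left_right:
  assumes d: "duality V W c u" and d': "duality W' V' c' u'" and f: "\<guillemotleft>f : A \<rightarrow> V' \<odot> B \<odot> V\<guillemotright>"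
  shows "bend_left W' c' B (bend_right W c (V' \<odot> B) f) = bend_right W c B (bend_left W' c' (B \<odot> V) f)"
proof -
  note D = dualityD[OF d] dualityD[OF d']
  have "bend_left W' c' B (bend_right W c (V' \<odot> B) f) =
      ((c' \<triangleleft> tgt (B \<triangleright> c)) \<bullet> (src c' \<triangleright> (B \<triangleright> c))) \<bullet> (W' \<triangleright> (f \<triangleleft> W))"
    using D(1,2,5,6) f by (simp add: bend_left_def bend_right_def acomp_assoc)
  also have "\<dots> = ((B \<triangleright> c) \<bullet> (c' \<triangleleft> src (B \<triangleright> c))) \<bullet> (W' \<triangleright> (f \<triangleleft> W))"
    using D f by (subst slide_cap_left) auto
  finally show ?thesis using D(1,2,5,6) f by (simp add: bend_left_def bend_right_def acomp_assoc)
qed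

text \<open>Both sides are the diagram in which \<open>c\<close> joins a right leg of \<open>f\<close> with a left leg of \<open>g\<close>.\<close>
lemma bend_crossing:
  assumes c: "\<guillemotleft>c : V \<odot> W \<rightarrow> \<I>\<guillemotright>" and f: "\<guillemotleft>f : A \<rightarrow> P \<odot> V\<guillemotright>" and g: "\<guillemotleft>g : B \<rightarrow> W \<odot> Q\<guillemotright>"
  shows "(P \<triangleright> bend_left V c Q g) \<bullet> (f \<triangleleft> B) = (bend_right W c P f \<triangleleft> Q) \<bullet> (A \<triangleright> g)"
proof -
  have "(P \<triangleright> bend_left V c Q g) \<bullet> (f \<triangleleft> B) = (P \<triangleright> (c \<triangleleft> Q)) \<bullet> ((tgt f \<triangleright> g) \<bullet> (f \<triangleleft> src g))"
    using assms by (simp add: bend_left_def acomp_assoc)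
  also have "\<dots> = (P \<triangleright> (c \<triangleleft> Q)) \<bullet> ((f \<triangleleft> tgt g) \<bullet> (src f \<triangleright> g))"
    using assms by (subst interchange) auto
  finally show ?thesis
    using assms by (simp add: bend_right_def acomp_assoc)
qed

lemma cap_determines_cup:
  assumes d: "duality V W c u" and d': "duality V W c u'"
  shows "u = u'"
proof -
  have "bend_right W c W u' = one W"
    using dualityD[OF d'] by (simp add: bend_right_def)
  moreover have "bend_right W c W u = one W"
    using dualityD[OF d] by (simp add: bend_right_def)
  moreover have "unbend_right V u \<I> (bend_right W c W u) = u"
    "unbend_right V u \<I> (bend_right W c W u') = u'"
    using unbend_bend_right[OF d, of _ \<I> W] dualityD(2)[OF d] dualityD(2)[OF d'] by auto
  ultimately show ?thesis by simp
qed

end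

context pivotal_category
begin

definition aev where "aev X = Arrow (dual C X \<odot> X) (ev C X) \<I>"
definition acoev where "acoev X = Arrow \<I> (coev C X) (X \<odot> dual C X)"
definition atev where "atev X = Arrow (X \<odot> dual C X) (tev C X) \<I>"
definition atcoev where "atcoev X = Arrow \<I> (tcoev C X) (dual C X \<odot> X)"

lemma mor_pivotal: "mor (aev X) = ev C X" "mor (acoev X) = coev C X"
  "mor (atev X) = tev C X" "mor (atcoev X) = tcoev C X"
  by (simp_all add: aev_def acoev_def atev_def atcoev_def)

lemma pivotal_arr [simp]:
  "arr (aev X)" "src (aev X) = dual C X \<odot> X" "tgt (aev X) = \<I>"
  "arr (acoev X)" "src (acoev X) = \<I>" "tgt (acoev X) = X \<odot> dual C X"
  "arr (atev X)" "src (atev X) = X \<odot> dual C X" "tgt (atev X) = \<I>"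
  "arr (atcoev X)" "src (atcoev X) = \<I>" "tgt (atcoev X) = dual C X \<odot> X"
  by (simp_all add: aev_def acoev_def atev_def atcoev_def ev_in coev_in tev_in tcoev_in)

lemma duality_left: "duality (dual C X) X (aev X) (acoev X)"
  unfolding duality_def
  by (auto intro!: arrow_eqI simp: mor_simps mor_pivotal zigzag zigzag_dual)

lemma duality_right: "duality X (dual C X) (atev X) (atcoev X)"
  unfolding duality_def
  by (auto intro!: arrow_eqI simp: mor_simps mor_pivotal tzigzag tzigzag_dual)

lemma ascale_one_unit_eqD: "c *\<^sub>a one \<I> = c' *\<^sub>a one \<I> \<Longrightarrow> c = c'"
  using End_unit[OF Hom_smult[OF Id_in[of \<I>]], of c]
  by (metis mor_ascale mor_one)

lemma unit_endo_scalar: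
  assumes "\<guillemotleft>f : \<I> \<rightarrow> \<I>\<guillemotright>"
  obtains c where "f = c *\<^sub>a one \<I>"
proof -
  obtain c where "mor f = smult C c (Id C \<I>)"
    using ex1_implies_ex[OF End_unit[OF mor_in[OF assms]]] by blast
  then have "f = c *\<^sub>a one \<I>" using assms by (intro arrow_eqI) (auto simp: mor_simps)
  then show thesis by (rule that)
qed

lemma coev_unit_inverse:
  "aev \<I> \<bullet> acoev \<I> = one \<I>" "acoev \<I> \<bullet> aev \<I> = one (dual C \<I>)"
  "atev \<I> \<bullet> atcoev \<I> = one \<I>" "atcoev \<I> \<bullet> atev \<I> = one (dual C \<I>)"
  using dualityD(3,4)[OF duality_left[of \<I>]] dualityD(3,4)[OF duality_right[of \<I>]]
    slide_cap_left[of "acoev \<I>" "aev \<I>"] slide_cap_right[of "atcoev \<I>" "atev \<I>"]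
  by simp_all

definition adual_tensor where
  "adual_tensor X Y = Arrow (dual C Y \<odot> dual C X) (dual_tensor C X Y) (dual C (X \<odot> Y))"

lemma adual_tensor_left:
  "adual_tensor X Y = unbend_right (dual C (X \<odot> Y)) (acoev (X \<odot> Y)) (dual C Y \<odot> dual C X)
     (aev Y \<bullet> (dual C Y \<triangleright> (aev X \<triangleleft> Y)))"
proof -
  have "unbend_right (dual C (X \<odot> Y)) (acoev (X \<odot> Y)) (dual C Y \<odot> dual C X)
     (aev Y \<bullet> (dual C Y \<triangleright> (aev X \<triangleleft> Y))) = (aev Y \<triangleleft> dual C (X \<odot> Y)) \<bullet>
     (dual C Y \<triangleright> (aev X \<triangleleft> (Y \<odot> dual C (X \<odot> Y)))) \<bullet>
     ((dual C Y \<odot> dual C X) \<triangleright> acoev (X \<odot> Y))"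
    by (simp add: unbend_right_def acomp_assoc)
  also have "mor \<dots> = dual_tensor C X Y"
    by (simp add: mor_simps mor_pivotal dual_tensor_def)
  finally show ?thesis
    by (intro arrow_eqI) (simp_all add: adual_tensor_def unbend_right_def)
qed

lemma adual_tensor_right:
  "adual_tensor X Y = unbend_left (dual C (X \<odot> Y)) (atcoev (X \<odot> Y)) (dual C Y \<odot> dual C X)
     (atev X \<bullet> (X \<triangleright> (atev Y \<triangleleft> dual C X)))"
proof -
  have "unbend_left (dual C (X \<odot> Y)) (atcoev (X \<odot> Y)) (dual C Y \<odot> dual C X)
     (atev X \<bullet> (X \<triangleright> (atev Y \<triangleleft> dual C X))) = (dual C (X \<odot> Y) \<triangleright> atev X) \<bullet>
     ((dual C (X \<odot> Y) \<odot> X) \<triangleright> (atev Y \<triangleleft> dual C X)) \<bullet>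
     (atcoev (X \<odot> Y) \<triangleleft> (dual C Y \<odot> dual C X))"
    by (simp add: unbend_left_def acomp_assoc)
  also have "mor \<dots> = dual_tensor_right C X Y"
    by (simp add: mor_simps mor_pivotal dual_tensor_right_def)
  finally show ?thesis
    by (intro arrow_eqI) (simp_all add: adual_tensor_def dual_tensor_left_right unbend_left_def)
qed

lemma adual_tensor_arr [simp]:
  "arr (adual_tensor X Y)" "src (adual_tensor X Y) = dual C Y \<odot> dual C X"
  "tgt (adual_tensor X Y) = dual C (X \<odot> Y)"
  unfolding adual_tensor_left by (simp_all add: unbend_right_def)

lemma aev_dual_tensor:
  "aev (X \<odot> Y) \<bullet> (adual_tensor X Y \<triangleleft> (X \<odot> Y)) = aev Y \<bullet> (dual C Y \<triangleright> (aev X \<triangleleft> Y))"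
  using bend_unbend_right[OF duality_left[of "X \<odot> Y"], of "aev Y \<bullet> (dual C Y \<triangleright> (aev X \<triangleleft> Y))"
      "dual C Y \<odot> dual C X" \<I>]
  unfolding adual_tensor_left[symmetric] by (simp add: bend_right_def)

lemma atev_dual_tensor:
  "atev (X \<odot> Y) \<bullet> ((X \<odot> Y) \<triangleright> adual_tensor X Y) = atev X \<bullet> (X \<triangleright> (atev Y \<triangleleft> dual C X))"
  using bend_unbend_left[OF duality_right[of "X \<odot> Y"], of "atev X \<bullet> (X \<triangleright> (atev Y \<triangleleft> dual C X))"
      "dual C Y \<odot> dual C X" \<I>]
  unfolding adual_tensor_right[symmetric] by (simp add: bend_left_def)

text \<open>
  The two coevaluations of \<open>\<I>\<close> are proportional, and the compatibility of the dualities with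
  \<open>\<I> \<odot> \<I> = \<I>\<close> shows that the factor is idempotent.
\<close>
lemma coev_unit: "acoev \<I> = atcoev \<I>"
proof -
  note inv = coev_unit_inverse
  obtain c where c: "atev \<I> \<bullet> acoev \<I> = c *\<^sub>a one \<I>"
    by (rule unit_endo_scalar[of "atev \<I> \<bullet> acoev \<I>"]) auto
  have tev: "atev \<I> = c *\<^sub>a aev \<I>"
  proof -
    have "atev \<I> = atev \<I> \<bullet> (acoev \<I> \<bullet> aev \<I>)" unfolding inv by simp
    also have "\<dots> = (atev \<I> \<bullet> acoev \<I>) \<bullet> aev \<I>" by (simp add: acomp_assoc)
    finally show ?thesis unfolding c by simp
  qed
  have tcoev: "acoev \<I> = c *\<^sub>a atcoev \<I>"
  proof -
    have "acoev \<I> = (atcoev \<I> \<bullet> atev \<I>) \<bullet> acoev \<I>" unfolding inv by simp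
    also have "\<dots> = atcoev \<I> \<bullet> (atev \<I> \<bullet> acoev \<I>)" by (simp add: acomp_assoc)
    finally show ?thesis unfolding c by simp
  qed
  let ?D = "adual_tensor \<I> \<I>" and ?e = "aev \<I> \<bullet> (dual C \<I> \<triangleright> aev \<I>)"
  have swap: "aev \<I> \<bullet> (aev \<I> \<triangleleft> dual C \<I>) = ?e"
    using interchange[of "aev \<I>" "aev \<I>"] by simp
  have "aev \<I> \<bullet> ?D = ?e" using aev_dual_tensor[of \<I> \<I>] by simp
  moreover have "atev \<I> \<bullet> ?D = atev \<I> \<bullet> (atev \<I> \<triangleleft> dual C \<I>)"
    using atev_dual_tensor[of \<I> \<I>] by simp
  ultimately have e: "c *\<^sub>a ?e = (c * c) *\<^sub>a ?e"
    using swap by (simp add: tev)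
  let ?u = "(dual C \<I> \<triangleright> acoev \<I>) \<bullet> acoev \<I>"
  have "?e \<bullet> ?u = aev \<I> \<bullet> ((dual C \<I> \<triangleright> (aev \<I> \<bullet> acoev \<I>)) \<bullet> acoev \<I>)"
    by (simp add: acomp_assoc)
  also have "\<dots> = one \<I>" unfolding inv by (simp add: inv)
  finally have eu: "?e \<bullet> ?u = one \<I>" .
  have "c *\<^sub>a (?e \<bullet> ?u) = (c * c) *\<^sub>a (?e \<bullet> ?u)"
    using arg_cong[OF e, of "\<lambda>x. x \<bullet> ?u"] by simp
  then have "c = c * c" unfolding eu by (rule ascale_one_unit_eqD)
  moreover have "c \<noteq> 0"
  proof
    assume "c = 0"
    have "one \<I> = c *\<^sub>a (aev \<I> \<bullet> atcoev \<I>)" using inv(3) tev by simp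
    then have "1 *\<^sub>a one \<I> = 0 *\<^sub>a one \<I>"
      unfolding \<open>c = 0\<close> by (auto intro!: arrow_eqI dest!: arg_cong[of _ _ mor] simp: mor_simps)
    then show False using ascale_one_unit_eqD[of 1 0] by simp
  qed
  ultimately have "c = 1" by simp
  then show ?thesis using tcoev by simp
qed

text \<open>
  The two duals of \<open>y\<close> are morphisms to \<open>\<I>\<^sup>*\<close>. They are the functionals \<open>aev X \<bullet> (1 \<otimes> y)\<close> and \<open>atev X \<bullet> (y \<otimes> 1)\<close>
  followed by the two coevaluations of \<open>\<I>\<close>, which coincide and are invertible.
\<close>
lemma vector_dual_left_right:
  assumes y: "\<guillemotleft>y : \<I> \<rightarrow> X\<guillemotright>"
  shows "aev X \<bullet> (dual C X \<triangleright> y) = atev X \<bullet> (y \<triangleleft> dual C X)"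
    and "ev C \<I> \<cdot> dual_mor C \<I> X (mor y) = mor (aev X \<bullet> (dual C X \<triangleright> y))"
proof -
  let ?L = "(aev X \<triangleleft> dual C \<I>) \<bullet> (dual C X \<triangleright> (y \<triangleleft> dual C \<I>)) \<bullet> (dual C X \<triangleright> acoev \<I>)"
  let ?R = "(dual C \<I> \<triangleright> atev X) \<bullet> (dual C \<I> \<triangleright> (y \<triangleleft> dual C X)) \<bullet> (atcoev \<I> \<triangleleft> dual C X)"
  have "mor ?L = dual_mor C \<I> X (mor y)"
    by (simp add: mor_simps mor_pivotal dual_mor_def)
  moreover have "mor ?R = dual_mor_right C \<I> X (mor y)"
    by (simp add: mor_simps mor_pivotal dual_mor_right_def)
  moreover have "mor y \<in> Hom C \<I> X" using y by (auto simp: arr_def)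
  ultimately have LR: "?L = ?R"
    using y by (intro arrow_eqI) (auto simp: dual_mor_left_right)
  let ?l = "aev X \<bullet> (dual C X \<triangleright> y)" and ?r = "atev X \<bullet> (y \<triangleleft> dual C X)"
  have L: "?L = acoev \<I> \<bullet> ?l"
    using interchange[of ?l "acoev \<I>"] y by (simp add: acomp_assoc)
  have R: "?R = acoev \<I> \<bullet> ?r"
    using interchange[of "acoev \<I>" ?r] y by (simp add: acomp_assoc coev_unit)
  have cancel: "aev \<I> \<bullet> (acoev \<I> \<bullet> f) = f" if "arr f" "tgt f = \<I>" for f
  proof -
    have "aev \<I> \<bullet> (acoev \<I> \<bullet> f) = (aev \<I> \<bullet> acoev \<I>) \<bullet> f" using that by (simp add: acomp_assoc)
    then show ?thesis using that unfolding coev_unit_inverse by simp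
  qed
  have "?l = aev \<I> \<bullet> (acoev \<I> \<bullet> ?l)"
    using y by (intro cancel[symmetric]) auto
  also have "acoev \<I> \<bullet> ?l = acoev \<I> \<bullet> ?r"
    using LR unfolding L R .
  also have "aev \<I> \<bullet> (acoev \<I> \<bullet> ?r) = ?r"
    using y by (intro cancel) auto
  finally show "?l = ?r" .
  have "ev C \<I> \<cdot> dual_mor C \<I> X (mor y) = mor (aev \<I> \<bullet> ?L)"
    using \<open>mor ?L = dual_mor C \<I> X (mor y)\<close> by (simp add: mor_acomp[of "aev \<I>"] mor_pivotal)
  also have "aev \<I> \<bullet> ?L = ?l"
    unfolding L using y by (intro cancel) auto
  finally show "ev C \<I> \<cdot> dual_mor C \<I> X (mor y) = mor ?l" .
qed

end

section \<open>Isomorphisms, simple objects and degrees\<close>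

context tensor_category
begin

definition inverses :: "('o, 'm) arrow \<Rightarrow> ('o, 'm) arrow \<Rightarrow> bool" where
  "inverses f g \<longleftrightarrow> arr f \<and> arr g \<and> src g = tgt f \<and> tgt g = src f \<and>
     g \<bullet> f = one (src f) \<and> f \<bullet> g = one (tgt f)"

lemma inversesD:
  assumes "inverses f g"
  shows "arr f" "arr g" "src g = tgt f" "tgt g = src f" "g \<bullet> f = one (src f)" "f \<bullet> g = one (tgt f)"
  using assms by (auto simp: inverses_def)

lemma inverse_pair_iff: "inverse_pair C A B f g \<longleftrightarrow> inverses (Arrow A f B) (Arrow B g A)"
  by (auto simp: inverse_pair_def inverses_def acomp_def one_def)

lemma isomorphic_iff: "isomorphic C A B \<longleftrightarrow> (\<exists>f g. inverses f g \<and> src f = A \<and> tgt f = B)"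
proof
  assume "\<exists>f g. inverses f g \<and> src f = A \<and> tgt f = B"
  then obtain f g where "inverses f g" "src f = A" "tgt f = B" by blast
  then have "inverses (Arrow A (mor f) B) (Arrow B (mor g) A)"
    by (cases f; cases g) (auto simp: inverses_def)
  then show "isomorphic C A B"
    unfolding isomorphic_def is_iso_def inverse_pair_iff by blast
qed (auto simp: isomorphic_def is_iso_def inverse_pair_iff intro: arrow.sel)

lemma isomorphicI: "\<lbrakk>inverses f g; src f = A; tgt f = B\<rbrakk> \<Longrightarrow> isomorphic C A B"
  unfolding isomorphic_iff by blast

lemma isomorphic_refl: "isomorphic C A A"
  by (rule isomorphicI[of "one A" "one A"]) (auto simp: inverses_def)

lemma isomorphic_sym: "isomorphic C A B \<Longrightarrow> isomorphic C B A"
  unfolding isomorphic_iff by (metis inverses_def)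

lemma isomorphic_trans:
  assumes "isomorphic C A B" "isomorphic C B D"
  shows "isomorphic C A D"
proof -
  obtain f g f' g' where fg: "inverses f g" "src f = A" "tgt f = B"
    and fg': "inverses f' g'" "src f' = B" "tgt f' = D"
    using assms unfolding isomorphic_iff by blast
  note i = inversesD[OF fg(1)] inversesD[OF fg'(1)] fg(2,3) fg'(2,3)
  have "(g \<bullet> g') \<bullet> (f' \<bullet> f) = g \<bullet> ((g' \<bullet> f') \<bullet> f)"
    using i(1-4,7-10,13-16) by (simp add: acomp_assoc)
  moreover have "(f' \<bullet> f) \<bullet> (g \<bullet> g') = f' \<bullet> ((f \<bullet> g) \<bullet> g')"
    using i(1-4,7-10,13-16) by (simp add: acomp_assoc)
  ultimately have "inverses (f' \<bullet> f) (g \<bullet> g')"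
    unfolding inverses_def using i by simp
  then show ?thesis by (rule isomorphicI) (use i in auto)
qed

lemma inv_mor_inverses:
  assumes "is_iso C A B f"
  shows "inverses (Arrow A f B) (Arrow B (inv_mor C A B f) A)"
proof -
  obtain g where g: "inverse_pair C A B f g" using assms by (auto simp: is_iso_def)
  have "inverse_pair C A B f (inv_mor C A B f)"
    unfolding inv_mor_def
  proof (rule theI)
    fix h assume h: "inverse_pair C A B f h"
    have "h = h \<cdot> (f \<cdot> g)" using g h by (auto simp: inverse_pair_def comp_Id)
    also have "\<dots> = (h \<cdot> f) \<cdot> g"
      using g h by (intro comp_assoc[symmetric]) (auto simp: inverse_pair_def)
    also have "\<dots> = g" using g h by (auto simp: inverse_pair_def Id_comp)
    finally show "h = g" .
  qed (rule g)
  then show ?thesis by (simp add: inverse_pair_iff)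
qed

lemma duality_transport_left:
  assumes d: "duality V W c u" and e: "inverses e e'" "src e = V'" "tgt e = V"
  shows "duality V' W (c \<bullet> (e \<triangleleft> W)) ((W \<triangleright> e') \<bullet> u)"
proof -
  note D = dualityD[OF d] and E = inversesD[OF e(1)] e(2,3)
  have "((c \<bullet> (e \<triangleleft> W)) \<triangleleft> V') \<bullet> (V' \<triangleright> ((W \<triangleright> e') \<bullet> u)) =
     (c \<triangleleft> V') \<bullet> ((e \<triangleleft> tgt (W \<triangleright> e')) \<bullet> (src e \<triangleright> (W \<triangleright> e'))) \<bullet> (V' \<triangleright> u)"
    using D(1,2) E by (simp add: acomp_assoc)
  also have "\<dots> = (c \<triangleleft> V') \<bullet> ((tgt e \<triangleright> (W \<triangleright> e')) \<bullet> (e \<triangleleft> src (W \<triangleright> e'))) \<bullet> (V' \<triangleright> u)"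
    using D E by (subst interchange) auto
  also have "\<dots> = ((c \<triangleleft> tgt e') \<bullet> (src c \<triangleright> e')) \<bullet> (e \<triangleleft> tgt u) \<bullet> (src e \<triangleright> u)"
    using D(1,2) E by (simp add: acomp_assoc)
  also have "\<dots> = (e' \<bullet> (c \<triangleleft> src e')) \<bullet> (tgt e \<triangleright> u) \<bullet> e"
    using slide_cup_right[of e u] slide_cap_left[of e' c] D(1,2) E(1-4) by metis
  also have "\<dots> = e' \<bullet> ((c \<triangleleft> V) \<bullet> (V \<triangleright> u)) \<bullet> e"
    using D(1,2) E by (simp add: acomp_assoc)
  also have "\<dots> = one V'" unfolding D(3) using E by simp
  finally have 1: "((c \<bullet> (e \<triangleleft> W)) \<triangleleft> V') \<bullet> (V' \<triangleright> ((W \<triangleright> e') \<bullet> u)) = one V'" .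
  have "(W \<triangleright> (c \<bullet> (e \<triangleleft> W))) \<bullet> (((W \<triangleright> e') \<bullet> u) \<triangleleft> W) =
     (W \<triangleright> c) \<bullet> (W \<triangleright> ((e \<bullet> e') \<triangleleft> W)) \<bullet> (u \<triangleleft> W)"
    using D(1,2) E(1-4,7,8) by (simp add: acomp_assoc)
  also have "\<dots> = one W" unfolding E(6) using D E by simp
  finally show ?thesis
    using 1 D(1,2) E by (simp add: duality_def)
qed

lemma duality_transport_right:
  assumes d: "duality V W c u" and e: "inverses e e'" "src e = W'" "tgt e = W"
  shows "duality V W' (c \<bullet> (V \<triangleright> e)) ((e' \<triangleleft> V) \<bullet> u)"
proof -
  note D = dualityD[OF d] and E = inversesD[OF e(1)] e(2,3)
  have "(W' \<triangleright> (c \<bullet> (V \<triangleright> e))) \<bullet> (((e' \<triangleleft> V) \<bullet> u) \<triangleleft> W') =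
     (W' \<triangleright> c) \<bullet> ((tgt (e' \<triangleleft> V) \<triangleright> e) \<bullet> ((e' \<triangleleft> V) \<triangleleft> src e)) \<bullet> (u \<triangleleft> W')"
    using D(1,2) E by (simp add: acomp_assoc)
  also have "\<dots> = (W' \<triangleright> c) \<bullet> (((e' \<triangleleft> V) \<triangleleft> tgt e) \<bullet> (src (e' \<triangleleft> V) \<triangleright> e)) \<bullet> (u \<triangleleft> W')"
    using D E by (subst interchange) auto
  also have "\<dots> = ((tgt e' \<triangleright> c) \<bullet> (e' \<triangleleft> src c)) \<bullet> (tgt u \<triangleright> e) \<bullet> (u \<triangleleft> src e)"
    using D(1,2) E by (simp add: acomp_assoc)
  also have "\<dots> = (e' \<bullet> (src e' \<triangleright> c)) \<bullet> (u \<triangleleft> tgt e) \<bullet> e"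
    using slide_cup_left[of e u] slide_cap_right[of e' c] D(1,2) E(1-4) by metis
  also have "\<dots> = e' \<bullet> ((W \<triangleright> c) \<bullet> (u \<triangleleft> W)) \<bullet> e"
    using D(1,2) E by (simp add: acomp_assoc)
  also have "\<dots> = one W'" unfolding D(4) using E by simp
  finally have 1: "(W' \<triangleright> (c \<bullet> (V \<triangleright> e))) \<bullet> (((e' \<triangleleft> V) \<bullet> u) \<triangleleft> W') = one W'" .
  have "((c \<bullet> (V \<triangleright> e)) \<triangleleft> V) \<bullet> (V \<triangleright> ((e' \<triangleleft> V) \<bullet> u)) =
     (c \<triangleleft> V) \<bullet> (V \<triangleright> ((e \<bullet> e') \<triangleleft> V)) \<bullet> (V \<triangleright> u)"
    using D(1,2) E(1-4,7,8) by (simp add: acomp_assoc)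
  also have "\<dots> = one V" unfolding E(6) using D E by simp
  finally show ?thesis
    using 1 D(1,2) E by (simp add: duality_def)
qed

text \<open>Two left duals of \<open>W\<close> are compared by bending the evaluation of one with the coevaluation of the other.\<close>
lemma duality_comparison:
  assumes d: "duality V W c u" and d': "duality V' W c' u'"
  shows "inverses (unbend_right V' u' V c) (unbend_right V u V' c')"
proof -
  have half: "(unbend_right V u V' c') \<bullet> (unbend_right V' u' V c) = one V"
    if d: "duality V W c u" and d': "duality V' W c' u'" for V V' c c' u u'
  proof -
    note D = dualityD[OF d] dualityD[OF d']
    let ?a = "unbend_right V' u' V c" and ?b = "unbend_right V u V' c'"
    have a: "\<guillemotleft>?a : V \<rightarrow> V'\<guillemotright>" using unbend_right_arr[OF d', of c V \<I>] D by simp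
    have b: "\<guillemotleft>?b : V' \<rightarrow> V\<guillemotright>" using unbend_right_arr[OF d, of c' V' \<I>] D by simp
    have "bend_right W c \<I> (?b \<bullet> ?a) = bend_right W c \<I> ?b \<bullet> (?a \<triangleleft> W)"
      using a b by (intro bend_right_pre[OF d]) auto
    also have "bend_right W c \<I> ?b = c'" using D by (intro bend_unbend_right[OF d]) auto
    also have "c' \<bullet> (?a \<triangleleft> W) = bend_right W c' \<I> ?a" using D a by (simp add: bend_right_def)
    also have "\<dots> = c" using D by (intro bend_unbend_right[OF d']) auto
    also have "c = bend_right W c \<I> (one V)" using D by (simp add: bend_right_def)
    finally have "unbend_right V u V (bend_right W c \<I> (?b \<bullet> ?a)) =
      unbend_right V u V (bend_right W c \<I> (one V))" by (rule arg_cong)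
    then show ?thesis
      using a b unbend_bend_right[OF d, of "?b \<bullet> ?a" V \<I>] unbend_bend_right[OF d, of "one V" V \<I>]
      by simp
  qed
  have "\<guillemotleft>unbend_right V' u' V c : V \<rightarrow> V'\<guillemotright>" "\<guillemotleft>unbend_right V u V' c' : V' \<rightarrow> V\<guillemotright>"
    using unbend_right_arr[OF d', of c V \<I>] unbend_right_arr[OF d, of c' V' \<I>]
      dualityD[OF d] dualityD[OF d'] by simp_all
  then show ?thesis
    using half[OF d d'] half[OF d' d] by (simp add: inverses_def)
qed

lemma duality_unique_left:
  assumes d: "duality V W c u" and d': "duality V' W c' u'"
  shows "isomorphic C V V'"
proof (rule isomorphicI[OF duality_comparison[OF d d']])
  show "src (unbend_right V' u' V c) = V" "tgt (unbend_right V' u' V c) = V'"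
    using unbend_right_arr[OF d', of c V \<I>] dualityD(1)[OF d] by simp_all
qed

text \<open>The equation \<open>0 *\<^sub>a f = f\<close> expresses that \<open>f\<close> is a zero morphism.\<close>
lemma zero_arrow: "mor f = 0 \<Longrightarrow> 0 *\<^sub>a f = f"
  by (intro arrow_eqI) (simp_all add: mor_simps)

lemma simple_endo:
  assumes "simple_obj C V" "\<guillemotleft>f : V \<rightarrow> V\<guillemotright>"
  obtains c where "f = c *\<^sub>a one V"
proof -
  obtain c where "mor f = smult C c (Id C V)"
    using assms(1) mor_in[OF assms(2)] unfolding simple_obj_def by blast
  then have "f = c *\<^sub>a one V" using assms by (intro arrow_eqI) (auto simp: mor_simps)
  then show thesis by (rule that)
qed

lemma simple_Id_nonzero: "simple_obj C V \<Longrightarrow> Id C V \<noteq> 0"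
proof
  assume "simple_obj C V" "Id C V = 0"
  then have "\<exists>!c::'k. (0::'m) = smult C c 0" using Id_in[of V] by (auto simp: simple_obj_def)
  then show False by (metis vs.scale_zero_right zero_neq_one)
qed

lemma simple_scalar_eqD: "\<lbrakk>simple_obj C V; c *\<^sub>a one V = c' *\<^sub>a one V\<rbrakk> \<Longrightarrow> c = c'"
  using simple_Id_nonzero[of V] by (auto simp: ascale_def one_def)

lemma simple_obj_iso:
  assumes "simple_obj C V" "isomorphic C V W"
  shows "simple_obj C W"
proof -
  obtain f g where fg: "inverses f g" "src f = V" "tgt f = W"
    using assms(2) unfolding isomorphic_iff by blast
  note i = inversesD[OF fg(1)] fg(2,3)
  show ?thesis unfolding simple_obj_def
  proof (intro ballI ex_ex1I)
    fix h assume h: "h \<in> Hom C W W"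
    let ?h = "Arrow W h W"
    obtain c where c: "g \<bullet> ?h \<bullet> f = c *\<^sub>a one V"
      by (rule simple_endo[OF assms(1), of "g \<bullet> ?h \<bullet> f"]) (use i h in auto)
    have "?h = (f \<bullet> g) \<bullet> ?h \<bullet> (f \<bullet> g)" unfolding i(6) using i h by simp
    also have "\<dots> = f \<bullet> (g \<bullet> ?h \<bullet> f) \<bullet> g"
      using i(1-4,7,8) h by (simp add: acomp_assoc)
    also have "\<dots> = c *\<^sub>a (f \<bullet> g)" unfolding c using i(1-4,7,8) by simp
    finally have "?h = c *\<^sub>a one W" unfolding i(6) using i by simp
    then show "\<exists>c. h = smult C c (Id C W)" by (auto simp: ascale_def one_def)
  next
    fix h c c' assume "h = smult C c (Id C W)" "h = smult C c' (Id C W)"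
    then have "c *\<^sub>a one W = c' *\<^sub>a one W" by (auto simp: ascale_def one_def)
    then have "g \<bullet> (c *\<^sub>a one W) \<bullet> f = g \<bullet> (c' *\<^sub>a one W) \<bullet> f" by simp
    then have "c *\<^sub>a one V = c' *\<^sub>a one V" using i by simp
    then show "c = c'" by (rule simple_scalar_eqD[OF assms(1)])
  qed
qed

text \<open>The endomorphisms of a dual are transposes of endomorphisms.\<close>
lemma simple_obj_dual:
  assumes d: "duality V W c u" and V: "simple_obj C V"
  shows "simple_obj C W"
proof -
  note D = dualityD[OF d]
  have W_inj: "f = g" if "c \<bullet> (V \<triangleright> f) = c \<bullet> (V \<triangleright> g)" "\<guillemotleft>f : W \<rightarrow> W\<guillemotright>" "\<guillemotleft>g : W \<rightarrow> W\<guillemotright>" for f g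
  proof -
    have *: "unbend_left W u W (c \<bullet> (V \<triangleright> f)) = f" if "\<guillemotleft>f : W \<rightarrow> W\<guillemotright>" for f
      using unbend_bend_left[OF d, of f W \<I>] that D(1) by (simp add: bend_left_def)
    show ?thesis using arg_cong[OF that(1), of "unbend_left W u W"] unfolding *[OF that(2)] *[OF that(3)] .
  qed
  have V_inj: "f = g" if "c \<bullet> (f \<triangleleft> W) = c \<bullet> (g \<triangleleft> W)" "\<guillemotleft>f : V \<rightarrow> V\<guillemotright>" "\<guillemotleft>g : V \<rightarrow> V\<guillemotright>" for f g
  proof -
    have *: "unbend_right V u V (c \<bullet> (f \<triangleleft> W)) = f" if "\<guillemotleft>f : V \<rightarrow> V\<guillemotright>" for f
      using unbend_bend_right[OF d, of f V \<I>] that D(1) by (simp add: bend_right_def)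
    show ?thesis using arg_cong[OF that(1), of "unbend_right V u V"] unfolding *[OF that(2)] *[OF that(3)] .
  qed
  show ?thesis unfolding simple_obj_def
  proof (intro ballI ex_ex1I)
    fix h assume h: "h \<in> Hom C W W"
    let ?h = "Arrow W h W"
    let ?g = "unbend_right V u V (c \<bullet> (V \<triangleright> ?h))"
    have g: "\<guillemotleft>?g : V \<rightarrow> V\<guillemotright>" using unbend_right_arr[OF d, of "c \<bullet> (V \<triangleright> ?h)" V \<I>] D(1) h by simp
    obtain e where e: "?g = e *\<^sub>a one V" using simple_endo[OF V g] .
    have "c \<bullet> (V \<triangleright> ?h) = c \<bullet> (?g \<triangleleft> W)"
      using bend_unbend_right[OF d, of "c \<bullet> (V \<triangleright> ?h)" V \<I>] D(1) h by (simp add: bend_right_def)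
    also have "\<dots> = c \<bullet> (V \<triangleright> (e *\<^sub>a one W))" unfolding e using D(1) by simp
    finally have "?h = e *\<^sub>a one W" by (rule W_inj) (use h in simp_all)
    then show "\<exists>c. h = smult C c (Id C W)" by (auto simp: ascale_def one_def)
  next
    fix h a a' assume "h = smult C a (Id C W)" "h = smult C a' (Id C W)"
    then have "a *\<^sub>a one W = a' *\<^sub>a one W" by (auto simp: ascale_def one_def)
    then have "c \<bullet> (V \<triangleright> (a *\<^sub>a one W)) = c \<bullet> (V \<triangleright> (a' *\<^sub>a one W))" by (rule arg_cong)
    then have "c \<bullet> ((a *\<^sub>a one V) \<triangleleft> W) = c \<bullet> ((a' *\<^sub>a one V) \<triangleleft> W)" using D(1) by simp
    then have "a *\<^sub>a one V = a' *\<^sub>a one V" by (rule V_inj) simp_all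
    then show "a = a'" by (rule simple_scalar_eqD[OF V])
  qed
qed

end

context relative_spherical_category
begin

lemma Deg_tensor: "\<lbrakk>A \<in> Deg C g; B \<in> Deg C h\<rbrakk> \<Longrightarrow> A \<odot> B \<in> Deg C (g + h)"
  and Deg_unit: "\<I> \<in> Deg C 0"
  and Hom_Deg: "\<lbrakk>A \<in> Deg C g; B \<in> Deg C h; g \<noteq> h\<rbrakk> \<Longrightarrow> Hom C A B = {0}"
  using graded unfolding graded_def by blast+

text \<open>
  For a summand \<open>S\<close> of a simple object, \<open>\<iota> \<bullet> \<pi>\<close> is an idempotent scalar, hence \<open>0\<close> or \<open>1\<close>. Not all of them
  vanish, and the value \<open>1\<close> gives an isomorphism.
\<close>
lemma simple_summand:
  assumes V: "simple_obj C V"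
  obtains g S where "S \<in> Deg C g" "isomorphic C V S"
proof -
  obtain n S where S: "\<And>l. l < n \<Longrightarrow> \<exists>g. S l \<in> Deg C g" and "direct_sum C V n S"
    using graded unfolding graded_def by meson
  then obtain \<iota> \<pi> where ip: "\<And>l. l < n \<Longrightarrow> \<iota> l \<in> Hom C (S l) V \<and> \<pi> l \<in> Hom C V (S l)"
    and pi: "\<forall>l<n. \<forall>m<n. \<pi> l \<cdot> \<iota> m = (if l = m then Id C (S l) else 0)" and sum: "(\<Sum>l<n. \<iota> l \<cdot> \<pi> l) = Id C V"
    unfolding direct_sum_def by blast
  have "\<exists>l<n. \<iota> l \<cdot> \<pi> l \<noteq> 0"
  proof (rule ccontr)
    assume "\<not> ?thesis"
    then have "(\<Sum>l<n. \<iota> l \<cdot> \<pi> l) = 0" by (intro sum.neutral) auto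
    then show False using sum simple_Id_nonzero[OF V] by simp
  qed
  then obtain l where l: "l < n" "\<iota> l \<cdot> \<pi> l \<noteq> 0" by blast
  let ?i = "Arrow (S l) (\<iota> l) V" and ?p = "Arrow V (\<pi> l) (S l)"
  have a: "\<guillemotleft>?i : S l \<rightarrow> V\<guillemotright>" "\<guillemotleft>?p : V \<rightarrow> S l\<guillemotright>" using ip[OF l(1)] by auto
  have p: "?p \<bullet> ?i = one (S l)" using pi l(1) by (simp add: acomp_def one_def)
  obtain c where c: "?i \<bullet> ?p = c *\<^sub>a one V"
    by (rule simple_endo[OF V, of "?i \<bullet> ?p"]) (use a in auto)
  have "c *\<^sub>a (?i \<bullet> ?p) = (?i \<bullet> ?p) \<bullet> (?i \<bullet> ?p)" using a by (subst (2) c) simp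
  also have "\<dots> = ?i \<bullet> (?p \<bullet> ?i) \<bullet> ?p" using a by (simp add: acomp_assoc)
  also have "\<dots> = ?i \<bullet> ?p" unfolding p using a by simp
  finally have "(c * c) *\<^sub>a one V = c *\<^sub>a one V" unfolding c by simp
  then have cc: "c * c = c" by (rule simple_scalar_eqD[OF V])
  have "\<iota> l \<cdot> \<pi> l = smult C c (Id C V)"
    using arg_cong[OF c, of mor] by (simp add: mor_simps)
  then have "c \<noteq> 0" using l(2) by auto
  then have "c = 1" using cc by simp
  then have "inverses ?p ?i" unfolding inverses_def using a p c by simp
  then show thesis using S[OF l(1)] that isomorphicI[of ?p ?i] by auto
qed

end

locale represented_spherical_category = relative_spherical_category C
  for C :: "('k::field, 'o, 'm::ab_group_add, 'g::ab_group_add, 'z) relative_cat_scheme" (structure) +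
  fixes I :: "'i set" and V :: "'i \<Rightarrow> 'o"
  assumes representatives: "generic_representatives C I V"
begin

abbreviation star :: "'i \<Rightarrow> 'i" ("_\<^sup>\<star>" [1000] 1000) where
  "i\<^sup>\<star> \<equiv> dual_label C I V i"

definition deg :: "'i \<Rightarrow> 'g" where
  "deg i = (THE g. V i \<in> Deg C g)"

lemma generic_V: "i \<in> I \<Longrightarrow> generic C (V i)"
  using representatives by (simp add: generic_representatives_def)

lemma representative: "generic C U \<Longrightarrow> \<exists>!i. i \<in> I \<and> isomorphic C U (V i)"
  using representatives by (simp add: generic_representatives_def)

lemma simple_V: "i \<in> I \<Longrightarrow> simple_obj C (V i)"
  using generic_V by (auto simp: generic_def)

lemma iso_Deg_unique:
  assumes "simple_obj C A" "isomorphic C A B" "A \<in> Deg C g" "B \<in> Deg C h"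
  shows "g = h"
proof (rule ccontr)
  assume "g \<noteq> h"
  obtain e e' where e: "inverses e e'" "src e = A" "tgt e = B"
    using assms(2) unfolding isomorphic_iff by blast
  note E = inversesD[OF e(1)] e(2,3)
  have "mor e = 0" using Hom_Deg[OF assms(3,4) \<open>g \<noteq> h\<close>] mor_in[of e A B] E by auto
  then have z: "0 *\<^sub>a e = e" by (rule zero_arrow)
  have "e' \<bullet> (0 *\<^sub>a e) = 0 *\<^sub>a (e' \<bullet> e)" using E(1-4) by simp
  then have "1 *\<^sub>a one A = 0 *\<^sub>a one A" unfolding z E(5,7) by simp
  then show False using simple_scalar_eqD[OF assms(1), of 1 0] by simp
qed

lemma Deg_V: "\<lbrakk>i \<in> I; V i \<in> Deg C g\<rbrakk> \<Longrightarrow> g = deg i"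
  unfolding deg_def
  by (rule the_equality[symmetric]) (auto intro: iso_Deg_unique[OF simple_V isomorphic_refl])

lemma V_Deg: "i \<in> I \<Longrightarrow> V i \<in> Deg C (deg i)"
  using generic_V Deg_V by (fastforce simp: generic_def)

lemma Deg_V_iff: "i \<in> I \<Longrightarrow> V i \<in> Deg C g \<longleftrightarrow> g = deg i"
  using V_Deg Deg_V by blast

lemma deg_generic: "i \<in> I \<Longrightarrow> deg i \<notin> Sing C"
  using generic_V Deg_V by (fastforce simp: generic_def)

lemma V_inj: "\<lbrakk>i \<in> I; j \<in> I; isomorphic C (V i) (V j)\<rbrakk> \<Longrightarrow> i = j"
  using representative[OF generic_V[of i]] isomorphic_refl by blast

lemma schur:
  assumes "i \<in> I" "j \<in> I" "i \<noteq> j"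
  shows "Hom C (V i) (V j) = {0}"
proof (cases "deg i = deg j")
  case True
  then show ?thesis
    using assms V_inj[of i j] V_Deg[of j]
    by (intro generic_schur[OF deg_generic V_Deg _ simple_V simple_V]) auto
next
  case False
  then show ?thesis by (intro Hom_Deg[of _ "deg i" _ "deg j"] V_Deg assms)
qed

lemma Sing_uminus: "- g \<in> Sing C \<longleftrightarrow> g \<in> Sing C"
proof -
  have "- h \<in> Sing C" if "h \<in> Sing C" for h
    using Sing_symmetric that unfolding symmetric_subset_def by blast
  from this[of g] this[of "- g"] show ?thesis by auto
qed

text \<open>
  The object \<open>dual C (V i)\<close> need not be homogeneous, but being simple it is isomorphic to a homogeneous
  object. The degree is \<open>- deg i\<close> since the coevaluation is a non-zero morphism from the unit object.
\<close>
lemma dual_generic: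
  assumes i: "i \<in> I"
  obtains S where "generic C S" "isomorphic C (dual C (V i)) S" "S \<in> Deg C (- deg i)"
proof -
  have s: "simple_obj C (dual C (V i))"
    by (rule simple_obj_dual[OF duality_right simple_V[OF i]])
  obtain g S where S: "S \<in> Deg C g" "isomorphic C (dual C (V i)) S"
    by (rule simple_summand[OF s])
  then obtain e e' where e: "inverses e e'" "src e = S" "tgt e = dual C (V i)"
    using isomorphic_sym[OF S(2)] unfolding isomorphic_iff by blast
  define u where "u = (V i \<triangleright> e') \<bullet> acoev (V i)"
  have d: "duality S (V i) (aev (V i) \<bullet> (e \<triangleleft> V i)) u"
    unfolding u_def by (rule duality_transport_left[OF duality_left e])
  have "deg i + g = 0"
  proof (rule ccontr)
    assume "deg i + g \<noteq> 0"
    then have "Hom C \<I> (V i \<odot> S) = {0}"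
      using Hom_Deg[OF Deg_unit Deg_tensor[OF V_Deg[OF i] S(1)]] by simp
    then have "mor u = 0" using dualityD(2)[OF d] mor_in[of u] by auto
    then have u: "0 *\<^sub>a u = u" by (rule zero_arrow)
    let ?c = "aev (V i) \<bullet> (e \<triangleleft> V i)"
    have "(V i \<triangleright> ?c) \<bullet> ((0 *\<^sub>a u) \<triangleleft> V i) = 0 *\<^sub>a ((V i \<triangleright> ?c) \<bullet> (u \<triangleleft> V i))"
      using dualityD(1,2)[OF d] by simp
    then have "1 *\<^sub>a one (V i) = 0 *\<^sub>a one (V i)"
      unfolding u dualityD(4)[OF d] by simp
    then show False using simple_scalar_eqD[OF simple_V[OF i], of 1 0] by simp
  qed
  then have g: "g = - deg i" by (simp add: eq_neg_iff_add_eq_0 add.commute)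
  have "generic C S"
    unfolding generic_def using simple_obj_iso[OF s S(2)] S(1) g deg_generic[OF i] Sing_uminus by auto
  then show thesis using that S g by blast
qed

lemma star_props:
  assumes i: "i \<in> I"
  shows star_in: "i\<^sup>\<star> \<in> I" and star_iso: "isomorphic C (V (i\<^sup>\<star>)) (dual C (V i))"
    and deg_star: "deg (i\<^sup>\<star>) = - deg i"
proof -
  obtain S where S: "generic C S" "isomorphic C (dual C (V i)) S" "S \<in> Deg C (- deg i)"
    using dual_generic[OF i] .
  have "j \<in> I \<and> isomorphic C (V j) (dual C (V i)) \<longleftrightarrow> j \<in> I \<and> isomorphic C S (V j)" for j
    using S(2) isomorphic_sym isomorphic_trans by blast
  then have "\<exists>!j. j \<in> I \<and> isomorphic C (V j) (dual C (V i))"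
    using representative[OF S(1)] by simp
  then have *: "i\<^sup>\<star> \<in> I \<and> isomorphic C (V (i\<^sup>\<star>)) (dual C (V i))"
    unfolding dual_label_def by (rule theI')
  then show "i\<^sup>\<star> \<in> I" "isomorphic C (V (i\<^sup>\<star>)) (dual C (V i))" by auto
  show "deg (i\<^sup>\<star>) = - deg i"
    using * S(3) isomorphic_trans[OF _ S(2)]
    by (intro iso_Deg_unique[of "V (i\<^sup>\<star>)" S] simple_V V_Deg) auto
qed

lemma star_eqI: "\<lbrakk>i \<in> I; j \<in> I; isomorphic C (V j) (dual C (V i))\<rbrakk> \<Longrightarrow> i\<^sup>\<star> = j"
  using V_inj[OF star_in, of i j] isomorphic_trans[OF star_iso isomorphic_sym] by blast

lemma star_star [simp]: "i \<in> I \<Longrightarrow> (i\<^sup>\<star>)\<^sup>\<star> = i"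
proof -
  assume i: "i \<in> I"
  obtain e e' where e: "inverses e e'" "src e = V (i\<^sup>\<star>)" "tgt e = dual C (V i)"
    using star_iso[OF i] unfolding isomorphic_iff by blast
  have "isomorphic C (V i) (dual C (V (i\<^sup>\<star>)))"
    by (rule duality_unique_left[OF duality_transport_right[OF duality_right e] duality_left])
  then show ?thesis using i star_in by (intro star_eqI) auto
qed

text \<open>In generic degrees the identity is a sum of morphisms that factor through the \<open>V i\<close>.\<close>
lemma decomposition:
  assumes "g \<notin> Sing C" "X \<in> Deg C g"
  obtains n \<kappa> \<iota> \<pi> where "\<And>l. l < (n::nat) \<Longrightarrow> \<kappa> l \<in> I \<and> deg (\<kappa> l) = g"
    "\<And>l. l < n \<Longrightarrow> \<guillemotleft>\<iota> l : V (\<kappa> l) \<rightarrow> X\<guillemotright>" "\<And>l. l < n \<Longrightarrow> \<guillemotleft>\<pi> l : X \<rightarrow> V (\<kappa> l)\<guillemotright>"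
    "(\<Sum>l<n. mor (\<iota> l \<bullet> \<pi> l)) = Id C X"
proof -
  obtain n S where S: "\<And>l. l < n \<Longrightarrow> S l \<in> Deg C g \<and> simple_obj C (S l)" and "direct_sum C X n S"
    using generic_semisimple[OF assms] by meson
  then obtain i p where ip: "\<And>l. l < n \<Longrightarrow> i l \<in> Hom C (S l) X \<and> p l \<in> Hom C X (S l)"
    and sum: "(\<Sum>l<n. i l \<cdot> p l) = Id C X"
    unfolding direct_sum_def by blast
  have "\<exists>k e e'. k \<in> I \<and> inverses e e' \<and> src e = S l \<and> tgt e = V k" if "l < n" for l
  proof -
    have "generic C (S l)" using S[OF that] assms(1) by (auto simp: generic_def)
    then obtain j where "j \<in> I" "isomorphic C (S l) (V j)" using representative by blast
    then show ?thesis unfolding isomorphic_iff by blast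
  qed
  then obtain \<kappa> e e' where k: "\<And>l. l < n \<Longrightarrow> \<kappa> l \<in> I \<and> inverses (e l) (e' l) \<and> src (e l) = S l \<and> tgt (e l) = V (\<kappa> l)"
    by metis
  have dk: "deg (\<kappa> l) = g" if l: "l < n" for l
    by (rule iso_Deg_unique[of "S l" "V (\<kappa> l)", symmetric])
      (use k[OF l] S[OF l] isomorphicI V_Deg in auto)
  have ip_sum: "mor ((Arrow (S l) (i l) X \<bullet> e' l) \<bullet> (e l \<bullet> Arrow X (p l) (S l))) = i l \<cdot> p l"
    if l: "l < n" for l
  proof -
    have kl: "inverses (e l) (e' l)" "src (e l) = S l" "tgt (e l) = V (\<kappa> l)" using k[OF l] by auto
    note E = inversesD[OF kl(1)] kl(2,3)
    have "(Arrow (S l) (i l) X \<bullet> e' l) \<bullet> (e l \<bullet> Arrow X (p l) (S l)) =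
      Arrow (S l) (i l) X \<bullet> (e' l \<bullet> e l) \<bullet> Arrow X (p l) (S l)"
      using E(1-4,7,8) ip[OF l] by (simp add: acomp_assoc)
    also have "\<dots> = Arrow (S l) (i l) X \<bullet> Arrow X (p l) (S l)"
      unfolding E(5) using E(7) ip[OF l] by simp
    finally show ?thesis by (simp add: mor_simps)
  qed
  show thesis
  proof (rule that[of n \<kappa> "\<lambda>l. Arrow (S l) (i l) X \<bullet> e' l" "\<lambda>l. e l \<bullet> Arrow X (p l) (S l)"])
    fix l assume l: "l < n"
    note E = inversesD(1-4)[of "e l" "e' l"] k[OF l]
    show "\<kappa> l \<in> I \<and> deg (\<kappa> l) = g" using k[OF l] dk[OF l] by simp
    show "\<guillemotleft>Arrow (S l) (i l) X \<bullet> e' l : V (\<kappa> l) \<rightarrow> X\<guillemotright>"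
      "\<guillemotleft>e l \<bullet> Arrow X (p l) (S l) : X \<rightarrow> V (\<kappa> l)\<guillemotright>"
      using E ip[OF l] by auto
  qed (use sum ip_sum in simp)
qed

end

section \<open>The trace, the dagger and the bends\<close>

context relative_spherical_category
begin

definition T :: "('o, 'm) arrow \<Rightarrow> 'k" where
  "T f = tr C (src f) (mor f)"

lemma tr_linear:
  "\<lbrakk>projective C A; f \<in> Hom C A A; g \<in> Hom C A A\<rbrakk> \<Longrightarrow>
    tr C A (f + g) = tr C A f + tr C A g \<and> tr C A (smult C c f) = c * tr C A f"
  using m_trace unfolding m_trace_def by blast

lemma T_scale: "\<lbrakk>projective C A; \<guillemotleft>f : A \<rightarrow> A\<guillemotright>\<rbrakk> \<Longrightarrow> T (c *\<^sub>a f) = c * T f"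
  using tr_linear[of A "mor f" "mor f" c] mor_in[of f A A] by (simp add: T_def mor_simps)

lemma T_cyclic:
  assumes "projective C A" "projective C B" "\<guillemotleft>f : A \<rightarrow> B\<guillemotright>" "\<guillemotleft>g : B \<rightarrow> A\<guillemotright>"
  shows "T (g \<bullet> f) = T (f \<bullet> g)"
proof -
  have "tr C A (mor g \<cdot> mor f) = tr C B (mor f \<cdot> mor g)"
    using m_trace assms(1,2) mor_in[OF assms(3)] mor_in[OF assms(4)] unfolding m_trace_def by blast
  then show ?thesis using assms by (simp add: T_def mor_simps)
qed

lemma T_partial_right:
  assumes "projective C A" "\<guillemotleft>f : A \<odot> B \<rightarrow> A \<odot> B\<guillemotright>"
  shows "T f = T ((A \<triangleright> atev B) \<bullet> (f \<triangleleft> dual C B) \<bullet> (A \<triangleright> acoev B))"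
proof -
  have "tr C (A \<odot> B) (mor f) = tr C A ((Id C A \<otimes> tev C B) \<cdot> (mor f \<otimes> Id C (dual C B)) \<cdot> (Id C A \<otimes> coev C B))"
    using m_trace assms(1) mor_in[OF assms(2)] unfolding m_trace_def by blast
  then show ?thesis using assms by (simp add: T_def mor_simps mor_pivotal)
qed

lemma T_partial_left:
  assumes "projective C A" "\<guillemotleft>f : B \<odot> A \<rightarrow> B \<odot> A\<guillemotright>"
  shows "T f = T ((aev B \<triangleleft> A) \<bullet> (dual C B \<triangleright> f) \<bullet> (atcoev B \<triangleleft> A))"
proof -
  have "tr C (B \<odot> A) (mor f) = tr C A ((ev C B \<otimes> Id C A) \<cdot> (Id C (dual C B) \<otimes> mor f) \<cdot> (tcoev C B \<otimes> Id C A))"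
    using m_trace assms(1) mor_in[OF assms(2)] unfolding m_trace_def by blast
  then show ?thesis using assms by (simp add: T_def mor_simps mor_pivotal)
qed

end

context hermitian_pivotal_category
begin

definition adag :: "('o, 'm) arrow \<Rightarrow> ('o, 'm) arrow" where
  "adag f = Arrow (tgt f) (dag (mor f)) (src f)"

lemma dag_in: "f \<in> Hom C A B \<Longrightarrow> dag f \<in> Hom C B A"
  using dag_bij bij_betwE by metis

lemma adag_simps [simp]: "src (adag f) = tgt f" "tgt (adag f) = src f"
  by (simp_all add: adag_def)

lemma mor_adag: "mor (adag f) = dag (mor f)"
  by (simp add: adag_def)

lemma arr_adag [simp]: "arr f \<Longrightarrow> arr (adag f)"
  by (simp add: arr_def adag_def dag_in)

lemma adag_adag [simp]: "arr f \<Longrightarrow> adag (adag f) = f"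
  by (rule arrow_eqI) (auto simp: mor_adag arr_def dag_dag)

lemma bar_zero: "bar 0 = 0"
  by (metis add_0 add_left_cancel add_0_right bar_add)

lemma bar_eq_zero_iff: "bar x = 0 \<longleftrightarrow> x = 0"
  using bar_bar bar_zero by metis

lemma dag_add: "\<lbrakk>f \<in> Hom C A B; g \<in> Hom C A B\<rbrakk> \<Longrightarrow> dag (f + g) = dag f + dag g"
  using dag_linear[of f A B g, where \<mu> = 1 and \<kappa> = 1] bar_one by simp

lemma dag_smult: "f \<in> Hom C A B \<Longrightarrow> dag (smult C c f) = smult C (bar c) (dag f)"
  using dag_linear[of f A B f, where \<mu> = c and \<kappa> = 0] bar_zero by simp

lemma dag_Id [simp]: "dag (Id C A) = Id C A"
proof -
  have "Id C A = dag (dag (Id C A))" by (rule dag_dag[OF Id_in, symmetric])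
  also have "dag (Id C A) = dag (Id C A) \<cdot> Id C A" by (rule comp_Id[OF dag_in[OF Id_in], symmetric])
  also have "dag \<dots> = dag (Id C A) \<cdot> dag (dag (Id C A))"
    by (rule dag_comp[OF dag_in[OF Id_in] Id_in])
  also have "\<dots> = dag (Id C A) \<cdot> Id C A" by (simp only: dag_dag[OF Id_in])
  also have "\<dots> = dag (Id C A)" by (rule comp_Id[OF dag_in[OF Id_in]])
  finally show ?thesis by simp
qed

lemma adag_one [simp]: "adag (one A) = one A"
  by (rule arrow_eqI) (auto simp: mor_adag mor_simps)

lemma adag_acomp [simp]: "\<lbrakk>arr g; arr f; src g = tgt f\<rbrakk> \<Longrightarrow> adag (g \<bullet> f) = adag f \<bullet> adag g"
  by (rule arrow_eqI) (auto simp: mor_adag mor_simps arr_def dag_comp)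

lemma adag_lwhisker [simp]: "arr f \<Longrightarrow> adag (P \<triangleright> f) = P \<triangleright> adag f"
  by (rule arrow_eqI) (auto simp: mor_adag mor_simps arr_def dag_tensor[OF Id_in])

lemma adag_rwhisker [simp]: "arr f \<Longrightarrow> adag (f \<triangleleft> P) = adag f \<triangleleft> P"
  by (rule arrow_eqI) (auto simp: mor_adag mor_simps arr_def dag_tensor[OF _ Id_in])

lemma adag_ascale [simp]: "arr f \<Longrightarrow> adag (c *\<^sub>a f) = bar c *\<^sub>a adag f"
  by (rule arrow_eqI) (auto simp: mor_adag mor_simps arr_def dag_smult)

lemma adag_pivotal [simp]: "adag (aev X) = atcoev X" "adag (acoev X) = atev X"
  "adag (atev X) = acoev X" "adag (atcoev X) = aev X"
  by (auto intro!: arrow_eqI simp: mor_adag mor_pivotal dag_ev dag_coev dag_tev dag_tcoev)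

end

lemma (in relative_hermitian_spherical_category) T_adag:
  "\<lbrakk>projective C A; \<guillemotleft>f : A \<rightarrow> A\<guillemotright>\<rbrakk> \<Longrightarrow> T (adag f) = bar (T f)"
  using tr_real[of A "mor f"] mor_in[of f A A] by (simp add: T_def mor_adag)

locale represented_hermitian_category =
  relative_hermitian_spherical_category bar C dag + represented_spherical_category C I V
  for bar :: "'k::field \<Rightarrow> 'k"
    and C :: "('k, 'o, 'm::ab_group_add, 'g::ab_group_add, 'z) relative_cat_scheme" (structure)
    and dag :: "'m \<Rightarrow> 'm" and I :: "'i set" and V :: "'i \<Rightarrow> 'o"

locale based_category = represented_hermitian_category bar C dag I V
  for bar :: "'k::field \<Rightarrow> 'k"
    and C :: "('k, 'o, 'm::ab_group_add, 'g::ab_group_add, 'z) relative_cat_scheme" (structure)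
    and dag :: "'m \<Rightarrow> 'm" and I :: "'i set" and V :: "'i \<Rightarrow> 'o" +
  fixes w :: "'i \<Rightarrow> 'm"
  assumes basic_data: "basic_data C I V w"
begin

declare star_in [simp, intro]

definition aw :: "'i \<Rightarrow> ('o, 'm) arrow" where
  "aw i = Arrow (V i) (w i) (dual C (V (i\<^sup>\<star>)))"

definition aw_inv :: "'i \<Rightarrow> ('o, 'm) arrow" where
  "aw_inv i = Arrow (dual C (V (i\<^sup>\<star>))) (inv_mor C (V i) (dual C (V (i\<^sup>\<star>))) (w i)) (V i)"

definition cap :: "'i \<Rightarrow> ('o, 'm) arrow" where
  "cap j = Arrow (V (j\<^sup>\<star>) \<odot> V j) (edge C I V w j) \<I>"

definition cup :: "'i \<Rightarrow> ('o, 'm) arrow" where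
  "cup j = (V j \<triangleright> aw_inv (j\<^sup>\<star>)) \<bullet> acoev (V j)"

lemma aw_simps [simp]: "src (aw i) = V i" "tgt (aw i) = dual C (V (i\<^sup>\<star>))"
  "src (aw_inv i) = dual C (V (i\<^sup>\<star>))" "tgt (aw_inv i) = V i"
  by (simp_all add: aw_def aw_inv_def)

lemma aw_inverses: "i \<in> I \<Longrightarrow> inverses (aw i) (aw_inv i)"
  using basic_data inv_mor_inverses unfolding basic_data_def aw_def aw_inv_def by blast

lemma aw_arr [simp]: "i \<in> I \<Longrightarrow> arr (aw i)" "i \<in> I \<Longrightarrow> arr (aw_inv i)"
  and aw_inv [simp]: "i \<in> I \<Longrightarrow> aw_inv i \<bullet> aw i = one (V i)"
    "i \<in> I \<Longrightarrow> aw i \<bullet> aw_inv i = one (dual C (V (i\<^sup>\<star>)))"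
  using inversesD[OF aw_inverses] by simp_all

lemma cap_eq: "j \<in> I \<Longrightarrow> cap j = aev (V j) \<bullet> (aw (j\<^sup>\<star>) \<triangleleft> V j)"
  by (rule arrow_eqI) (auto simp: mor_simps mor_pivotal cap_def edge_def aw_def)

lemma duality_cap: "j \<in> I \<Longrightarrow> duality (V (j\<^sup>\<star>)) (V j) (cap j) (cup j)"
  unfolding cap_eq cup_def using star_in
  by (intro duality_transport_left[OF duality_left aw_inverses]) auto

lemma duality_cap': "j \<in> I \<Longrightarrow> duality (V j) (V (j\<^sup>\<star>)) (cap (j\<^sup>\<star>)) (cup (j\<^sup>\<star>))"
  using duality_cap[of "j\<^sup>\<star>"] by simp

lemma cap_arr [simp]:
  "src (cap j) = V (j\<^sup>\<star>) \<odot> V j" "tgt (cap j) = \<I>" "j \<in> I \<Longrightarrow> arr (cap j)"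
  "src (cup j) = \<I>" "j \<in> I \<Longrightarrow> tgt (cup j) = V j \<odot> V (j\<^sup>\<star>)" "j \<in> I \<Longrightarrow> arr (cup j)"
  using dualityD(1,2)[OF duality_cap] by (auto simp: cap_def cup_def)

text \<open>The condition \<open>w\<^sub>i\<^sub>* = w\<^sub>i\<^sup>* \<phi>\<close> says that the caps can be built from either evaluation.\<close>
lemma cap_eq_tev:
  assumes i: "i \<in> I"
  shows "cap i = atev (V (i\<^sup>\<star>)) \<bullet> (V (i\<^sup>\<star>) \<triangleright> aw i)"
proof -
  let ?U = "V (i\<^sup>\<star>)" and ?d = "dual C (V i)" and ?dU = "dual C (V (i\<^sup>\<star>))"
  let ?ddU = "dual C (dual C (V (i\<^sup>\<star>)))"
  define p where "p = (atev ?U \<triangleleft> ?ddU) \<bullet> (?U \<triangleright> acoev ?dU)"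
  define s where "s = (aev ?dU \<triangleleft> ?d) \<bullet> (?ddU \<triangleright> (aw i \<triangleleft> ?d)) \<bullet> (?ddU \<triangleright> acoev (V i))"
  have p_arr: "\<guillemotleft>p : ?U \<rightarrow> ?ddU\<guillemotright>" by (simp add: p_def)
  have s_arr: "\<guillemotleft>s : ?ddU \<rightarrow> ?d\<guillemotright>" using i by (simp add: s_def)
  have "w (i\<^sup>\<star>) = dual_mor C (V i) ?dU (w i) \<cdot> piv C ?U"
    using basic_data i unfolding basic_data_def by blast
  also have "\<dots> = mor (s \<bullet> p)"
    by (simp add: s_def p_def mor_simps mor_pivotal dual_mor_def piv_def aw_def)
  finally have aw: "aw (i\<^sup>\<star>) = s \<bullet> p"
    using p_arr s_arr i by (intro arrow_eqI) (auto simp: aw_def)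
  have p: "aev ?dU \<bullet> (p \<triangleleft> ?dU) = atev ?U"
    using bend_unbend_right[OF duality_left[of ?dU], of "atev ?U" ?U \<I>]
    by (simp add: p_def unbend_right_def bend_right_def)
  have s: "aev (V i) \<bullet> (s \<triangleleft> V i) = aev ?dU \<bullet> (?ddU \<triangleright> aw i)"
  proof -
    have "s = unbend_right ?d (acoev (V i)) ?ddU (aev ?dU \<bullet> (?ddU \<triangleright> aw i))"
      using i by (simp add: s_def unbend_right_def acomp_assoc)
    then show ?thesis
      using bend_unbend_right[OF duality_left[of "V i"], of "aev ?dU \<bullet> (?ddU \<triangleright> aw i)" ?ddU \<I>] i
      by (simp add: bend_right_def)
  qed
  have "cap i = (aev (V i) \<bullet> (s \<triangleleft> V i)) \<bullet> (p \<triangleleft> V i)"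
    using i p_arr s_arr by (simp add: cap_eq aw acomp_assoc)
  also have "\<dots> = aev ?dU \<bullet> ((tgt p \<triangleright> aw i) \<bullet> (p \<triangleleft> src (aw i)))"
    unfolding s using i p_arr by (simp add: acomp_assoc)
  also have "\<dots> = aev ?dU \<bullet> ((p \<triangleleft> tgt (aw i)) \<bullet> (src p \<triangleright> aw i))"
    using i p_arr by (subst interchange) auto
  also have "\<dots> = (aev ?dU \<bullet> (p \<triangleleft> ?dU)) \<bullet> (?U \<triangleright> aw i)"
    using i p_arr by (simp add: acomp_assoc)
  finally show ?thesis unfolding p .
qed

lemma cup_eq_tcoev:
  assumes i: "i \<in> I"
  shows "cup i = (aw_inv i \<triangleleft> V (i\<^sup>\<star>)) \<bullet> atcoev (V (i\<^sup>\<star>))"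
  by (rule cap_determines_cup[OF duality_cap[OF i]], subst cap_eq_tev[OF i],
      rule duality_transport_right[OF duality_right aw_inverses[OF i]]) simp_all

definition rb :: "'i \<Rightarrow> 'o \<Rightarrow> ('o, 'm) arrow \<Rightarrow> ('o, 'm) arrow" where
  "rb j B f = bend_right (V (j\<^sup>\<star>)) (cap (j\<^sup>\<star>)) B f"

definition ru :: "'i \<Rightarrow> 'o \<Rightarrow> ('o, 'm) arrow \<Rightarrow> ('o, 'm) arrow" where
  "ru j A g = unbend_right (V j) (cup (j\<^sup>\<star>)) A g"

definition lb :: "'i \<Rightarrow> 'o \<Rightarrow> ('o, 'm) arrow \<Rightarrow> ('o, 'm) arrow" where
  "lb i B f = bend_left (V (i\<^sup>\<star>)) (cap i) B f"

definition lu :: "'i \<Rightarrow> 'o \<Rightarrow> ('o, 'm) arrow \<Rightarrow> ('o, 'm) arrow" where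
  "lu i A g = unbend_left (V i) (cup i) A g"

lemma rb_arr: "\<lbrakk>j \<in> I; \<guillemotleft>f : A \<rightarrow> B \<odot> V j\<guillemotright>\<rbrakk> \<Longrightarrow> \<guillemotleft>rb j B f : A \<odot> V (j\<^sup>\<star>) \<rightarrow> B\<guillemotright>"
  unfolding rb_def by (rule bend_right_arr[OF duality_cap'])
lemma ru_arr: "\<lbrakk>j \<in> I; \<guillemotleft>g : A \<odot> V (j\<^sup>\<star>) \<rightarrow> B\<guillemotright>\<rbrakk> \<Longrightarrow> \<guillemotleft>ru j A g : A \<rightarrow> B \<odot> V j\<guillemotright>"
  unfolding ru_def by (rule unbend_right_arr[OF duality_cap'])
lemma lb_arr: "\<lbrakk>j \<in> I; \<guillemotleft>f : A \<rightarrow> V j \<odot> B\<guillemotright>\<rbrakk> \<Longrightarrow> \<guillemotleft>lb j B f : V (j\<^sup>\<star>) \<odot> A \<rightarrow> B\<guillemotright>"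
  unfolding lb_def by (rule bend_left_arr[OF duality_cap])
lemma lu_arr: "\<lbrakk>j \<in> I; \<guillemotleft>g : V (j\<^sup>\<star>) \<odot> A \<rightarrow> B\<guillemotright>\<rbrakk> \<Longrightarrow> \<guillemotleft>lu j A g : A \<rightarrow> V j \<odot> B\<guillemotright>"
  unfolding lu_def by (rule unbend_left_arr[OF duality_cap])

lemma ru_rb: "\<lbrakk>j \<in> I; \<guillemotleft>f : A \<rightarrow> B \<odot> V j\<guillemotright>\<rbrakk> \<Longrightarrow> ru j A (rb j B f) = f"
  unfolding rb_def ru_def by (rule unbend_bend_right[OF duality_cap'])
lemma rb_ru: "\<lbrakk>j \<in> I; \<guillemotleft>g : A \<odot> V (j\<^sup>\<star>) \<rightarrow> B\<guillemotright>\<rbrakk> \<Longrightarrow> rb j B (ru j A g) = g"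
  unfolding rb_def ru_def by (rule bend_unbend_right[OF duality_cap'])
lemma lu_lb: "\<lbrakk>j \<in> I; \<guillemotleft>f : A \<rightarrow> V j \<odot> B\<guillemotright>\<rbrakk> \<Longrightarrow> lu j A (lb j B f) = f"
  unfolding lb_def lu_def by (rule unbend_bend_left[OF duality_cap])
lemma lb_lu: "\<lbrakk>j \<in> I; \<guillemotleft>g : V (j\<^sup>\<star>) \<odot> A \<rightarrow> B\<guillemotright>\<rbrakk> \<Longrightarrow> lb j B (lu j A g) = g"
  unfolding lb_def lu_def by (rule bend_unbend_left[OF duality_cap])

lemma rb_pre: "\<lbrakk>j \<in> I; \<guillemotleft>f : A \<rightarrow> B \<odot> V j\<guillemotright>; \<guillemotleft>h : A' \<rightarrow> A\<guillemotright>\<rbrakk> \<Longrightarrow>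
    rb j B (f \<bullet> h) = rb j B f \<bullet> (h \<triangleleft> V (j\<^sup>\<star>))"
  unfolding rb_def by (rule bend_right_pre[OF duality_cap'])
lemma rb_post: "\<lbrakk>j \<in> I; \<guillemotleft>f : A \<rightarrow> B \<odot> V j\<guillemotright>; \<guillemotleft>k : B \<rightarrow> B'\<guillemotright>\<rbrakk> \<Longrightarrow>
    rb j B' ((k \<triangleleft> V j) \<bullet> f) = k \<bullet> rb j B f"
  unfolding rb_def by (rule bend_right_post[OF duality_cap'])
lemma rb_lwhisker: "\<lbrakk>j \<in> I; \<guillemotleft>f : A \<rightarrow> B \<odot> V j\<guillemotright>\<rbrakk> \<Longrightarrow> rb j (P \<odot> B) (P \<triangleright> f) = P \<triangleright> rb j B f"
  unfolding rb_def by (rule bend_right_lwhisker[OF duality_cap'])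
lemma lb_pre: "\<lbrakk>j \<in> I; \<guillemotleft>f : A \<rightarrow> V j \<odot> B\<guillemotright>; \<guillemotleft>h : A' \<rightarrow> A\<guillemotright>\<rbrakk> \<Longrightarrow>
    lb j B (f \<bullet> h) = lb j B f \<bullet> (V (j\<^sup>\<star>) \<triangleright> h)"
  unfolding lb_def by (rule bend_left_pre[OF duality_cap])
lemma lb_post: "\<lbrakk>j \<in> I; \<guillemotleft>f : A \<rightarrow> V j \<odot> B\<guillemotright>; \<guillemotleft>k : B \<rightarrow> B'\<guillemotright>\<rbrakk> \<Longrightarrow>
    lb j B' ((V j \<triangleright> k) \<bullet> f) = k \<bullet> lb j B f"
  unfolding lb_def by (rule bend_left_post[OF duality_cap])
lemma lb_rb: "\<lbrakk>i \<in> I; j \<in> I; \<guillemotleft>f : A \<rightarrow> V i \<odot> B \<odot> V j\<guillemotright>\<rbrakk> \<Longrightarrow>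
    lb i B (rb j (V i \<odot> B) f) = rb j B (lb i (B \<odot> V j) f)"
  unfolding lb_def rb_def by (rule bend_left_right[OF duality_cap' duality_cap])
lemma rb_lb_crossing: "\<lbrakk>j \<in> I; \<guillemotleft>f : A \<rightarrow> P \<odot> V (j\<^sup>\<star>)\<guillemotright>; \<guillemotleft>g : B \<rightarrow> V j \<odot> Q\<guillemotright>\<rbrakk> \<Longrightarrow>
    (P \<triangleright> lb j Q g) \<bullet> (f \<triangleleft> B) = (rb (j\<^sup>\<star>) P f \<triangleleft> Q) \<bullet> (A \<triangleright> g)"
  unfolding lb_def rb_def using bend_crossing[of "cap j" "V (j\<^sup>\<star>)" "V j" f A P g B Q] by simp

text \<open>
  The two occurrences of \<open>w\<close> cancel, and the right-hand side becomes the partial trace of \<open>f \<bullet> g\<close> over \<open>V j\<close>.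
\<close>
lemma T_bend_right:
  assumes j: "j \<in> I" and B: "projective C B"
    and f: "\<guillemotleft>f : A \<rightarrow> B \<odot> V j\<guillemotright>" and g: "\<guillemotleft>g : B \<odot> V j \<rightarrow> A\<guillemotright>"
  shows "T (f \<bullet> g) = T (rb j B f \<bullet> ru (j\<^sup>\<star>) B g)"
proof -
  let ?h = "f \<bullet> g" and ?d = "dual C (V j)" and ?w = "aw (j\<^sup>\<star>)" and ?w' = "aw_inv (j\<^sup>\<star>)"
  have h: "\<guillemotleft>?h : B \<odot> V j \<rightarrow> B \<odot> V j\<guillemotright>" using f g by simp
  have "rb j B f \<bullet> ru (j\<^sup>\<star>) B g = (B \<triangleright> cap (j\<^sup>\<star>)) \<bullet> (?h \<triangleleft> V (j\<^sup>\<star>)) \<bullet> (B \<triangleright> cup j)"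
    using f g j by (simp add: rb_def bend_right_def ru_def unbend_right_def acomp_assoc)
  also have "\<dots> = (B \<triangleright> atev (V j)) \<bullet> ((tgt ?h \<triangleright> ?w) \<bullet> (?h \<triangleleft> src ?w)) \<bullet> ((B \<odot> V j) \<triangleright> ?w') \<bullet> (B \<triangleright> acoev (V j))"
    using f g j by (simp add: cap_eq_tev cup_def acomp_assoc)
  also have "\<dots> = (B \<triangleright> atev (V j)) \<bullet> ((?h \<triangleleft> tgt ?w) \<bullet> (src ?h \<triangleright> ?w)) \<bullet> ((B \<odot> V j) \<triangleright> ?w') \<bullet> (B \<triangleright> acoev (V j))"
    using h j by (subst interchange) auto
  also have "\<dots> = (B \<triangleright> atev (V j)) \<bullet> (?h \<triangleleft> ?d) \<bullet> ((B \<odot> V j) \<triangleright> (?w \<bullet> ?w')) \<bullet> (B \<triangleright> acoev (V j))"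
    using f g j by (simp add: acomp_assoc del: aw_inv)
  also have "\<dots> = (B \<triangleright> atev (V j)) \<bullet> (?h \<triangleleft> ?d) \<bullet> (B \<triangleright> acoev (V j))"
    using f g j by simp
  finally show ?thesis using T_partial_right[OF B h] by simp
qed

lemma T_bend_left:
  assumes j: "j \<in> I" and B: "projective C B"
    and f: "\<guillemotleft>f : A \<rightarrow> V j \<odot> B\<guillemotright>" and g: "\<guillemotleft>g : V j \<odot> B \<rightarrow> A\<guillemotright>"
  shows "T (f \<bullet> g) = T (lb j B f \<bullet> lu (j\<^sup>\<star>) B g)"
proof -
  let ?h = "f \<bullet> g" and ?d = "dual C (V j)" and ?w = "aw (j\<^sup>\<star>)" and ?w' = "aw_inv (j\<^sup>\<star>)"
  have h: "\<guillemotleft>?h : V j \<odot> B \<rightarrow> V j \<odot> B\<guillemotright>" using f g by simp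
  have "lb j B f \<bullet> lu (j\<^sup>\<star>) B g = (cap j \<triangleleft> B) \<bullet> (V (j\<^sup>\<star>) \<triangleright> ?h) \<bullet> (cup (j\<^sup>\<star>) \<triangleleft> B)"
    using f g j by (simp add: lb_def bend_left_def lu_def unbend_left_def acomp_assoc)
  also have "\<dots> = (aev (V j) \<triangleleft> B) \<bullet> ((?w \<triangleleft> tgt ?h) \<bullet> (src ?w \<triangleright> ?h)) \<bullet> (?w' \<triangleleft> (V j \<odot> B)) \<bullet> (atcoev (V j) \<triangleleft> B)"
    using f g j by (simp add: cap_eq cup_eq_tcoev acomp_assoc)
  also have "\<dots> = (aev (V j) \<triangleleft> B) \<bullet> ((tgt ?w \<triangleright> ?h) \<bullet> (?w \<triangleleft> src ?h)) \<bullet> (?w' \<triangleleft> (V j \<odot> B)) \<bullet> (atcoev (V j) \<triangleleft> B)"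
    using h j by (subst interchange) auto
  also have "\<dots> = (aev (V j) \<triangleleft> B) \<bullet> (?d \<triangleright> ?h) \<bullet> ((?w \<bullet> ?w') \<triangleleft> (V j \<odot> B)) \<bullet> (atcoev (V j) \<triangleleft> B)"
    using f g j by (simp add: acomp_assoc del: aw_inv)
  also have "\<dots> = (aev (V j) \<triangleleft> B) \<bullet> (?d \<triangleright> ?h) \<bullet> (atcoev (V j) \<triangleleft> B)"
    using f g j by simp
  finally show ?thesis using T_partial_left[OF B h] by simp
qed

end

section \<open>Vectors of triple tensor products\<close>

context pivotal_category
begin

lemma dual_mor_vector_in:
  assumes y: "\<guillemotleft>y : \<I> \<rightarrow> X\<guillemotright>"
  shows "dual_mor C \<I> X (mor y) \<in> Hom C (dual C X) (dual C \<I>)"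
proof -
  let ?L = "(aev X \<triangleleft> dual C \<I>) \<bullet> (dual C X \<triangleright> (y \<triangleleft> dual C \<I>)) \<bullet> (dual C X \<triangleright> acoev \<I>)"
  have "mor ?L = dual_mor C \<I> X (mor y)"
    by (simp add: mor_simps mor_pivotal dual_mor_def)
  moreover have "mor ?L \<in> Hom C (dual C X) (dual C \<I>)"
    using y by (intro mor_in) auto
  ultimately show ?thesis by simp
qed

text \<open>
  Bending three legs one after another amounts to bending their tensor product, up to the canonical
  isomorphism between the dual of the product and the product of the duals.
\<close>
lemma triple_dual_right:
  fixes X1 X2 X3
  assumes y: "\<guillemotleft>y : \<I> \<rightarrow> X1 \<odot> X2 \<odot> X3\<guillemotright>"
  defines "D \<equiv> adual_tensor (X1 \<odot> X2) X3 \<bullet> (dual C X3 \<triangleright> adual_tensor X1 X2)"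
  defines "X \<equiv> X1 \<odot> X2 \<odot> X3"
  shows "bend_right (dual C X1) (atev X1) \<I> (bend_right (dual C X2) (atev X2) X1
      (bend_right (dual C X3) (atev X3) (X1 \<odot> X2) y)) = (atev X \<bullet> (y \<triangleleft> dual C X)) \<bullet> D"
proof -
  let ?P = "X1 \<odot> X2" and ?d1 = "dual C X1" and ?d2 = "dual C X2" and ?d3 = "dual C X3"
  let ?D2 = "adual_tensor X1 X2"
  have "(atev X \<bullet> (y \<triangleleft> dual C X)) \<bullet> D = atev X \<bullet> ((y \<triangleleft> tgt D) \<bullet> (src y \<triangleright> D))"
    using y by (simp add: D_def X_def acomp_assoc)
  also have "\<dots> = atev X \<bullet> ((tgt y \<triangleright> D) \<bullet> (y \<triangleleft> src D))"
    using y by (subst interchange) (auto simp: D_def X_def)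
  also have "\<dots> = (atev (?P \<odot> X3) \<bullet> ((?P \<odot> X3) \<triangleright> adual_tensor ?P X3)) \<bullet> ((X \<odot> ?d3) \<triangleright> ?D2) \<bullet> (y \<triangleleft> src D)"
    using y by (simp add: D_def X_def acomp_assoc)
  also have "\<dots> = atev ?P \<bullet> (?P \<triangleright> ((atev X3 \<triangleleft> tgt ?D2) \<bullet> (src (atev X3) \<triangleright> ?D2))) \<bullet> (y \<triangleleft> src D)"
    unfolding atev_dual_tensor using y by (simp add: D_def X_def acomp_assoc)
  also have "\<dots> = atev ?P \<bullet> (?P \<triangleright> (?D2 \<bullet> (atev X3 \<triangleleft> src ?D2))) \<bullet> (y \<triangleleft> src D)"
    by (subst slide_cap_left) auto
  also have "\<dots> = (atev ?P \<bullet> (?P \<triangleright> ?D2)) \<bullet> (?P \<triangleright> (atev X3 \<triangleleft> (?d2 \<odot> ?d1))) \<bullet> (y \<triangleleft> (?d3 \<odot> ?d2 \<odot> ?d1))"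
    using y by (simp add: D_def acomp_assoc)
  also have "\<dots> = bend_right ?d1 (atev X1) \<I> (bend_right ?d2 (atev X2) X1 (bend_right ?d3 (atev X3) ?P y))"
    unfolding atev_dual_tensor using y by (simp add: bend_right_def acomp_assoc)
  finally show ?thesis by simp
qed

lemma triple_dual_left:
  fixes X1 X2 X3
  assumes y: "\<guillemotleft>y : \<I> \<rightarrow> X1 \<odot> X2 \<odot> X3\<guillemotright>"
  defines "D \<equiv> adual_tensor (X1 \<odot> X2) X3 \<bullet> (dual C X3 \<triangleright> adual_tensor X1 X2)"
  defines "X \<equiv> X1 \<odot> X2 \<odot> X3"
  shows "bend_left (dual C X3) (aev X3) \<I> (bend_left (dual C X2) (aev X2) X3
      (bend_left (dual C X1) (aev X1) (X2 \<odot> X3) y)) = (aev X \<bullet> (dual C X \<triangleright> y)) \<bullet> D"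
proof -
  let ?P = "X1 \<odot> X2" and ?d1 = "dual C X1" and ?d2 = "dual C X2" and ?d3 = "dual C X3"
  let ?D2 = "adual_tensor X1 X2"
  have "(aev X \<bullet> (dual C X \<triangleright> y)) \<bullet> D = aev X \<bullet> ((tgt D \<triangleright> y) \<bullet> (D \<triangleleft> src y))"
    using y by (simp add: D_def X_def acomp_assoc)
  also have "\<dots> = aev X \<bullet> ((D \<triangleleft> tgt y) \<bullet> (src D \<triangleright> y))"
    using y by (subst interchange) (auto simp: D_def X_def)
  also have "\<dots> = (aev (?P \<odot> X3) \<bullet> (adual_tensor ?P X3 \<triangleleft> (?P \<odot> X3))) \<bullet> (?d3 \<triangleright> (?D2 \<triangleleft> X)) \<bullet> (src D \<triangleright> y)"
    using y by (simp add: D_def X_def acomp_assoc)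
  also have "\<dots> = aev X3 \<bullet> (?d3 \<triangleright> ((aev ?P \<bullet> (?D2 \<triangleleft> ?P)) \<triangleleft> X3)) \<bullet> (src D \<triangleright> y)"
    unfolding aev_dual_tensor[of ?P X3] using y by (simp add: D_def X_def acomp_assoc)
  also have "\<dots> = bend_left ?d3 (aev X3) \<I> (bend_left ?d2 (aev X2) X3 (bend_left ?d1 (aev X1) (X2 \<odot> X3) y))"
    unfolding aev_dual_tensor[of X1 X2] using y by (simp add: D_def bend_left_def acomp_assoc)
  finally show ?thesis by simp
qed

end

context based_category
begin

abbreviation \<beta> :: "'i \<Rightarrow> 'k" where
  "\<beta> \<equiv> beta C I V dag w"

text \<open>
  \<open>adag (aw i) \<bullet> aw i\<close> is a scalar because \<open>V i\<close> is simple; this scalar is \<open>\<beta> i\<close>.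
\<close>
lemma adag_aw: "i \<in> I \<Longrightarrow> adag (aw i) = \<beta> i *\<^sub>a aw_inv i"
  and dag_w: "i \<in> I \<Longrightarrow>
    dag (w i) = smult C (\<beta> i) (inv_mor C (V i) (dual C (V (i\<^sup>\<star>))) (w i))"
proof -
  assume i: "i \<in> I"
  let ?w' = "inv_mor C (V i) (dual C (V (i\<^sup>\<star>))) (w i)"
  obtain c where c: "adag (aw i) \<bullet> aw i = c *\<^sub>a one (V i)"
    by (rule simple_endo[OF simple_V[OF i], of "adag (aw i) \<bullet> aw i"]) (use i in auto)
  have "adag (aw i) = (adag (aw i) \<bullet> aw i) \<bullet> aw_inv i"
    using i by (simp add: acomp_assoc)
  then have "adag (aw i) = c *\<^sub>a aw_inv i"
    unfolding c using i by simp
  then have c: "dag (w i) = smult C c ?w'"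
    by (simp add: adag_def aw_def aw_inv_def ascale_def)
  have "c' = c" if c': "dag (w i) = smult C c' ?w'" for c'
  proof -
    have "c' *\<^sub>a aw_inv i = c *\<^sub>a aw_inv i"
      using c c' by (simp add: aw_inv_def ascale_def)
    then have "(c' *\<^sub>a aw_inv i) \<bullet> aw i = (c *\<^sub>a aw_inv i) \<bullet> aw i" by simp
    then have "c' *\<^sub>a one (V i) = c *\<^sub>a one (V i)" using i by simp
    then show ?thesis by (rule simple_scalar_eqD[OF simple_V[OF i]])
  qed
  then have "\<beta> i = c" unfolding beta_def using c by (intro the_equality) auto
  then show d: "dag (w i) = smult C (\<beta> i) ?w'" using c by simp
  show "adag (aw i) = \<beta> i *\<^sub>a aw_inv i"
    using d by (simp add: adag_def aw_def aw_inv_def ascale_def)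
qed

lemma adag_cap: "j \<in> I \<Longrightarrow> adag (cap j) = \<beta> j *\<^sub>a cup (j\<^sup>\<star>)"
  by (simp add: cap_eq_tev cup_def adag_aw)

text \<open>
  The cup has two descriptions, by \<open>coev\<close> with \<open>w (i\<^sup>\<star>)\<close> and by \<open>tcoev\<close> with \<open>w i\<close>; they give the two sides.
\<close>
lemma beta_star:
  assumes j: "j \<in> I"
  shows "\<beta> (j\<^sup>\<star>) = \<beta> j"
proof -
  have "\<beta> (j\<^sup>\<star>) *\<^sub>a cup (j\<^sup>\<star>) = adag (cap j)"
    using j by (simp add: cap_eq cup_eq_tcoev adag_aw)
  also have "\<dots> = \<beta> j *\<^sub>a cup (j\<^sup>\<star>)" by (rule adag_cap[OF j])
  finally have e: "\<beta> (j\<^sup>\<star>) *\<^sub>a cup (j\<^sup>\<star>) = \<beta> j *\<^sub>a cup (j\<^sup>\<star>)" .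
  have z: "(cap (j\<^sup>\<star>) \<triangleleft> V j) \<bullet> (V j \<triangleright> (c *\<^sub>a cup (j\<^sup>\<star>))) = c *\<^sub>a one (V j)" for c
    using j dualityD(3)[OF duality_cap'[OF j]] by simp
  have "\<beta> (j\<^sup>\<star>) *\<^sub>a one (V j) = \<beta> j *\<^sub>a one (V j)"
    using arg_cong[OF e, of "\<lambda>x. (cap (j\<^sup>\<star>) \<triangleleft> V j) \<bullet> (V j \<triangleright> x)"] unfolding z .
  then show ?thesis by (rule simple_scalar_eqD[OF simple_V[OF j]])
qed

lemma beta_nonzero: "i \<in> I \<Longrightarrow> \<beta> i \<noteq> 0"
  and beta_real: "i \<in> I \<Longrightarrow> bar (\<beta> i) = \<beta> i"
proof -
  assume i: "i \<in> I"
  have "one (dual C (V (i\<^sup>\<star>))) = adag (aw i \<bullet> aw_inv i)" using i by (simp only: aw_inv adag_one)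
  also have "\<dots> = \<beta> i *\<^sub>a (adag (aw_inv i) \<bullet> aw_inv i)"
    using i by (simp add: adag_aw del: aw_inv)
  finally have 1: "\<beta> i *\<^sub>a (adag (aw_inv i) \<bullet> aw_inv i) = one (dual C (V (i\<^sup>\<star>)))" ..
  have "(\<beta> i *\<^sub>a (adag (aw_inv i) \<bullet> aw_inv i)) \<bullet> aw i = aw i" unfolding 1 using i by simp
  then have 2: "\<beta> i *\<^sub>a adag (aw_inv i) = aw i" using i by (simp add: acomp_assoc)
  have "bar (\<beta> i) *\<^sub>a aw_inv i = adag (\<beta> i *\<^sub>a adag (aw_inv i))" using i by simp
  also have "\<dots> = \<beta> i *\<^sub>a aw_inv i" unfolding 2 by (rule adag_aw[OF i])
  finally have "(bar (\<beta> i) *\<^sub>a aw_inv i) \<bullet> aw i = (\<beta> i *\<^sub>a aw_inv i) \<bullet> aw i" by simp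
  then have "bar (\<beta> i) *\<^sub>a one (V i) = \<beta> i *\<^sub>a one (V i)" using i by simp
  then show "bar (\<beta> i) = \<beta> i" by (rule simple_scalar_eqD[OF simple_V[OF i]])
  show "\<beta> i \<noteq> 0"
  proof
    assume "\<beta> i = 0"
    then have "mor (aw i) = 0" using arg_cong[OF 2, of mor] by (simp add: mor_simps)
    then have z: "0 *\<^sub>a aw i = aw i" by (rule zero_arrow)
    have "aw_inv i \<bullet> (0 *\<^sub>a aw i) = 0 *\<^sub>a (aw_inv i \<bullet> aw i)" using i by (simp del: aw_inv)
    then have "1 *\<^sub>a one (V i) = 0 *\<^sub>a one (V i)" unfolding z using i by simp
    then show False using simple_scalar_eqD[OF simple_V[OF i], of 1 0] by simp
  qed
qed

lemma adag_rb: "\<lbrakk>j \<in> I; \<guillemotleft>f : A \<rightarrow> B \<odot> V j\<guillemotright>\<rbrakk> \<Longrightarrow> adag (rb j B f) = \<beta> j *\<^sub>a ru (j\<^sup>\<star>) B (adag f)"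
  by (simp add: rb_def ru_def bend_right_def unbend_right_def adag_cap beta_star)

lemma adag_lb: "\<lbrakk>i \<in> I; \<guillemotleft>f : A \<rightarrow> V i \<odot> B\<guillemotright>\<rbrakk> \<Longrightarrow> adag (lb i B f) = \<beta> i *\<^sub>a lu (i\<^sup>\<star>) B (adag f)"
  by (simp add: lb_def lu_def bend_left_def unbend_left_def adag_cap)

text \<open>
  Bending a leg labelled \<open>j\<close> is a similitude of factor \<open>\<beta> j\<close> for the Hermitian form \<open>T (f \<bullet> adag g)\<close>.
\<close>
lemma T_rb_adag:
  assumes "j \<in> I" "projective C B" "\<guillemotleft>f : A \<rightarrow> B \<odot> V j\<guillemotright>" "\<guillemotleft>g : A \<rightarrow> B \<odot> V j\<guillemotright>"
  shows "T (rb j B f \<bullet> adag (rb j B g)) = \<beta> j * T (f \<bullet> adag g)"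
proof -
  have g: "\<guillemotleft>ru (j\<^sup>\<star>) B (adag g) : B \<rightarrow> A \<odot> V (j\<^sup>\<star>)\<guillemotright>" using assms by (intro ru_arr) auto
  note f = rb_arr[OF assms(1,3)]
  have "T (rb j B f \<bullet> adag (rb j B g)) = T (\<beta> j *\<^sub>a (rb j B f \<bullet> ru (j\<^sup>\<star>) B (adag g)))"
    using f g by (simp add: adag_rb[OF assms(1,4)])
  also have "\<dots> = \<beta> j * T (rb j B f \<bullet> ru (j\<^sup>\<star>) B (adag g))"
    using f g assms by (intro T_scale) auto
  also have "T (rb j B f \<bullet> ru (j\<^sup>\<star>) B (adag g)) = T (f \<bullet> adag g)"
    using assms by (intro T_bend_right[symmetric]) auto
  finally show ?thesis .
qed

lemma T_lb_adag:
  assumes "j \<in> I" "projective C B" "\<guillemotleft>f : A \<rightarrow> V j \<odot> B\<guillemotright>" "\<guillemotleft>g : A \<rightarrow> V j \<odot> B\<guillemotright>"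
  shows "T (lb j B f \<bullet> adag (lb j B g)) = \<beta> j * T (f \<bullet> adag g)"
proof -
  have g: "\<guillemotleft>lu (j\<^sup>\<star>) B (adag g) : B \<rightarrow> V (j\<^sup>\<star>) \<odot> A\<guillemotright>" using assms by (intro lu_arr) auto
  note f = lb_arr[OF assms(1,3)]
  have "T (lb j B f \<bullet> adag (lb j B g)) = T (\<beta> j *\<^sub>a (lb j B f \<bullet> lu (j\<^sup>\<star>) B (adag g)))"
    using f g by (simp add: adag_lb[OF assms(1,4)])
  also have "\<dots> = \<beta> j * T (lb j B f \<bullet> lu (j\<^sup>\<star>) B (adag g))"
    using f g assms by (intro T_scale) auto
  also have "T (lb j B f \<bullet> lu (j\<^sup>\<star>) B (adag g)) = T (f \<bullet> adag g)"
    using assms by (intro T_bend_left[symmetric]) auto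
  finally show ?thesis .
qed

lemma epiD: "\<lbrakk>epi C A B p; u \<in> Hom C B D; v \<in> Hom C B D; u \<cdot> p = v \<cdot> p\<rbrakk> \<Longrightarrow> u = v"
  unfolding epi_def by blast

lemma epi_in: "epi C A B p \<Longrightarrow> p \<in> Hom C A B"
  unfolding epi_def by blast

lemma projectiveD:
  "\<lbrakk>projective C P; epi C A B p; f \<in> Hom C P B\<rbrakk> \<Longrightarrow> \<exists>h\<in>Hom C P A. p \<cdot> h = f"
  unfolding projective_def by blast

lemma projective_V: "i \<in> I \<Longrightarrow> projective C (V i)"
  using mdim_map generic_V by blast

lemma ru_pre:
  assumes "j \<in> I" "\<guillemotleft>g : A \<odot> V (j\<^sup>\<star>) \<rightarrow> B\<guillemotright>" "\<guillemotleft>h : A' \<rightarrow> A\<guillemotright>"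
  shows "ru j A' (g \<bullet> (h \<triangleleft> V (j\<^sup>\<star>))) = ru j A g \<bullet> h"
proof -
  note g = ru_arr[OF assms(1,2)]
  have "rb j B (ru j A g \<bullet> h) = g \<bullet> (h \<triangleleft> V (j\<^sup>\<star>))"
    using rb_pre[OF assms(1) g assms(3)] rb_ru[OF assms(1,2)] by simp
  then show ?thesis using ru_rb[OF assms(1), of "ru j A g \<bullet> h" A' B] g assms(3) by simp
qed

text \<open>\<open>- \<odot> V j\<close> is left adjoint to \<open>- \<odot> V (j\<^sup>\<star>)\<close>, which preserves epimorphisms, being a left adjoint as well.\<close>
lemma projective_tensor_V:
  assumes P: "projective C P" and j: "j \<in> I"
  shows "projective C (P \<odot> V j)"
  unfolding projective_def
proof (intro allI impI, elim conjE)
  fix A B p f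
  assume p: "epi C A B p" and f: "f \<in> Hom C (P \<odot> V j) B"
  let ?p = "Arrow A p B" and ?f = "Arrow (P \<odot> V j) f B"
  have j': "j\<^sup>\<star> \<in> I" "(j\<^sup>\<star>)\<^sup>\<star> = j" using j by auto
  have pa: "\<guillemotleft>?p : A \<rightarrow> B\<guillemotright>" and fa: "\<guillemotleft>?f : P \<odot> V ((j\<^sup>\<star>)\<^sup>\<star>) \<rightarrow> B\<guillemotright>"
    using epi_in[OF p] f j by simp_all
  have e: "epi C (A \<odot> V (j\<^sup>\<star>)) (B \<odot> V (j\<^sup>\<star>)) (mor (?p \<triangleleft> V (j\<^sup>\<star>)))"
    unfolding epi_def
  proof (intro conjI allI ballI impI)
    show "mor (?p \<triangleleft> V (j\<^sup>\<star>)) \<in> Hom C (A \<odot> V (j\<^sup>\<star>)) (B \<odot> V (j\<^sup>\<star>))"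
      using pa by (intro mor_in) auto
  next
    fix D u v
    assume u: "u \<in> Hom C (B \<odot> V (j\<^sup>\<star>)) D" and v: "v \<in> Hom C (B \<odot> V (j\<^sup>\<star>)) D"
      and uv: "u \<cdot> mor (?p \<triangleleft> V (j\<^sup>\<star>)) = v \<cdot> mor (?p \<triangleleft> V (j\<^sup>\<star>))"
    let ?u = "Arrow (B \<odot> V (j\<^sup>\<star>)) u D" and ?v = "Arrow (B \<odot> V (j\<^sup>\<star>)) v D"
    have ua: "\<guillemotleft>?u : B \<odot> V (j\<^sup>\<star>) \<rightarrow> D\<guillemotright>" and va: "\<guillemotleft>?v : B \<odot> V (j\<^sup>\<star>) \<rightarrow> D\<guillemotright>" using u v by auto
    have "?u \<bullet> (?p \<triangleleft> V (j\<^sup>\<star>)) = ?v \<bullet> (?p \<triangleleft> V (j\<^sup>\<star>))" using uv by (simp add: acomp_def)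
    then have "ru j B ?u \<bullet> ?p = ru j B ?v \<bullet> ?p"
      using ru_pre[OF j ua pa] ru_pre[OF j va pa] by simp
    then have "mor (ru j B ?u) \<cdot> p = mor (ru j B ?v) \<cdot> p" by (simp add: acomp_def)
    then have "mor (ru j B ?u) = mor (ru j B ?v)"
      by (rule epiD[OF p mor_in[OF ru_arr[OF j ua]] mor_in[OF ru_arr[OF j va]]])
    then have "ru j B ?u = ru j B ?v"
      using ru_arr[OF j ua] ru_arr[OF j va] by (intro arrow_eqI) auto
    from arg_cong[OF this, of "rb j D"] have "?u = ?v"
      unfolding rb_ru[OF j ua] rb_ru[OF j va] .
    then show "u = v" by simp
  qed
  have f': "\<guillemotleft>ru (j\<^sup>\<star>) P ?f : P \<rightarrow> B \<odot> V (j\<^sup>\<star>)\<guillemotright>" by (rule ru_arr[OF j'(1) fa])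
  obtain h where h: "h \<in> Hom C P (A \<odot> V (j\<^sup>\<star>))"
    and ph: "mor (?p \<triangleleft> V (j\<^sup>\<star>)) \<cdot> h = mor (ru (j\<^sup>\<star>) P ?f)"
    using projectiveD[OF P e mor_in[OF f']] by blast
  let ?h = "Arrow P h (A \<odot> V (j\<^sup>\<star>))"
  have ha: "\<guillemotleft>?h : P \<rightarrow> A \<odot> V (j\<^sup>\<star>)\<guillemotright>" using h by simp
  have "(?p \<triangleleft> V (j\<^sup>\<star>)) \<bullet> ?h = ru (j\<^sup>\<star>) P ?f"
    using ph f' by (intro arrow_eqI) (auto simp: mor_acomp)
  then have "?p \<bullet> rb (j\<^sup>\<star>) A ?h = ?f"
    using rb_post[OF j'(1) ha pa] rb_ru[OF j'(1) fa] by simp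
  from arg_cong[OF this, of mor] have "p \<cdot> mor (rb (j\<^sup>\<star>) A ?h) = f"
    by (simp add: mor_acomp)
  moreover have "mor (rb (j\<^sup>\<star>) A ?h) \<in> Hom C (P \<odot> V j) A"
    using rb_arr[OF j'(1) ha] j by (intro mor_in) simp
  ultimately show "\<exists>h\<in>Hom C (P \<odot> V j) A. p \<cdot> h = f" by blast
qed

lemma projective_V2 [intro]: "\<lbrakk>i \<in> I; j \<in> I\<rbrakk> \<Longrightarrow> projective C (V i \<odot> V j)"
  by (intro projective_tensor_V projective_V)

lemma projective_V3 [intro]: "\<lbrakk>i \<in> I; j \<in> I; k \<in> I\<rbrakk> \<Longrightarrow> projective C (V i \<odot> V j \<odot> V k)"
  using projective_tensor_V[OF projective_V2[of i j], of k] by simp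

text \<open>All three legs of a vector are bent to the right.\<close>
definition functional3 :: "'i \<Rightarrow> 'i \<Rightarrow> 'i \<Rightarrow> ('o, 'm) arrow \<Rightarrow> ('o, 'm) arrow" where
  "functional3 i j k y = rb i \<I> (rb j (V i) (rb k (V i \<odot> V j) y))"

lemma rb_dual:
  assumes "j \<in> I" "\<guillemotleft>f : A \<rightarrow> B \<odot> V j\<guillemotright>"
  shows "rb j B f = bend_right (dual C (V j)) (atev (V j)) B f \<bullet> (A \<triangleright> aw (j\<^sup>\<star>))"
  using assms interchange[of f "aw (j\<^sup>\<star>)"]
  by (simp add: rb_def bend_right_def cap_eq_tev acomp_assoc)

lemma lb_dual:
  assumes "j \<in> I" "\<guillemotleft>f : A \<rightarrow> V j \<odot> B\<guillemotright>"
  shows "lb j B f = bend_left (dual C (V j)) (aev (V j)) B f \<bullet> (aw (j\<^sup>\<star>) \<triangleleft> A)"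
  using assms interchange[of "aw (j\<^sup>\<star>)" f]
  by (simp add: lb_def bend_left_def cap_eq acomp_assoc)

definition aw3 :: "'i \<Rightarrow> 'i \<Rightarrow> 'i \<Rightarrow> ('o, 'm) arrow" where
  "aw3 i j k = (aw i \<triangleleft> (dual C (V (j\<^sup>\<star>)) \<odot> dual C (V (k\<^sup>\<star>)))) \<bullet> (V i \<triangleright> (aw j \<triangleleft> dual C (V (k\<^sup>\<star>)))) \<bullet>
     ((V i \<odot> V j) \<triangleright> aw k)"

lemma functional3_right:
  assumes "a \<in> I" "b \<in> I" "c \<in> I" and y: "\<guillemotleft>y : \<I> \<rightarrow> V a \<odot> V b \<odot> V c\<guillemotright>"
  defines "X \<equiv> V a \<odot> V b \<odot> V c"
  defines "D \<equiv> adual_tensor (V a \<odot> V b) (V c) \<bullet> (dual C (V c) \<triangleright> adual_tensor (V a) (V b))"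
  shows "functional3 a b c y = ((atev X \<bullet> (y \<triangleleft> dual C X)) \<bullet> D) \<bullet> aw3 (c\<^sup>\<star>) (b\<^sup>\<star>) (a\<^sup>\<star>)"
proof -
  let ?r = "\<lambda>j. bend_right (dual C (V j)) (atev (V j))"
  let ?y1 = "?r c (V a \<odot> V b) y" and ?y2 = "?r b (V a) (?r c (V a \<odot> V b) y)"
  have y1: "\<guillemotleft>?y1 : dual C (V c) \<rightarrow> V a \<odot> V b\<guillemotright>"
    using bend_right_arr[OF duality_right, of y \<I> "V a \<odot> V b"] y by simp
  have y2: "\<guillemotleft>?y2 : dual C (V c) \<odot> dual C (V b) \<rightarrow> V a\<guillemotright>"
    using bend_right_arr[OF duality_right, of ?y1 "dual C (V c)" "V a"] y1 by simp
  have y3: "\<guillemotleft>?r a \<I> ?y2 : dual C (V c) \<odot> dual C (V b) \<odot> dual C (V a) \<rightarrow> \<I>\<guillemotright>"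
    using bend_right_arr[OF duality_right, of ?y2 "dual C (V c) \<odot> dual C (V b)" \<I>] y2 by simp
  have e1: "rb c (V a \<odot> V b) y = ?y1 \<bullet> aw (c\<^sup>\<star>)"
    using rb_dual[of c y \<I> "V a \<odot> V b"] y assms by simp
  have e2: "rb b (V a) (rb c (V a \<odot> V b) y) = ?y2 \<bullet> ((aw (c\<^sup>\<star>) \<triangleleft> dual C (V b)) \<bullet> (V (c\<^sup>\<star>) \<triangleright> aw (b\<^sup>\<star>)))"
    using rb_dual[of b "?y1 \<bullet> aw (c\<^sup>\<star>)" "V (c\<^sup>\<star>)" "V a"] y1 y2 assms(1-3)
      bend_right_pre[OF duality_right y1, of "aw (c\<^sup>\<star>)" "V (c\<^sup>\<star>)"] by (simp add: e1 acomp_assoc)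
  let ?h = "(aw (c\<^sup>\<star>) \<triangleleft> dual C (V b)) \<bullet> (V (c\<^sup>\<star>) \<triangleright> aw (b\<^sup>\<star>))"
  have "functional3 a b c y = ?r a \<I> ?y2 \<bullet> (?h \<triangleleft> dual C (V a)) \<bullet> ((V (c\<^sup>\<star>) \<odot> V (b\<^sup>\<star>)) \<triangleright> aw (a\<^sup>\<star>))"
    using rb_dual[of a "?y2 \<bullet> ?h" "V (c\<^sup>\<star>) \<odot> V (b\<^sup>\<star>)" \<I>] y2 y3 assms(1-3)
      bend_right_pre[OF duality_right, of ?y2 _ \<I> "V a" ?h "V (c\<^sup>\<star>) \<odot> V (b\<^sup>\<star>)"]
    by (simp add: functional3_def e2 acomp_assoc)
  also have "\<dots> = ?r a \<I> ?y2 \<bullet> aw3 (c\<^sup>\<star>) (b\<^sup>\<star>) (a\<^sup>\<star>)"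
    using assms(1-3) y3 by (simp add: aw3_def acomp_assoc)
  finally show ?thesis using triple_dual_right[OF y] unfolding X_def D_def by simp
qed

text \<open>
  Up to the isomorphisms \<open>w\<close> and the canonical isomorphism for triple products, both sides are duals of \<open>y\<close>,
  one with respect to the right evaluations and one with respect to the left ones. Pivotality identifies them.
\<close>
lemma functional3_left:
  assumes "a \<in> I" "b \<in> I" "c \<in> I" and y: "\<guillemotleft>y : \<I> \<rightarrow> V a \<odot> V b \<odot> V c\<guillemotright>"
  shows "functional3 a b c y = lb c \<I> (lb b (V c) (lb a (V b \<odot> V c) y))"
proof -
  let ?X = "V a \<odot> V b \<odot> V c"
  let ?D = "adual_tensor (V a \<odot> V b) (V c) \<bullet> (dual C (V c) \<triangleright> adual_tensor (V a) (V b))"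
  let ?l = "\<lambda>j. bend_left (dual C (V j)) (aev (V j))"
  let ?y1 = "?l a (V b \<odot> V c) y" and ?y2 = "?l b (V c) (?l a (V b \<odot> V c) y)"
  have y1: "\<guillemotleft>?y1 : dual C (V a) \<rightarrow> V b \<odot> V c\<guillemotright>"
    using bend_left_arr[OF duality_left, of y \<I> "V a" "V b \<odot> V c"] y by simp
  have y2: "\<guillemotleft>?y2 : dual C (V b) \<odot> dual C (V a) \<rightarrow> V c\<guillemotright>"
    using bend_left_arr[OF duality_left, of ?y1 "dual C (V a)" "V b" "V c"] y1 by simp
  have y3: "\<guillemotleft>?l c \<I> ?y2 : dual C (V c) \<odot> dual C (V b) \<odot> dual C (V a) \<rightarrow> \<I>\<guillemotright>"
    using bend_left_arr[OF duality_left, of ?y2 "dual C (V b) \<odot> dual C (V a)" "V c" \<I>] y2 by simp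
  have e1: "lb a (V b \<odot> V c) y = ?y1 \<bullet> aw (a\<^sup>\<star>)"
    using lb_dual[of a y \<I> "V b \<odot> V c"] y assms by simp
  let ?h = "(dual C (V b) \<triangleright> aw (a\<^sup>\<star>)) \<bullet> (aw (b\<^sup>\<star>) \<triangleleft> V (a\<^sup>\<star>))"
  have e2: "lb b (V c) (lb a (V b \<odot> V c) y) = ?y2 \<bullet> ?h"
    using lb_dual[of b "?y1 \<bullet> aw (a\<^sup>\<star>)" "V (a\<^sup>\<star>)" "V c"] y1 y2 assms(1-3)
      bend_left_pre[OF duality_left y1, of "aw (a\<^sup>\<star>)" "V (a\<^sup>\<star>)"] by (simp add: e1 acomp_assoc)
  have h: "?h = (aw (b\<^sup>\<star>) \<triangleleft> dual C (V a)) \<bullet> (V (b\<^sup>\<star>) \<triangleright> aw (a\<^sup>\<star>))"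
    using interchange[of "aw (b\<^sup>\<star>)" "aw (a\<^sup>\<star>)"] assms(1-3) by simp
  have "lb c \<I> (lb b (V c) (lb a (V b \<odot> V c) y)) =
      ?l c \<I> ?y2 \<bullet> ((tgt (aw (c\<^sup>\<star>)) \<triangleright> ?h) \<bullet> (aw (c\<^sup>\<star>) \<triangleleft> src ?h))"
    using lb_dual[of c "?y2 \<bullet> ?h" "V (b\<^sup>\<star>) \<odot> V (a\<^sup>\<star>)" \<I>] y2 y3 assms(1-3)
      bend_left_pre[OF duality_left, of ?y2 _ "V c" \<I> ?h "V (b\<^sup>\<star>) \<odot> V (a\<^sup>\<star>)"]
    by (simp add: e2 acomp_assoc)
  also have "\<dots> = ?l c \<I> ?y2 \<bullet> ((aw (c\<^sup>\<star>) \<triangleleft> tgt ?h) \<bullet> (src (aw (c\<^sup>\<star>)) \<triangleright> ?h))"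
    using assms(1-3) by (subst interchange) auto
  also have "\<dots> = ?l c \<I> ?y2 \<bullet> aw3 (c\<^sup>\<star>) (b\<^sup>\<star>) (a\<^sup>\<star>)"
    unfolding h using assms(1-3) y3 by (simp add: aw3_def acomp_assoc)
  also have "\<dots> = functional3 a b c y"
    unfolding functional3_right[OF assms(1-3) y] triple_dual_left[OF y] vector_dual_left_right(1)[OF y] ..
  finally show ?thesis by simp
qed

lemma functional3_arr:
  "\<lbrakk>a \<in> I; b \<in> I; c \<in> I; \<guillemotleft>y : \<I> \<rightarrow> V a \<odot> V b \<odot> V c\<guillemotright>\<rbrakk> \<Longrightarrow>
    \<guillemotleft>functional3 a b c y : V (c\<^sup>\<star>) \<odot> V (b\<^sup>\<star>) \<odot> V (a\<^sup>\<star>) \<rightarrow> \<I>\<guillemotright>"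
  unfolding functional3_def
  using rb_arr[of c y \<I> "V a \<odot> V b"] rb_arr[of b _ "V (c\<^sup>\<star>)" "V a"]
    rb_arr[of a _ "V (c\<^sup>\<star>) \<odot> V (b\<^sup>\<star>)" \<I>] by simp

lemma mor_aw: "mor (aw i) = w i"
  by (simp add: aw_def)

text \<open>
  In the definition of \<open>\<Theta>\<close> the canonical isomorphisms and the three \<open>w\<close> combine into three caps.
\<close>
lemma Theta_eq:
  assumes "i \<in> I" "j \<in> I" "k \<in> I"
    and y': "\<guillemotleft>y' : \<I> \<rightarrow> V (k\<^sup>\<star>) \<odot> V (j\<^sup>\<star>) \<odot> V (i\<^sup>\<star>)\<guillemotright>" and y: "\<guillemotleft>y : \<I> \<rightarrow> V i \<odot> V j \<odot> V k\<guillemotright>"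
  shows "Theta C I V w i j k (mor y') (mor y) = T (y \<bullet> functional3 (k\<^sup>\<star>) (j\<^sup>\<star>) (i\<^sup>\<star>) y')"
proof -
  let ?X = "V (k\<^sup>\<star>) \<odot> V (j\<^sup>\<star>) \<odot> V (i\<^sup>\<star>)"
  let ?D1 = "adual_tensor (V (k\<^sup>\<star>) \<odot> V (j\<^sup>\<star>)) (V (i\<^sup>\<star>))"
  let ?D2 = "dual C (V (i\<^sup>\<star>)) \<triangleright> adual_tensor (V (k\<^sup>\<star>)) (V (j\<^sup>\<star>))"
  let ?G = "aw3 i j k"
  let ?M = "Arrow (dual C ?X) (dual_mor C \<I> ?X (mor y')) (dual C \<I>)"
  have M: "\<guillemotleft>?M : dual C ?X \<rightarrow> dual C \<I>\<guillemotright>" using dual_mor_vector_in[OF y'] by simp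
  have G: "w i \<otimes> w j \<otimes> w k = mor ?G"
  proof -
    have "w j \<otimes> w k = mor ((aw j \<triangleleft> tgt (aw k)) \<bullet> (src (aw j) \<triangleright> aw k))"
      using mor_tensor[of "aw j" "aw k"] assms(2,3) unfolding mor_aw by simp
    moreover have "w i \<otimes> mor ((aw j \<triangleleft> tgt (aw k)) \<bullet> (src (aw j) \<triangleright> aw k)) = mor ?G"
      using mor_tensor[of "aw i" "(aw j \<triangleleft> tgt (aw k)) \<bullet> (src (aw j) \<triangleright> aw k)"] assms(1-3)
      unfolding mor_aw by (simp add: aw3_def)
    ultimately show ?thesis by simp
  qed
  have G_arr: "\<guillemotleft>?G : V i \<odot> V j \<odot> V k \<rightarrow> dual C (V (i\<^sup>\<star>)) \<odot> dual C (V (j\<^sup>\<star>)) \<odot> dual C (V (k\<^sup>\<star>))\<guillemotright>"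
    using assms(1-3) by (simp add: aw3_def)
  have aM: "aev \<I> \<bullet> ?M = atev ?X \<bullet> (y' \<triangleleft> dual C ?X)"
    using vector_dual_left_right[OF y'] y' M
    by (intro arrow_eqI) (auto simp: mor_acomp[of "aev \<I>"] mor_pivotal)
  have "y \<bullet> aev \<I> \<bullet> ?M \<bullet> ?D1 \<bullet> ?D2 \<bullet> ?G = y \<bullet> ((aev \<I> \<bullet> ?M) \<bullet> (?D1 \<bullet> ?D2)) \<bullet> ?G"
    using y M G_arr by (simp add: acomp_assoc)
  also have "((aev \<I> \<bullet> ?M) \<bullet> (?D1 \<bullet> ?D2)) \<bullet> ?G = functional3 (k\<^sup>\<star>) (j\<^sup>\<star>) (i\<^sup>\<star>) y'"
    using functional3_right[of "k\<^sup>\<star>" "j\<^sup>\<star>" "i\<^sup>\<star>" y'] y' assms(1-3) unfolding aM by simp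
  finally have e: "y \<bullet> aev \<I> \<bullet> ?M \<bullet> ?D1 \<bullet> ?D2 \<bullet> ?G = y \<bullet> functional3 (k\<^sup>\<star>) (j\<^sup>\<star>) (i\<^sup>\<star>) y'" .
  have "Theta C I V w i j k (mor y') (mor y) = tr C (V i \<odot> V j \<odot> V k) (mor (y \<bullet> aev \<I> \<bullet> ?M \<bullet> ?D1 \<bullet> ?D2 \<bullet> ?G))"
    unfolding Theta_def G by (simp add: mor_simps mor_pivotal adual_tensor_def)
  then show ?thesis
    unfolding e T_def using functional3_arr[of "k\<^sup>\<star>" "j\<^sup>\<star>" "i\<^sup>\<star>" y'] y' assms(1-3) by simp
qed

end

section \<open>Rotation and the tetrahedral evaluation\<close>

context based_category
begin

text \<open>
  The trivalent vertices: for vectors \<open>y\<close> of \<open>V i \<odot> V j \<odot> V (k\<^sup>\<star>)\<close> and of \<open>V k \<odot> V (j\<^sup>\<star>) \<odot> V (i\<^sup>\<star>)\<close>, respectively,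
  morphisms \<open>V k \<rightarrow> V i \<odot> V j\<close> and \<open>V i \<odot> V j \<rightarrow> V k\<close>.
\<close>
definition split :: "'i \<Rightarrow> 'i \<Rightarrow> 'i \<Rightarrow> ('o, 'm) arrow \<Rightarrow> ('o, 'm) arrow" where
  "split i j k y = rb (k\<^sup>\<star>) (V i \<odot> V j) y"

definition fuse :: "'i \<Rightarrow> 'i \<Rightarrow> 'i \<Rightarrow> ('o, 'm) arrow \<Rightarrow> ('o, 'm) arrow" where
  "fuse i j k y = rb (j\<^sup>\<star>) (V k) (rb (i\<^sup>\<star>) (V k \<odot> V (j\<^sup>\<star>)) y)"

definition arot :: "'i \<Rightarrow> 'i \<Rightarrow> 'i \<Rightarrow> ('o, 'm) arrow \<Rightarrow> ('o, 'm) arrow" where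
  "arot i j k y = Arrow \<I> (rot C V i j k (mor y)) (V j \<odot> V k \<odot> V i)"

abbreviation vec :: "'i \<Rightarrow> 'i \<Rightarrow> 'i \<Rightarrow> ('o, 'm) arrow \<Rightarrow> bool" where
  "vec i j k y \<equiv> \<guillemotleft>y : \<I> \<rightarrow> V i \<odot> V j \<odot> V k\<guillemotright>"

lemma split_arr: "\<lbrakk>i \<in> I; j \<in> I; k \<in> I; vec i j (k\<^sup>\<star>) y\<rbrakk> \<Longrightarrow> \<guillemotleft>split i j k y : V k \<rightarrow> V i \<odot> V j\<guillemotright>"
  using rb_arr[of "k\<^sup>\<star>" y \<I> "V i \<odot> V j"] by (simp add: split_def)

lemma fuse_arr:
  assumes "i \<in> I" "j \<in> I" "k \<in> I" "vec k (j\<^sup>\<star>) (i\<^sup>\<star>) y"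
  shows "\<guillemotleft>fuse i j k y : V i \<odot> V j \<rightarrow> V k\<guillemotright>"
proof -
  have "\<guillemotleft>rb (i\<^sup>\<star>) (V k \<odot> V (j\<^sup>\<star>)) y : V i \<rightarrow> V k \<odot> V (j\<^sup>\<star>)\<guillemotright>"
    using rb_arr[of "i\<^sup>\<star>" y \<I> "V k \<odot> V (j\<^sup>\<star>)"] assms by simp
  then show ?thesis
    using rb_arr[of "j\<^sup>\<star>" "rb (i\<^sup>\<star>) (V k \<odot> V (j\<^sup>\<star>)) y" "V i" "V k"] assms by (simp add: fuse_def)
qed

lemma functional3_fuse:
  "\<lbrakk>i \<in> I; j \<in> I\<rbrakk> \<Longrightarrow> functional3 k (j\<^sup>\<star>) (i\<^sup>\<star>) y = rb k \<I> (fuse i j k y)"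
  by (simp add: functional3_def fuse_def)

text \<open>The isomorphisms \<open>w\<close> in the cap and in the cup cancel.\<close>
lemma arot_eq:
  assumes "i \<in> I" "j \<in> I" "k \<in> I" and y: "vec i j k y"
  shows "arot i j k y = ru i \<I> (lb i (V j \<odot> V k) y)"
proof -
  let ?B = "V j \<odot> V k" and ?w = "aw (i\<^sup>\<star>)" and ?w' = "aw_inv (i\<^sup>\<star>)"
  let ?h = "y \<triangleleft> V i"
  have "ru i \<I> (lb i ?B y) = (cap i \<triangleleft> (?B \<odot> V i)) \<bullet> (V (i\<^sup>\<star>) \<triangleright> ?h) \<bullet> cup (i\<^sup>\<star>)"
    using assms by (simp add: ru_def unbend_right_def lb_def bend_left_def acomp_assoc)
  also have "\<dots> = (aev (V i) \<triangleleft> (?B \<odot> V i)) \<bullet> ((?w \<triangleleft> tgt ?h) \<bullet> (src ?w \<triangleright> ?h)) \<bullet> (?w' \<triangleleft> V i) \<bullet> atcoev (V i)"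
    using assms by (simp add: cap_eq cup_eq_tcoev acomp_assoc)
  also have "\<dots> = (aev (V i) \<triangleleft> (?B \<odot> V i)) \<bullet> ((tgt ?w \<triangleright> ?h) \<bullet> (?w \<triangleleft> src ?h)) \<bullet> (?w' \<triangleleft> V i) \<bullet> atcoev (V i)"
    using assms by (subst interchange) auto
  also have "\<dots> = (aev (V i) \<triangleleft> (?B \<odot> V i)) \<bullet> (dual C (V i) \<triangleright> ?h) \<bullet> ((?w \<bullet> ?w') \<triangleleft> V i) \<bullet> atcoev (V i)"
    using assms by (simp add: acomp_assoc del: aw_inv)
  also have "\<dots> = (aev (V i) \<triangleleft> (?B \<odot> V i)) \<bullet> (dual C (V i) \<triangleright> (y \<triangleleft> V i)) \<bullet> atcoev (V i)"
    using assms by simp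
  finally have e: "ru i \<I> (lb i ?B y) = \<dots>" .
  show ?thesis unfolding e
    by (rule arrow_eqI) (use y in \<open>simp_all add: arot_def rot_def mor_simps mor_pivotal\<close>)
qed

lemma arot_arr: "\<lbrakk>i \<in> I; j \<in> I; k \<in> I; vec i j k y\<rbrakk> \<Longrightarrow> vec j k i (arot i j k y)"
  using ru_arr[of i "lb i (V j \<odot> V k) y" \<I> "V j \<odot> V k"] lb_arr[of i y \<I> "V j \<odot> V k"]
  by (simp add: arot_eq)

lemma rb_arot:
  "\<lbrakk>i \<in> I; j \<in> I; k \<in> I; vec i j k y\<rbrakk> \<Longrightarrow> rb i (V j \<odot> V k) (arot i j k y) = lb i (V j \<odot> V k) y"
  using rb_ru[of i "lb i (V j \<odot> V k) y" \<I> "V j \<odot> V k"] lb_arr[of i y \<I> "V j \<odot> V k"]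
  by (simp add: arot_eq)

lemma functional3_arot:
  assumes "i \<in> I" "j \<in> I" "k \<in> I" and y: "vec i j k y"
  shows "functional3 j k i (arot i j k y) = lb i \<I> (rb j (V i) (rb k (V i \<odot> V j) y))"
proof -
  have y1: "\<guillemotleft>rb k (V i \<odot> V j) y : V (k\<^sup>\<star>) \<rightarrow> V i \<odot> V j\<guillemotright>"
    using rb_arr[of k y \<I> "V i \<odot> V j"] assms by simp
  have "functional3 j k i (arot i j k y) = rb j \<I> (rb k (V j) (lb i (V j \<odot> V k) y))"
    using assms by (simp add: functional3_def rb_arot)
  also have "rb k (V j) (lb i (V j \<odot> V k) y) = lb i (V j) (rb k (V i \<odot> V j) y)"
    using assms by (intro lb_rb[symmetric]) auto
  also have "rb j \<I> (lb i (V j) (rb k (V i \<odot> V j) y)) = lb i \<I> (rb j (V i) (rb k (V i \<odot> V j) y))"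
    using lb_rb[of i j "rb k (V i \<odot> V j) y" "V (k\<^sup>\<star>)" \<I>] y1 assms by simp
  finally show ?thesis .
qed

lemma functional3_inj:
  assumes "i \<in> I" "j \<in> I" "k \<in> I" "vec i j k y" "vec i j k y'" "functional3 i j k y = functional3 i j k y'"
  shows "y = y'"
proof -
  have inv: "ru k \<I> (ru j (V (k\<^sup>\<star>)) (ru i (V (k\<^sup>\<star>) \<odot> V (j\<^sup>\<star>)) (functional3 i j k y))) = y" if "vec i j k y" for y
  proof -
    note 1 = rb_arr[of k y \<I> "V i \<odot> V j", simplified, OF assms(3) that]
    have 2: "\<guillemotleft>rb j (V i) (rb k (V i \<odot> V j) y) : V (k\<^sup>\<star>) \<odot> V (j\<^sup>\<star>) \<rightarrow> V i\<guillemotright>"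
      by (rule rb_arr[OF assms(2) 1])
    show ?thesis
      unfolding functional3_def using ru_rb[of i _ "V (k\<^sup>\<star>) \<odot> V (j\<^sup>\<star>)" \<I>, simplified, OF assms(1) 2]
        ru_rb[OF assms(2) 1] ru_rb[of k y \<I> "V i \<odot> V j", simplified, OF assms(3) that] by simp
  qed
  show ?thesis
    using arg_cong[OF assms(6), of "\<lambda>x. ru k \<I> (ru j (V (k\<^sup>\<star>)) (ru i (V (k\<^sup>\<star>) \<odot> V (j\<^sup>\<star>)) x))"]
    unfolding inv[OF assms(4)] inv[OF assms(5)] .
qed

text \<open>
  Three rotations move all legs from the left to the right, so the functional of the rotated vector is that
  of \<open>y\<close> with all legs bent to the left.
\<close>
lemma arot_cubed:
  assumes "i \<in> I" "j \<in> I" "k \<in> I" and y: "vec i j k y"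
  shows "arot k i j (arot j k i (arot i j k y)) = y"
proof -
  let ?y1 = "arot i j k y" and ?y2 = "arot j k i (arot i j k y)"
  note y1 = arot_arr[OF assms]
  note y2 = arot_arr[OF assms(2,3,1) y1]
  note y3 = arot_arr[OF assms(3,1,2) y2]
  have "functional3 i j k (arot k i j ?y2) = lb k \<I> (rb i (V k) (lb j (V k \<odot> V i) ?y1))"
    unfolding functional3_arot[OF assms(3,1,2) y2] rb_arot[OF assms(2,3,1) y1] ..
  also have "rb i (V k) (lb j (V k \<odot> V i) ?y1) = lb j (V k) (rb i (V j \<odot> V k) ?y1)"
    using assms y1 by (intro lb_rb[symmetric]) auto
  also have "rb i (V j \<odot> V k) ?y1 = lb i (V j \<odot> V k) y" by (rule rb_arot[OF assms])
  also have "lb k \<I> (lb j (V k) (lb i (V j \<odot> V k) y)) = functional3 i j k y"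
    by (rule functional3_left[OF assms, symmetric])
  finally show ?thesis
    by (rule functional3_inj[OF assms(1-3) y3 y])
qed

text \<open>Rotation moves the first leg to the end; bending it from there or from the front gives the same result.\<close>
lemma fuse_arot:
  assumes "i \<in> I" "j \<in> I" "k \<in> I" and y: "vec (i\<^sup>\<star>) k (j\<^sup>\<star>) y"
  shows "fuse i j k (arot (i\<^sup>\<star>) k (j\<^sup>\<star>) y) = lb (i\<^sup>\<star>) (V k) (split (i\<^sup>\<star>) k j y)"
proof -
  have "rb (i\<^sup>\<star>) (V k \<odot> V (j\<^sup>\<star>)) (arot (i\<^sup>\<star>) k (j\<^sup>\<star>) y) = lb (i\<^sup>\<star>) (V k \<odot> V (j\<^sup>\<star>)) y"
    using assms by (intro rb_arot) auto
  then show ?thesis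
    using lb_rb[of "i\<^sup>\<star>" "j\<^sup>\<star>" y \<I> "V k"] assms by (simp add: fuse_def split_def)
qed

lemma Theta_fuse_split:
  assumes ijk: "i \<in> I" "j \<in> I" "k \<in> I" and y': "vec k (j\<^sup>\<star>) (i\<^sup>\<star>) y'" and y: "vec i j (k\<^sup>\<star>) y"
  shows "Theta C I V w i j (k\<^sup>\<star>) (mor y') (mor y) = T (fuse i j k y' \<bullet> split i j k y)"
proof -
  note f = fuse_arr[OF ijk y'] and s = split_arr[OF ijk y]
  have g: "\<guillemotleft>rb k \<I> (fuse i j k y') : V i \<odot> V j \<odot> V (k\<^sup>\<star>) \<rightarrow> \<I>\<guillemotright>"
    using rb_arr[of k "fuse i j k y'" "V i \<odot> V j" \<I>] f ijk by simp
  have "Theta C I V w i j (k\<^sup>\<star>) (mor y') (mor y) = T (y \<bullet> rb k \<I> (fuse i j k y'))"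
    using Theta_eq[of i j "k\<^sup>\<star>" y' y] y y' ijk by (simp add: functional3_fuse)
  also have "\<dots> = T (split i j k y \<bullet> ru k (V i \<odot> V j) (rb k \<I> (fuse i j k y')))"
    using T_bend_right[of "k\<^sup>\<star>" "V i \<odot> V j" y \<I> "rb k \<I> (fuse i j k y')"] y g ijk projective_V2
    by (simp add: split_def)
  also have "\<dots> = T (split i j k y \<bullet> fuse i j k y')"
    using ru_rb[of k "fuse i j k y'" "V i \<odot> V j" \<I>] f ijk by simp
  also have "\<dots> = T (fuse i j k y' \<bullet> split i j k y)"
    using f s ijk projective_V projective_V2 by (intro T_cyclic) auto
  finally show ?thesis .
qed

text \<open>The evaluation of the tetrahedral graph, cut open along the edge \<open>j5\<close>.\<close>
definition tet where
  "tet j1 j2 j3 j4 j5 j6 y1 y2 y3 y4 = T (fuse j1 j6 j5 y3 \<bullet> (V j1 \<triangleright> fuse j2 j4 j6 y4) \<bullet>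
     (split j1 j2 j3 y1 \<triangleleft> V j4) \<bullet> split j3 j4 j5 y2)"

text \<open>
  \<open>z\<close> is the vector in the definition of the 6j-symbol. Each contraction of two legs is a composition once
  the legs are bent appropriately.
\<close>
lemma fuse_contraction:
  fixes j1 j2 j3 j4 j5 j6
  assumes j: "j1 \<in> I" "j2 \<in> I" "j3 \<in> I" "j4 \<in> I" "j5 \<in> I" "j6 \<in> I"
    and y1: "vec j1 j2 (j3\<^sup>\<star>) y1" and y3: "vec j5 (j6\<^sup>\<star>) (j1\<^sup>\<star>) y3" and y4: "vec j6 (j4\<^sup>\<star>) (j2\<^sup>\<star>) y4"
  defines "z \<equiv> ((V j5 \<odot> V (j4\<^sup>\<star>)) \<triangleright> (cap j2 \<triangleleft> V (j3\<^sup>\<star>))) \<bullet>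
    ((V j5 \<odot> V (j4\<^sup>\<star>) \<odot> V (j2\<^sup>\<star>)) \<triangleright> (cap j1 \<triangleleft> (V j2 \<odot> V (j3\<^sup>\<star>)))) \<bullet>
    (V j5 \<triangleright> (cap j6 \<triangleleft> (V (j4\<^sup>\<star>) \<odot> V (j2\<^sup>\<star>) \<odot> V (j1\<^sup>\<star>) \<odot> V j1 \<odot> V j2 \<odot> V (j3\<^sup>\<star>)))) \<bullet>
    ((((V j5 \<odot> V (j6\<^sup>\<star>)) \<triangleright> (y4 \<triangleleft> V (j1\<^sup>\<star>))) \<bullet> y3) \<triangleleft> (V j1 \<odot> V j2 \<odot> V (j3\<^sup>\<star>))) \<bullet> y1"
  shows "vec j5 (j4\<^sup>\<star>) (j3\<^sup>\<star>) z"
    and "fuse j3 j4 j5 z = fuse j1 j6 j5 y3 \<bullet> (V j1 \<triangleright> fuse j2 j4 j6 y4) \<bullet> (split j1 j2 j3 y1 \<triangleleft> V j4)"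
proof -
  have js: "j1\<^sup>\<star> \<in> I" "j2\<^sup>\<star> \<in> I" "j3\<^sup>\<star> \<in> I" "j4\<^sup>\<star> \<in> I" "j6\<^sup>\<star> \<in> I" using j by auto
  show z: "vec j5 (j4\<^sup>\<star>) (j3\<^sup>\<star>) z" using j y1 y3 y4 by (simp add: z_def)
  define e where "e = lb j6 (V (j4\<^sup>\<star>) \<odot> V (j2\<^sup>\<star>)) y4"
  have e: "\<guillemotleft>e : V (j6\<^sup>\<star>) \<rightarrow> V (j4\<^sup>\<star>) \<odot> V (j2\<^sup>\<star>)\<guillemotright>"
    using lb_arr[of j6 y4 \<I> "V (j4\<^sup>\<star>) \<odot> V (j2\<^sup>\<star>)"] y4 j by (simp add: e_def)
  define S where "S = rb (j1\<^sup>\<star>) (V j5 \<odot> V (j6\<^sup>\<star>)) y3"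
  have S: "\<guillemotleft>S : V j1 \<rightarrow> V j5 \<odot> V (j6\<^sup>\<star>)\<guillemotright>"
    using rb_arr[of "j1\<^sup>\<star>" y3 \<I> "V j5 \<odot> V (j6\<^sup>\<star>)"] y3 j by (simp add: S_def)
  define v where "v = (V j5 \<triangleright> (e \<triangleleft> V (j1\<^sup>\<star>))) \<bullet> y3"
  have v: "\<guillemotleft>v : \<I> \<rightarrow> V j5 \<odot> V (j4\<^sup>\<star>) \<odot> V (j2\<^sup>\<star>) \<odot> V (j1\<^sup>\<star>)\<guillemotright>" using e y3 by (simp add: v_def)
  define p where "p = rb (j2\<^sup>\<star>) (V j5 \<odot> V (j4\<^sup>\<star>)) (rb (j1\<^sup>\<star>) (V j5 \<odot> V (j4\<^sup>\<star>) \<odot> V (j2\<^sup>\<star>)) v)"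
  have p1: "rb (j1\<^sup>\<star>) (V j5 \<odot> V (j4\<^sup>\<star>) \<odot> V (j2\<^sup>\<star>)) v = (V j5 \<triangleright> e) \<bullet> S"
    using rb_post[of "j1\<^sup>\<star>" y3 \<I> "V j5 \<odot> V (j6\<^sup>\<star>)" "V j5 \<triangleright> e"] e y3 j
    by (simp add: v_def S_def)
  let ?e1 = "rb (j2\<^sup>\<star>) (V (j4\<^sup>\<star>)) e"
  have e1: "\<guillemotleft>?e1 : V (j6\<^sup>\<star>) \<odot> V j2 \<rightarrow> V (j4\<^sup>\<star>)\<guillemotright>"
    using rb_arr[OF js(2) e] j by simp
  have p2: "p = (V j5 \<triangleright> ?e1) \<bullet> (S \<triangleleft> V j2)"
    using rb_pre[of "j2\<^sup>\<star>" "V j5 \<triangleright> e" _ "V j5 \<odot> V (j4\<^sup>\<star>)" S] rb_lwhisker[OF js(2) e, of "V j5"] e S j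
    unfolding p_def p1 by simp
  let ?e2 = "rb (j4\<^sup>\<star>) \<I> ?e1"
  have e2: "\<guillemotleft>?e2 : V (j6\<^sup>\<star>) \<odot> V j2 \<odot> V j4 \<rightarrow> \<I>\<guillemotright>"
    using rb_arr[of "j4\<^sup>\<star>" ?e1 "V (j6\<^sup>\<star>) \<odot> V j2" \<I>] e1 j by simp
  have p: "\<guillemotleft>p : V j1 \<odot> V j2 \<rightarrow> V j5 \<odot> V (j4\<^sup>\<star>)\<guillemotright>" unfolding p2 using e1 S by simp
  have p3: "rb (j4\<^sup>\<star>) (V j5) p = (V j5 \<triangleright> ?e2) \<bullet> (S \<triangleleft> (V j2 \<odot> V j4))"
    using rb_pre[of "j4\<^sup>\<star>" "V j5 \<triangleright> ?e1" _ "V j5" "S \<triangleleft> V j2" "V j1 \<odot> V j2"]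
      rb_lwhisker[of "j4\<^sup>\<star>" ?e1 "V (j6\<^sup>\<star>) \<odot> V j2" \<I> "V j5"] e1 S j
    unfolding p2 by simp
  let ?g = "fuse j2 j4 j6 y4"
  have g: "\<guillemotleft>?g : V j2 \<odot> V j4 \<rightarrow> V j6\<guillemotright>" using j y4 by (intro fuse_arr) auto
  have y41: "\<guillemotleft>rb (j2\<^sup>\<star>) (V j6 \<odot> V (j4\<^sup>\<star>)) y4 : V j2 \<rightarrow> V j6 \<odot> V (j4\<^sup>\<star>)\<guillemotright>"
    using rb_arr[of "j2\<^sup>\<star>" y4 \<I> "V j6 \<odot> V (j4\<^sup>\<star>)"] y4 j by simp
  have "?e1 = lb j6 (V (j4\<^sup>\<star>)) (rb (j2\<^sup>\<star>) (V j6 \<odot> V (j4\<^sup>\<star>)) y4)"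
    unfolding e_def using j y4 by (intro lb_rb[symmetric]) auto
  then have "?e2 = lb j6 \<I> ?g"
    using lb_rb[of j6 "j4\<^sup>\<star>" _ "V j2" \<I>, OF _ _ , simplified, OF j(6) js(4) y41] by (simp add: fuse_def)
  then have p4: "rb (j4\<^sup>\<star>) (V j5) p = fuse j1 j6 j5 y3 \<bullet> (V j1 \<triangleright> ?g)"
    using rb_lb_crossing[OF j(6) S, of ?g _ \<I>] g S j p3 rb_arr[of "j6\<^sup>\<star>" S "V j1" "V j5"]
    by (simp add: fuse_def S_def)
  have zp: "z = (p \<triangleleft> V (j3\<^sup>\<star>)) \<bullet> y1"
    unfolding z_def p_def v_def e_def using j y1 y3 y4
    by (simp add: rb_def bend_right_def lb_def bend_left_def acomp_assoc)
  have s: "\<guillemotleft>split j1 j2 j3 y1 : V j3 \<rightarrow> V j1 \<odot> V j2\<guillemotright>" using j y1 by (intro split_arr) auto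
  have "rb (j3\<^sup>\<star>) (V j5 \<odot> V (j4\<^sup>\<star>)) z = p \<bullet> split j1 j2 j3 y1"
    unfolding zp split_def using rb_post[of "j3\<^sup>\<star>" y1 \<I> "V j1 \<odot> V j2" p] y1 p j by simp
  then have "fuse j3 j4 j5 z = rb (j4\<^sup>\<star>) (V j5) p \<bullet> (split j1 j2 j3 y1 \<triangleleft> V j4)"
    using rb_pre[OF js(4) p s] j by (simp add: fuse_def)
  also have "\<dots> = fuse j1 j6 j5 y3 \<bullet> (V j1 \<triangleright> fuse j2 j4 j6 y4) \<bullet> (split j1 j2 j3 y1 \<triangleleft> V j4)"
    unfolding p4 using g s fuse_arr[of j1 j6 j5 y3] j y3 by (simp add: acomp_assoc)
  finally show "fuse j3 j4 j5 z = \<dots>" .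
qed

text \<open>
  By cyclicity the fusion at \<open>y3\<close> may come first in the diagram. Then the leg \<open>j1\<close> is bent to the left: the
  fusion at \<open>y3\<close> becomes a splitting, and the splitting at \<open>y2\<close> becomes a fusion by the crossing relation.
\<close>
lemma tet_symmetric1:
  fixes j1 j2 j3 j4 j5 j6
  assumes j: "j1 \<in> I" "j2 \<in> I" "j3 \<in> I" "j4 \<in> I" "j5 \<in> I" "j6 \<in> I"
    and y1: "vec j1 j2 (j3\<^sup>\<star>) y1" and y2: "vec j3 j4 (j5\<^sup>\<star>) y2"
    and y3: "vec (j1\<^sup>\<star>) j5 (j6\<^sup>\<star>) y3" and y4: "vec j6 (j4\<^sup>\<star>) (j2\<^sup>\<star>) y4"
  shows "tet j1 j2 j3 j4 j5 j6 y1 y2 (arot (j1\<^sup>\<star>) j5 (j6\<^sup>\<star>) y3) y4 =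
    tet j2 (j3\<^sup>\<star>) (j1\<^sup>\<star>) j5 j6 j4 (arot j1 j2 (j3\<^sup>\<star>) y1) y3 y4 (arot j3 j4 (j5\<^sup>\<star>) y2)"
proof -
  have js: "j1\<^sup>\<star> \<in> I" "j2\<^sup>\<star> \<in> I" "j3\<^sup>\<star> \<in> I" "j4\<^sup>\<star> \<in> I" "j5\<^sup>\<star> \<in> I" "j6\<^sup>\<star> \<in> I" using j by auto
  let ?y1 = "arot j1 j2 (j3\<^sup>\<star>) y1" and ?y2 = "arot j3 j4 (j5\<^sup>\<star>) y2" and ?y3 = "arot (j1\<^sup>\<star>) j5 (j6\<^sup>\<star>) y3"
  have v1: "vec j2 (j3\<^sup>\<star>) j1 ?y1" using j y1 by (intro arot_arr) auto
  have v3: "vec j5 (j6\<^sup>\<star>) (j1\<^sup>\<star>) ?y3" using j y3 by (intro arot_arr) auto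
  define S1 where "S1 = split j1 j2 j3 y1"
  define S2 where "S2 = split j3 j4 j5 y2"
  define F4 where "F4 = fuse j2 j4 j6 y4"
  define F3 where "F3 = fuse j1 j6 j5 ?y3"
  define S3 where "S3 = split (j1\<^sup>\<star>) j5 j6 y3"
  define S1' where "S1' = split j2 (j3\<^sup>\<star>) (j1\<^sup>\<star>) ?y1"
  have S1: "\<guillemotleft>S1 : V j3 \<rightarrow> V j1 \<odot> V j2\<guillemotright>" unfolding S1_def by (rule split_arr[OF j(1,2,3) y1])
  have S2: "\<guillemotleft>S2 : V j5 \<rightarrow> V j3 \<odot> V j4\<guillemotright>" unfolding S2_def by (rule split_arr[OF j(3,4,5) y2])
  have F4: "\<guillemotleft>F4 : V j2 \<odot> V j4 \<rightarrow> V j6\<guillemotright>" unfolding F4_def by (rule fuse_arr[OF j(2,4,6) y4])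
  have F3: "\<guillemotleft>F3 : V j1 \<odot> V j6 \<rightarrow> V j5\<guillemotright>" unfolding F3_def by (rule fuse_arr[OF j(1,6,5) v3])
  have S3: "\<guillemotleft>S3 : V j6 \<rightarrow> V (j1\<^sup>\<star>) \<odot> V j5\<guillemotright>" unfolding S3_def by (rule split_arr[OF js(1) j(5,6) y3])
  have S1': "\<guillemotleft>S1' : V (j1\<^sup>\<star>) \<rightarrow> V j2 \<odot> V (j3\<^sup>\<star>)\<guillemotright>"
    unfolding S1'_def using v1 j js by (intro split_arr) auto
  let ?f = "(V j1 \<triangleright> F4) \<bullet> ((S1 \<triangleleft> V j4) \<bullet> S2)"
  have f: "\<guillemotleft>?f : V j5 \<rightarrow> V j1 \<odot> V j6\<guillemotright>" using S1 S2 F4 by simp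
  have F3_eq: "F3 = lb (j1\<^sup>\<star>) (V j5) S3"
    unfolding F3_def S3_def by (rule fuse_arot[OF j(1,6,5) y3])
  have lu3: "lu (j1\<^sup>\<star>) (V j6) F3 = S3"
    unfolding F3_eq by (rule lu_lb[OF js(1) S3])
  have l1: "lb j1 (V j2) S1 = rb (j3\<^sup>\<star>) (V j2) S1'"
    using lb_rb[of j1 "j3\<^sup>\<star>" y1 \<I> "V j2"] rb_arot[of j1 j2 "j3\<^sup>\<star>" y1] j js y1
    by (simp add: S1_def S1'_def split_def)
  have l1_arr: "\<guillemotleft>lb j1 (V j2) S1 : V (j1\<^sup>\<star>) \<odot> V j3 \<rightarrow> V j2\<guillemotright>" by (rule lb_arr[OF j(1) S1])
  have "lb j1 (V j2 \<odot> V j4) (S1 \<triangleleft> V j4) = lb j1 (V j2) S1 \<triangleleft> V j4"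
    unfolding lb_def by (rule bend_left_rwhisker[OF duality_cap[OF j(1)] S1])
  then have l2: "lb j1 (V j2 \<odot> V j4) ((S1 \<triangleleft> V j4) \<bullet> S2) = (lb j1 (V j2) S1 \<triangleleft> V j4) \<bullet> (V (j1\<^sup>\<star>) \<triangleright> S2)"
    using lb_pre[of j1 "S1 \<triangleleft> V j4" "V j3 \<odot> V j4" "V j2 \<odot> V j4" S2 "V j5"] S1 S2 j by simp
  have l3: "lb j3 (V j4) S2 = fuse (j3\<^sup>\<star>) j5 j4 ?y2"
    using fuse_arot[of "j3\<^sup>\<star>" j5 j4 y2] j js y2 by (simp add: S2_def)
  have "lb j1 (V j6) ?f = F4 \<bullet> lb j1 (V j2 \<odot> V j4) ((S1 \<triangleleft> V j4) \<bullet> S2)"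
    using S1 S2 F4 j by (intro lb_post) auto
  also have "\<dots> = F4 \<bullet> (V j2 \<triangleright> lb j3 (V j4) S2) \<bullet> (S1' \<triangleleft> V j5)"
    unfolding l2 l1 using rb_lb_crossing[OF j(3) S1' S2] by simp
  finally have lf: "lb j1 (V j6) ?f = F4 \<bullet> (V j2 \<triangleright> fuse (j3\<^sup>\<star>) j5 j4 ?y2) \<bullet> (S1' \<triangleleft> V j5)"
    unfolding l3 .
  have "tet j1 j2 j3 j4 j5 j6 y1 y2 ?y3 y4 = T (F3 \<bullet> ?f)"
    by (simp add: tet_def S1_def S2_def F4_def F3_def)
  also have "\<dots> = T (?f \<bullet> F3)"
    using f F3 j projective_V projective_V2 by (intro T_cyclic) auto
  also have "\<dots> = T (lb j1 (V j6) ?f \<bullet> S3)"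
    unfolding lu3[symmetric] by (rule T_bend_left[OF j(1) projective_V[OF j(6)] f F3])
  also have "\<dots> = tet j2 (j3\<^sup>\<star>) (j1\<^sup>\<star>) j5 j6 j4 ?y1 y3 y4 ?y2"
    unfolding lf using S1' S3 F4 lb_arr[OF j(3) S2]
    by (simp add: tet_def F4_def S1'_def S3_def l3 acomp_assoc)
  finally show ?thesis .
qed

text \<open>
  By cyclicity the fusion at \<open>y3\<close> comes first, as for the other symmetry. Now the leg \<open>j6\<close> is bent to the
  right, and the crossing relation is applied to the edge \<open>j2\<close>.
\<close>
lemma tet_symmetric2:
  fixes j1 j2 j3 j4 j5 j6
  assumes j: "j1 \<in> I" "j2 \<in> I" "j3 \<in> I" "j4 \<in> I" "j5 \<in> I" "j6 \<in> I"
    and y1: "vec j1 j2 (j3\<^sup>\<star>) y1" and y2: "vec j3 j4 (j5\<^sup>\<star>) y2"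
    and y3: "vec j5 (j6\<^sup>\<star>) (j1\<^sup>\<star>) y3" and y4: "vec (j2\<^sup>\<star>) j6 (j4\<^sup>\<star>) y4"
  shows "tet j1 j2 j3 j4 j5 j6 y1 y2 y3 (arot (j2\<^sup>\<star>) j6 (j4\<^sup>\<star>) y4) =
    tet j3 j4 j5 (j6\<^sup>\<star>) j1 (j2\<^sup>\<star>) y2 y3 y1 y4"
proof -
  have js: "j1\<^sup>\<star> \<in> I" "j2\<^sup>\<star> \<in> I" "j3\<^sup>\<star> \<in> I" "j4\<^sup>\<star> \<in> I" "j5\<^sup>\<star> \<in> I" "j6\<^sup>\<star> \<in> I" using j by auto
  let ?y4 = "arot (j2\<^sup>\<star>) j6 (j4\<^sup>\<star>) y4"
  have v4: "vec j6 (j4\<^sup>\<star>) (j2\<^sup>\<star>) ?y4" using j y4 by (intro arot_arr) auto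
  define S1 where "S1 = split j1 j2 j3 y1"
  define S2 where "S2 = split j3 j4 j5 y2"
  define F4 where "F4 = fuse j2 j4 j6 ?y4"
  define F3 where "F3 = fuse j1 j6 j5 y3"
  define S3 where "S3 = split j5 (j6\<^sup>\<star>) j1 y3"
  define G where "G = fuse j4 (j6\<^sup>\<star>) (j2\<^sup>\<star>) y4"
  have S1: "\<guillemotleft>S1 : V j3 \<rightarrow> V j1 \<odot> V ((j2\<^sup>\<star>)\<^sup>\<star>)\<guillemotright>"
    unfolding S1_def using split_arr[OF j(1,2,3) y1] j by simp
  have S2: "\<guillemotleft>S2 : V j5 \<rightarrow> V j3 \<odot> V j4\<guillemotright>" unfolding S2_def by (rule split_arr[OF j(3,4,5) y2])
  have F4: "\<guillemotleft>F4 : V j2 \<odot> V j4 \<rightarrow> V j6\<guillemotright>" unfolding F4_def by (rule fuse_arr[OF j(2,4,6) v4])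
  have F3: "\<guillemotleft>F3 : V j1 \<odot> V j6 \<rightarrow> V j5\<guillemotright>" unfolding F3_def by (rule fuse_arr[OF j(1,6,5) y3])
  have S3: "\<guillemotleft>S3 : V j1 \<rightarrow> V j5 \<odot> V (j6\<^sup>\<star>)\<guillemotright>" unfolding S3_def by (rule split_arr[OF j(5) js(6) j(1) y3])
  have G: "\<guillemotleft>G : V j4 \<odot> V (j6\<^sup>\<star>) \<rightarrow> V (j2\<^sup>\<star>) \<odot> \<I>\<guillemotright>"
    unfolding G_def using fuse_arr[of j4 "j6\<^sup>\<star>" "j2\<^sup>\<star>" y4] j js y4 by simp
  have ru3: "ru (j6\<^sup>\<star>) (V j1) F3 = S3"
    unfolding F3_def S3_def fuse_def split_def
    by (rule ru_rb[OF js(6)]) (use S3 in \<open>simp add: S3_def split_def\<close>)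
  have r4: "rb j6 \<I> F4 = lb (j2\<^sup>\<star>) \<I> G"
    using functional3_arot[of "j2\<^sup>\<star>" j6 "j4\<^sup>\<star>" y4] functional3_fuse[of j2 j4 j6 ?y4] j js y4
    by (simp add: F4_def G_def fuse_def)
  have r4_arr: "\<guillemotleft>rb j6 \<I> F4 : V j2 \<odot> V j4 \<odot> V (j6\<^sup>\<star>) \<rightarrow> \<I>\<guillemotright>"
    using rb_arr[of j6 F4 "V j2 \<odot> V j4" \<I>] F4 j by simp
  have r1: "rb j2 (V j1) S1 = fuse j3 (j2\<^sup>\<star>) j1 y1"
    using j by (simp add: S1_def split_def fuse_def)
  let ?f = "((V j1 \<triangleright> F4) \<bullet> (S1 \<triangleleft> V j4)) \<bullet> S2"
  have f: "\<guillemotleft>?f : V j5 \<rightarrow> V j1 \<odot> V j6\<guillemotright>" using S1 S2 F4 j by simp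
  have "rb j6 (V j1) ?f = rb j6 (V j1) ((V j1 \<triangleright> F4) \<bullet> (S1 \<triangleleft> V j4)) \<bullet> (S2 \<triangleleft> V (j6\<^sup>\<star>))"
    using S1 S2 F4 j by (intro rb_pre) auto
  also have "rb j6 (V j1) ((V j1 \<triangleright> F4) \<bullet> (S1 \<triangleleft> V j4)) = rb j6 (V j1) (V j1 \<triangleright> F4) \<bullet> ((S1 \<triangleleft> V j4) \<triangleleft> V (j6\<^sup>\<star>))"
    using S1 F4 j by (intro rb_pre) auto
  also have "rb j6 (V j1) (V j1 \<triangleright> F4) = V j1 \<triangleright> lb (j2\<^sup>\<star>) \<I> G"
    using rb_lwhisker[of j6 F4 "V j2 \<odot> V j4" \<I> "V j1"] F4 j by (simp add: r4)
  also have "(V j1 \<triangleright> lb (j2\<^sup>\<star>) \<I> G) \<bullet> ((S1 \<triangleleft> V j4) \<triangleleft> V (j6\<^sup>\<star>)) = rb j2 (V j1) S1 \<bullet> (V j3 \<triangleright> G)"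
    using rb_lb_crossing[OF js(2) S1 G] S1 j rb_arr[of j2 S1 "V j3" "V j1"] by simp
  finally have rf: "rb j6 (V j1) ?f = (fuse j3 (j2\<^sup>\<star>) j1 y1 \<bullet> (V j3 \<triangleright> G)) \<bullet> (S2 \<triangleleft> V (j6\<^sup>\<star>))"
    unfolding r1 .
  have "tet j1 j2 j3 j4 j5 j6 y1 y2 y3 ?y4 = T (F3 \<bullet> ?f)"
    using S1 S2 F4 j by (simp add: tet_def S1_def S2_def F4_def F3_def acomp_assoc)
  also have "\<dots> = T (?f \<bullet> F3)"
    using f F3 j projective_V projective_V2 by (intro T_cyclic) auto
  also have "\<dots> = T (rb j6 (V j1) ?f \<bullet> S3)"
    unfolding ru3[symmetric] by (rule T_bend_right[OF j(6) projective_V[OF j(1)] f F3])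
  also have "\<dots> = tet j3 j4 j5 (j6\<^sup>\<star>) j1 (j2\<^sup>\<star>) y2 y3 y1 y4"
    unfolding rf using S2 S3 G fuse_arr[of j3 "j2\<^sup>\<star>" j1 y1] y1 j js
    by (simp add: tet_def G_def S2_def S3_def acomp_assoc)
  finally show ?thesis .
qed

text \<open>
  In the left-hand diagram the edge \<open>j2\<close> runs from a splitting on the right to a fusion on the left. The
  crossing relation replaces these by a splitting on the left and a fusion on the right.
\<close>
lemma tet_upside_down:
  fixes j1 j2 j3 j4 j5 j6
  assumes j: "j1 \<in> I" "j2 \<in> I" "j3 \<in> I" "j4 \<in> I" "j5 \<in> I" "j6 \<in> I"
    and y1: "vec j3 (j2\<^sup>\<star>) (j1\<^sup>\<star>) y1" and y2: "vec j5 (j4\<^sup>\<star>) (j3\<^sup>\<star>) y2"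
    and y3: "vec j1 j6 (j5\<^sup>\<star>) y3" and y4: "vec j2 j4 (j6\<^sup>\<star>) y4"
  shows "T (fuse j3 j4 j5 y2 \<bullet> (fuse j1 j2 j3 y1 \<triangleleft> V j4) \<bullet> (V j1 \<triangleright> split j2 j4 j6 y4) \<bullet> split j1 j6 j5 y3) =
    tet j3 (j2\<^sup>\<star>) j1 j6 j5 j4 y1 y3 y2 (arot j2 j4 (j6\<^sup>\<star>) y4)"
proof -
  have js: "j2\<^sup>\<star> \<in> I" using j by auto
  let ?f = "split j3 (j2\<^sup>\<star>) j1 y1" and ?g = "split j2 j4 j6 y4"
  have f: "\<guillemotleft>?f : V j1 \<rightarrow> V j3 \<odot> V (j2\<^sup>\<star>)\<guillemotright>" by (rule split_arr[OF j(3) js j(1) y1])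
  have g: "\<guillemotleft>?g : V j6 \<rightarrow> V j2 \<odot> V j4\<guillemotright>" by (rule split_arr[OF j(2,4,6) y4])
  have l: "fuse (j2\<^sup>\<star>) j6 j4 (arot j2 j4 (j6\<^sup>\<star>) y4) = lb j2 (V j4) ?g"
    using fuse_arot[of "j2\<^sup>\<star>" j6 j4 y4] j js y4 by simp
  have r: "rb (j2\<^sup>\<star>) (V j3) ?f = fuse j1 j2 j3 y1" by (simp add: split_def fuse_def)
  have c: "(V j3 \<triangleright> lb j2 (V j4) ?g) \<bullet> (?f \<triangleleft> V j6) = (fuse j1 j2 j3 y1 \<triangleleft> V j4) \<bullet> (V j1 \<triangleright> ?g)"
    using rb_lb_crossing[OF j(2) f g] unfolding r .
  have s: "\<guillemotleft>split j1 j6 j5 y3 : V j5 \<rightarrow> V j1 \<odot> V j6\<guillemotright>" by (rule split_arr[OF j(1,6,5) y3])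
  have "((V j3 \<triangleright> lb j2 (V j4) ?g) \<bullet> (?f \<triangleleft> V j6)) \<bullet> split j1 j6 j5 y3 =
    ((fuse j1 j2 j3 y1 \<triangleleft> V j4) \<bullet> (V j1 \<triangleright> ?g)) \<bullet> split j1 j6 j5 y3" unfolding c ..
  then show ?thesis
    unfolding tet_def l using f g s lb_arr[OF j(2) g] fuse_arr[OF j(1,2,3) y1] by (simp add: acomp_assoc)
qed

end

section \<open>Multiplicity spaces and their bases\<close>

lemma (in vector_space) semilinear_span:
  assumes S: "subspace S" "B \<subseteq> S"
    and add: "\<And>x y. \<lbrakk>x \<in> S; y \<in> S\<rbrakk> \<Longrightarrow> \<phi> (x + y) = \<phi> x + \<phi> y"
    and scale: "\<And>c x. x \<in> S \<Longrightarrow> \<phi> (c *s x) = \<sigma> c *s \<phi> x"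
    and x: "x \<in> span B"
  shows "\<phi> x \<in> span (\<phi> ` B)"
proof -
  have z: "\<phi> 0 = 0" using add[of 0 0] S(1) by (simp add: subspace_0)
  have "x \<in> S \<and> \<phi> x \<in> span (\<phi> ` B)"
    using x
  proof (induction rule: span_induct_alt)
    case base
    then show ?case using S(1) by (simp add: z subspace_0 span_zero)
  next
    case (step c x y)
    then have "x \<in> S" using S(2) by blast
    moreover have "c *s x \<in> S" by (rule subspace_scale[OF S(1) \<open>x \<in> S\<close>])
    ultimately show ?case
      using step S(1) by (simp add: add scale subspace_add span_add span_scale span_base)
  qed
  then show ?thesis ..
qed

text \<open>
  This is applied to bends, with \<open>\<sigma>\<close> the identity, and to the dagger, with \<open>\<sigma>\<close> the involution of the field.
\<close>
lemma (in vector_space) semilinear_dim: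
  assumes S: "subspace S" and bij: "bij_betw \<phi> S T"
    and add: "\<And>x y. \<lbrakk>x \<in> S; y \<in> S\<rbrakk> \<Longrightarrow> \<phi> (x + y) = \<phi> x + \<phi> y"
    and scale: "\<And>c x. x \<in> S \<Longrightarrow> \<phi> (c *s x) = \<sigma> c *s \<phi> x"
    and inv: "\<And>c. \<sigma> (\<sigma> c) = c"
  shows "dim T = dim S"
proof -
  define \<psi> where "\<psi> = inv_into S \<phi>"
  have \<psi>: "\<psi> y \<in> S" "\<phi> (\<psi> y) = y" if "y \<in> T" for y
    using that bij unfolding \<psi>_def bij_betw_def by (auto intro: inv_into_into f_inv_into_f)
  have \<phi>: "\<phi> x \<in> T" "\<psi> (\<phi> x) = x" if "x \<in> S" for x
    using that bij unfolding \<psi>_def bij_betw_def by (auto intro: inv_into_f_f)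
  have add': "y + y' \<in> T" "\<psi> (y + y') = \<psi> y + \<psi> y'" if "y \<in> T" "y' \<in> T" for y y'
  proof -
    have "\<phi> (\<psi> y + \<psi> y') = y + y'" using add[of "\<psi> y" "\<psi> y'"] \<psi> that by simp
    moreover have "\<psi> y + \<psi> y' \<in> S" using \<psi> that by (intro subspace_add[OF S]) auto
    ultimately show "y + y' \<in> T" "\<psi> (y + y') = \<psi> y + \<psi> y'" using \<phi> by metis+
  qed
  have scale': "c *s y \<in> T" "\<psi> (c *s y) = \<sigma> c *s \<psi> y" if "y \<in> T" for y c
  proof -
    have "\<phi> (\<sigma> c *s \<psi> y) = c *s y" using scale[of "\<psi> y" "\<sigma> c"] \<psi> that by (simp add: inv)
    moreover have "\<sigma> c *s \<psi> y \<in> S" using \<psi> that by (intro subspace_scale[OF S]) auto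
    ultimately show "c *s y \<in> T" "\<psi> (c *s y) = \<sigma> c *s \<psi> y" using \<phi> by metis+
  qed
  have "\<phi> 0 = 0" using add[of 0 0] subspace_0[OF S] by simp
  then have T: "subspace T"
    using add' scale' \<phi>(1)[OF subspace_0[OF S]] by (auto intro: subspaceI)
  obtain B where B: "B \<subseteq> S" "independent B" "S \<subseteq> span B" "card B = dim S"
    using basis_exists[of S] by blast
  have inj: "inj_on \<phi> B" using bij B(1) unfolding bij_betw_def by (auto intro: inj_on_subset)
  have sub: "\<phi> ` B \<subseteq> T" using B(1) \<phi>(1) by blast
  have "T \<subseteq> span (\<phi> ` B)"
  proof
    fix y assume y: "y \<in> T"
    have "\<psi> y \<in> span B" using \<psi>[OF y] B(3) by blast
    from semilinear_span[OF S B(1) add scale this] show "y \<in> span (\<phi> ` B)" using \<psi>[OF y] by simp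
  qed
  moreover have "independent (\<phi> ` B)"
  proof
    assume "dependent (\<phi> ` B)"
    then obtain b where b: "b \<in> B" "\<phi> b \<in> span (\<phi> ` B - {\<phi> b})"
      unfolding dependent_def by blast
    have e: "\<phi> ` B - {\<phi> b} = \<phi> ` (B - {b})" using inj b(1) by (auto dest: inj_onD)
    have "\<psi> (\<phi> b) \<in> span (\<psi> ` \<phi> ` (B - {b}))"
      using b(2) sub unfolding e
      by (intro semilinear_span[OF T _ add'(2) scale'(2)]) auto
    also have "\<psi> ` \<phi> ` (B - {b}) = B - {b}"
      using \<phi>(2) B(1) by force
    finally have "b \<in> span (B - {b})" using \<phi>(2) B(1) b(1) by auto
    then show False using B(2) b(1) unfolding dependent_def by blast
  qed
  ultimately show ?thesis
    using basis_card_eq_dim[OF sub] B(4) card_image[OF inj] by simp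
qed

context tensor_category
begin

text \<open>A diagram with a hole for a morphism \<open>A \<rightarrow> B\<close> is linear in that morphism.\<close>
lemma frame_linear:
  assumes F: "\<guillemotleft>F : D \<rightarrow> P \<odot> A \<odot> Q\<guillemotright>" and G: "\<guillemotleft>G : P \<odot> B \<odot> Q \<rightarrow> E\<guillemotright>"
    and f: "f \<in> Hom C A B"
  shows frame_in: "mor (G \<bullet> (P \<triangleright> (Arrow A f B \<triangleleft> Q)) \<bullet> F) \<in> Hom C D E"
    and frame_add: "g \<in> Hom C A B \<Longrightarrow> mor (G \<bullet> (P \<triangleright> (Arrow A (f + g) B \<triangleleft> Q)) \<bullet> F) =
      mor (G \<bullet> (P \<triangleright> (Arrow A f B \<triangleleft> Q)) \<bullet> F) + mor (G \<bullet> (P \<triangleright> (Arrow A g B \<triangleleft> Q)) \<bullet> F)"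
    and frame_scale: "mor (G \<bullet> (P \<triangleright> (Arrow A (smult C c f) B \<triangleleft> Q)) \<bullet> F) =
      smult C c (mor (G \<bullet> (P \<triangleright> (Arrow A f B \<triangleleft> Q)) \<bullet> F))"
proof -
  have 1: "Id C P \<otimes> (f \<otimes> Id C Q) \<in> Hom C (P \<odot> A \<odot> Q) (P \<odot> B \<odot> Q)" if "f \<in> Hom C A B" for f
    using that by (intro tensor_in Id_in)
  note F' = mor_in[OF F] and G' = mor_in[OF G]
  show "mor (G \<bullet> (P \<triangleright> (Arrow A f B \<triangleleft> Q)) \<bullet> F) \<in> Hom C D E"
    using comp_in[OF G' comp_in[OF 1[OF f] F']] by (simp add: mor_simps)
  show "mor (G \<bullet> (P \<triangleright> (Arrow A (f + g) B \<triangleleft> Q)) \<bullet> F) =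
      mor (G \<bullet> (P \<triangleright> (Arrow A f B \<triangleleft> Q)) \<bullet> F) + mor (G \<bullet> (P \<triangleright> (Arrow A g B \<triangleleft> Q)) \<bullet> F)"
    if g: "g \<in> Hom C A B"
    using comp_add_right[OF G' comp_in[OF 1[OF f] F'] comp_in[OF 1[OF g] F']]
      comp_add_left[OF 1[OF f] 1[OF g] F'] tensor_add_left[OF f g Id_in[of Q]]
      tensor_add_right[OF Id_in[of P] tensor_in[OF f Id_in] tensor_in[OF g Id_in]] by (simp add: mor_simps)
  show "mor (G \<bullet> (P \<triangleright> (Arrow A (smult C c f) B \<triangleleft> Q)) \<bullet> F) =
      smult C c (mor (G \<bullet> (P \<triangleright> (Arrow A f B \<triangleleft> Q)) \<bullet> F))"
    using comp_smult_right[OF G' comp_in[OF 1[OF f] F']]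
      comp_smult_left[OF 1[OF f] F'] tensor_smult_left[OF f Id_in[of Q]]
      tensor_smult_right[OF Id_in[of P] tensor_in[OF f Id_in]] by (simp add: mor_simps)
qed

text \<open>\<open>\<psi>\<close> recovers the morphism that fills the hole of the diagram.\<close>
lemma frame_dim:
  assumes F: "\<guillemotleft>F : D \<rightarrow> P \<odot> A \<odot> Q\<guillemotright>" and G: "\<guillemotleft>G : P \<odot> B \<odot> Q \<rightarrow> E\<guillemotright>"
    and inv: "\<And>f. \<guillemotleft>f : A \<rightarrow> B\<guillemotright> \<Longrightarrow> \<psi> (G \<bullet> (P \<triangleright> (f \<triangleleft> Q)) \<bullet> F) = f"
    and inv': "\<And>g. \<guillemotleft>g : D \<rightarrow> E\<guillemotright> \<Longrightarrow> \<guillemotleft>\<psi> g : A \<rightarrow> B\<guillemotright> \<and> G \<bullet> (P \<triangleright> (\<psi> g \<triangleleft> Q)) \<bullet> F = g"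
  shows "hom_dim C D E = hom_dim C A B"
proof -
  let ?\<phi> = "\<lambda>m. mor (G \<bullet> (P \<triangleright> (Arrow A m B \<triangleleft> Q)) \<bullet> F)"
  have "bij_betw ?\<phi> (Hom C A B) (Hom C D E)"
  proof (rule bij_betw_byWitness[where f' = "\<lambda>m. mor (\<psi> (Arrow D m E))"])
    show "\<forall>m\<in>Hom C A B. mor (\<psi> (Arrow D (?\<phi> m) E)) = m"
    proof
      fix m assume m: "m \<in> Hom C A B"
      have "Arrow D (?\<phi> m) E = G \<bullet> (P \<triangleright> (Arrow A m B \<triangleleft> Q)) \<bullet> F"
        using F G by (intro arrow_eqI) auto
      then show "mor (\<psi> (Arrow D (?\<phi> m) E)) = m" using inv[of "Arrow A m B"] m by simp
    qed
    show "\<forall>m\<in>Hom C D E. ?\<phi> (mor (\<psi> (Arrow D m E))) = m"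
    proof
      fix m assume m: "m \<in> Hom C D E"
      note i = inv'[of "Arrow D m E", simplified, OF m]
      have "Arrow A (mor (\<psi> (Arrow D m E))) B = \<psi> (Arrow D m E)"
        using i by (intro arrow_eqI) auto
      then show "?\<phi> (mor (\<psi> (Arrow D m E))) = m" using i by simp
    qed
    show "?\<phi> ` Hom C A B \<subseteq> Hom C D E" using frame_in[OF F G] by blast
    show "(\<lambda>m. mor (\<psi> (Arrow D m E))) ` Hom C D E \<subseteq> Hom C A B"
      using inv'[of "Arrow D _ E"] by (auto intro!: mor_in)
  qed
  then show ?thesis
    unfolding hom_dim_def
    by (rule vs.semilinear_dim[where \<sigma> = "\<lambda>c. c", OF Hom_subspace])
      (simp_all add: frame_add[OF F G] frame_scale[OF F G])
qed

end

lemma (in relative_spherical_category) functional_T: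
  assumes D: "projective C D" and F: "\<guillemotleft>F : D \<rightarrow> P \<odot> A \<odot> Q\<guillemotright>" and G: "\<guillemotleft>G : P \<odot> B \<odot> Q \<rightarrow> D\<guillemotright>"
  shows "functional A B (\<lambda>m. T (G \<bullet> (P \<triangleright> (Arrow A m B \<triangleleft> Q)) \<bullet> F))"
  unfolding functional_def T_def
proof (intro ballI allI)
  fix f g c assume f: "f \<in> Hom C A B" and g: "g \<in> Hom C A B"
  show "tr C (src (G \<bullet> (P \<triangleright> (Arrow A (f + g) B \<triangleleft> Q)) \<bullet> F)) (mor (G \<bullet> (P \<triangleright> (Arrow A (f + g) B \<triangleleft> Q)) \<bullet> F)) =
      tr C (src (G \<bullet> (P \<triangleright> (Arrow A f B \<triangleleft> Q)) \<bullet> F)) (mor (G \<bullet> (P \<triangleright> (Arrow A f B \<triangleleft> Q)) \<bullet> F)) +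
      tr C (src (G \<bullet> (P \<triangleright> (Arrow A g B \<triangleleft> Q)) \<bullet> F)) (mor (G \<bullet> (P \<triangleright> (Arrow A g B \<triangleleft> Q)) \<bullet> F)) \<and>
    tr C (src (G \<bullet> (P \<triangleright> (Arrow A (smult C c f) B \<triangleleft> Q)) \<bullet> F)) (mor (G \<bullet> (P \<triangleright> (Arrow A (smult C c f) B \<triangleleft> Q)) \<bullet> F)) =
      c * tr C (src (G \<bullet> (P \<triangleright> (Arrow A f B \<triangleleft> Q)) \<bullet> F)) (mor (G \<bullet> (P \<triangleright> (Arrow A f B \<triangleleft> Q)) \<bullet> F))"
    unfolding frame_add[OF F G f g] frame_scale[OF F G f]
    using tr_linear[OF D frame_in[OF F G f] frame_in[OF F G g]] F by simp
qed

lemma (in hermitian_pivotal_category) dim_dag: "hom_dim C B A = hom_dim C A B"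
  unfolding hom_dim_def
  by (rule vs.semilinear_dim[where \<sigma> = bar, OF Hom_subspace dag_bij])
    (simp_all add: dag_add dag_smult bar_bar)

context based_category
begin

lemma dim_rb:
  assumes j: "j \<in> I"
  shows "hom_dim C (A \<odot> V (j\<^sup>\<star>)) B = hom_dim C A (B \<odot> V j)"
proof (rule frame_dim[where P = \<I> and Q = "V (j\<^sup>\<star>)" and F = "one (A \<odot> V (j\<^sup>\<star>))"
      and G = "B \<triangleright> cap (j\<^sup>\<star>)" and \<psi> = "ru j A"])
  have e: "(B \<triangleright> cap (j\<^sup>\<star>)) \<bullet> (\<I> \<triangleright> (f \<triangleleft> V (j\<^sup>\<star>))) \<bullet> one (A \<odot> V (j\<^sup>\<star>)) = rb j B f"
    if "\<guillemotleft>f : A \<rightarrow> B \<odot> V j\<guillemotright>" for f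
    using that by (simp add: rb_def bend_right_def)
  show "ru j A ((B \<triangleright> cap (j\<^sup>\<star>)) \<bullet> (\<I> \<triangleright> (f \<triangleleft> V (j\<^sup>\<star>))) \<bullet> one (A \<odot> V (j\<^sup>\<star>))) = f"
    if "\<guillemotleft>f : A \<rightarrow> B \<odot> V j\<guillemotright>" for f
    unfolding e[OF that] by (rule ru_rb[OF j that])
  show "\<guillemotleft>ru j A g : A \<rightarrow> B \<odot> V j\<guillemotright> \<and>
      (B \<triangleright> cap (j\<^sup>\<star>)) \<bullet> (\<I> \<triangleright> (ru j A g \<triangleleft> V (j\<^sup>\<star>))) \<bullet> one (A \<odot> V (j\<^sup>\<star>)) = g"
    if g: "\<guillemotleft>g : A \<odot> V (j\<^sup>\<star>) \<rightarrow> B\<guillemotright>" for g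
    unfolding e[OF ru_arr[OF j g]] rb_ru[OF j g] using ru_arr[OF j g] by simp
qed (use j in simp_all)

lemma dim_lb:
  assumes j: "j \<in> I"
  shows "hom_dim C (V (j\<^sup>\<star>) \<odot> A) B = hom_dim C A (V j \<odot> B)"
proof (rule frame_dim[where Q = \<I> and P = "V (j\<^sup>\<star>)" and F = "one (V (j\<^sup>\<star>) \<odot> A)"
      and G = "cap j \<triangleleft> B" and \<psi> = "lu j A"])
  have e: "(cap j \<triangleleft> B) \<bullet> (V (j\<^sup>\<star>) \<triangleright> (f \<triangleleft> \<I>)) \<bullet> one (V (j\<^sup>\<star>) \<odot> A) = lb j B f"
    if "\<guillemotleft>f : A \<rightarrow> V j \<odot> B\<guillemotright>" for f
    using that by (simp add: lb_def bend_left_def)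
  show "lu j A ((cap j \<triangleleft> B) \<bullet> (V (j\<^sup>\<star>) \<triangleright> (f \<triangleleft> \<I>)) \<bullet> one (V (j\<^sup>\<star>) \<odot> A)) = f"
    if "\<guillemotleft>f : A \<rightarrow> V j \<odot> B\<guillemotright>" for f
    unfolding e[OF that] by (rule lu_lb[OF j that])
  show "\<guillemotleft>lu j A g : A \<rightarrow> V j \<odot> B\<guillemotright> \<and>
      (cap j \<triangleleft> B) \<bullet> (V (j\<^sup>\<star>) \<triangleright> (lu j A g \<triangleleft> \<I>)) \<bullet> one (V (j\<^sup>\<star>) \<odot> A) = g"
    if g: "\<guillemotleft>g : V (j\<^sup>\<star>) \<odot> A \<rightarrow> B\<guillemotright>" for g
    unfolding e[OF lu_arr[OF j g]] lb_lu[OF j g] using lu_arr[OF j g] by simp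
qed (use j in simp_all)

abbreviation \<delta> :: "'i \<Rightarrow> 'i \<Rightarrow> 'i \<Rightarrow> nat" where
  "\<delta> \<equiv> mult_dim C V"

lemma mult_dim_hom_dim: "\<delta> i j k = hom_dim C \<I> (V i \<odot> V j \<odot> V k)"
  by (simp add: mult_dim_def mult_space_def hom_dim_def)

lemma mult_dim_rot: "\<lbrakk>i \<in> I; j \<in> I; k \<in> I\<rbrakk> \<Longrightarrow> \<delta> i j k = \<delta> j k i"
  using dim_lb[of i \<I> "V j \<odot> V k"] dim_rb[of i \<I> "V j \<odot> V k"]
  by (simp add: mult_dim_hom_dim)

lemma mult_dim_split: "\<lbrakk>i \<in> I; j \<in> I; k \<in> I\<rbrakk> \<Longrightarrow> \<delta> (k\<^sup>\<star>) i j = hom_dim C (V k) (V i \<odot> V j)"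
  using dim_lb[of "k\<^sup>\<star>" \<I> "V i \<odot> V j"] by (simp add: mult_dim_hom_dim)

lemma mult_dim_star:
  assumes "i \<in> I" "j \<in> I" "k \<in> I"
  shows "\<delta> i j k = \<delta> (k\<^sup>\<star>) (j\<^sup>\<star>) (i\<^sup>\<star>)"
proof -
  have "\<delta> (k\<^sup>\<star>) (j\<^sup>\<star>) (i\<^sup>\<star>) = hom_dim C (V i \<odot> V j \<odot> V k) \<I>"
    using dim_rb[of "i\<^sup>\<star>" \<I> "V (k\<^sup>\<star>) \<odot> V (j\<^sup>\<star>)"] dim_rb[of "j\<^sup>\<star>" "V i" "V (k\<^sup>\<star>)"]
      dim_rb[of "k\<^sup>\<star>" "V i \<odot> V j" \<I>] assms by (simp add: mult_dim_hom_dim)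
  then show ?thesis using dim_dag[of "V i \<odot> V j \<odot> V k" \<I>] by (simp add: mult_dim_hom_dim)
qed

lemma label_degree_finite: "finite {i \<in> I. V i \<in> Deg C g}" if g: "g \<notin> Sing C"
proof -
  obtain R where R: "finite R" "irr_representatives C g R" using generic_finite[OF g] by blast
  define r where "r i = (THE S. S \<in> R \<and> isomorphic C (V i) S)" for i
  have r: "r i \<in> R \<and> isomorphic C (V i) (r i)" if "i \<in> {i \<in> I. V i \<in> Deg C g}" for i
  proof -
    have "\<exists>!S. S \<in> R \<and> isomorphic C (V i) S"
      using R(2) that simple_V unfolding irr_representatives_def by blast
    then show ?thesis unfolding r_def by (rule theI')
  qed
  have "inj_on r {i \<in> I. V i \<in> Deg C g}"
  proof (rule inj_onI)
    fix i j assume i: "i \<in> {i \<in> I. V i \<in> Deg C g}" and j: "j \<in> {i \<in> I. V i \<in> Deg C g}" and e: "r i = r j"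
    have "isomorphic C (V i) (V j)"
      using r[OF i] r[OF j] e isomorphic_trans isomorphic_sym by metis
    then show "i = j" using i j V_inj by blast
  qed
  moreover have "r ` {i \<in> I. V i \<in> Deg C g} \<subseteq> R" using r by blast
  ultimately show ?thesis using R(1) by (metis finite_imageD finite_subset)
qed

lemma labels_of_degree_irr:
  assumes g: "g \<notin> Sing C"
  shows "irr_representatives C g (V ` {i \<in> I. V i \<in> Deg C g})"
  unfolding irr_representatives_def
proof (intro conjI ballI impI)
  show "V ` {i \<in> I. V i \<in> Deg C g} \<subseteq> {V \<in> Deg C g. simple_obj C V}" using simple_V by blast
next
  fix U assume U: "U \<in> Deg C g" "simple_obj C U"
  then have "generic C U" using g by (auto simp: generic_def)
  then obtain i where i: "i \<in> I" "isomorphic C U (V i)"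
    and u: "\<And>j. \<lbrakk>j \<in> I; isomorphic C U (V j)\<rbrakk> \<Longrightarrow> j = i" using representative by blast
  have "deg i = g" using iso_Deg_unique[OF U(2) i(2) U(1) V_Deg[OF i(1)]] by simp
  then have "V i \<in> V ` {i \<in> I. V i \<in> Deg C g}" using i V_Deg by blast
  then show "\<exists>!S. S \<in> V ` {i \<in> I. V i \<in> Deg C g} \<and> isomorphic C U S"
    using i(2) u by blast
qed

text \<open>Both sides are the trace of \<open>cup i \<bullet> cap (i\<^sup>\<star>)\<close>, bent to the left and to the right.\<close>
lemma mdim_star:
  assumes i: "i \<in> I"
  shows "mdim C (V (i\<^sup>\<star>)) = mdim C (V i)"
proof -
  let ?f = "cap (i\<^sup>\<star>)"
  have i': "i\<^sup>\<star> \<in> I" using i by simp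
  note D = dualityD[OF duality_cap'[OF i]]
  have f: "\<guillemotleft>cup i : \<I> \<rightarrow> V i \<odot> V (i\<^sup>\<star>)\<guillemotright>" and g: "\<guillemotleft>cap (i\<^sup>\<star>) : V i \<odot> V (i\<^sup>\<star>) \<rightarrow> \<I>\<guillemotright>"
    using i by simp_all
  have "T (cup i \<bullet> cap (i\<^sup>\<star>)) = T (rb (i\<^sup>\<star>) (V i) (cup i) \<bullet> ru i (V i) (cap (i\<^sup>\<star>)))"
    using T_bend_right[OF i' projective_V[OF i] f g] i by simp
  also have "rb (i\<^sup>\<star>) (V i) (cup i) = one (V i)"
    using dualityD(4)[OF duality_cap[OF i]] i by (simp add: rb_def bend_right_def)
  also have "ru i (V i) (cap (i\<^sup>\<star>)) = one (V i)"
    using dualityD(3)[OF duality_cap'[OF i]] i by (simp add: ru_def unbend_right_def)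
  finally have 1: "T (cup i \<bullet> cap (i\<^sup>\<star>)) = T (one (V i))" by simp
  have "T (cup i \<bullet> cap (i\<^sup>\<star>)) = T (lb i (V (i\<^sup>\<star>)) (cup i) \<bullet> lu (i\<^sup>\<star>) (V (i\<^sup>\<star>)) (cap (i\<^sup>\<star>)))"
    by (rule T_bend_left[OF i projective_V[OF i'] f g])
  also have "lb i (V (i\<^sup>\<star>)) (cup i) = one (V (i\<^sup>\<star>))"
    using dualityD(3)[OF duality_cap[OF i]] i by (simp add: lb_def bend_left_def)
  also have "lu (i\<^sup>\<star>) (V (i\<^sup>\<star>)) (cap (i\<^sup>\<star>)) = one (V (i\<^sup>\<star>))"
    using dualityD(4)[OF duality_cap'[OF i]] i by (simp add: lu_def unbend_left_def)
  finally have 2: "T (cup i \<bullet> cap (i\<^sup>\<star>)) = T (one (V (i\<^sup>\<star>)))" by simp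
  show ?thesis using 1 2 by (simp add: T_def mdim_def mor_one)
qed

abbreviation d :: "'i \<Rightarrow> 'k" where
  "d i \<equiv> mdim C (V i)"

lemma T_one: "T (one (V i)) = d i"
  by (simp add: T_def mdim_def mor_one)

lemma d_nonzero: "i \<in> I \<Longrightarrow> d i \<noteq> 0"
  using mdim_map generic_V by blast

lemma d_real: "i \<in> I \<Longrightarrow> bar (d i) = d i"
  using T_adag[of "V i" "one (V i)"] projective_V T_one[of i] by simp

lemma endo_T:
  assumes i: "i \<in> I" and f: "\<guillemotleft>f : V i \<rightarrow> V i\<guillemotright>"
  shows "f = (T f / d i) *\<^sub>a one (V i)"
proof -
  obtain c where c: "f = c *\<^sub>a one (V i)" by (rule simple_endo[OF simple_V[OF i] f])
  then have "T f = c * d i" using T_scale[OF projective_V[OF i], of "one (V i)" c] T_one by simp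
  then show ?thesis using c d_nonzero[OF i] by simp
qed

end

section \<open>Modified 6j-symbols\<close>

lemma (in tensor_category) frame_sum:
  assumes F: "\<guillemotleft>F : D \<rightarrow> P \<odot> A \<odot> Q\<guillemotright>" and G: "\<guillemotleft>G : P \<odot> B \<odot> Q \<rightarrow> E\<guillemotright>"
    and m: "\<And>x. x \<in> S \<Longrightarrow> m x \<in> Hom C A B"
  shows "mor (G \<bullet> (P \<triangleright> (Arrow A (\<Sum>x\<in>S. smult C (c x) (m x)) B \<triangleleft> Q)) \<bullet> F) =
    (\<Sum>x\<in>S. smult C (c x) (mor (G \<bullet> (P \<triangleright> (Arrow A (m x) B \<triangleleft> Q)) \<bullet> F)))"
proof -
  let ?\<phi> = "\<lambda>m. mor (G \<bullet> (P \<triangleright> (Arrow A m B \<triangleleft> Q)) \<bullet> F)"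
  have zero: "?\<phi> 0 = 0"
    using frame_add[OF F G Hom_zero Hom_zero] by simp
  have "(\<Sum>x\<in>S. smult C (c x) (m x)) \<in> Hom C A B \<and>
    ?\<phi> (\<Sum>x\<in>S. smult C (c x) (m x)) = (\<Sum>x\<in>S. smult C (c x) (?\<phi> (m x)))"
    using m
  proof (induction S rule: infinite_finite_induct)
    case (insert x S)
    then have mx: "m x \<in> Hom C A B" and IH: "(\<Sum>x\<in>S. smult C (c x) (m x)) \<in> Hom C A B"
      "?\<phi> (\<Sum>x\<in>S. smult C (c x) (m x)) = (\<Sum>x\<in>S. smult C (c x) (?\<phi> (m x)))" by auto
    then show ?case
      using insert.hyps frame_add[OF F G Hom_smult[OF mx] IH(1)] frame_scale[OF F G mx]
      by (simp add: Hom_add Hom_smult)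
  qed (use zero Hom_zero in simp_all)
  then show ?thesis ..
qed

locale hermitian_based_category = based_category bar C dag I V w
  for bar :: "'k::field \<Rightarrow> 'k"
    and C :: "('k, 'o, 'm::ab_group_add, 'g::ab_group_add, 'z) relative_cat_scheme" (structure)
    and dag :: "'m \<Rightarrow> 'm" and I :: "'i set" and V :: "'i \<Rightarrow> 'o" and w :: "'i \<Rightarrow> 'm" +
  fixes y :: "'i \<Rightarrow> 'i \<Rightarrow> 'i \<Rightarrow> nat \<Rightarrow> 'm"
  assumes hermitian_basic_data: "hermitian_basic_data C I V dag w y"
begin

abbreviation \<gamma> :: "'i \<Rightarrow> 'i \<Rightarrow> 'i \<Rightarrow> nat \<Rightarrow> 'k" where
  "\<gamma> \<equiv> gamma C V dag y"

abbreviation N where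
  "N \<equiv> sixj C I V w y"

definition vy :: "'i \<Rightarrow> 'i \<Rightarrow> 'i \<Rightarrow> nat \<Rightarrow> ('o, 'm) arrow" where
  "vy i j k n = Arrow \<I> (vertex C V y i j k n) (V i \<odot> V j \<odot> V k)"

lemma vy_simps [simp]: "src (vy i j k n) = \<I>" "tgt (vy i j k n) = V i \<odot> V j \<odot> V k"
  "mor (vy i j k n) = vertex C V y i j k n"
  by (simp_all add: vy_def)

lemma vertex_out: "n \<notin> {1..\<delta> i j k} \<Longrightarrow> vertex C V y i j k n = 0"
  and vertex_in: "n \<in> {1..\<delta> i j k} \<Longrightarrow> vertex C V y i j k n = y i j k n"
  by (auto simp: vertex_def)

lemma vy_out: "n \<notin> {1..\<delta> i j k} \<Longrightarrow> 0 *\<^sub>a vy i j k n = vy i j k n"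
  by (rule zero_arrow) (simp add: vertex_out)

lemma y_basis: "\<lbrakk>i \<in> I; j \<in> I; k \<in> I\<rbrakk> \<Longrightarrow> basis_family C (mult_space C V i j k) (\<delta> i j k) (y i j k)"
  using hermitian_basic_data unfolding hermitian_basic_data_def by blast

lemma vy_vec [simp]:
  assumes "i \<in> I" "j \<in> I" "k \<in> I"
  shows "arr (vy i j k n)"
proof (cases "n \<in> {1..\<delta> i j k}")
  case True
  have "y i j k n \<in> vs.span (y i j k ` {1..\<delta> i j k})" using True by (intro vs.span_base) simp
  then have "y i j k n \<in> Hom C \<I> (V i \<odot> V j \<odot> V k)"
    using y_basis[OF assms] unfolding basis_family_def mult_space_def by simp
  then show ?thesis using vertex_in[OF True] by (simp add: vy_def)
next
  case False
  then show ?thesis using vertex_out[OF False] Hom_zero by (simp add: vy_def)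
qed

lemma split_scale: "\<lbrakk>i \<in> I; j \<in> I; k \<in> I; vec i j (k\<^sup>\<star>) x\<rbrakk> \<Longrightarrow> split i j k (c *\<^sub>a x) = c *\<^sub>a split i j k x"
  by (simp add: split_def rb_def bend_right_def)

lemma fuse_scale: "\<lbrakk>i \<in> I; j \<in> I; k \<in> I; vec k (j\<^sup>\<star>) (i\<^sup>\<star>) x\<rbrakk> \<Longrightarrow> fuse i j k (c *\<^sub>a x) = c *\<^sub>a fuse i j k x"
  by (simp add: fuse_def rb_def bend_right_def)

abbreviation S :: "'i \<Rightarrow> 'i \<Rightarrow> 'i \<Rightarrow> nat \<Rightarrow> ('o, 'm) arrow" where
  "S i j k n \<equiv> split i j k (vy i j (k\<^sup>\<star>) n)"

abbreviation F :: "'i \<Rightarrow> 'i \<Rightarrow> 'i \<Rightarrow> nat \<Rightarrow> ('o, 'm) arrow" where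
  "F i j k n \<equiv> fuse i j k (vy k (j\<^sup>\<star>) (i\<^sup>\<star>) n)"

lemma S_arr: "\<lbrakk>i \<in> I; j \<in> I; k \<in> I\<rbrakk> \<Longrightarrow> \<guillemotleft>S i j k n : V k \<rightarrow> V i \<odot> V j\<guillemotright>"
  by (intro split_arr) auto

lemma F_arr: "\<lbrakk>i \<in> I; j \<in> I; k \<in> I\<rbrakk> \<Longrightarrow> \<guillemotleft>F i j k n : V i \<odot> V j \<rightarrow> V k\<guillemotright>"
  by (intro fuse_arr) auto

lemma mult_dim_fuse: "\<lbrakk>i \<in> I; j \<in> I; k \<in> I\<rbrakk> \<Longrightarrow> \<delta> k (j\<^sup>\<star>) (i\<^sup>\<star>) = \<delta> i j (k\<^sup>\<star>)"
  using mult_dim_star[of i j "k\<^sup>\<star>"] by simp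

lemma S_out: "\<lbrakk>i \<in> I; j \<in> I; k \<in> I; n \<notin> {1..\<delta> i j (k\<^sup>\<star>)}\<rbrakk> \<Longrightarrow> 0 *\<^sub>a S i j k n = S i j k n"
  using split_scale[of i j k "vy i j (k\<^sup>\<star>) n" 0] by (simp add: vy_out)

lemma F_out: "\<lbrakk>i \<in> I; j \<in> I; k \<in> I; n \<notin> {1..\<delta> k (j\<^sup>\<star>) (i\<^sup>\<star>)}\<rbrakk> \<Longrightarrow> 0 *\<^sub>a F i j k n = F i j k n"
  using fuse_scale[of i j k "vy k (j\<^sup>\<star>) (i\<^sup>\<star>) n" 0] by (simp add: vy_out)

lemma T_F_S:
  assumes "i \<in> I" "j \<in> I" "k \<in> I" "n \<in> {1..\<delta> i j (k\<^sup>\<star>)}"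
  shows "T (F i j k m \<bullet> S i j k n) = (if m = n then 1 else 0)"
proof (cases "m \<in> {1..\<delta> i j (k\<^sup>\<star>)}")
  case True
  have k: "k\<^sup>\<star> \<in> I" "(k\<^sup>\<star>)\<^sup>\<star> = k" using assms by auto
  have "Theta C I V w i j (k\<^sup>\<star>) (y k (j\<^sup>\<star>) (i\<^sup>\<star>) m) (y i j (k\<^sup>\<star>) n) = (if m = n then 1 else 0)"
    using hermitian_basic_data assms(1,2,4) k True mult_dim_fuse[OF assms(1-3)]
    unfolding hermitian_basic_data_def by metis
  moreover have "vertex C V y k (j\<^sup>\<star>) (i\<^sup>\<star>) m = y k (j\<^sup>\<star>) (i\<^sup>\<star>) m" "vertex C V y i j (k\<^sup>\<star>) n = y i j (k\<^sup>\<star>) n"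
    using True assms mult_dim_fuse[OF assms(1-3)] by (simp_all add: vertex_in)
  ultimately show ?thesis
    using Theta_fuse_split[of i j k "vy k (j\<^sup>\<star>) (i\<^sup>\<star>) m" "vy i j (k\<^sup>\<star>) n"] assms by simp
next
  case False
  note F = F_arr[OF assms(1-3), of m] and S = S_arr[OF assms(1-3), of n]
  have "T (F i j k m \<bullet> S i j k n) = T (0 *\<^sub>a (F i j k m \<bullet> S i j k n))"
    using F S F_out[OF assms(1-3), of m] False mult_dim_fuse[OF assms(1-3)]
      ascale_simps(1)[of "F i j k m" "S i j k n" 0] by simp
  also have "\<dots> = 0" using T_scale[OF projective_V[OF assms(3)], of "F i j k m \<bullet> S i j k n" 0] F S by simp
  finally show ?thesis using False assms(4) by auto
qed

lemma F_S:
  assumes "i \<in> I" "j \<in> I" "k \<in> I" "n \<in> {1..\<delta> i j (k\<^sup>\<star>)}"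
  shows "F i j k m \<bullet> S i j k n = (if m = n then 1 / d k else 0) *\<^sub>a one (V k)"
proof -
  have "F i j k m \<bullet> S i j k n = (T (F i j k m \<bullet> S i j k n) / d k) *\<^sub>a one (V k)"
    using F_arr[OF assms(1-3)] S_arr[OF assms(1-3)] by (intro endo_T[OF assms(3)]) auto
  then show ?thesis unfolding T_F_S[OF assms] by simp
qed

lemma schur_zero: "\<lbrakk>k \<in> I; p \<in> I; k \<noteq> p; \<guillemotleft>f : V k \<rightarrow> V p\<guillemotright>\<rbrakk> \<Longrightarrow> 0 *\<^sub>a f = f"
  using schur[of k p] mor_in[of f "V k" "V p"] by (intro zero_arrow) auto

lemma basis_expansion:
  assumes "i \<in> I" "j \<in> I" "k \<in> I" "vec i j k x"
  obtains c where "mor x = (\<Sum>n\<in>{1..\<delta> i j k}. smult C (c n) (mor (vy i j k n)))"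
proof -
  let ?B = "y i j k ` {1..\<delta> i j k}"
  have b: "inj_on (y i j k) {1..\<delta> i j k}" "vs.span ?B = Hom C \<I> (V i \<odot> V j \<odot> V k)"
    using y_basis[OF assms(1-3)] unfolding basis_family_def mult_space_def by auto
  have "mor x \<in> vs.span ?B" using b(2) mor_in[OF assms(4)] by simp
  then obtain u where "mor x = (\<Sum>v\<in>?B. smult C (u v) v)"
    using vs.span_finite[of ?B] by auto
  also have "\<dots> = (\<Sum>n\<in>{1..\<delta> i j k}. smult C (u (y i j k n)) (y i j k n))"
    using b(1) by (simp add: sum.reindex)
  also have "\<dots> = (\<Sum>n\<in>{1..\<delta> i j k}. smult C (u (y i j k n)) (mor (vy i j k n)))"
    by (intro sum.cong) (auto simp: vertex_in)
  finally show thesis by (rule that)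
qed

text \<open>
  Since fusions and splittings are dual for the trace, \<open>F i j k a\<close> reads off the coefficient of \<open>S i j k a\<close>.
\<close>
lemma S_expansion:
  assumes ijk: "i \<in> I" "j \<in> I" "k \<in> I" and f: "\<guillemotleft>f : V k \<rightarrow> V i \<odot> V j\<guillemotright>"
  shows "mor f = (\<Sum>a\<in>{1..\<delta> i j (k\<^sup>\<star>)}. smult C (T (F i j k a \<bullet> f)) (mor (S i j k a)))"
proof -
  have k: "k\<^sup>\<star> \<in> I" "(k\<^sup>\<star>)\<^sup>\<star> = k" using ijk by auto
  define x where "x = ru (k\<^sup>\<star>) \<I> f"
  have x: "vec i j (k\<^sup>\<star>) x" using ru_arr[OF k(1), of f \<I> "V i \<odot> V j"] f k by (simp add: x_def)
  have fx: "split i j k x = f"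
    using rb_ru[OF k(1), of f \<I> "V i \<odot> V j"] f k by (simp add: split_def x_def)
  obtain c where c: "mor x = (\<Sum>n\<in>{1..\<delta> i j (k\<^sup>\<star>)}. smult C (c n) (mor (vy i j (k\<^sup>\<star>) n)))"
    by (rule basis_expansion[OF ijk(1,2) k(1) x])
  let ?X = "V i \<odot> V j \<odot> V (k\<^sup>\<star>)" and ?G = "(V i \<odot> V j) \<triangleright> cap k"
  have sp: "split i j k z = ?G \<bullet> (\<I> \<triangleright> (Arrow \<I> (mor z) ?X \<triangleleft> V k)) \<bullet> one (V k)" if z: "vec i j (k\<^sup>\<star>) z" for z
  proof -
    have "Arrow \<I> (mor z) ?X = z" using z by (intro arrow_eqI) auto
    then show ?thesis using z k by (simp add: split_def rb_def bend_right_def)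
  qed
  have "mor f = mor (?G \<bullet> (\<I> \<triangleright> (Arrow \<I> (mor x) ?X \<triangleleft> V k)) \<bullet> one (V k))"
    using sp[OF x] fx by simp
  also have "\<dots> = (\<Sum>a\<in>{1..\<delta> i j (k\<^sup>\<star>)}. smult C (c a)
      (mor (?G \<bullet> (\<I> \<triangleright> (Arrow \<I> (mor (vy i j (k\<^sup>\<star>) a)) ?X \<triangleleft> V k)) \<bullet> one (V k))))"
    unfolding c using ijk k by (intro frame_sum mor_in) auto
  also have "\<dots> = (\<Sum>a\<in>{1..\<delta> i j (k\<^sup>\<star>)}. smult C (c a) (mor (S i j k a)))"
    using sp[of "vy i j (k\<^sup>\<star>) _"] ijk k by (intro sum.cong) auto
  finally have fc: "mor f = (\<Sum>a\<in>{1..\<delta> i j (k\<^sup>\<star>)}. smult C (c a) (mor (S i j k a)))" .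
  have "T (F i j k b \<bullet> f) = c b" if b: "b \<in> {1..\<delta> i j (k\<^sup>\<star>)}" for b
  proof -
    let ?\<phi> = "\<lambda>m. T (F i j k b \<bullet> (\<I> \<triangleright> (Arrow (V k) m (V i \<odot> V j) \<triangleleft> \<I>)) \<bullet> one (V k))"
    have e: "?\<phi> (mor h) = T (F i j k b \<bullet> h)" if h: "\<guillemotleft>h : V k \<rightarrow> V i \<odot> V j\<guillemotright>" for h
    proof -
      have "Arrow (V k) (mor h) (V i \<odot> V j) = h" using h by (intro arrow_eqI) auto
      then show ?thesis using h by simp
    qed
    have "functional (V k) (V i \<odot> V j) ?\<phi>"
      using F_arr[OF ijk] by (intro functional_T[where D = "V k"] projective_V ijk) auto
    then have "?\<phi> (mor f) = (\<Sum>a\<in>{1..\<delta> i j (k\<^sup>\<star>)}. c a * ?\<phi> (mor (S i j k a)))"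
      unfolding fc using S_arr[OF ijk] by (intro functional_sum mor_in) auto
    also have "\<dots> = (\<Sum>a\<in>{1..\<delta> i j (k\<^sup>\<star>)}. if a = b then c a else 0)"
      using e[OF S_arr[OF ijk]] T_F_S[OF ijk] by (intro sum.cong) auto
    also have "\<dots> = c b" using b by simp
    finally show ?thesis using e[OF f] by simp
  qed
  then show ?thesis using fc by simp
qed

lemma F_expansion:
  assumes ijk: "i \<in> I" "j \<in> I" "k \<in> I" and g: "\<guillemotleft>g : V i \<odot> V j \<rightarrow> V k\<guillemotright>"
  shows "mor g = (\<Sum>a\<in>{1..\<delta> i j (k\<^sup>\<star>)}. smult C (T (g \<bullet> S i j k a)) (mor (F i j k a)))"
proof -
  have s: "i\<^sup>\<star> \<in> I" "j\<^sup>\<star> \<in> I" "(i\<^sup>\<star>)\<^sup>\<star> = i" "(j\<^sup>\<star>)\<^sup>\<star> = j" using ijk by auto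
  have dim: "\<delta> k (j\<^sup>\<star>) (i\<^sup>\<star>) = \<delta> i j (k\<^sup>\<star>)" by (rule mult_dim_fuse[OF ijk])
  define x1 where "x1 = ru (j\<^sup>\<star>) (V i) g"
  have x1: "\<guillemotleft>x1 : V i \<rightarrow> V k \<odot> V (j\<^sup>\<star>)\<guillemotright>" using ru_arr[OF s(2), of g "V i" "V k"] g s by (simp add: x1_def)
  define x where "x = ru (i\<^sup>\<star>) \<I> x1"
  have x: "vec k (j\<^sup>\<star>) (i\<^sup>\<star>) x" using ru_arr[OF s(1), of x1 \<I> "V k \<odot> V (j\<^sup>\<star>)"] x1 s by (simp add: x_def)
  have gx: "fuse i j k x = g"
    using rb_ru[OF s(1), of x1 \<I> "V k \<odot> V (j\<^sup>\<star>)"] rb_ru[OF s(2), of g "V i" "V k"] g x1 s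
    by (simp add: fuse_def x_def x1_def)
  obtain c where c: "mor x = (\<Sum>n\<in>{1..\<delta> i j (k\<^sup>\<star>)}. smult C (c n) (mor (vy k (j\<^sup>\<star>) (i\<^sup>\<star>) n)))"
    using basis_expansion[OF ijk(3) s(2,1) x] unfolding dim by blast
  let ?X = "V k \<odot> V (j\<^sup>\<star>) \<odot> V (i\<^sup>\<star>)"
  let ?G = "(V k \<triangleright> cap j) \<bullet> ((V k \<odot> V (j\<^sup>\<star>)) \<triangleright> (cap i \<triangleleft> V j))"
  have fu: "fuse i j k z = ?G \<bullet> (\<I> \<triangleright> (Arrow \<I> (mor z) ?X \<triangleleft> (V i \<odot> V j))) \<bullet> one (V i \<odot> V j)"
    if z: "vec k (j\<^sup>\<star>) (i\<^sup>\<star>) z" for z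
  proof -
    have "Arrow \<I> (mor z) ?X = z" using z by (intro arrow_eqI) auto
    then show ?thesis using z s ijk by (simp add: fuse_def rb_def bend_right_def acomp_assoc)
  qed
  have "mor g = mor (?G \<bullet> (\<I> \<triangleright> (Arrow \<I> (mor x) ?X \<triangleleft> (V i \<odot> V j))) \<bullet> one (V i \<odot> V j))"
    using fu[OF x] gx by simp
  also have "\<dots> = (\<Sum>a\<in>{1..\<delta> i j (k\<^sup>\<star>)}. smult C (c a)
      (mor (?G \<bullet> (\<I> \<triangleright> (Arrow \<I> (mor (vy k (j\<^sup>\<star>) (i\<^sup>\<star>) a)) ?X \<triangleleft> (V i \<odot> V j))) \<bullet> one (V i \<odot> V j))))"
    unfolding c using ijk s by (intro frame_sum mor_in) auto
  also have "\<dots> = (\<Sum>a\<in>{1..\<delta> i j (k\<^sup>\<star>)}. smult C (c a) (mor (F i j k a)))"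
    using fu[of "vy k (j\<^sup>\<star>) (i\<^sup>\<star>) _"] ijk s by (intro sum.cong) auto
  finally have gc: "mor g = (\<Sum>a\<in>{1..\<delta> i j (k\<^sup>\<star>)}. smult C (c a) (mor (F i j k a)))" .
  have "T (g \<bullet> S i j k b) = c b" if b: "b \<in> {1..\<delta> i j (k\<^sup>\<star>)}" for b
  proof -
    let ?\<phi> = "\<lambda>m. T (one (V k) \<bullet> (\<I> \<triangleright> (Arrow (V i \<odot> V j) m (V k) \<triangleleft> \<I>)) \<bullet> S i j k b)"
    have e: "?\<phi> (mor h) = T (h \<bullet> S i j k b)" if h: "\<guillemotleft>h : V i \<odot> V j \<rightarrow> V k\<guillemotright>" for h
    proof -
      have "Arrow (V i \<odot> V j) (mor h) (V k) = h" using h by (intro arrow_eqI) auto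
      then show ?thesis using h S_arr[OF ijk] by simp
    qed
    have "functional (V i \<odot> V j) (V k) ?\<phi>"
      using S_arr[OF ijk] by (intro functional_T[where D = "V k"] projective_V ijk) auto
    then have "?\<phi> (mor g) = (\<Sum>a\<in>{1..\<delta> i j (k\<^sup>\<star>)}. c a * ?\<phi> (mor (F i j k a)))"
      unfolding gc using F_arr[OF ijk] by (intro functional_sum mor_in) auto
    also have "\<dots> = (\<Sum>a\<in>{1..\<delta> i j (k\<^sup>\<star>)}. if a = b then c a else 0)"
      using e[OF F_arr[OF ijk]] T_F_S[OF ijk b] by (intro sum.cong) auto
    also have "\<dots> = c b" using b by simp
    finally show ?thesis using e[OF g] by simp
  qed
  then show ?thesis using gc by simp
qed

abbreviation lab :: "'g \<Rightarrow> 'i set" where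
  "lab g \<equiv> {i \<in> I. V i \<in> Deg C g}"

text \<open>
  It suffices to compare both sides on the summands \<open>\<iota> l\<close> of \<open>V i \<odot> V j\<close>. There \<open>F \<bullet> \<iota> l\<close> is a scalar or zero by
  Schur's lemma, and the sum becomes the expansion of \<open>\<iota> l\<close> in splittings.
\<close>
lemma completeness:
  assumes ij: "i \<in> I" "j \<in> I" and g: "deg i + deg j \<notin> Sing C"
  shows "(\<Sum>k\<in>lab (deg i + deg j). \<Sum>a\<in>{1..\<delta> i j (k\<^sup>\<star>)}. smult C (d k) (mor (S i j k a \<bullet> F i j k a))) =
    Id C (V i \<odot> V j)"
    (is "?E = _")
proof -
  let ?X = "V i \<odot> V j" and ?g = "deg i + deg j"
  have X: "?X \<in> Deg C ?g" by (intro Deg_tensor V_Deg ij)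
  show ?thesis
  proof (rule decomposition[OF g X])
  fix n :: nat and \<kappa> \<iota> \<pi>
  assume kp: "\<And>l. l < n \<Longrightarrow> \<kappa> l \<in> I \<and> deg (\<kappa> l) = ?g"
    and io: "\<And>l. l < n \<Longrightarrow> \<guillemotleft>\<iota> l : V (\<kappa> l) \<rightarrow> ?X\<guillemotright>" and pi: "\<And>l. l < n \<Longrightarrow> \<guillemotleft>\<pi> l : ?X \<rightarrow> V (\<kappa> l)\<guillemotright>"
    and sum: "(\<Sum>l<n. mor (\<iota> l \<bullet> \<pi> l)) = Id C ?X"
  have SF: "mor (S i j k a \<bullet> F i j k a) \<in> Hom C ?X ?X" if "k \<in> I" for k a
    using S_arr[OF ij that] F_arr[OF ij that] by (intro mor_in) auto
  have E_in: "?E \<in> Hom C ?X ?X" using SF by (intro Hom_sum Hom_smult) auto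
  have absorb: "mor (S i j k a) \<cdot> mor (F i j k a) \<cdot> mor (\<iota> l) =
      (if k = \<kappa> l then smult C (1 / d k) (smult C (T (F i j k a \<bullet> \<iota> l)) (mor (S i j k a))) else 0)"
    if k: "k \<in> I" and l: "l < n" for k a l
  proof -
    note S' = S_arr[OF ij k, of a] and F' = F_arr[OF ij k, of a]
    have h: "\<guillemotleft>F i j k a \<bullet> \<iota> l : V (\<kappa> l) \<rightarrow> V k\<guillemotright>" using F' io[OF l] by simp
    show ?thesis
    proof (cases "k = \<kappa> l")
      case True
      then have "F i j k a \<bullet> \<iota> l = (T (F i j k a \<bullet> \<iota> l) / d k) *\<^sub>a one (V k)"
        using h by (intro endo_T k) auto
      then have "S i j k a \<bullet> (F i j k a \<bullet> \<iota> l) = (T (F i j k a \<bullet> \<iota> l) / d k) *\<^sub>a S i j k a"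
        using ascale_simps(2)[of "S i j k a" "one (V k)" "T (F i j k a \<bullet> \<iota> l) / d k"] S' by simp
      from arg_cong[OF this, of mor] show ?thesis using True by (simp add: mor_simps)
    next
      case False
      have "0 *\<^sub>a (F i j k a \<bullet> \<iota> l) = F i j k a \<bullet> \<iota> l"
        using kp[OF l] k False h by (intro schur_zero[of "\<kappa> l" k]) auto
      then have "S i j k a \<bullet> (F i j k a \<bullet> \<iota> l) = 0 *\<^sub>a (S i j k a \<bullet> (F i j k a \<bullet> \<iota> l))"
        using ascale_simps(2)[of "S i j k a" "F i j k a \<bullet> \<iota> l" 0] S' h by simp
      from arg_cong[OF this, of mor] show ?thesis using False by (simp add: mor_simps)
    qed
  qed
  have E_iota: "?E \<cdot> mor (\<iota> l) = mor (\<iota> l)" if l: "l < n" for l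
  proof -
    note k = kp[OF l]
    have fin: "finite (lab ?g)" by (rule label_degree_finite[OF g])
    have k_in: "\<kappa> l \<in> lab ?g" using k V_Deg[of "\<kappa> l"] by auto
    have c: "(\<Sum>x\<in>A. f x) \<cdot> mor (\<iota> l) = (\<Sum>x\<in>A. f x \<cdot> mor (\<iota> l))"
      if "\<And>x. x \<in> A \<Longrightarrow> f x \<in> Hom C ?X ?X" for A :: "'x set" and f
      by (rule comp_sum_left[OF that mor_in[OF io[OF l]]])
    have "?E \<cdot> mor (\<iota> l) = (\<Sum>k\<in>lab ?g. \<Sum>a\<in>{1..\<delta> i j (k\<^sup>\<star>)}. smult C (d k) (mor (S i j k a \<bullet> F i j k a)) \<cdot> mor (\<iota> l))"
      using SF by (subst c, force intro!: Hom_sum Hom_smult, intro sum.cong c Hom_smult) auto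
    also have "\<dots> = (\<Sum>k\<in>lab ?g. \<Sum>a\<in>{1..\<delta> i j (k\<^sup>\<star>)}. if k = \<kappa> l then smult C (T (F i j k a \<bullet> \<iota> l)) (mor (S i j k a)) else 0)"
    proof (intro sum.cong refl)
      fix k a assume "k \<in> lab ?g" "a \<in> {1..\<delta> i j (k\<^sup>\<star>)}"
      then have k: "k \<in> I" by simp
      have "smult C (d k) (mor (S i j k a \<bullet> F i j k a)) \<cdot> mor (\<iota> l) =
          smult C (d k) (mor (S i j k a) \<cdot> mor (F i j k a) \<cdot> mor (\<iota> l))"
        using comp_smult_left[OF SF[OF k] mor_in[OF io[OF l]]]
          comp_assoc[OF mor_in[OF S_arr[OF ij k]] mor_in[OF F_arr[OF ij k]] mor_in[OF io[OF l]]]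
        by (simp add: mor_simps)
      then show "smult C (d k) (mor (S i j k a \<bullet> F i j k a)) \<cdot> mor (\<iota> l) =
          (if k = \<kappa> l then smult C (T (F i j k a \<bullet> \<iota> l)) (mor (S i j k a)) else 0)"
        unfolding absorb[OF k l] using d_nonzero[OF k] by (cases "k = \<kappa> l") auto
    qed
    also have "\<dots> = (\<Sum>k\<in>lab ?g. if k = \<kappa> l then
        (\<Sum>a\<in>{1..\<delta> i j (k\<^sup>\<star>)}. smult C (T (F i j k a \<bullet> \<iota> l)) (mor (S i j k a))) else 0)"
      by (intro sum.cong) auto
    also have "\<dots> = (\<Sum>a\<in>{1..\<delta> i j ((\<kappa> l)\<^sup>\<star>)}. smult C (T (F i j (\<kappa> l) a \<bullet> \<iota> l)) (mor (S i j (\<kappa> l) a)))"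
      using fin k_in by simp
    also have "\<dots> = mor (\<iota> l)"
      using S_expansion[OF ij conjunct1[OF k] io[OF l]] by simp
    finally show ?thesis .
  qed
  have "?E = ?E \<cdot> (\<Sum>l<n. mor (\<iota> l \<bullet> \<pi> l))" unfolding sum by (rule comp_Id[OF E_in, symmetric])
  also have "\<dots> = (\<Sum>l<n. ?E \<cdot> mor (\<iota> l \<bullet> \<pi> l))"
  proof -
    have "(\<Sum>l<m. mor (\<iota> l \<bullet> \<pi> l)) \<in> Hom C ?X ?X \<and>
        ?E \<cdot> (\<Sum>l<m. mor (\<iota> l \<bullet> \<pi> l)) = (\<Sum>l<m. ?E \<cdot> mor (\<iota> l \<bullet> \<pi> l))" if "m \<le> n" for m
      using that
    proof (induction m)
      case 0
      then show ?case using comp_add_right[OF E_in Hom_zero Hom_zero] Hom_zero by simp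
    next
      case (Suc m)
      have m: "mor (\<iota> m \<bullet> \<pi> m) \<in> Hom C ?X ?X"
        using io[of m] pi[of m] Suc.prems by (intro mor_in) auto
      then show ?case
        using Suc comp_add_right[OF E_in _ m, of "\<Sum>l<m. mor (\<iota> l \<bullet> \<pi> l)"] by (simp add: Hom_add)
    qed
    from this[of n] show ?thesis by simp
  qed
  also have "\<dots> = (\<Sum>l<n. mor (\<iota> l \<bullet> \<pi> l))"
  proof (intro sum.cong refl)
    fix l assume "l \<in> {..<n}"
    then have l: "l < n" by simp
    have "?E \<cdot> mor (\<iota> l \<bullet> \<pi> l) = (?E \<cdot> mor (\<iota> l)) \<cdot> mor (\<pi> l)"
      using comp_assoc[OF E_in mor_in[OF io[OF l]] mor_in[OF pi[OF l]]] by (simp add: mor_simps)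
    then show "?E \<cdot> mor (\<iota> l \<bullet> \<pi> l) = mor (\<iota> l \<bullet> \<pi> l)"
      unfolding E_iota[OF l] by (simp add: mor_simps)
  qed
  finally show ?thesis unfolding sum .
  qed
qed

end

section \<open>The identities of LW data\<close>

context hermitian_based_category
begin

lemma sixj_tet:
  fixes j1 j2 j3 j4 j5 j6
  assumes j: "j1 \<in> I" "j2 \<in> I" "j3 \<in> I" "j4 \<in> I" "j5 \<in> I" "j6 \<in> I"
  shows "N j1 j2 j3 j4 j5 j6 a1 a2 a3 a4 = tet j1 j2 j3 j4 j5 j6 (vy j1 j2 (j3\<^sup>\<star>) a1) (vy j3 j4 (j5\<^sup>\<star>) a2)
    (vy j5 (j6\<^sup>\<star>) (j1\<^sup>\<star>) a3) (vy j6 (j4\<^sup>\<star>) (j2\<^sup>\<star>) a4)"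
proof -
  let ?y1 = "vy j1 j2 (j3\<^sup>\<star>) a1" and ?y2 = "vy j3 j4 (j5\<^sup>\<star>) a2"
    and ?y3 = "vy j5 (j6\<^sup>\<star>) (j1\<^sup>\<star>) a3" and ?y4 = "vy j6 (j4\<^sup>\<star>) (j2\<^sup>\<star>) a4"
  have y1: "vec j1 j2 (j3\<^sup>\<star>) ?y1" and y2: "vec j3 j4 (j5\<^sup>\<star>) ?y2"
    and y3: "vec j5 (j6\<^sup>\<star>) (j1\<^sup>\<star>) ?y3" and y4: "vec j6 (j4\<^sup>\<star>) (j2\<^sup>\<star>) ?y4"
    using j by auto
  let ?A = "((V j5 \<odot> V (j6\<^sup>\<star>)) \<triangleright> (?y4 \<triangleleft> V (j1\<^sup>\<star>))) \<bullet> ?y3"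
  have A: "arr ?A" using j by simp
  define z where "z = ((V j5 \<odot> V (j4\<^sup>\<star>)) \<triangleright> (cap j2 \<triangleleft> V (j3\<^sup>\<star>))) \<bullet>
    ((V j5 \<odot> V (j4\<^sup>\<star>) \<odot> V (j2\<^sup>\<star>)) \<triangleright> (cap j1 \<triangleleft> (V j2 \<odot> V (j3\<^sup>\<star>)))) \<bullet>
    (V j5 \<triangleright> (cap j6 \<triangleleft> (V (j4\<^sup>\<star>) \<odot> V (j2\<^sup>\<star>) \<odot> V (j1\<^sup>\<star>) \<odot> V j1 \<odot> V j2 \<odot> V (j3\<^sup>\<star>)))) \<bullet>
    (?A \<triangleleft> (V j1 \<odot> V j2 \<odot> V (j3\<^sup>\<star>))) \<bullet> ?y1"
  have mt: "mor ?A \<otimes> mor ?y1 = mor ((?A \<triangleleft> (V j1 \<odot> V j2 \<odot> V (j3\<^sup>\<star>))) \<bullet> ?y1)"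
    using mor_tensor[OF A, of ?y1] j by simp
  have cap: "edge C I V w i = mor (cap i)" for i by (simp add: cap_def)
  have Id_Id: "Id C X \<otimes> Id C Y \<otimes> mor (cap i) \<otimes> Id C Q = Id C (X \<odot> Y) \<otimes> mor (cap i) \<otimes> Id C Q"
    if "i \<in> I" for X Y Q i
    using lwhisker_lwhisker[of "cap i \<triangleleft> Q" X Y] that by (metis arr_rwhisker cap_arr(3) mor_lwhisker mor_rwhisker)
  have mA: "(Id C (V j5 \<odot> V (j6\<^sup>\<star>)) \<otimes> vertex C V y j6 (j4\<^sup>\<star>) (j2\<^sup>\<star>) a4 \<otimes> Id C (V (j1\<^sup>\<star>))) \<cdot>
      vertex C V y j5 (j6\<^sup>\<star>) (j1\<^sup>\<star>) a3 = mor ?A"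
    by (simp add: mor_acomp mor_lwhisker mor_rwhisker)
  have m1: "vertex C V y j1 j2 (j3\<^sup>\<star>) a1 = mor ?y1" and m2: "vertex C V y j3 j4 (j5\<^sup>\<star>) a2 = mor ?y2" by simp_all
  have "N j1 j2 j3 j4 j5 j6 a1 a2 a3 a4 = Theta C I V w j3 j4 (j5\<^sup>\<star>) (mor z) (mor ?y2)"
    unfolding sixj_def Let_def mA cap
    unfolding m1 m2 mt z_def tensor_Id
    by (simp only: mor_acomp mor_lwhisker mor_rwhisker Id_Id j tensor_obj_assoc)
  also have "\<dots> = T (fuse j3 j4 j5 z \<bullet> split j3 j4 j5 ?y2)"
    using fuse_contraction(1)[OF j y1 y3 y4, folded z_def] y2 j by (intro Theta_fuse_split) auto
  also have "\<dots> = tet j1 j2 j3 j4 j5 j6 ?y1 ?y2 ?y3 ?y4"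
    unfolding fuse_contraction(2)[OF j y1 y3 y4, folded z_def] tet_def
    using fuse_arr[OF j(1,6,5) y3] fuse_arr[OF j(2,4,6) y4] split_arr[OF j(1,2,3) y1] split_arr[OF j(3,4,5) y2]
    by (simp add: acomp_assoc)
  finally show ?thesis .
qed

lemma sixj_eq:
  fixes j1 j2 j3 j4 j5 j6
  assumes j: "j1 \<in> I" "j2 \<in> I" "j3 \<in> I" "j4 \<in> I" "j5 \<in> I" "j6 \<in> I"
  shows "N j1 j2 j3 j4 j5 j6 a1 a2 a3 a4 = T (F j1 j6 j5 a3 \<bullet> (V j1 \<triangleright> F j2 j4 j6 a4) \<bullet>
     (S j1 j2 j3 a1 \<triangleleft> V j4) \<bullet> S j3 j4 j5 a2)"
  unfolding sixj_tet[OF j] tet_def ..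

lemma arot_scale: "\<lbrakk>i \<in> I; j \<in> I; k \<in> I; vec i j k x\<rbrakk> \<Longrightarrow> arot i j k (c *\<^sub>a x) = c *\<^sub>a arot i j k x"
  by (simp add: arot_eq lb_def bend_left_def ru_def unbend_right_def)

lemma arot_vy:
  assumes "i \<in> I" "j \<in> I" "k \<in> I"
  shows "arot i j k (vy i j k n) = vy j k i n"
proof (cases "n \<in> {1..\<delta> i j k}")
  case True
  have "rot C V i j k (y i j k n) = y j k i n"
    using hermitian_basic_data assms True unfolding hermitian_basic_data_def by blast
  then show ?thesis
    using True vertex_in[OF True] vertex_in[of n j k i] mult_dim_rot[OF assms]
    by (simp add: arot_def vy_def)
next
  case False
  have "0 *\<^sub>a arot i j k (vy i j k n) = arot i j k (vy i j k n)"
    using arot_scale[OF assms, of "vy i j k n" 0] vy_out[OF False] assms by simp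
  from arg_cong[OF this, of mor] have "mor (arot i j k (vy i j k n)) = 0" by (simp add: mor_ascale)
  then show ?thesis
    using vertex_out[of n j k i] False mult_dim_rot[OF assms]
    by (intro arrow_eqI) (auto simp: arot_def)
qed

lemma sixj_symmetric1:
  fixes j1 j2 j3 j4 j5 j6
  assumes j: "j1 \<in> I" "j2 \<in> I" "j3 \<in> I" "j4 \<in> I" "j5 \<in> I" "j6 \<in> I"
  shows "N j1 j2 j3 j4 j5 j6 a1 a2 a3 a4 = N j2 (j3\<^sup>\<star>) (j1\<^sup>\<star>) j5 j6 j4 a1 a3 a4 a2"
  using tet_symmetric1[OF j, of "vy j1 j2 (j3\<^sup>\<star>) a1" "vy j3 j4 (j5\<^sup>\<star>) a2"
      "vy (j1\<^sup>\<star>) j5 (j6\<^sup>\<star>) a3" "vy j6 (j4\<^sup>\<star>) (j2\<^sup>\<star>) a4"] j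
  by (simp add: sixj_tet arot_vy)

lemma sixj_symmetric2:
  fixes j1 j2 j3 j4 j5 j6
  assumes j: "j1 \<in> I" "j2 \<in> I" "j3 \<in> I" "j4 \<in> I" "j5 \<in> I" "j6 \<in> I"
  shows "N j1 j2 j3 j4 j5 j6 a1 a2 a3 a4 = N j3 j4 j5 (j6\<^sup>\<star>) j1 (j2\<^sup>\<star>) a2 a3 a1 a4"
  using tet_symmetric2[OF j, of "vy j1 j2 (j3\<^sup>\<star>) a1" "vy j3 j4 (j5\<^sup>\<star>) a2"
      "vy j5 (j6\<^sup>\<star>) (j1\<^sup>\<star>) a3" "vy (j2\<^sup>\<star>) j6 (j4\<^sup>\<star>) a4"] j
  by (simp add: sixj_tet arot_vy)

lemma sixj_upside_down:
  fixes j1 j2 j3 j4 j5 j6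
  assumes j: "j1 \<in> I" "j2 \<in> I" "j3 \<in> I" "j4 \<in> I" "j5 \<in> I" "j6 \<in> I"
  shows "N j3 (j2\<^sup>\<star>) j1 j6 j5 j4 a1 a3 a2 a4 =
    T (F j3 j4 j5 a2 \<bullet> (F j1 j2 j3 a1 \<triangleleft> V j4) \<bullet> (V j1 \<triangleright> S j2 j4 j6 a4) \<bullet> S j1 j6 j5 a3)"
  using tet_upside_down[OF j, of "vy j3 (j2\<^sup>\<star>) (j1\<^sup>\<star>) a1" "vy j5 (j4\<^sup>\<star>) (j3\<^sup>\<star>) a2"
      "vy j1 j6 (j5\<^sup>\<star>) a3" "vy j2 j4 (j6\<^sup>\<star>) a4"] j
  by (simp add: sixj_tet arot_vy)

lemma Arrow_mor: "\<lbrakk>src f = A; tgt f = B\<rbrakk> \<Longrightarrow> Arrow A (mor f) B = f"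
  by (intro arrow_eqI) auto

text \<open>
  The trace of a diagram is a linear functional of any of its parts, so that the expansions and the
  decomposition of the identity may be inserted in a diagram.
\<close>
lemma T_insert_S:
  assumes ijk: "i \<in> I" "j \<in> I" "k \<in> I" and D: "projective C D"
    and f: "\<guillemotleft>f : V k \<rightarrow> V i \<odot> V j\<guillemotright>" and X: "\<guillemotleft>X : D \<rightarrow> P \<odot> V k \<odot> Q\<guillemotright>"
    and G: "\<guillemotleft>G : P \<odot> (V i \<odot> V j) \<odot> Q \<rightarrow> D\<guillemotright>"
  shows "T (G \<bullet> (P \<triangleright> (f \<triangleleft> Q)) \<bullet> X) =
    (\<Sum>a\<in>{1..\<delta> i j (k\<^sup>\<star>)}. T (F i j k a \<bullet> f) * T (G \<bullet> (P \<triangleright> (S i j k a \<triangleleft> Q)) \<bullet> X))"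
proof -
  let ?\<phi> = "\<lambda>m. T (G \<bullet> (P \<triangleright> (Arrow (V k) m (V i \<odot> V j) \<triangleleft> Q)) \<bullet> X)"
  have "?\<phi> (mor f) = (\<Sum>a\<in>{1..\<delta> i j (k\<^sup>\<star>)}. T (F i j k a \<bullet> f) * ?\<phi> (mor (S i j k a)))"
    unfolding S_expansion[OF ijk f]
    by (rule functional_sum[OF functional_T[OF D X G]]) (intro mor_in S_arr[OF ijk])
  then show ?thesis using f S_arr[OF ijk] by (simp add: Arrow_mor)
qed

lemma T_insert_F:
  assumes ijk: "i \<in> I" "j \<in> I" "k \<in> I" and D: "projective C D"
    and g: "\<guillemotleft>g : V i \<odot> V j \<rightarrow> V k\<guillemotright>" and X: "\<guillemotleft>X : D \<rightarrow> P \<odot> (V i \<odot> V j) \<odot> Q\<guillemotright>"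
    and G: "\<guillemotleft>G : P \<odot> V k \<odot> Q \<rightarrow> D\<guillemotright>"
  shows "T (G \<bullet> (P \<triangleright> (g \<triangleleft> Q)) \<bullet> X) =
    (\<Sum>a\<in>{1..\<delta> i j (k\<^sup>\<star>)}. T (g \<bullet> S i j k a) * T (G \<bullet> (P \<triangleright> (F i j k a \<triangleleft> Q)) \<bullet> X))"
proof -
  let ?\<phi> = "\<lambda>m. T (G \<bullet> (P \<triangleright> (Arrow (V i \<odot> V j) m (V k) \<triangleleft> Q)) \<bullet> X)"
  have "?\<phi> (mor g) = (\<Sum>a\<in>{1..\<delta> i j (k\<^sup>\<star>)}. T (g \<bullet> S i j k a) * ?\<phi> (mor (F i j k a)))"
    unfolding F_expansion[OF ijk g]
    by (rule functional_sum[OF functional_T[OF D X G]]) (intro mor_in F_arr[OF ijk])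
  then show ?thesis using g F_arr[OF ijk] by (simp add: Arrow_mor)
qed

lemma T_insert_complete:
  assumes ij: "i \<in> I" "j \<in> I" "deg i + deg j \<notin> Sing C" and D: "projective C D"
    and X: "\<guillemotleft>X : D \<rightarrow> P \<odot> (V i \<odot> V j) \<odot> Q\<guillemotright>" and G: "\<guillemotleft>G : P \<odot> (V i \<odot> V j) \<odot> Q \<rightarrow> D\<guillemotright>"
  shows "T (G \<bullet> X) = (\<Sum>k\<in>lab (deg i + deg j). \<Sum>a\<in>{1..\<delta> i j (k\<^sup>\<star>)}.
    d k * T (G \<bullet> (P \<triangleright> ((S i j k a \<bullet> F i j k a) \<triangleleft> Q)) \<bullet> X))"
proof -
  let ?Y = "V i \<odot> V j"
  let ?\<phi> = "\<lambda>m. T (G \<bullet> (P \<triangleright> (Arrow ?Y m ?Y \<triangleleft> Q)) \<bullet> X)"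
  note fn = functional_T[OF D X G]
  have SF: "\<guillemotleft>S i j k a \<bullet> F i j k a : ?Y \<rightarrow> ?Y\<guillemotright>" if "k \<in> I" for k a
    using S_arr[OF ij(1,2) that] F_arr[OF ij(1,2) that] by simp
  let ?m = "\<lambda>k. \<Sum>a\<in>{1..\<delta> i j (k\<^sup>\<star>)}. smult C (d k) (mor (S i j k a \<bullet> F i j k a))"
  have "T (G \<bullet> X) = ?\<phi> (mor (one ?Y))"
    using X G by (simp add: Arrow_mor)
  also have "\<dots> = ?\<phi> (\<Sum>k\<in>lab (deg i + deg j). smult C 1 (?m k))"
    unfolding mor_one completeness[OF ij, symmetric] by simp
  also have "\<dots> = (\<Sum>k\<in>lab (deg i + deg j). 1 * ?\<phi> (?m k))"
    by (rule functional_sum[OF fn]) (intro Hom_sum Hom_smult mor_in SF, simp)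
  also have "\<dots> = (\<Sum>k\<in>lab (deg i + deg j). \<Sum>a\<in>{1..\<delta> i j (k\<^sup>\<star>)}. d k * ?\<phi> (mor (S i j k a \<bullet> F i j k a)))"
  proof (intro sum.cong refl)
    fix k assume "k \<in> lab (deg i + deg j)"
    then have "?\<phi> (?m k) = (\<Sum>a\<in>{1..\<delta> i j (k\<^sup>\<star>)}. d k * ?\<phi> (mor (S i j k a \<bullet> F i j k a)))"
      by (intro functional_sum[OF fn] mor_in SF) simp
    then show "1 * ?\<phi> (?m k) = \<dots>" by simp
  qed
  also have "\<dots> = (\<Sum>k\<in>lab (deg i + deg j). \<Sum>a\<in>{1..\<delta> i j (k\<^sup>\<star>)}.
    d k * T (G \<bullet> (P \<triangleright> ((S i j k a \<bullet> F i j k a) \<triangleleft> Q)) \<bullet> X))"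
  proof (intro sum.cong refl)
    fix k a assume "k \<in> lab (deg i + deg j)"
    then have "Arrow ?Y (mor (S i j k a \<bullet> F i j k a)) ?Y = S i j k a \<bullet> F i j k a"
      using SF[of k a] by (intro Arrow_mor) auto
    then show "d k * ?\<phi> (mor (S i j k a \<bullet> F i j k a)) =
        d k * T (G \<bullet> (P \<triangleright> ((S i j k a \<bullet> F i j k a) \<triangleleft> Q)) \<bullet> X)" by simp
  qed
  finally show ?thesis .
qed

text \<open>
  The sum over \<open>a3\<close> joins the two tetrahedra to one trace, by the expansion in splittings, and the sum over
  \<open>n\<close> and \<open>a4\<close> is a decomposition of the identity of \<open>V j \<odot> V l\<close>. There remains the trace of
  \<open>F \<bullet> (F \<otimes> 1) \<bullet> (S \<otimes> 1) \<bullet> S\<close>, which is evaluated by Schur's lemma.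
\<close>
lemma sixj_orthogonal:
  assumes L: "i \<in> I" "j \<in> I" "k \<in> I" "l \<in> I" "m \<in> I" "p \<in> I" and g: "deg j + deg l \<notin> Sing C"
    and a1: "a1 \<in> {1..\<delta> i j (p\<^sup>\<star>)}" and a2: "a2 \<in> {1..\<delta> p l (m\<^sup>\<star>)}"
  shows "(\<Sum>n\<in>lab (deg j + deg l). \<Sum>a3\<in>{1..\<delta> m (n\<^sup>\<star>) (i\<^sup>\<star>)}. \<Sum>a4\<in>{1..\<delta> n (l\<^sup>\<star>) (j\<^sup>\<star>)}.
         d n * N i j p l m n a1 a2 a3 a4 * N k (j\<^sup>\<star>) i n m l a1' a3 a2' a4)
      = (if k = p \<and> a1 = a1' \<and> a2 = a2' then 1 / d k else 0)"
    (is "?lhs = ?rhs")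
proof -
  note F1 = F_arr[OF L(1,2,3), of a1'] and F2 = F_arr[OF L(3,4,5), of a2']
    and S1 = S_arr[OF L(1,2,6), of a1] and S2 = S_arr[OF L(6,4,5), of a2]
  let ?X = "(S i j p a1 \<triangleleft> V l) \<bullet> S p l m a2"
  let ?G = "F k l m a2' \<bullet> (F i j k a1' \<triangleleft> V l)"
  have X: "\<guillemotleft>?X : V m \<rightarrow> V i \<odot> (V j \<odot> V l) \<odot> \<I>\<guillemotright>" using S1 S2 by simp
  have G: "\<guillemotleft>?G : V i \<odot> (V j \<odot> V l) \<odot> \<I> \<rightarrow> V m\<guillemotright>" using F1 F2 by simp
  have inner: "(\<Sum>a3\<in>{1..\<delta> m (n\<^sup>\<star>) (i\<^sup>\<star>)}. N i j p l m n a1 a2 a3 a4 * N k (j\<^sup>\<star>) i n m l a1' a3 a2' a4)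
      = T (?G \<bullet> (V i \<triangleright> ((S j l n a4 \<bullet> F j l n a4) \<triangleleft> \<I>)) \<bullet> ?X)" if n: "n \<in> I" for n a4
  proof -
    note S3 = S_arr[OF L(2,4) n, of a4] and F3 = F_arr[OF L(2,4) n, of a4]
    let ?f = "(V i \<triangleright> F j l n a4) \<bullet> ?X" and ?H = "?G \<bullet> (V i \<triangleright> S j l n a4)"
    have f: "\<guillemotleft>?f : V m \<rightarrow> V i \<odot> V n\<guillemotright>" using S1 S2 F3 by simp
    have H: "\<guillemotleft>?H : \<I> \<odot> (V i \<odot> V n) \<odot> \<I> \<rightarrow> V m\<guillemotright>" using F1 F2 S3 by simp
    have "T (?G \<bullet> (V i \<triangleright> ((S j l n a4 \<bullet> F j l n a4) \<triangleleft> \<I>)) \<bullet> ?X) = T (?H \<bullet> (\<I> \<triangleright> (?f \<triangleleft> \<I>)) \<bullet> one (V m))"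
      using F1 F2 S3 S1 S2 F3 by (simp add: acomp_assoc)
    also have "\<dots> = (\<Sum>a\<in>{1..\<delta> i n (m\<^sup>\<star>)}. T (F i n m a \<bullet> ?f) * T (?H \<bullet> (\<I> \<triangleright> (S i n m a \<triangleleft> \<I>)) \<bullet> one (V m)))"
      by (rule T_insert_S[OF L(1) n L(5) projective_V[OF L(5)] f _ H]) simp
    also have "\<dots> = (\<Sum>a\<in>{1..\<delta> i n (m\<^sup>\<star>)}. N i j p l m n a1 a2 a a4 * N k (j\<^sup>\<star>) i n m l a1' a a2' a4)"
      using F1 F2 S3 S_arr[OF L(1) n L(5)]
      by (simp add: sixj_eq[OF L(1,2,6,4,5) n] sixj_upside_down[OF L(1,2,3,4,5) n] acomp_assoc)
    finally show ?thesis using mult_dim_fuse[OF L(1) n L(5)] by simp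
  qed
  have "?lhs = (\<Sum>n\<in>lab (deg j + deg l). \<Sum>a4\<in>{1..\<delta> j l (n\<^sup>\<star>)}. d n *
      (\<Sum>a3\<in>{1..\<delta> m (n\<^sup>\<star>) (i\<^sup>\<star>)}. N i j p l m n a1 a2 a3 a4 * N k (j\<^sup>\<star>) i n m l a1' a3 a2' a4))"
  proof (rule sum.cong[OF refl])
    fix n assume "n \<in> lab (deg j + deg l)"
    then have n: "n \<in> I" by simp
    show "(\<Sum>a3\<in>{1..\<delta> m (n\<^sup>\<star>) (i\<^sup>\<star>)}. \<Sum>a4\<in>{1..\<delta> n (l\<^sup>\<star>) (j\<^sup>\<star>)}.
         d n * N i j p l m n a1 a2 a3 a4 * N k (j\<^sup>\<star>) i n m l a1' a3 a2' a4) =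
      (\<Sum>a4\<in>{1..\<delta> j l (n\<^sup>\<star>)}. d n *
        (\<Sum>a3\<in>{1..\<delta> m (n\<^sup>\<star>) (i\<^sup>\<star>)}. N i j p l m n a1 a2 a3 a4 * N k (j\<^sup>\<star>) i n m l a1' a3 a2' a4))"
      unfolding mult_dim_fuse[OF L(2,4) n]
      by (subst sum.swap) (simp add: sum_distrib_left mult.assoc)
  qed
  also have "\<dots> = (\<Sum>n\<in>lab (deg j + deg l). \<Sum>a4\<in>{1..\<delta> j l (n\<^sup>\<star>)}. d n *
      T (?G \<bullet> (V i \<triangleright> ((S j l n a4 \<bullet> F j l n a4) \<triangleleft> \<I>)) \<bullet> ?X))"
    by (intro sum.cong refl) (simp only: inner mem_Collect_eq)
  also have "\<dots> = T (?G \<bullet> ?X)"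
    by (rule T_insert_complete[OF L(2,4) g projective_V[OF L(5)] X G, symmetric])
  also have "\<dots> = T (F k l m a2' \<bullet> ((F i j k a1' \<bullet> S i j p a1) \<triangleleft> V l) \<bullet> S p l m a2)"
    using F1 F2 S1 S2 by (simp add: acomp_assoc)
  also have "\<dots> = ?rhs"
  proof (cases "k = p")
    case True
    let ?c = "if a1' = a1 then 1 / d k else 0"
    have "F k l m a2' \<bullet> ((F i j k a1' \<bullet> S i j p a1) \<triangleleft> V l) \<bullet> S p l m a2 = ?c *\<^sub>a (F k l m a2' \<bullet> S k l m a2)"
      using F_S[OF L(1,2,3), of a1 a1'] a1 F2 S2 unfolding True by simp
    then have "T (F k l m a2' \<bullet> ((F i j k a1' \<bullet> S i j p a1) \<triangleleft> V l) \<bullet> S p l m a2) = ?c * T (F k l m a2' \<bullet> S k l m a2)"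
      using T_scale[OF projective_V[OF L(5)], of "F k l m a2' \<bullet> S k l m a2" ?c] F2 S2 True by simp
    then show ?thesis using T_F_S[OF L(3,4,5), of a2 a2'] a2 True by auto
  next
    case False
    let ?h = "F i j k a1' \<bullet> S i j p a1"
    have h: "\<guillemotleft>?h : V p \<rightarrow> V k\<guillemotright>" using F1 S1 by simp
    have z: "0 *\<^sub>a ?h = ?h" using L False h by (intro schur_zero[of p k]) auto
    have e: "\<guillemotleft>F k l m a2' \<bullet> (?h \<triangleleft> V l) \<bullet> S p l m a2 : V m \<rightarrow> V m\<guillemotright>" using F2 S2 h by simp
    have "F k l m a2' \<bullet> ((0 *\<^sub>a ?h) \<triangleleft> V l) \<bullet> S p l m a2 = 0 *\<^sub>a (F k l m a2' \<bullet> (?h \<triangleleft> V l) \<bullet> S p l m a2)"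
      using F2 S2 F1 S1 by simp
    then show ?thesis
      unfolding z using T_scale[OF projective_V[OF L(5)] e, of 0] False by simp
  qed
  finally show ?thesis .
qed

text \<open>
  Both sides evaluate the trace \<open>T (?G \<bullet> ?X)\<close> of the diagram that successively splits off \<open>j4\<close>, \<open>j3\<close> and \<open>j2\<close> from
  \<open>j0\<close> and then fuses \<open>j3\<close> with \<open>j4\<close>, the result with \<open>j2\<close>, and that with \<open>j1\<close>. On the right-hand side an expansion
  is inserted on \<open>V j5 \<odot> V j8\<close>, on the left-hand side the decomposition of the identity of \<open>V j2 \<odot> V j3\<close>.
\<close>
lemma sixj_pentagon:
  fixes j0 j1 j2 j3 j4 j5 j6 j7 j8
  assumes L: "j0 \<in> I" "j1 \<in> I" "j2 \<in> I" "j3 \<in> I" "j4 \<in> I" "j5 \<in> I" "j6 \<in> I" "j7 \<in> I" "j8 \<in> I"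
    and g: "deg j2 + deg j3 \<notin> Sing C"
  shows "(\<Sum>j\<in>lab (deg j2 + deg j3).
         \<Sum>c1\<in>{1..\<delta> j6 (j\<^sup>\<star>) (j1\<^sup>\<star>)}. \<Sum>c2\<in>{1..\<delta> j (j3\<^sup>\<star>) (j2\<^sup>\<star>)}. \<Sum>c3\<in>{1..\<delta> j7 (j4\<^sup>\<star>) (j\<^sup>\<star>)}.
           d j * N j1 j2 j5 j3 j6 j a1 a2 c1 c2
               * N j1 j j6 j4 j0 j7 c1 a3 a0 c3
               * N j2 j3 j j4 j7 j8 c2 c3 a4 a5)
      = (\<Sum>c4\<in>{1..\<delta> j0 (j8\<^sup>\<star>) (j5\<^sup>\<star>)}.
           N j5 j3 j6 j4 j0 j8 a2 a3 c4 a5 * N j1 j2 j5 j8 j0 j7 a1 c4 a0 a4)"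
    (is "?lhs = ?rhs")
proof -
  define Z1 where "Z1 = F j1 j7 j0 a0"
  define Z2 where "Z2 = F j2 j8 j7 a4"
  define Z3 where "Z3 = F j3 j4 j8 a5"
  define Y1 where "Y1 = S j1 j2 j5 a1"
  define Y2 where "Y2 = S j5 j3 j6 a2"
  define Y3 where "Y3 = S j6 j4 j0 a3"
  have Z1: "\<guillemotleft>Z1 : V j1 \<odot> V j7 \<rightarrow> V j0\<guillemotright>" and Z2: "\<guillemotleft>Z2 : V j2 \<odot> V j8 \<rightarrow> V j7\<guillemotright>"
    and Z3: "\<guillemotleft>Z3 : V j3 \<odot> V j4 \<rightarrow> V j8\<guillemotright>"
    unfolding Z1_def Z2_def Z3_def by (intro F_arr L)+
  have Y1: "\<guillemotleft>Y1 : V j5 \<rightarrow> V j1 \<odot> V j2\<guillemotright>" and Y2: "\<guillemotleft>Y2 : V j6 \<rightarrow> V j5 \<odot> V j3\<guillemotright>"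
    and Y3: "\<guillemotleft>Y3 : V j0 \<rightarrow> V j6 \<odot> V j4\<guillemotright>"
    unfolding Y1_def Y2_def Y3_def by (intro S_arr L)+
  note ar = Z1 Z2 Z3 Y1 Y2 Y3
  note P0 = projective_V[OF L(1)]
  let ?G = "Z1 \<bullet> (V j1 \<triangleright> Z2) \<bullet> ((V j1 \<odot> V j2) \<triangleright> Z3)"
  let ?X = "(Y1 \<triangleleft> (V j3 \<odot> V j4)) \<bullet> (Y2 \<triangleleft> V j4) \<bullet> Y3"
  have rhs: "?rhs = T (?G \<bullet> ?X)"
  proof -
    let ?f = "(V j5 \<triangleright> Z3) \<bullet> (Y2 \<triangleleft> V j4) \<bullet> Y3" and ?H = "Z1 \<bullet> (V j1 \<triangleright> Z2) \<bullet> (Y1 \<triangleleft> V j8)"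
    have f: "\<guillemotleft>?f : V j0 \<rightarrow> V j5 \<odot> V j8\<guillemotright>" using ar by simp
    have H: "\<guillemotleft>?H : \<I> \<odot> (V j5 \<odot> V j8) \<odot> \<I> \<rightarrow> V j0\<guillemotright>" using ar by simp
    have "T (?G \<bullet> ?X) = T (Z1 \<bullet> (V j1 \<triangleright> Z2) \<bullet> ((tgt Y1 \<triangleright> Z3) \<bullet> (Y1 \<triangleleft> src Z3)) \<bullet> (Y2 \<triangleleft> V j4) \<bullet> Y3)"
      using ar by (simp add: acomp_assoc)
    also have "(tgt Y1 \<triangleright> Z3) \<bullet> (Y1 \<triangleleft> src Z3) = (Y1 \<triangleleft> tgt Z3) \<bullet> (src Y1 \<triangleright> Z3)"
      using ar by (intro interchange[symmetric]) auto
    also have "T (Z1 \<bullet> (V j1 \<triangleright> Z2) \<bullet> ((Y1 \<triangleleft> tgt Z3) \<bullet> (src Y1 \<triangleright> Z3)) \<bullet> (Y2 \<triangleleft> V j4) \<bullet> Y3) =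
        T (?H \<bullet> (\<I> \<triangleright> (?f \<triangleleft> \<I>)) \<bullet> one (V j0))"
      using ar by (simp add: acomp_assoc)
    also have "\<dots> = (\<Sum>a\<in>{1..\<delta> j5 j8 (j0\<^sup>\<star>)}. T (F j5 j8 j0 a \<bullet> ?f) * T (?H \<bullet> (\<I> \<triangleright> (S j5 j8 j0 a \<triangleleft> \<I>)) \<bullet> one (V j0)))"
      by (rule T_insert_S[OF L(6,9,1) P0 f _ H]) simp
    also have "\<dots> = ?rhs"
      using ar S_arr[OF L(6,9,1)] mult_dim_fuse[OF L(6,9,1)]
      by (simp add: sixj_eq L Z1_def[symmetric] Z2_def[symmetric] Z3_def[symmetric]
          Y1_def[symmetric] Y2_def[symmetric] Y3_def[symmetric] acomp_assoc)
    finally show ?thesis by simp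
  qed
  have inner: "(\<Sum>c1\<in>{1..\<delta> j6 (j\<^sup>\<star>) (j1\<^sup>\<star>)}. \<Sum>c3\<in>{1..\<delta> j7 (j4\<^sup>\<star>) (j\<^sup>\<star>)}.
        N j1 j2 j5 j3 j6 j a1 a2 c1 c2 * N j1 j j6 j4 j0 j7 c1 a3 a0 c3 * N j2 j3 j j4 j7 j8 c2 c3 a4 a5) =
      T (?G \<bullet> (V j1 \<triangleright> ((S j2 j3 j c2 \<bullet> F j2 j3 j c2) \<triangleleft> V j4)) \<bullet> ?X)" if j: "j \<in> I" for j c2
  proof -
    note Sc = S_arr[OF L(3,4) j, of c2] and Fc = F_arr[OF L(3,4) j, of c2]
    let ?f = "(V j1 \<triangleright> F j2 j3 j c2) \<bullet> (Y1 \<triangleleft> V j3) \<bullet> Y2"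
    let ?g = "Z2 \<bullet> (V j2 \<triangleright> Z3) \<bullet> (S j2 j3 j c2 \<triangleleft> V j4)"
    have f: "\<guillemotleft>?f : V j6 \<rightarrow> V j1 \<odot> V j\<guillemotright>" using ar Fc by simp
    have g': "\<guillemotleft>?g : V j \<odot> V j4 \<rightarrow> V j7\<guillemotright>" using ar Sc by simp
    have "T (?G \<bullet> (V j1 \<triangleright> ((S j2 j3 j c2 \<bullet> F j2 j3 j c2) \<triangleleft> V j4)) \<bullet> ?X) =
        T (Z1 \<bullet> (V j1 \<triangleright> (?g \<triangleleft> \<I>)) \<bullet> ((?f \<triangleleft> V j4) \<bullet> Y3))"
      using ar Sc Fc by (simp add: acomp_assoc)
    also have "\<dots> = (\<Sum>c3\<in>{1..\<delta> j j4 (j7\<^sup>\<star>)}. T (?g \<bullet> S j j4 j7 c3) *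
        T (Z1 \<bullet> (V j1 \<triangleright> (F j j4 j7 c3 \<triangleleft> \<I>)) \<bullet> ((?f \<triangleleft> V j4) \<bullet> Y3)))"
      using ar f Fc by (intro T_insert_F[OF j L(5,8) P0 g']) auto
    also have "\<dots> = (\<Sum>c3\<in>{1..\<delta> j j4 (j7\<^sup>\<star>)}. N j2 j3 j j4 j7 j8 c2 c3 a4 a5 *
        (\<Sum>c1\<in>{1..\<delta> j1 j (j6\<^sup>\<star>)}. N j1 j2 j5 j3 j6 j a1 a2 c1 c2 * N j1 j j6 j4 j0 j7 c1 a3 a0 c3))"
    proof (intro sum.cong refl arg_cong2[where f = "(*)"])
      fix c3
      note F3 = F_arr[OF j L(5,8), of c3] and S3 = S_arr[OF j L(5,8), of c3]
      show "T (?g \<bullet> S j j4 j7 c3) = N j2 j3 j j4 j7 j8 c2 c3 a4 a5"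
        using ar Sc S3 by (simp add: sixj_eq L j Z2_def[symmetric] Z3_def[symmetric] acomp_assoc)
      let ?H = "Z1 \<bullet> (V j1 \<triangleright> F j j4 j7 c3)"
      have "T (Z1 \<bullet> (V j1 \<triangleright> (F j j4 j7 c3 \<triangleleft> \<I>)) \<bullet> ((?f \<triangleleft> V j4) \<bullet> Y3)) = T (?H \<bullet> (\<I> \<triangleright> (?f \<triangleleft> V j4)) \<bullet> Y3)"
        using ar Fc F3 by (simp add: acomp_assoc)
      also have "\<dots> = (\<Sum>c1\<in>{1..\<delta> j1 j (j6\<^sup>\<star>)}. T (F j1 j j6 c1 \<bullet> ?f) * T (?H \<bullet> (\<I> \<triangleright> (S j1 j j6 c1 \<triangleleft> V j4)) \<bullet> Y3))"
        using ar F3 by (intro T_insert_S[OF L(2) j L(7) P0 f]) auto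
      also have "\<dots> = (\<Sum>c1\<in>{1..\<delta> j1 j (j6\<^sup>\<star>)}. N j1 j2 j5 j3 j6 j a1 a2 c1 c2 * N j1 j j6 j4 j0 j7 c1 a3 a0 c3)"
        using ar F3 S_arr[OF L(2) j L(7)]
        by (simp add: sixj_eq L j Z1_def[symmetric] Y1_def[symmetric] Y2_def[symmetric] Y3_def[symmetric] acomp_assoc)
      finally show "T (Z1 \<bullet> (V j1 \<triangleright> (F j j4 j7 c3 \<triangleleft> \<I>)) \<bullet> ((?f \<triangleleft> V j4) \<bullet> Y3)) = \<dots>" .
    qed
    also have "\<dots> = (\<Sum>c1\<in>{1..\<delta> j6 (j\<^sup>\<star>) (j1\<^sup>\<star>)}. \<Sum>c3\<in>{1..\<delta> j7 (j4\<^sup>\<star>) (j\<^sup>\<star>)}.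
        N j1 j2 j5 j3 j6 j a1 a2 c1 c2 * N j1 j j6 j4 j0 j7 c1 a3 a0 c3 * N j2 j3 j j4 j7 j8 c2 c3 a4 a5)"
      unfolding mult_dim_fuse[OF j L(5,8)] mult_dim_fuse[OF L(2) j L(7)]
      by (subst sum.swap) (simp add: sum_distrib_left mult_ac)
    finally show ?thesis by simp
  qed
  have "?lhs = (\<Sum>j\<in>lab (deg j2 + deg j3). \<Sum>c2\<in>{1..\<delta> j2 j3 (j\<^sup>\<star>)}. d j *
      (\<Sum>c1\<in>{1..\<delta> j6 (j\<^sup>\<star>) (j1\<^sup>\<star>)}. \<Sum>c3\<in>{1..\<delta> j7 (j4\<^sup>\<star>) (j\<^sup>\<star>)}.
        N j1 j2 j5 j3 j6 j a1 a2 c1 c2 * N j1 j j6 j4 j0 j7 c1 a3 a0 c3 * N j2 j3 j j4 j7 j8 c2 c3 a4 a5))"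
  proof (rule sum.cong[OF refl])
    fix j assume "j \<in> lab (deg j2 + deg j3)"
    then have j: "j \<in> I" by simp
    show "(\<Sum>c1\<in>{1..\<delta> j6 (j\<^sup>\<star>) (j1\<^sup>\<star>)}. \<Sum>c2\<in>{1..\<delta> j (j3\<^sup>\<star>) (j2\<^sup>\<star>)}. \<Sum>c3\<in>{1..\<delta> j7 (j4\<^sup>\<star>) (j\<^sup>\<star>)}.
        d j * N j1 j2 j5 j3 j6 j a1 a2 c1 c2 * N j1 j j6 j4 j0 j7 c1 a3 a0 c3 * N j2 j3 j j4 j7 j8 c2 c3 a4 a5) =
      (\<Sum>c2\<in>{1..\<delta> j2 j3 (j\<^sup>\<star>)}. d j * (\<Sum>c1\<in>{1..\<delta> j6 (j\<^sup>\<star>) (j1\<^sup>\<star>)}. \<Sum>c3\<in>{1..\<delta> j7 (j4\<^sup>\<star>) (j\<^sup>\<star>)}.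
        N j1 j2 j5 j3 j6 j a1 a2 c1 c2 * N j1 j j6 j4 j0 j7 c1 a3 a0 c3 * N j2 j3 j j4 j7 j8 c2 c3 a4 a5))"
      unfolding mult_dim_fuse[OF L(3,4) j]
      by (subst sum.swap) (simp add: sum_distrib_left mult.assoc)
  qed
  also have "\<dots> = (\<Sum>j\<in>lab (deg j2 + deg j3). \<Sum>c2\<in>{1..\<delta> j2 j3 (j\<^sup>\<star>)}. d j *
      T (?G \<bullet> (V j1 \<triangleright> ((S j2 j3 j c2 \<bullet> F j2 j3 j c2) \<triangleleft> V j4)) \<bullet> ?X))"
    by (intro sum.cong refl) (simp only: inner mem_Collect_eq)
  also have "\<dots> = T (?G \<bullet> ?X)"
    using ar by (intro T_insert_complete[OF L(3,4) g P0, symmetric]) auto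
  finally show ?thesis unfolding rhs .
qed

subsection \<open>Norms of the basis vectors\<close>

lemma gamma_T: "\<lbrakk>i \<in> I; j \<in> I; k \<in> I\<rbrakk> \<Longrightarrow> \<gamma> i j k n = T (vy i j k n \<bullet> adag (vy i j k n))"
  by (simp add: gamma_def herm_form_def T_def mor_acomp mor_adag)

lemma T_vy_orthogonal:
  assumes "i \<in> I" "j \<in> I" "k \<in> I" "m \<in> {1..\<delta> i j k}" "n \<in> {1..\<delta> i j k}"
  shows "T (vy i j k n \<bullet> adag (vy i j k m)) = (if m = n then \<gamma> i j k n else 0)"
proof (cases "m = n")
  case False
  have "herm_form C V dag i j k (y i j k m) (y i j k n) = 0"
    using hermitian_basic_data assms False unfolding hermitian_basic_data_def by blast
  then show ?thesis
    using False assms vertex_in[OF assms(4)] vertex_in[OF assms(5)]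
    by (simp add: herm_form_def T_def mor_acomp mor_adag)
qed (use assms gamma_T in simp)

lemma gamma_nonzero:
  assumes "i \<in> I" "j \<in> I" "k \<in> I" "n \<in> {1..\<delta> i j k}"
  shows "\<gamma> i j k n \<noteq> 0"
proof -
  have "herm_form C V dag i j k (y i j k n) (y i j k n) \<noteq> 0"
    using hermitian_basic_data assms unfolding hermitian_basic_data_def by blast
  then show ?thesis using vertex_in[OF assms(4)] by (simp add: gamma_def)
qed

lemma gamma_real: "\<lbrakk>i \<in> I; j \<in> I; k \<in> I\<rbrakk> \<Longrightarrow> bar (\<gamma> i j k n) = \<gamma> i j k n"
  using T_adag[OF projective_V3, of i j k "vy i j k n \<bullet> adag (vy i j k n)"] by (simp add: gamma_T)

text \<open>A vector bent to the left is its rotation bent to the right, and both bends have the factor \<open>\<beta> i\<close>.\<close>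
lemma gamma_rot:
  assumes "i \<in> I" "j \<in> I" "k \<in> I"
  shows "\<gamma> i j k n = \<gamma> j k i n"
proof -
  have r: "rb i (V j \<odot> V k) (vy j k i n) = lb i (V j \<odot> V k) (vy i j k n)"
    using rb_arot[OF assms, of "vy i j k n"] assms by (simp add: arot_vy)
  have "\<beta> i * \<gamma> j k i n = T (rb i (V j \<odot> V k) (vy j k i n) \<bullet> adag (rb i (V j \<odot> V k) (vy j k i n)))"
    using T_rb_adag[OF assms(1) projective_V2[OF assms(2,3)], of "vy j k i n" \<I> "vy j k i n"] assms
    by (simp add: gamma_T)
  also have "\<dots> = \<beta> i * \<gamma> i j k n"
    unfolding r using T_lb_adag[OF assms(1) projective_V2[OF assms(2,3)], of "vy i j k n" \<I> "vy i j k n"] assms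
    by (simp add: gamma_T)
  finally show ?thesis using beta_nonzero[OF assms(1)] by simp
qed

text \<open>
  The traces of \<open>adag (S i j k a)\<close> against the splittings \<open>S i j k b\<close> are values of the Hermitian form, which is
  diagonal on the basis; they are the coefficients of the expansion in fusions.
\<close>
lemma adag_S:
  assumes ijk: "i \<in> I" "j \<in> I" "k \<in> I" and a: "a \<in> {1..\<delta> i j (k\<^sup>\<star>)}"
  shows "adag (S i j k a) = (\<beta> k * \<gamma> i j (k\<^sup>\<star>) a) *\<^sub>a F i j k a"
proof -
  have k: "k\<^sup>\<star> \<in> I" "(k\<^sup>\<star>)\<^sup>\<star> = k" using ijk by auto
  note S = S_arr[OF ijk] and F = F_arr[OF ijk]
  have t: "T (adag (S i j k a) \<bullet> S i j k b) = (if b = a then \<beta> k * \<gamma> i j (k\<^sup>\<star>) a else 0)"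
    if b: "b \<in> {1..\<delta> i j (k\<^sup>\<star>)}" for b
  proof -
    have "T (adag (S i j k a) \<bullet> S i j k b) = T (S i j k b \<bullet> adag (S i j k a))"
      using S[of a] S[of b] ijk projective_V projective_V2 by (intro T_cyclic) auto
    also have "\<dots> = \<beta> (k\<^sup>\<star>) * T (vy i j (k\<^sup>\<star>) b \<bullet> adag (vy i j (k\<^sup>\<star>) a))"
      unfolding split_def using ijk k by (intro T_rb_adag projective_V2) auto
    finally show ?thesis
      using T_vy_orthogonal[OF ijk(1,2) k(1) a b] beta_star[OF ijk(3)] by auto
  qed
  have "mor (adag (S i j k a)) = (\<Sum>b\<in>{1..\<delta> i j (k\<^sup>\<star>)}. smult C (T (adag (S i j k a) \<bullet> S i j k b)) (mor (F i j k b)))"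
    using S[of a] by (intro F_expansion ijk) auto
  also have "\<dots> = (\<Sum>b\<in>{1..\<delta> i j (k\<^sup>\<star>)}. if b = a then smult C (\<beta> k * \<gamma> i j (k\<^sup>\<star>) a) (mor (F i j k a)) else 0)"
    by (intro sum.cong refl) (simp add: t)
  also have "\<dots> = smult C (\<beta> k * \<gamma> i j (k\<^sup>\<star>) a) (mor (F i j k a))" using a by simp
  finally show ?thesis using S[of a] F[of a] by (intro arrow_eqI) (auto simp: mor_ascale)
qed

lemma adag_F:
  assumes ijk: "i \<in> I" "j \<in> I" "k \<in> I" and a: "a \<in> {1..\<delta> i j (k\<^sup>\<star>)}"
  shows "adag (F i j k a) = (1 / (\<beta> k * \<gamma> i j (k\<^sup>\<star>) a)) *\<^sub>a S i j k a"
proof -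
  let ?c = "\<beta> k * \<gamma> i j (k\<^sup>\<star>) a"
  have c: "?c \<noteq> 0" "bar ?c = ?c"
    using beta_nonzero beta_real gamma_nonzero gamma_real ijk a by (auto simp: bar_mult)
  have "S i j k a = adag (?c *\<^sub>a F i j k a)"
    using adag_S[OF ijk a] S_arr[OF ijk, of a] adag_adag[of "S i j k a"] by simp
  also have "\<dots> = ?c *\<^sub>a adag (F i j k a)" using F_arr[OF ijk, of a] c by simp
  finally have "(1 / ?c) *\<^sub>a S i j k a = (1 / ?c * ?c) *\<^sub>a adag (F i j k a)" by simp
  then show ?thesis using c by simp
qed

text \<open>
  The norm of the fusion \<open>F i j (k\<^sup>\<star>) a\<close> is computed in two ways: from the norm of its vector by two bends, and
  from the norm of the dual splitting by \<open>adag_F\<close>.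
\<close>
lemma gamma_beta:
  assumes ijk: "i \<in> I" "j \<in> I" "k \<in> I" and a: "a \<in> {1..\<delta> i j k}"
  shows "\<gamma> i j k a * \<gamma> (k\<^sup>\<star>) (j\<^sup>\<star>) (i\<^sup>\<star>) a * \<beta> i * \<beta> j * \<beta> k = 1"
proof -
  have s: "i\<^sup>\<star> \<in> I" "j\<^sup>\<star> \<in> I" "k\<^sup>\<star> \<in> I" "(i\<^sup>\<star>)\<^sup>\<star> = i" "(j\<^sup>\<star>)\<^sup>\<star> = j" "(k\<^sup>\<star>)\<^sup>\<star> = k" using ijk by auto
  have a': "a \<in> {1..\<delta> i j ((k\<^sup>\<star>)\<^sup>\<star>)}" using a s by simp
  let ?y = "vy (k\<^sup>\<star>) (j\<^sup>\<star>) (i\<^sup>\<star>) a" and ?F = "F i j (k\<^sup>\<star>) a" and ?S = "S i j (k\<^sup>\<star>) a"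
  let ?c = "\<beta> k * \<gamma> i j k a"
  have c: "?c \<noteq> 0" using beta_nonzero gamma_nonzero ijk a by simp
  note F = F_arr[OF ijk(1,2) s(3), of a] and S = S_arr[OF ijk(1,2) s(3), of a]
  have r: "\<guillemotleft>rb (i\<^sup>\<star>) (V (k\<^sup>\<star>) \<odot> V (j\<^sup>\<star>)) ?y : V i \<rightarrow> V (k\<^sup>\<star>) \<odot> V (j\<^sup>\<star>)\<guillemotright>"
    using rb_arr[of "i\<^sup>\<star>" ?y \<I> "V (k\<^sup>\<star>) \<odot> V (j\<^sup>\<star>)"] ijk s by simp
  have "T (?F \<bullet> adag ?F) = \<beta> (j\<^sup>\<star>) * T (rb (i\<^sup>\<star>) (V (k\<^sup>\<star>) \<odot> V (j\<^sup>\<star>)) ?y \<bullet> adag (rb (i\<^sup>\<star>) (V (k\<^sup>\<star>) \<odot> V (j\<^sup>\<star>)) ?y))"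
    unfolding fuse_def using r s projective_V by (intro T_rb_adag) auto
  also have "T (rb (i\<^sup>\<star>) (V (k\<^sup>\<star>) \<odot> V (j\<^sup>\<star>)) ?y \<bullet> adag (rb (i\<^sup>\<star>) (V (k\<^sup>\<star>) \<odot> V (j\<^sup>\<star>)) ?y)) = \<beta> (i\<^sup>\<star>) * T (?y \<bullet> adag ?y)"
    using s projective_V2 by (intro T_rb_adag) auto
  finally have 1: "T (?F \<bullet> adag ?F) = \<beta> j * (\<beta> i * \<gamma> (k\<^sup>\<star>) (j\<^sup>\<star>) (i\<^sup>\<star>) a)"
    using ijk s by (simp add: gamma_T beta_star)
  have "T (?F \<bullet> adag ?F) = T ((1 / ?c) *\<^sub>a (?F \<bullet> ?S))"
    using adag_F[OF ijk(1,2) s(3) a'] beta_star[OF ijk(3)] F S s by simp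
  also have "\<dots> = 1 / ?c"
    using T_scale[OF projective_V[OF s(3)], of "?F \<bullet> ?S" "1 / ?c"] F S T_F_S[OF ijk(1,2) s(3) a', of a] by simp
  finally show ?thesis using 1 c by (simp add: field_simps)
qed

lemma sixj_zero:
  fixes j1 j2 j3 j4 j5 j6
  assumes j: "j1 \<in> I" "j2 \<in> I" "j3 \<in> I" "j4 \<in> I" "j5 \<in> I" "j6 \<in> I"
    and a: "\<not> (a1 \<in> {1..\<delta> j1 j2 (j3\<^sup>\<star>)} \<and> a2 \<in> {1..\<delta> j3 j4 (j5\<^sup>\<star>)} \<and>
       a3 \<in> {1..\<delta> j5 (j6\<^sup>\<star>) (j1\<^sup>\<star>)} \<and> a4 \<in> {1..\<delta> j6 (j4\<^sup>\<star>) (j2\<^sup>\<star>)})"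
  shows "N j1 j2 j3 j4 j5 j6 a1 a2 a3 a4 = 0"
proof -
  note ar = F_arr[OF j(1,6,5), of a3] F_arr[OF j(2,4,6), of a4] S_arr[OF j(1,2,3), of a1] S_arr[OF j(3,4,5), of a2]
  let ?t = "\<lambda>f3 f4 s1 s2. f3 \<bullet> (V j1 \<triangleright> f4) \<bullet> (s1 \<triangleleft> V j4) \<bullet> s2"
  let ?f3 = "F j1 j6 j5 a3" and ?f4 = "F j2 j4 j6 a4" and ?s1 = "S j1 j2 j3 a1" and ?s2 = "S j3 j4 j5 a2"
  have "?t (0 *\<^sub>a ?f3) ?f4 ?s1 ?s2 = 0 *\<^sub>a ?t ?f3 ?f4 ?s1 ?s2"
    "?t ?f3 (0 *\<^sub>a ?f4) ?s1 ?s2 = 0 *\<^sub>a ?t ?f3 ?f4 ?s1 ?s2"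
    "?t ?f3 ?f4 (0 *\<^sub>a ?s1) ?s2 = 0 *\<^sub>a ?t ?f3 ?f4 ?s1 ?s2"
    "?t ?f3 ?f4 ?s1 (0 *\<^sub>a ?s2) = 0 *\<^sub>a ?t ?f3 ?f4 ?s1 ?s2"
    using ar by simp_all
  then have "?t ?f3 ?f4 ?s1 ?s2 = 0 *\<^sub>a ?t ?f3 ?f4 ?s1 ?s2"
    using a F_out[OF j(1,6,5)] F_out[OF j(2,4,6)] S_out[OF j(1,2,3)] S_out[OF j(3,4,5)] by metis
  moreover have "T (0 *\<^sub>a ?t ?f3 ?f4 ?s1 ?s2) = 0"
    using ar T_scale[OF projective_V[OF j(5)], of "?t ?f3 ?f4 ?s1 ?s2" 0] by simp
  ultimately show ?thesis using sixj_eq[OF j] by metis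
qed

text \<open>
  The dagger exchanges splittings and fusions and reverses their order, which gives the tetrahedron
  upside down. The first symmetry brings its labels into the form stated.
\<close>
lemma sixj_bar:
  fixes j1 j2 j3 j4 j5 j6
  assumes j: "j1 \<in> I" "j2 \<in> I" "j3 \<in> I" "j4 \<in> I" "j5 \<in> I" "j6 \<in> I"
  shows "bar (N j1 j2 j3 j4 j5 j6 a1 a2 a3 a4) = N (j2\<^sup>\<star>) (j1\<^sup>\<star>) (j3\<^sup>\<star>) j5 j4 j6 a1 a2 a4 a3
        * \<gamma> j1 j2 (j3\<^sup>\<star>) a1 * \<gamma> j3 j4 (j5\<^sup>\<star>) a2 * \<gamma> (j1\<^sup>\<star>) j5 (j6\<^sup>\<star>) a3 * \<gamma> (j2\<^sup>\<star>) j6 (j4\<^sup>\<star>) a4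
        * (\<beta> j1 * \<beta> j2 * \<beta> j3 * \<beta> j4 * \<beta> j5 * \<beta> j6)"
proof -
  have js: "j1\<^sup>\<star> \<in> I" "j2\<^sup>\<star> \<in> I" "j3\<^sup>\<star> \<in> I" "j4\<^sup>\<star> \<in> I" "j5\<^sup>\<star> \<in> I" "j6\<^sup>\<star> \<in> I" using j by auto
  have mirror: "N (j2\<^sup>\<star>) (j1\<^sup>\<star>) (j3\<^sup>\<star>) j5 j4 j6 a1 a2 a4 a3 = N j3 (j2\<^sup>\<star>) j1 j6 j5 j4 a1 a3 a2 a4"
    by (rule sixj_symmetric1[OF j(3) js(2) j(1,6,5,4), symmetric])
  have d1: "\<delta> j3 (j2\<^sup>\<star>) (j1\<^sup>\<star>) = \<delta> j1 j2 (j3\<^sup>\<star>)" by (rule mult_dim_fuse[OF j(1,2,3)])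
  have d2: "\<delta> j5 (j4\<^sup>\<star>) (j3\<^sup>\<star>) = \<delta> j3 j4 (j5\<^sup>\<star>)" by (rule mult_dim_fuse[OF j(3,4,5)])
  have d3: "\<delta> j1 j6 (j5\<^sup>\<star>) = \<delta> j5 (j6\<^sup>\<star>) (j1\<^sup>\<star>)" by (rule mult_dim_fuse[OF j(1,6,5), symmetric])
  have d4: "\<delta> j2 j4 (j6\<^sup>\<star>) = \<delta> j6 (j4\<^sup>\<star>) (j2\<^sup>\<star>)" by (rule mult_dim_fuse[OF j(2,4,6), symmetric])
  have d4': "\<delta> j4 (j6\<^sup>\<star>) j2 = \<delta> j2 j4 (j6\<^sup>\<star>)" by (rule mult_dim_rot[OF j(2,4) js(6), symmetric])
  show ?thesis
  proof (cases "a1 \<in> {1..\<delta> j1 j2 (j3\<^sup>\<star>)} \<and> a2 \<in> {1..\<delta> j3 j4 (j5\<^sup>\<star>)} \<and>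
       a3 \<in> {1..\<delta> j5 (j6\<^sup>\<star>) (j1\<^sup>\<star>)} \<and> a4 \<in> {1..\<delta> j6 (j4\<^sup>\<star>) (j2\<^sup>\<star>)}")
    case False
    have "N j3 (j2\<^sup>\<star>) j1 j6 j5 j4 a1 a3 a2 a4 = 0"
      using False j d1 d2 d3 d4 d4' by (intro sixj_zero[OF j(3) js(2) j(1,6,5,4)]) auto
    then show ?thesis using sixj_zero[OF j False] mirror bar_zero by simp
  next
    case True
    note ar = F_arr[OF j(1,6,5), of a3] F_arr[OF j(2,4,6), of a4] S_arr[OF j(1,2,3), of a1] S_arr[OF j(3,4,5), of a2]
      F_arr[OF j(1,2,3), of a1] F_arr[OF j(3,4,5), of a2] S_arr[OF j(1,6,5), of a3] S_arr[OF j(2,4,6), of a4]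
    let ?f = "F j1 j6 j5 a3 \<bullet> (V j1 \<triangleright> F j2 j4 j6 a4) \<bullet> (S j1 j2 j3 a1 \<triangleleft> V j4) \<bullet> S j3 j4 j5 a2"
    let ?h = "F j3 j4 j5 a2 \<bullet> (F j1 j2 j3 a1 \<triangleleft> V j4) \<bullet> (V j1 \<triangleright> S j2 j4 j6 a4) \<bullet> S j1 j6 j5 a3"
    define c1 where "c1 = \<beta> j3 * \<gamma> j1 j2 (j3\<^sup>\<star>) a1"
    define c2 where "c2 = \<beta> j5 * \<gamma> j3 j4 (j5\<^sup>\<star>) a2"
    define c3 where "c3 = \<gamma> (j1\<^sup>\<star>) j5 (j6\<^sup>\<star>) a3 * \<beta> j1 * \<beta> j6"
    define c4 where "c4 = \<gamma> (j2\<^sup>\<star>) j6 (j4\<^sup>\<star>) a4 * \<beta> j2 * \<beta> j4"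
    have c3: "1 / (\<beta> j5 * \<gamma> j1 j6 (j5\<^sup>\<star>) a3) = c3"
      using gamma_beta[OF j(1,6) js(5), of a3] gamma_rot[OF js(1) j(5) js(6), of a3] True d3 j
        beta_nonzero[OF j(5)] gamma_nonzero[OF j(1,6) js(5), of a3] beta_star[OF j(5)]
      by (simp add: c3_def field_simps)
    have c4: "1 / (\<beta> j6 * \<gamma> j2 j4 (j6\<^sup>\<star>) a4) = c4"
      using gamma_beta[OF j(2,4) js(6), of a4] gamma_rot[OF js(2) j(6) js(4), of a4] True d4 j
        beta_nonzero[OF j(6)] gamma_nonzero[OF j(2,4) js(6), of a4] beta_star[OF j(6)]
      by (simp add: c4_def field_simps)
    have s1: "adag (S j1 j2 j3 a1) = c1 *\<^sub>a F j1 j2 j3 a1"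
      unfolding c1_def using True by (intro adag_S[OF j(1,2,3)]) simp
    have s2: "adag (S j3 j4 j5 a2) = c2 *\<^sub>a F j3 j4 j5 a2"
      unfolding c2_def using True by (intro adag_S[OF j(3,4,5)]) simp
    have s3: "adag (F j1 j6 j5 a3) = c3 *\<^sub>a S j1 j6 j5 a3"
      unfolding c3[symmetric] using True d3 by (intro adag_F[OF j(1,6,5)]) simp
    have s4: "adag (F j2 j4 j6 a4) = c4 *\<^sub>a S j2 j4 j6 a4"
      unfolding c4[symmetric] using True d4 by (intro adag_F[OF j(2,4,6)]) simp
    have f: "\<guillemotleft>?f : V j5 \<rightarrow> V j5\<guillemotright>" and h: "\<guillemotleft>?h : V j5 \<rightarrow> V j5\<guillemotright>" using ar by simp_all
    have "adag ?f = (c1 * c2 * c3 * c4) *\<^sub>a ?h"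
      using ar by (simp add: s1 s2 s3 s4 acomp_assoc mult_ac)
    then have "bar (T ?f) = (c1 * c2 * c3 * c4) * T ?h"
      using T_adag[OF projective_V[OF j(5)] f] T_scale[OF projective_V[OF j(5)] h] by simp
    then show ?thesis
      unfolding mirror sixj_eq[OF j] sixj_upside_down[OF j]
      by (simp add: c1_def c2_def c3_def c4_def mult_ac)
  qed
qed

end

section \<open>LW data from Hermitian basic data\<close>

context based_category
begin

lemma mult_dim_degree:
  assumes "i \<in> I" "j \<in> I" "k \<in> I" "deg i + deg j + deg k \<noteq> 0"
  shows "\<delta> i j k = 0"
proof -
  have "V i \<odot> V j \<odot> V k \<in> Deg C (deg i + (deg j + deg k))"
    by (intro Deg_tensor V_Deg assms)
  then have "Hom C \<I> (V i \<odot> V j \<odot> V k) = {0}"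
    using Hom_Deg[OF Deg_unit] assms(4) by (metis add.assoc)
  then have "\<delta> i j k = vs.dim {0}" by (simp add: mult_dim_def mult_space_def)
  also have "\<dots> = 0" using vs.dim_eq_card[of "{}" "{0}"] by (simp add: vs.span_insert_0 vs.independent_empty)
  finally show ?thesis .
qed

end

context hermitian_based_category
begin

lemma labels_lab: "labels (Sing C) lab = I"
proof
  show "labels (Sing C) lab \<subseteq> I" by (auto simp: labels_def)
  show "I \<subseteq> labels (Sing C) lab"
  proof
    fix i assume i: "i \<in> I"
    then show "i \<in> labels (Sing C) lab"
      using V_Deg[OF i] deg_generic[OF i] unfolding labels_def by blast
  qed
qed

lemma lab_deg: "i \<in> lab g \<Longrightarrow> i \<in> I \<and> g = deg i"
  using Deg_V by blast

lemma bmap_star: "i \<in> I \<Longrightarrow> bmap C (V (i\<^sup>\<star>)) = bmap C (V i)"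
  by (rule bmap_dual[OF generic_V generic_V[OF star_in] star_iso, symmetric])

lemma bmap_labels_sum:
  assumes "g1 \<notin> Sing C" "g2 \<notin> Sing C" "g1 + g2 \<notin> Sing C" and j: "j \<in> lab (g1 + g2)"
  shows "bmap C (V j) = (\<Sum>j1\<in>lab g1. \<Sum>j2\<in>lab g2. bmap C (V j1) * bmap C (V j2) * of_nat (\<delta> (j\<^sup>\<star>) j1 j2))"
proof -
  have inj: "inj_on V (lab g)" for g
    using V_inj isomorphic_refl by (intro inj_onI) (metis (mono_tags, lifting) mem_Collect_eq)
  have "bmap C (V j) = (\<Sum>V1\<in>V ` lab g1. \<Sum>V2\<in>V ` lab g2.
      bmap C V1 * bmap C V2 * of_nat (hom_dim C (V j) (V1 \<odot> V2)))"
    using j by (intro bmap_sum[OF assms(1-3)] generic_V labels_of_degree_irr assms) auto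
  also have "\<dots> = (\<Sum>j1\<in>lab g1. \<Sum>j2\<in>lab g2.
      bmap C (V j1) * bmap C (V j2) * of_nat (hom_dim C (V j) (V j1 \<odot> V j2)))"
    by (simp add: sum.reindex[OF inj])
  also have "\<dots> = (\<Sum>j1\<in>lab g1. \<Sum>j2\<in>lab g2. bmap C (V j1) * bmap C (V j2) * of_nat (\<delta> (j\<^sup>\<star>) j1 j2))"
    using j by (intro sum.cong refl) (simp add: mult_dim_split)
  finally show ?thesis .
qed

lemma star_degree: "star ` lab g = lab (- g)"
proof
  show "star ` lab g \<subseteq> lab (- g)"
    using deg_star Deg_V_iff by (auto simp: Deg_V_iff)
  show "lab (- g) \<subseteq> star ` lab g"
  proof
    fix i assume "i \<in> lab (- g)"
    then have i: "i \<in> I" "deg i = - g" using lab_deg[of i "- g"] by auto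
    then have "i\<^sup>\<star> \<in> lab g" using deg_star[OF i(1)] by (simp add: Deg_V_iff)
    from imageI[OF this, of star] show "i \<in> star ` lab g" unfolding star_star[OF i(1)] .
  qed
qed

theorem LW_data:
  assumes b_real: "\<And>U. generic C U \<Longrightarrow> bar (bmap C U) = bmap C U"
  shows "LW_data bar (Sing C) lab star \<delta> (\<lambda>i. bmap C (V i)) d N \<beta> \<gamma>"
proof (intro LW_data.intro LW_data_axioms.intro, unfold labels_lab insert_subset)
  show "field_involution bar" by unfold_locales
  show "symmetric_subset (Sing C)" by (rule Sing_symmetric)
  show "small_subset (Sing C)" by (rule Sing_small)
  show "finite (lab g)" if "g \<notin> Sing C" for g by (rule label_degree_finite[OF that])
  show "lab g \<inter> lab h = {}" if "g \<noteq> h" for g h using lab_deg that by blast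
  show "(i\<^sup>\<star>)\<^sup>\<star> = i" if "i \<in> I" for i by (rule star_star[OF that])
  show "star ` lab g = lab (- g)" for g by (rule star_degree)
  show "\<delta> i j k = \<delta> j k i" if "i \<in> I" "j \<in> I" "k \<in> I" for i j k by (rule mult_dim_rot[OF that])
  show "\<delta> i j k = \<delta> (k\<^sup>\<star>) (j\<^sup>\<star>) (i\<^sup>\<star>)" if "i \<in> I" "j \<in> I" "k \<in> I" for i j k
    by (rule mult_dim_star[OF that])
  show "\<delta> i j k = 0" if "i \<in> lab f" "j \<in> lab g" "k \<in> lab h" "f + g + h \<noteq> 0" for f g h i j k
    using lab_deg[OF that(1)] lab_deg[OF that(2)] lab_deg[OF that(3)] that(4) by (intro mult_dim_degree) auto
  show "d i \<noteq> 0" if "i \<in> I" for i by (rule d_nonzero[OF that])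
  show "bar (d i) = d i" if "i \<in> I" for i by (rule d_real[OF that])
  show "d (i\<^sup>\<star>) = d i" if "i \<in> I" for i by (rule mdim_star[OF that])
  show "bmap C (V i) \<noteq> 0" if "i \<in> I" for i by (rule bmap_nonzero[OF generic_V[OF that]])
  show "bar (bmap C (V i)) = bmap C (V i)" if "i \<in> I" for i by (rule b_real[OF generic_V[OF that]])
  show "bmap C (V (i\<^sup>\<star>)) = bmap C (V i)" if "i \<in> I" for i by (rule bmap_star[OF that])
  show "bmap C (V j) = (\<Sum>j1\<in>lab g1. \<Sum>j2\<in>lab g2. bmap C (V j1) * bmap C (V j2) * of_nat (\<delta> (j\<^sup>\<star>) j1 j2))"
    if "g1 \<notin> Sing C" "g2 \<notin> Sing C" "g1 + g2 \<notin> Sing C" "j \<in> lab (g1 + g2)" for g1 g2 j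
    by (rule bmap_labels_sum[OF that])
  show "\<beta> i \<noteq> 0" if "i \<in> I" for i by (rule beta_nonzero[OF that])
  show "bar (\<beta> i) = \<beta> i" if "i \<in> I" for i by (rule beta_real[OF that])
  show "\<beta> (i\<^sup>\<star>) = \<beta> i" if "i \<in> I" for i by (rule beta_star[OF that])
  show "\<gamma> i j k n \<noteq> 0" if "i \<in> I" "j \<in> I" "k \<in> I" "n \<in> {1..\<delta> i j k}" for i j k n
    by (rule gamma_nonzero[OF that])
  show "bar (\<gamma> i j k n) = \<gamma> i j k n" if "i \<in> I" "j \<in> I" "k \<in> I" for i j k n
    by (rule gamma_real[OF that])
  show "\<gamma> i j k n * \<gamma> (k\<^sup>\<star>) (j\<^sup>\<star>) (i\<^sup>\<star>) n * \<beta> i * \<beta> j * \<beta> k = 1"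
    if "i \<in> I" "j \<in> I" "k \<in> I" "n \<in> {1..\<delta> i j k}" for i j k n
    by (rule gamma_beta[OF that])
next
  fix j1 j2 j3 j4 j5 j6 a1 a2 a3 a4
  assume "j1 \<in> I \<and> j2 \<in> I \<and> j3 \<in> I \<and> j4 \<in> I \<and> j5 \<in> I \<and> j6 \<in> I \<and> {} \<subseteq> I"
  then have j: "j1 \<in> I" "j2 \<in> I" "j3 \<in> I" "j4 \<in> I" "j5 \<in> I" "j6 \<in> I" by auto
  show "N j1 j2 j3 j4 j5 j6 a1 a2 a3 a4 = 0"
    if "\<not> (a1 \<in> {1..\<delta> j1 j2 (j3\<^sup>\<star>)} \<and> a2 \<in> {1..\<delta> j3 j4 (j5\<^sup>\<star>)} \<and>
       a3 \<in> {1..\<delta> j5 (j6\<^sup>\<star>) (j1\<^sup>\<star>)} \<and> a4 \<in> {1..\<delta> j6 (j4\<^sup>\<star>) (j2\<^sup>\<star>)})"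
    by (rule sixj_zero[OF j that])
  show "N j1 j2 j3 j4 j5 j6 a1 a2 a3 a4 = N j2 (j3\<^sup>\<star>) (j1\<^sup>\<star>) j5 j6 j4 a1 a3 a4 a2"
    by (rule sixj_symmetric1[OF j])
  show "N j1 j2 j3 j4 j5 j6 a1 a2 a3 a4 = N j3 j4 j5 (j6\<^sup>\<star>) j1 (j2\<^sup>\<star>) a2 a3 a1 a4"
    by (rule sixj_symmetric2[OF j])
  show "bar (N j1 j2 j3 j4 j5 j6 a1 a2 a3 a4) = N (j2\<^sup>\<star>) (j1\<^sup>\<star>) (j3\<^sup>\<star>) j5 j4 j6 a1 a2 a4 a3
        * \<gamma> j1 j2 (j3\<^sup>\<star>) a1 * \<gamma> j3 j4 (j5\<^sup>\<star>) a2 * \<gamma> (j1\<^sup>\<star>) j5 (j6\<^sup>\<star>) a3 * \<gamma> (j2\<^sup>\<star>) j6 (j4\<^sup>\<star>) a4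
        * (\<beta> j1 * \<beta> j2 * \<beta> j3 * \<beta> j4 * \<beta> j5 * \<beta> j6)"
    by (rule sixj_bar[OF j])
next
  fix j0 j1 j2 j3 j4 j5 j6 j7 j8 g2 g3 a0 a1 a2 a3 a4 a5
  assume L: "j0 \<in> I \<and> j1 \<in> I \<and> j2 \<in> I \<and> j3 \<in> I \<and> j4 \<in> I \<and> j5 \<in> I \<and> j6 \<in> I \<and> j7 \<in> I \<and> j8 \<in> I \<and> {} \<subseteq> I"
    and g: "j2 \<in> lab g2" "j3 \<in> lab g3" "g2 + g3 \<notin> Sing C"
  have e: "g2 = deg j2" "g3 = deg j3" using lab_deg[OF g(1)] lab_deg[OF g(2)] by auto
  show "(\<Sum>j\<in>lab (g2 + g3).
         \<Sum>c1\<in>{1..\<delta> j6 (j\<^sup>\<star>) (j1\<^sup>\<star>)}. \<Sum>c2\<in>{1..\<delta> j (j3\<^sup>\<star>) (j2\<^sup>\<star>)}. \<Sum>c3\<in>{1..\<delta> j7 (j4\<^sup>\<star>) (j\<^sup>\<star>)}.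
           d j * N j1 j2 j5 j3 j6 j a1 a2 c1 c2
               * N j1 j j6 j4 j0 j7 c1 a3 a0 c3
               * N j2 j3 j j4 j7 j8 c2 c3 a4 a5)
      = (\<Sum>c4\<in>{1..\<delta> j0 (j8\<^sup>\<star>) (j5\<^sup>\<star>)}.
           N j5 j3 j6 j4 j0 j8 a2 a3 c4 a5 * N j1 j2 j5 j8 j0 j7 a1 c4 a0 a4)"
    unfolding e by (rule sixj_pentagon) (use L g e in auto)
next
  fix i j k l m p g h a1 a2 a1' a2'
  assume L: "i \<in> I \<and> j \<in> I \<and> k \<in> I \<and> l \<in> I \<and> m \<in> I \<and> p \<in> I \<and> {} \<subseteq> I"
    and g: "j \<in> lab g" "l \<in> lab h" "g + h \<notin> Sing C"
    and a: "a1 \<in> {1..\<delta> i j (p\<^sup>\<star>)}" "a2 \<in> {1..\<delta> p l (m\<^sup>\<star>)}"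
  have e: "g = deg j" "h = deg l" using lab_deg[OF g(1)] lab_deg[OF g(2)] by auto
  show "(\<Sum>n\<in>lab (g + h). \<Sum>a3\<in>{1..\<delta> m (n\<^sup>\<star>) (i\<^sup>\<star>)}. \<Sum>a4\<in>{1..\<delta> n (l\<^sup>\<star>) (j\<^sup>\<star>)}.
         d n * N i j p l m n a1 a2 a3 a4 * N k (j\<^sup>\<star>) i n m l a1' a3 a2' a4)
      = (if k = p \<and> a1 = a1' \<and> a2 = a2' then 1 / d k else 0)"
    unfolding e by (rule sixj_orthogonal) (use L g e a in auto)
qed

end

section \<open>Existence of basic data\<close>

context pivotal_category
begin

definition apiv :: "'o \<Rightarrow> ('o, 'm) arrow" where
  "apiv U = unbend_right (dual C (dual C U)) (acoev (dual C U)) U (atev U)"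

lemma apiv_arr: "\<guillemotleft>apiv U : U \<rightarrow> dual C (dual C U)\<guillemotright>"
  by (simp add: apiv_def unbend_right_def)

lemma mor_apiv: "mor (apiv U) = piv C U"
  by (simp add: apiv_def unbend_right_def mor_simps mor_pivotal piv_def)

lemma aev_apiv: "aev (dual C U) \<bullet> (apiv U \<triangleleft> dual C U) = atev U"
  using bend_unbend_right[OF duality_left[of "dual C U"], of "atev U" U \<I>]
  by (simp add: apiv_def bend_right_def)

text \<open>Pivotality for the vector \<open>coev\<close>: \<open>\<phi>\<close> can also be built from the other half of the duality.\<close>
lemma atev_apiv: "atev (dual C U) \<bullet> (dual C U \<triangleright> apiv U) = aev U"
proof -
  let ?d = "dual C U" and ?dd = "dual C (dual C U)"
  let ?X = "U \<odot> ?d"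
  let ?D = "adual_tensor U ?d" and ?y = "acoev U"
  let ?k = "(U \<triangleright> atev ?d) \<bullet> (acoev U \<triangleleft> ?dd)"
  have k: "\<guillemotleft>?k : ?dd \<rightarrow> U\<guillemotright>" by simp
  note p = apiv_arr[of U]
  have "(aev ?X \<bullet> (dual C ?X \<triangleright> ?y)) \<bullet> ?D = (atev ?X \<bullet> (?y \<triangleleft> dual C ?X)) \<bullet> ?D"
    by (subst vector_dual_left_right(1)) simp_all
  moreover have "(aev ?X \<bullet> (dual C ?X \<triangleright> ?y)) \<bullet> ?D = aev ?d"
  proof -
    have "(aev ?X \<bullet> (dual C ?X \<triangleright> ?y)) \<bullet> ?D = aev ?X \<bullet> ((tgt ?D \<triangleright> ?y) \<bullet> (?D \<triangleleft> src ?y))"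
      by (simp add: acomp_assoc)
    also have "\<dots> = aev ?X \<bullet> ((?D \<triangleleft> tgt ?y) \<bullet> (src ?D \<triangleright> ?y))"
      by (subst interchange) auto
    also have "\<dots> = (aev ?X \<bullet> (?D \<triangleleft> ?X)) \<bullet> ((?dd \<odot> ?d) \<triangleright> ?y)"
      by (simp add: acomp_assoc)
    also have "\<dots> = aev ?d \<bullet> (?dd \<triangleright> ((aev U \<triangleleft> ?d) \<bullet> (?d \<triangleright> acoev U)))"
      unfolding aev_dual_tensor by (simp add: acomp_assoc)
    also have "\<dots> = aev ?d" unfolding dualityD(3)[OF duality_left[of U]] by simp
    finally show ?thesis .
  qed
  moreover have "(atev ?X \<bullet> (?y \<triangleleft> dual C ?X)) \<bullet> ?D = atev U \<bullet> (?k \<triangleleft> ?d)"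
  proof -
    have "(atev ?X \<bullet> (?y \<triangleleft> dual C ?X)) \<bullet> ?D = atev ?X \<bullet> ((?y \<triangleleft> tgt ?D) \<bullet> (src ?y \<triangleright> ?D))"
      by (simp add: acomp_assoc)
    also have "\<dots> = atev ?X \<bullet> ((tgt ?y \<triangleright> ?D) \<bullet> (?y \<triangleleft> src ?D))"
      by (subst interchange) auto
    also have "\<dots> = (atev ?X \<bullet> (?X \<triangleright> ?D)) \<bullet> (?y \<triangleleft> (?dd \<odot> ?d))"
      by (simp add: acomp_assoc)
    also have "\<dots> = atev U \<bullet> (?k \<triangleleft> ?d)"
      unfolding atev_dual_tensor by (simp add: acomp_assoc)
    finally show ?thesis .
  qed
  ultimately have aev_k: "aev ?d = atev U \<bullet> (?k \<triangleleft> ?d)" by simp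
  have "bend_right ?d (atev U) \<I> (?k \<bullet> apiv U) = (atev U \<bullet> (?k \<triangleleft> ?d)) \<bullet> (apiv U \<triangleleft> ?d)"
    using p by (simp add: bend_right_def acomp_assoc)
  also have "\<dots> = bend_right ?d (atev U) \<I> (one U)"
    unfolding aev_k[symmetric] aev_apiv by (simp add: bend_right_def)
  finally have b: "bend_right ?d (atev U) \<I> (?k \<bullet> apiv U) = bend_right ?d (atev U) \<I> (one U)" .
  have kp: "?k \<bullet> apiv U = one U"
    using arg_cong[OF b, of "unbend_right U (atcoev U) U"] p
      unbend_bend_right[OF duality_right[of U], of "?k \<bullet> apiv U" U \<I>]
      unbend_bend_right[OF duality_right[of U], of "one U" U \<I>] by simp
  have ak: "aev U \<bullet> (?d \<triangleright> ?k) = atev ?d"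
  proof -
    have "aev U \<bullet> (?d \<triangleright> ?k) = (aev U \<bullet> (src (aev U) \<triangleright> atev ?d)) \<bullet> (?d \<triangleright> (acoev U \<triangleleft> ?dd))"
      by (simp add: acomp_assoc)
    also have "aev U \<bullet> (src (aev U) \<triangleright> atev ?d) = atev ?d \<bullet> (aev U \<triangleleft> src (atev ?d))"
      using slide_cap_left[of "atev ?d" "aev U"] by simp
    also have "(atev ?d \<bullet> (aev U \<triangleleft> src (atev ?d))) \<bullet> (?d \<triangleright> (acoev U \<triangleleft> ?dd)) =
        atev ?d \<bullet> (((aev U \<triangleleft> ?d) \<bullet> (?d \<triangleright> acoev U)) \<triangleleft> ?dd)"
      by (simp add: acomp_assoc)
    also have "\<dots> = atev ?d" unfolding dualityD(3)[OF duality_left[of U]] by simp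
    finally show ?thesis .
  qed
  have "atev ?d \<bullet> (?d \<triangleright> apiv U) = (aev U \<bullet> (?d \<triangleright> ?k)) \<bullet> (?d \<triangleright> apiv U)"
    by (simp only: ak)
  also have "\<dots> = aev U \<bullet> (?d \<triangleright> (?k \<bullet> apiv U))"
    using p by (simp add: acomp_assoc)
  finally show ?thesis unfolding kp by simp
qed

text \<open>
  The condition on basic data in terms of caps: \<open>f\<close> and \<open>g\<close> define the same pairing of \<open>W\<close> and \<open>U\<close>.
\<close>
lemma dual_mor_piv:
  assumes f: "\<guillemotleft>f : U \<rightarrow> dual C W\<guillemotright>" and g: "\<guillemotleft>g : W \<rightarrow> dual C U\<guillemotright>"
  shows "mor g = dual_mor C U (dual C W) (mor f) \<cdot> piv C W \<longleftrightarrow>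
    aev U \<bullet> (g \<triangleleft> U) = atev W \<bullet> (W \<triangleright> f)"
proof -
  let ?s = "unbend_right (dual C U) (acoev U) (dual C (dual C W)) (aev (dual C W) \<bullet> (dual C (dual C W) \<triangleright> f))"
  have s: "\<guillemotleft>?s : dual C (dual C W) \<rightarrow> dual C U\<guillemotright>"
    using f by (simp add: unbend_right_def)
  note p = apiv_arr[of W]
  have "dual_mor C U (dual C W) (mor f) \<cdot> piv C W = mor (?s \<bullet> apiv W)"
    using f by (simp add: mor_acomp mor_apiv unbend_right_def acomp_assoc)
      (simp add: mor_simps mor_pivotal dual_mor_def)
  then have "mor g = dual_mor C U (dual C W) (mor f) \<cdot> piv C W \<longleftrightarrow> g = ?s \<bullet> apiv W"
    using s p g by (metis arrow_eqI src_simps(2) tgt_simps(2))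
  moreover have sp: "bend_right U (aev U) \<I> (?s \<bullet> apiv W) = atev W \<bullet> (W \<triangleright> f)"
  proof -
    have "bend_right U (aev U) \<I> (?s \<bullet> apiv W) = bend_right U (aev U) \<I> ?s \<bullet> (apiv W \<triangleleft> U)"
      using s p by (intro bend_right_pre[OF duality_left]) auto
    also have "bend_right U (aev U) \<I> ?s = aev (dual C W) \<bullet> (dual C (dual C W) \<triangleright> f)"
      using f by (intro bend_unbend_right[OF duality_left]) auto
    also have "(aev (dual C W) \<bullet> (dual C (dual C W) \<triangleright> f)) \<bullet> (apiv W \<triangleleft> U) =
        aev (dual C W) \<bullet> ((tgt (apiv W) \<triangleright> f) \<bullet> (apiv W \<triangleleft> src f))"
      using f p by (simp add: acomp_assoc)
    also have "\<dots> = aev (dual C W) \<bullet> ((apiv W \<triangleleft> tgt f) \<bullet> (src (apiv W) \<triangleright> f))"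
      using f p by (subst interchange) auto
    also have "\<dots> = (aev (dual C W) \<bullet> (apiv W \<triangleleft> dual C W)) \<bullet> (W \<triangleright> f)"
      using f p by (simp add: acomp_assoc)
    finally show ?thesis unfolding aev_apiv .
  qed
  moreover have "g = ?s \<bullet> apiv W \<longleftrightarrow> bend_right U (aev U) \<I> g = bend_right U (aev U) \<I> (?s \<bullet> apiv W)"
  proof
    assume e: "bend_right U (aev U) \<I> g = bend_right U (aev U) \<I> (?s \<bullet> apiv W)"
    have 1: "unbend_right (dual C U) (acoev U) W (bend_right U (aev U) \<I> g) = g"
      using g by (intro unbend_bend_right[OF duality_left]) auto
    have 2: "unbend_right (dual C U) (acoev U) W (bend_right U (aev U) \<I> (?s \<bullet> apiv W)) = ?s \<bullet> apiv W"
      using s p by (intro unbend_bend_right[OF duality_left]) auto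
    show "g = ?s \<bullet> apiv W"
      using arg_cong[OF e, of "unbend_right (dual C U) (acoev U) W"] unfolding 1 2 .
  qed simp
  ultimately show ?thesis using g by (simp add: bend_right_def)
qed

text \<open>
  By pivotality \<open>g\<close> may be dualized with the right evaluations; then the pairing defined by \<open>f\<close> appears.
\<close>
lemma dual_mor_piv_symmetric:
  assumes f: "\<guillemotleft>f : U \<rightarrow> dual C W\<guillemotright>" and g: "\<guillemotleft>g : W \<rightarrow> dual C U\<guillemotright>"
    and e: "mor g = dual_mor C U (dual C W) (mor f) \<cdot> piv C W"
  shows "mor f = dual_mor C W (dual C U) (mor g) \<cdot> piv C U"
proof -
  let ?dd = "dual C (dual C U)" and ?dW = "dual C W"
  have c: "aev U \<bullet> (g \<triangleleft> U) = atev W \<bullet> (W \<triangleright> f)" using e dual_mor_piv[OF f g] by simp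
  note p = apiv_arr[of U]
  let ?r = "(?dW \<triangleright> atev (dual C U)) \<bullet> (?dW \<triangleright> (g \<triangleleft> ?dd)) \<bullet> (atcoev W \<triangleleft> ?dd)"
  have "mor ?r = dual_mor_right C W (dual C U) (mor g)"
    by (simp add: mor_simps mor_pivotal dual_mor_right_def)
  then have "dual_mor C W (dual C U) (mor g) \<cdot> piv C U = mor (?r \<bullet> apiv U)"
    using dual_mor_left_right[OF mor_in[OF g]] by (simp add: mor_acomp[of ?r] mor_apiv)
  also have "?r \<bullet> apiv U = (?dW \<triangleright> atev (dual C U)) \<bullet> (?dW \<triangleright> (g \<triangleleft> ?dd)) \<bullet> ((atcoev W \<triangleleft> tgt (apiv U)) \<bullet> apiv U)"
    using g p by (simp add: acomp_assoc)
  also have "\<dots> = (?dW \<triangleright> atev (dual C U)) \<bullet> (?dW \<triangleright> (g \<triangleleft> ?dd)) \<bullet> ((tgt (atcoev W) \<triangleright> apiv U) \<bullet> (atcoev W \<triangleleft> src (apiv U)))"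
    using p by (subst slide_cup_left) auto
  also have "\<dots> = (?dW \<triangleright> atev (dual C U)) \<bullet> (?dW \<triangleright> ((g \<triangleleft> tgt (apiv U)) \<bullet> (src g \<triangleright> apiv U))) \<bullet> (atcoev W \<triangleleft> U)"
    using g p by (simp add: acomp_assoc)
  also have "\<dots> = (?dW \<triangleright> atev (dual C U)) \<bullet> (?dW \<triangleright> ((tgt g \<triangleright> apiv U) \<bullet> (g \<triangleleft> src (apiv U)))) \<bullet> (atcoev W \<triangleleft> U)"
    using g p by (subst interchange) auto
  also have "\<dots> = (?dW \<triangleright> ((atev (dual C U) \<bullet> (dual C U \<triangleright> apiv U)) \<bullet> (g \<triangleleft> U))) \<bullet> (atcoev W \<triangleleft> U)"
    using g p by (simp add: acomp_assoc)
  also have "\<dots> = unbend_left ?dW (atcoev W) U (bend_left W (atev W) \<I> f)"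
    unfolding atev_apiv c by (simp add: unbend_left_def bend_left_def)
  also have "\<dots> = f" using f by (intro unbend_bend_left[OF duality_right]) auto
  finally show ?thesis by simp
qed

end

text \<open>
  On one label of each pair \<open>{i, i\<^sup>\<star>}\<close> any isomorphism \<open>f i\<close> is taken. The condition on basic data defines \<open>w\<close> on
  the other label, and by symmetry it then holds for that label as well.
\<close>
lemma (in represented_spherical_category) exists_basic_data:
  assumes free: "\<And>i. i \<in> I \<Longrightarrow> i\<^sup>\<star> \<noteq> i"
  shows "\<exists>w. basic_data C I V w"
proof -
  \<comment> \<open>\<open>S\<close> contains exactly one label of each pair.\<close>
  define S where "S = {i. (SOME x. x \<in> {i, i\<^sup>\<star>}) = i}"
  have S: "i\<^sup>\<star> \<in> S \<longleftrightarrow> i \<notin> S" if i: "i \<in> I" for i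
  proof -
    have "{i\<^sup>\<star>, (i\<^sup>\<star>)\<^sup>\<star>} = {i, i\<^sup>\<star>}" using i by auto
    moreover have "(SOME x. x \<in> {i, i\<^sup>\<star>}) \<in> {i, i\<^sup>\<star>}" by (rule someI[of _ i]) simp
    ultimately show ?thesis using free[OF i] unfolding S_def mem_Collect_eq by (metis insertE singletonD)
  qed
  have "\<exists>f f'. inverses f f' \<and> src f = V i \<and> tgt f = dual C (V (i\<^sup>\<star>))" if i: "i \<in> I" for i
    using star_iso[OF star_in[OF i]] i unfolding isomorphic_iff star_star[OF i] by blast
  then obtain f f' where f: "\<And>i. i \<in> I \<Longrightarrow> inverses (f i) (f' i) \<and> src (f i) = V i \<and> tgt (f i) = dual C (V (i\<^sup>\<star>))"
    by metis
  define g where "g i = Arrow (V (i\<^sup>\<star>)) (dual_mor C (V i) (dual C (V (i\<^sup>\<star>))) (mor (f i)) \<cdot> piv C (V (i\<^sup>\<star>))) (dual C (V i))" for i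
  define w where "w i = (if i \<in> S then mor (f i) else mor (g (i\<^sup>\<star>)))" for i
  have fi: "\<guillemotleft>f i : V i \<rightarrow> dual C (V (i\<^sup>\<star>))\<guillemotright>" if i: "i \<in> I" for i
    using f[OF i] inversesD(1)[of "f i" "f' i"] by blast
  have g: "\<guillemotleft>g i : V (i\<^sup>\<star>) \<rightarrow> dual C (V i)\<guillemotright> \<and> (\<exists>h. inverses (g i) h)" if i: "i \<in> I" for i
  proof -
    let ?U = "V i" and ?W = "V (i\<^sup>\<star>)"
    let ?c = "atev ?W \<bullet> (?W \<triangleright> f i)"
    have d: "duality ?W ?U ?c ((f' i \<triangleleft> ?W) \<bullet> atcoev ?W)"
      using f[OF i] by (intro duality_transport_right[OF duality_right]) auto
    let ?g = "unbend_right (dual C ?U) (acoev ?U) ?W ?c"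
    have c: "\<guillemotleft>?c : ?W \<odot> ?U \<rightarrow> \<I>\<guillemotright>" using dualityD(1)[OF d] .
    have g: "\<guillemotleft>?g : ?W \<rightarrow> dual C ?U\<guillemotright>"
      using unbend_right_arr[OF duality_left, of ?c ?W ?U \<I>] c by simp
    have "aev ?U \<bullet> (?g \<triangleleft> ?U) = ?c"
      using bend_unbend_right[OF duality_left, of ?c ?W ?U \<I>] c by (simp add: bend_right_def)
    then have "mor ?g = mor (g i)"
      using dual_mor_piv[OF fi[OF i] g] by (simp add: g_def)
    then have "?g = g i" using g by (intro arrow_eqI) (auto simp: g_def)
    then show ?thesis using g duality_comparison[OF d duality_left] by auto
  qed
  have "is_iso C (V i) (dual C (V (i\<^sup>\<star>))) (w i) \<and>
        w (i\<^sup>\<star>) = dual_mor C (V i) (dual C (V (i\<^sup>\<star>))) (w i) \<cdot> piv C (V (i\<^sup>\<star>))" if i: "i \<in> I" for i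
  proof
    note s = star_in[OF i] star_star[OF i]
    have iso: "is_iso C A B (mor h)" if "\<guillemotleft>h : A \<rightarrow> B\<guillemotright>" "inverses h h'" for A B h h'
    proof -
      have "inverse_pair C A B (mor h) (mor h')"
        using that inversesD[OF that(2)] unfolding inverse_pair_def
        by (auto simp: arr_def acomp_def one_def)
      then show ?thesis unfolding is_iso_def by blast
    qed
    show "is_iso C (V i) (dual C (V (i\<^sup>\<star>))) (w i)"
      using iso[OF fi[OF i], of "f' i"] f[OF i] g[OF s(1)] iso[of "g (i\<^sup>\<star>)"] unfolding w_def s(2) by auto
    show "w (i\<^sup>\<star>) = dual_mor C (V i) (dual C (V (i\<^sup>\<star>))) (w i) \<cdot> piv C (V (i\<^sup>\<star>))"
    proof (cases "i \<in> S")
      case True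
      then show ?thesis using S[OF i] s by (simp add: w_def g_def)
    next
      case False
      then have "w (i\<^sup>\<star>) = mor (f (i\<^sup>\<star>))" "w i = mor (g (i\<^sup>\<star>))" using S[OF i] by (simp_all add: w_def)
      moreover have "mor (f (i\<^sup>\<star>)) = dual_mor C (V i) (dual C (V (i\<^sup>\<star>))) (mor (g (i\<^sup>\<star>))) \<cdot> piv C (V (i\<^sup>\<star>))"
        by (rule dual_mor_piv_symmetric[of "f (i\<^sup>\<star>)" "V (i\<^sup>\<star>)" "V i" "g (i\<^sup>\<star>)"])
          (use fi[OF s(1)] g[OF s(1)] s(2) in \<open>simp_all add: g_def\<close>)
      ultimately show ?thesis by simp
    qed
  qed
  then show ?thesis unfolding basic_data_def by blast
qed

section \<open>Orthogonal bases\<close>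

lemma (in vector_space) form_sum:
  assumes H: "subspace H" and S: "S \<subseteq> H" and x: "x \<in> H"
    and add: "\<And>x y z. \<lbrakk>x \<in> H; y \<in> H; z \<in> H\<rbrakk> \<Longrightarrow> h x (y + z) = h x y + h x z"
    and scale: "\<And>c x y. \<lbrakk>x \<in> H; y \<in> H\<rbrakk> \<Longrightarrow> h x (c *s y) = c * h x y"
  shows "h x (\<Sum>v\<in>S. a v *s v) = (\<Sum>v\<in>S. a v * h x v)"
proof -
  have z: "h x 0 = 0" using scale[OF x subspace_0[OF H], of 0] by simp
  have "(\<Sum>v\<in>S. a v *s v) \<in> H \<and> h x (\<Sum>v\<in>S. a v *s v) = (\<Sum>v\<in>S. a v * h x v)"
    using S
  proof (induction S rule: infinite_finite_induct)
    case (insert v S)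
    then have "v \<in> H" "a v *s v \<in> H" using H by (auto intro: subspace_scale)
    then show ?case using insert x H by (simp add: add scale subspace_add)
  qed (use z H in \<open>simp_all add: subspace_0\<close>)
  then show ?thesis ..
qed

lemma (in vector_space) orthogonal_independent:
  assumes H: "subspace H" and B: "B \<subseteq> H"
    and add: "\<And>x y z. \<lbrakk>x \<in> H; y \<in> H; z \<in> H\<rbrakk> \<Longrightarrow> h x (y + z) = h x y + h x z"
    and scale: "\<And>c x y. \<lbrakk>x \<in> H; y \<in> H\<rbrakk> \<Longrightarrow> h x (c *s y) = c * h x y"
    and orth: "\<And>x y. \<lbrakk>x \<in> B; y \<in> B; x \<noteq> y\<rbrakk> \<Longrightarrow> h x y = 0" and aniso: "\<And>x. x \<in> B \<Longrightarrow> h x x \<noteq> 0"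
  shows "independent B"
  unfolding independent_explicit_finite_subsets
proof (intro allI impI ballI)
  fix S u v
  assume S: "S \<subseteq> B" "finite S" and s: "(\<Sum>v\<in>S. u v *s v) = 0" and v: "v \<in> S"
  have vH: "v \<in> H" using v S B by blast
  have "0 = h v (\<Sum>v\<in>S. u v *s v)" using scale[OF vH subspace_0[OF H], of 0] s by simp
  also have "\<dots> = (\<Sum>x\<in>S. u x * h v x)" using S B by (intro form_sum[OF H _ vH add scale]) auto
  also have "\<dots> = (\<Sum>x\<in>S. if x = v then u v * h v v else 0)"
    using orth[of v] v S by (intro sum.cong) auto
  also have "\<dots> = u v * h v v" using v S by simp
  finally show "u v = 0" using aniso[of v] v S by auto
qed

text \<open>
  Let \<open>B\<close> be a maximal orthogonal family of anisotropic vectors. All vectors of its orthogonal complement are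
  isotropic. If \<open>x\<close> were a non-zero one, some \<open>y\<close> in the complement would have \<open>h x y \<noteq> 0\<close>, and the vector
  \<open>x + (c / h x y) y\<close> would have the norm \<open>c + bar c\<close>. The hypothesis on \<open>c\<close> fails exactly for the trivial
  involution in characteristic two, where alternating forms occur.
\<close>
lemma (in vector_space) orthogonal_basis_exists:
  fixes bar :: "'a \<Rightarrow> 'a"
  assumes bar: "field_involution bar" and H: "subspace H" and fin: "finite U" "H \<subseteq> span U"
    and add: "\<And>x y z. \<lbrakk>x \<in> H; y \<in> H; z \<in> H\<rbrakk> \<Longrightarrow> h x (y + z) = h x y + h x z"
    and scale: "\<And>c x y. \<lbrakk>x \<in> H; y \<in> H\<rbrakk> \<Longrightarrow> h x (c *s y) = c * h x y"
    and sym: "\<And>x y. \<lbrakk>x \<in> H; y \<in> H\<rbrakk> \<Longrightarrow> h y x = bar (h x y)"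
    and nondeg: "\<And>x. \<lbrakk>x \<in> H; x \<noteq> 0\<rbrakk> \<Longrightarrow> \<exists>y\<in>H. h y x \<noteq> 0"
    and c: "c + bar c \<noteq> 0"
  obtains u :: "nat \<Rightarrow> 'b" where "\<And>n. n \<in> {1..dim H} \<Longrightarrow> u n \<in> H"
    "\<And>m n. \<lbrakk>m \<in> {1..dim H}; n \<in> {1..dim H}; m \<noteq> n\<rbrakk> \<Longrightarrow> h (u m) (u n) = 0"
    "\<And>n. n \<in> {1..dim H} \<Longrightarrow> h (u n) (u n) \<noteq> 0"
proof -
  interpret field_involution bar by (rule bar)
  have bar0: "bar 0 = 0" by (metis add_0 add_left_cancel add_0_right bar_add)
  define P where "P B \<longleftrightarrow> B \<subseteq> H \<and> (\<forall>x\<in>B. \<forall>y\<in>B. x \<noteq> y \<longrightarrow> h x y = 0) \<and> (\<forall>x\<in>B. h x x \<noteq> 0)" for B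
  have ind: "independent B" if "P B" for B
    using that unfolding P_def by (intro orthogonal_independent[OF H _ add scale]) auto
  have bound: "finite B \<and> card B \<le> card U" if "P B" for B
    using that fin(2) unfolding P_def by (intro independent_span_bound[OF fin(1) ind[OF that]]) auto
  have "\<exists>B. P B \<and> (\<forall>B'. P B' \<longrightarrow> card B' \<le> card B)"
  proof (rule ex_has_greatest_nat)
    show "P {}" by (simp add: P_def)
    show "\<forall>B. P B \<longrightarrow> card B < Suc (card U)" using bound by (simp add: less_Suc_eq_le)
  qed
  then obtain B where B: "P B" and max: "\<And>B'. P B' \<Longrightarrow> card B' \<le> card B" by blast
  have BH: "B \<subseteq> H" and Bo: "\<And>x y. \<lbrakk>x \<in> B; y \<in> B; x \<noteq> y\<rbrakk> \<Longrightarrow> h x y = 0" and Ba: "\<And>x. x \<in> B \<Longrightarrow> h x x \<noteq> 0"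
    and Bf: "finite B" using B bound[OF B] unfolding P_def by auto
  define W where "W = {x \<in> H. \<forall>b\<in>B. h b x = 0}"
  define p where "p x = x - (\<Sum>b\<in>B. (h b x / h b b) *s b)" for x
  have sumH: "(\<Sum>b\<in>B. a b *s b) \<in> H" for a
    using BH by (intro subspace_sum[OF H] subspace_scale[OF H]) auto
  have diff: "h x (y - z) = h x y - h x z" if "x \<in> H" "y \<in> H" "z \<in> H" for x y z
    using add[of x "y - z" z] that subspace_diff[OF H] by simp
  have pW: "p x \<in> W" if x: "x \<in> H" for x
  proof -
    have "h b (p x) = 0" if b: "b \<in> B" for b
    proof -
      have bH: "b \<in> H" using b BH by blast
      have "h b (p x) = h b x - h b (\<Sum>b\<in>B. (h b x / h b b) *s b)"
        unfolding p_def by (rule diff[OF bH x sumH])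
      also have "h b (\<Sum>b\<in>B. (h b x / h b b) *s b) = (\<Sum>b'\<in>B. (h b' x / h b' b') * h b b')"
        by (rule form_sum[OF H BH bH add scale])
      also have "\<dots> = (\<Sum>b'\<in>B. if b' = b then h b x else 0)"
        using Bo[of b] Ba b by (intro sum.cong) auto
      also have "\<dots> = h b x" using b Bf by simp
      finally show ?thesis by simp
    qed
    then show ?thesis unfolding W_def using subspace_diff[OF H x sumH] by (simp add: p_def)
  qed
  have aniso_false: "h x x = 0" if x: "x \<in> W" for x
  proof (rule ccontr)
    assume n: "h x x \<noteq> 0"
    have xB: "x \<notin> B" using x n unfolding W_def by blast
    have "h x b = 0" if b: "b \<in> B" for b
      using sym[of b x] x b BH bar0 unfolding W_def by auto
    then have "P (insert x B)" using x n B unfolding P_def W_def by auto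
    from max[OF this] show False using xB Bf by simp
  qed
  have W0: "x = 0" if x: "x \<in> W" for x
  proof (rule ccontr)
    assume x0: "x \<noteq> 0"
    have xH: "x \<in> H" using x by (simp add: W_def)
    obtain y where y: "y \<in> H" "h y x \<noteq> 0" using nondeg[OF xH x0] by blast
    define y' where "y' = p y"
    have y': "y' \<in> W" "y' \<in> H" using pW[OF y(1)] by (simp_all add: y'_def W_def)
    have xb: "h x b = 0" if "b \<in> B" for b using sym[of b x] x that BH bar0 unfolding W_def by auto
    have "h x y' = h x y - h x (\<Sum>b\<in>B. (h b y / h b b) *s b)"
      unfolding y'_def p_def by (rule diff[OF xH y(1) sumH])
    also have "h x (\<Sum>b\<in>B. (h b y / h b b) *s b) = (\<Sum>b\<in>B. (h b y / h b b) * h x b)"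
      by (rule form_sum[OF H BH xH add scale])
    also have "\<dots> = 0" using xb by (intro sum.neutral) auto
    finally have e: "h x y' = h x y" by simp
    define a where "a = h x y'"
    have a: "a \<noteq> 0"
    proof
      assume "a = 0"
      then have "h y x = 0" using sym[OF xH y(1)] e bar0 by (simp add: a_def)
      then show False using y(2) by simp
    qed
    define z where "z = x + (c / a) *s y'"
    have zH: "z \<in> H" using xH y'(2) H by (simp add: z_def subspace_add subspace_scale)
    have "z \<in> W" using x y' zH add scale BH unfolding W_def z_def
      by (auto simp: subspace_scale[OF H])
    have s: "(c / a) *s y' \<in> H" using y'(2) H by (simp add: subspace_scale)
    have "h z x = bar (h x z)" using sym[OF xH zH] .
    also have "h x z = c" using add[OF xH xH s] scale[OF xH y'(2)] aniso_false[OF x] a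
      by (simp add: z_def a_def)
    finally have zx: "h z x = bar c" .
    have "h z y' = bar (h y' z)" using sym[OF y'(2) zH] .
    also have "h y' z = bar a" using add[OF y'(2) xH s] scale[OF y'(2) y'(2)] aniso_false[OF y'(1)] sym[OF xH y'(2)]
      by (simp add: z_def a_def)
    finally have zy: "h z y' = a" by (simp add: bar_bar)
    have "h z z = h z x + (c / a) * h z y'" using add[OF zH xH s] scale[OF zH y'(2)] by (simp add: z_def)
    also have "\<dots> = bar c + c" unfolding zx zy using a by simp
    finally have "h z z \<noteq> 0" using c by (simp add: add.commute)
    then show False using aniso_false[OF \<open>z \<in> W\<close>] by simp
  qed
  have "H \<subseteq> span B"
  proof
    fix x assume x: "x \<in> H"
    then have "x = (\<Sum>b\<in>B. (h b x / h b b) *s b)" using W0[OF pW[OF x]] by (simp add: p_def)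
    also have "\<dots> \<in> span B" by (intro span_sum span_scale span_base)
    finally show "x \<in> span B" .
  qed
  then have card: "card B = dim H" by (intro basis_card_eq_dim BH ind[OF B])
  obtain u where u: "bij_betw u {1..card B} B" using ex_bij_betw_nat_finite_1[OF Bf] by blast
  have uB: "u n \<in> B" if "n \<in> {1..dim H}" for n using bij_betwE[OF u] that card by auto
  have uinj: "u m \<noteq> u n" if "m \<in> {1..dim H}" "n \<in> {1..dim H}" "m \<noteq> n" for m n
    using inj_on_eq_iff[OF bij_betw_imp_inj_on[OF u], of m n] that unfolding card by simp
  show thesis
  proof (rule that[of u])
    show "u n \<in> H" if "n \<in> {1..dim H}" for n using uB[OF that] BH by blast
    show "h (u m) (u n) = 0" if "m \<in> {1..dim H}" "n \<in> {1..dim H}" "m \<noteq> n" for m n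
      by (rule Bo[OF uB[OF that(1)] uB[OF that(2)] uinj[OF that]])
    show "h (u n) (u n) \<noteq> 0" if "n \<in> {1..dim H}" for n by (rule Ba[OF uB[OF that]])
  qed
qed

section \<open>Existence of Hermitian basic data\<close>

context based_category
begin

abbreviation herm :: "'i \<Rightarrow> 'i \<Rightarrow> 'i \<Rightarrow> 'm \<Rightarrow> 'm \<Rightarrow> 'k" where
  "herm \<equiv> herm_form C V dag"

lemma mult_space_vec: "x \<in> mult_space C V i j k \<longleftrightarrow> vec i j k (Arrow \<I> x (V i \<odot> V j \<odot> V k))"
  by (simp add: mult_space_def)

lemma mor_mult_space: "vec i j k x \<Longrightarrow> mor x \<in> mult_space C V i j k"
  unfolding mult_space_def by (rule mor_in)

lemma herm_T: "\<lbrakk>vec i j k x; vec i j k z\<rbrakk> \<Longrightarrow> herm i j k (mor x) (mor z) = T (z \<bullet> adag x)"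
  by (simp add: herm_form_def T_def mor_acomp mor_adag)

text \<open>
  The expansion of a morphism in splittings without chosen bases: it comes from a decomposition of
  \<open>V i \<odot> V j\<close> into simple objects, of which only the summands isomorphic to \<open>V k\<close> contribute.
\<close>
lemma Hom_split_expansion:
  assumes ijk: "i \<in> I" "j \<in> I" "k \<in> I"
  obtains n :: nat and \<iota> \<pi> where "\<And>l. l < n \<Longrightarrow> \<guillemotleft>\<iota> l : V k \<rightarrow> V i \<odot> V j\<guillemotright>"
    "\<And>l. l < n \<Longrightarrow> \<guillemotleft>\<pi> l : V i \<odot> V j \<rightarrow> V k\<guillemotright>"
    "\<And>f. \<guillemotleft>f : V k \<rightarrow> V i \<odot> V j\<guillemotright> \<Longrightarrow> mor f = (\<Sum>l<n. smult C (T (\<pi> l \<bullet> f)) (mor (\<iota> l)))"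
proof (cases "deg i + deg j = deg k")
  case False
  have X: "V i \<odot> V j \<in> Deg C (deg i + deg j)" by (intro Deg_tensor V_Deg ijk)
  have "mor f = 0" if "\<guillemotleft>f : V k \<rightarrow> V i \<odot> V j\<guillemotright>" for f
    using Hom_Deg[OF V_Deg[OF ijk(3)] X] False mor_in[OF that] by auto
  then show thesis by (intro that[of 0]) auto
next
  case True
  let ?X = "V i \<odot> V j"
  have X: "?X \<in> Deg C (deg k)" using Deg_tensor[OF V_Deg[OF ijk(1)] V_Deg[OF ijk(2)]] True by simp
  show thesis
  proof (rule decomposition[OF deg_generic[OF ijk(3)] X])
    fix n :: nat and \<kappa> \<iota> \<pi>
    assume kp: "\<And>l. l < n \<Longrightarrow> \<kappa> l \<in> I \<and> deg (\<kappa> l) = deg k"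
      and io: "\<And>l. l < n \<Longrightarrow> \<guillemotleft>\<iota> l : V (\<kappa> l) \<rightarrow> ?X\<guillemotright>" and pi: "\<And>l. l < n \<Longrightarrow> \<guillemotleft>\<pi> l : ?X \<rightarrow> V (\<kappa> l)\<guillemotright>"
      and sum: "(\<Sum>l<n. mor (\<iota> l \<bullet> \<pi> l)) = Id C ?X"
    define \<iota>' where "\<iota>' l = (if \<kappa> l = k then (1 / d k) *\<^sub>a \<iota> l else Arrow (V k) 0 ?X)" for l
    define \<pi>' where "\<pi>' l = (if \<kappa> l = k then \<pi> l else Arrow ?X 0 (V k))" for l
    show thesis
    proof (rule that[of n \<iota>' \<pi>'])
      show "\<guillemotleft>\<iota>' l : V k \<rightarrow> ?X\<guillemotright>" if "l < n" for l using io[OF that] by (auto simp: \<iota>'_def Hom_zero)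
      show "\<guillemotleft>\<pi>' l : ?X \<rightarrow> V k\<guillemotright>" if "l < n" for l using pi[OF that] by (auto simp: \<pi>'_def Hom_zero)
      fix f assume f: "\<guillemotleft>f : V k \<rightarrow> ?X\<guillemotright>"
      have "mor f = (\<Sum>l<n. mor (\<iota> l \<bullet> \<pi> l)) \<cdot> mor f" unfolding sum using Id_comp[OF mor_in[OF f]] by simp
      also have "\<dots> = (\<Sum>l<n. mor (\<iota> l \<bullet> \<pi> l) \<cdot> mor f)"
        by (rule comp_sum_left[OF mor_in mor_in[OF f]]) (use io pi in auto)
      also have "\<dots> = (\<Sum>l<n. smult C (T (\<pi>' l \<bullet> f)) (mor (\<iota>' l)))"
      proof (intro sum.cong refl)
        fix l assume "l \<in> {..<n}"
        then have l: "l < n" by simp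
        have e: "mor (\<iota> l \<bullet> \<pi> l) \<cdot> mor f = mor (\<iota> l \<bullet> (\<pi> l \<bullet> f))"
          using acomp_assoc[of "\<iota> l" "\<pi> l" f] io[OF l] pi[OF l] f by (simp flip: mor_acomp)
        have h: "\<guillemotleft>\<pi> l \<bullet> f : V k \<rightarrow> V (\<kappa> l)\<guillemotright>" using pi[OF l] f by simp
        show "mor (\<iota> l \<bullet> \<pi> l) \<cdot> mor f = smult C (T (\<pi>' l \<bullet> f)) (mor (\<iota>' l))"
        proof (cases "\<kappa> l = k")
          case True
          have "\<pi> l \<bullet> f = (T (\<pi> l \<bullet> f) / d k) *\<^sub>a one (V k)" using h True by (intro endo_T ijk) auto
          then have "\<iota> l \<bullet> (\<pi> l \<bullet> f) = (T (\<pi> l \<bullet> f) / d k) *\<^sub>a \<iota> l"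
            using ascale_simps(2)[of "\<iota> l" "one (V k)" "T (\<pi> l \<bullet> f) / d k"] io[OF l] True by simp
          then show ?thesis unfolding e by (simp add: \<pi>'_def \<iota>'_def True mor_ascale)
        next
          case False
          have "0 *\<^sub>a (\<pi> l \<bullet> f) = \<pi> l \<bullet> f"
            using schur[of k "\<kappa> l"] kp[OF l] ijk False mor_in[OF h] by (intro zero_arrow) auto
          then have "\<iota> l \<bullet> (\<pi> l \<bullet> f) = 0 *\<^sub>a (\<iota> l \<bullet> (\<pi> l \<bullet> f))"
            using ascale_simps(2)[of "\<iota> l" "\<pi> l \<bullet> f" 0] io[OF l] h by simp
          from arg_cong[OF this, of mor] show ?thesis
            unfolding e using False by (simp add: \<iota>'_def mor_ascale)
        qed
      qed
      finally show "mor f = (\<Sum>l<n. smult C (T (\<pi>' l \<bullet> f)) (mor (\<iota>' l)))" .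
    qed
  qed
qed

lemma mult_space_finite:
  assumes ijk: "i \<in> I" "j \<in> I" "k \<in> I"
  obtains U where "finite U" "mult_space C V i j k \<subseteq> vs.span U"
proof (rule Hom_split_expansion[OF ijk(1,2) star_in[OF ijk(3)]])
  fix n :: nat and \<iota> \<pi>
  let ?X = "V i \<odot> V j"
  assume io: "\<And>l. l < n \<Longrightarrow> \<guillemotleft>\<iota> l : V (k\<^sup>\<star>) \<rightarrow> ?X\<guillemotright>" and pi: "\<And>l. l < n \<Longrightarrow> \<guillemotleft>\<pi> l : ?X \<rightarrow> V (k\<^sup>\<star>)\<guillemotright>"
    and ex: "\<And>f. \<guillemotleft>f : V (k\<^sup>\<star>) \<rightarrow> ?X\<guillemotright> \<Longrightarrow> mor f = (\<Sum>l<n. smult C (T (\<pi> l \<bullet> f)) (mor (\<iota> l)))"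
  let ?b = "\<lambda>m. mor (one (?X \<odot> V k) \<bullet> (\<I> \<triangleright> (Arrow (V (k\<^sup>\<star>)) m ?X \<triangleleft> V k)) \<bullet> cup (k\<^sup>\<star>))"
  have "mult_space C V i j k \<subseteq> vs.span ((\<lambda>l. ?b (mor (\<iota> l))) ` {..<n})"
  proof
    fix x assume "x \<in> mult_space C V i j k"
    then have x: "vec i j k (Arrow \<I> x (V i \<odot> V j \<odot> V k))" (is "vec i j k ?x") by (simp add: mult_space_vec)
    let ?f = "rb k ?X ?x"
    have f: "\<guillemotleft>?f : V (k\<^sup>\<star>) \<rightarrow> ?X\<guillemotright>" using rb_arr[of k ?x \<I> ?X] x ijk by simp
    have "x = mor (ru k \<I> ?f)" using ru_rb[of k ?x \<I> ?X] x ijk by simp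
    also have "\<dots> = ?b (mor ?f)"
    proof -
      have "Arrow (V (k\<^sup>\<star>)) (mor ?f) ?X = ?f" using f by (intro arrow_eqI) auto
      then show ?thesis using f ijk by (simp add: ru_def unbend_right_def)
    qed
    also have "\<dots> = (\<Sum>l<n. smult C (T (\<pi> l \<bullet> ?f)) (?b (mor (\<iota> l))))"
      unfolding ex[OF f] by (rule frame_sum) (use io ijk in \<open>auto intro: mor_in\<close>)
    also have "\<dots> \<in> vs.span ((\<lambda>l. ?b (mor (\<iota> l))) ` {..<n})"
      by (intro vs.span_sum vs.span_scale vs.span_base) auto
    finally show "x \<in> vs.span ((\<lambda>l. ?b (mor (\<iota> l))) ` {..<n})" .
  qed
  then show thesis by (rule that[rotated]) simp
qed

text \<open>
  Bent vectors are expanded in splittings with coefficients \<open>T (\<pi> l \<bullet> f)\<close>; the daggers of the \<open>\<pi> l\<close>, bent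
  back, are vectors \<open>u\<close> that compute these coefficients.
\<close>
lemma herm_nondegenerate:
  assumes ijk: "i \<in> I" "j \<in> I" "k \<in> I" and v: "vec i j k v" "mor v \<noteq> 0"
  obtains u where "vec i j k u" "T (v \<bullet> adag u) \<noteq> 0"
proof (rule Hom_split_expansion[OF ijk(1,2) star_in[OF ijk(3)]])
  fix n :: nat and \<iota> \<pi>
  let ?X = "V i \<odot> V j"
  assume pi: "\<And>l. l < n \<Longrightarrow> \<guillemotleft>\<pi> l : ?X \<rightarrow> V (k\<^sup>\<star>)\<guillemotright>"
    and ex: "\<And>f. \<guillemotleft>f : V (k\<^sup>\<star>) \<rightarrow> ?X\<guillemotright> \<Longrightarrow> mor f = (\<Sum>l<n. smult C (T (\<pi> l \<bullet> f)) (mor (\<iota> l)))"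
  let ?f = "rb k ?X v"
  have f: "\<guillemotleft>?f : V (k\<^sup>\<star>) \<rightarrow> ?X\<guillemotright>" using rb_arr[of k v \<I> ?X] v ijk by simp
  have "\<exists>l<n. T (\<pi> l \<bullet> ?f) \<noteq> 0"
  proof (rule ccontr)
    assume "\<not> ?thesis"
    then have "mor ?f = 0" unfolding ex[OF f] by (intro sum.neutral) auto
    then have z: "0 *\<^sub>a ?f = ?f" by (rule zero_arrow)
    have "ru k \<I> (0 *\<^sub>a ?f) = 0 *\<^sub>a ru k \<I> ?f" using f ijk by (simp add: ru_def unbend_right_def)
    then have "v = 0 *\<^sub>a v" unfolding z using ru_rb[of k v \<I> ?X] v ijk by simp
    from arg_cong[OF this, of mor] show False using v(2) by (simp add: mor_ascale)
  qed
  then obtain l where l: "l < n" "T (\<pi> l \<bullet> ?f) \<noteq> 0" by blast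
  note p = pi[OF l(1)]
  define u where "u = ru k \<I> (adag (\<pi> l))"
  have u: "vec i j k u" using ru_arr[of k "adag (\<pi> l)" \<I> ?X] p ijk by (simp add: u_def)
  have "rb k ?X u = adag (\<pi> l)" using rb_ru[of k "adag (\<pi> l)" \<I> ?X] p ijk by (simp add: u_def)
  then have "\<beta> k * T (v \<bullet> adag u) = T (?f \<bullet> \<pi> l)"
    using T_rb_adag[of k ?X v \<I> u] ijk v u p projective_V2 by simp
  also have "\<dots> = T (\<pi> l \<bullet> ?f)" using f p ijk projective_V projective_V2 by (intro T_cyclic) auto
  finally show thesis using l(2) by (intro that[OF u]) auto
qed

definition orth_family :: "'i \<Rightarrow> 'i \<Rightarrow> 'i \<Rightarrow> (nat \<Rightarrow> ('o, 'm) arrow) \<Rightarrow> bool" where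
  "orth_family i j k u \<longleftrightarrow> (\<forall>n. vec i j k (u n)) \<and>
     (\<forall>m\<in>{1..\<delta> i j k}. \<forall>n\<in>{1..\<delta> i j k}. m \<noteq> n \<longrightarrow> T (u n \<bullet> adag (u m)) = 0) \<and>
     (\<forall>n\<in>{1..\<delta> i j k}. T (u n \<bullet> adag (u n)) \<noteq> 0)"

lemma herm_linear:
  assumes "i \<in> I" "j \<in> I" "k \<in> I" and x: "x \<in> mult_space C V i j k" and y: "y \<in> mult_space C V i j k"
  shows herm_add: "z \<in> mult_space C V i j k \<Longrightarrow> herm i j k x (y + z) = herm i j k x y + herm i j k x z"
    and herm_scale: "herm i j k x (smult C c y) = c * herm i j k x y"
    and herm_sym: "herm i j k y x = bar (herm i j k x y)"
proof -
  let ?X = "V i \<odot> V j \<odot> V k"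
  have P: "projective C ?X" by (rule projective_V3[OF assms(1-3)])
  have x': "dag x \<in> Hom C ?X \<I>" using x dag_in by (simp add: mult_space_def)
  have in_End: "y \<cdot> dag x \<in> Hom C ?X ?X" if "y \<in> mult_space C V i j k" for y
    using that x' comp_in by (simp add: mult_space_def)
  show "herm i j k x (y + z) = herm i j k x y + herm i j k x z" if z: "z \<in> mult_space C V i j k"
    using comp_add_left[OF _ _ x', of y ?X z] y z tr_linear[OF P in_End[OF y] in_End[OF z]]
    by (simp add: herm_form_def mult_space_def)
  show "herm i j k x (smult C c y) = c * herm i j k x y"
    using comp_smult_left[OF _ x', of y ?X c] y tr_linear[OF P in_End[OF y] in_End[OF y]]
    by (simp add: herm_form_def mult_space_def)
  have "dag (y \<cdot> dag x) = dag (dag x) \<cdot> dag y"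
    using y by (intro dag_comp[OF _ x']) (simp add: mult_space_def)
  also have "dag (dag x) = x" using x by (intro dag_dag) (simp add: mult_space_def)
  finally show "herm i j k y x = bar (herm i j k x y)"
    using tr_real[OF P in_End[OF y]] by (simp add: herm_form_def)
qed

lemma orth_family_exists:
  assumes ijk: "i \<in> I" "j \<in> I" "k \<in> I" and c: "c + bar c \<noteq> 0"
  obtains u where "orth_family i j k u"
proof -
  let ?H = "mult_space C V i j k" and ?X = "V i \<odot> V j \<odot> V k"
  have H: "vs.subspace ?H" unfolding mult_space_def by (rule Hom_subspace)
  obtain U where U: "finite U" "?H \<subseteq> vs.span U" by (rule mult_space_finite[OF ijk])
  have nd: "\<exists>y\<in>?H. herm i j k y x \<noteq> 0" if x: "x \<in> ?H" "x \<noteq> 0" for x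
  proof -
    have vx: "vec i j k (Arrow \<I> x ?X)" using x(1) by (simp add: mult_space_vec)
    obtain u where u: "vec i j k u" "T (Arrow \<I> x ?X \<bullet> adag u) \<noteq> 0"
      by (rule herm_nondegenerate[OF ijk vx]) (use x in auto)
    then show ?thesis
      using herm_T[OF u(1) vx] by (intro bexI[OF _ mor_mult_space[OF u(1)]]) simp
  qed
  show thesis
  proof (rule vs.orthogonal_basis_exists[OF _ H U herm_add[OF ijk] herm_scale[OF ijk] herm_sym[OF ijk] nd c])
    show "field_involution bar" by unfold_locales
    fix u assume u: "\<And>n. n \<in> {1..vs.dim ?H} \<Longrightarrow> u n \<in> ?H"
      "\<And>m n. \<lbrakk>m \<in> {1..vs.dim ?H}; n \<in> {1..vs.dim ?H}; m \<noteq> n\<rbrakk> \<Longrightarrow> herm i j k (u m) (u n) = 0"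
      "\<And>n. n \<in> {1..vs.dim ?H} \<Longrightarrow> herm i j k (u n) (u n) \<noteq> 0"
    define v where "v n = (if n \<in> {1..\<delta> i j k} then Arrow \<I> (u n) ?X else Arrow \<I> 0 ?X)" for n
    have v: "vec i j k (v n)" for n
      using u(1)[of n] by (auto simp: v_def mult_space_vec mult_dim_def Hom_zero)
    have vm: "mor (v n) = u n" if "n \<in> {1..\<delta> i j k}" for n using that by (simp add: v_def)
    have "orth_family i j k v"
      unfolding orth_family_def
    proof (intro conjI allI ballI impI)
      fix m n assume mn: "m \<in> {1..\<delta> i j k}" "n \<in> {1..\<delta> i j k}" "m \<noteq> n"
      then show "T (v n \<bullet> adag (v m)) = 0"
        using u(2)[of m n] herm_T[OF v v, of m n] by (simp add: vm mult_dim_def)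
    next
      fix n assume "n \<in> {1..\<delta> i j k}"
      then show "T (v n \<bullet> adag (v n)) \<noteq> 0"
        using u(3)[of n] herm_T[OF v v, of n n] by (simp add: vm mult_dim_def)
    qed (use v in auto)
    then show thesis by (rule that)
  qed
qed

lemma orth_family_basis:
  assumes ijk: "i \<in> I" "j \<in> I" "k \<in> I" and u: "orth_family i j k u"
  shows "basis_family C (mult_space C V i j k) (\<delta> i j k) (\<lambda>n. mor (u n))"
proof -
  let ?H = "mult_space C V i j k" and ?R = "{1..\<delta> i j k}"
  let ?B = "(\<lambda>n. mor (u n)) ` ?R"
  have H: "vs.subspace ?H" unfolding mult_space_def by (rule Hom_subspace)
  have v: "vec i j k (u n)" for n using u by (simp add: orth_family_def)
  have BH: "?B \<subseteq> ?H" using mor_mult_space[OF v] by blast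
  have o: "herm i j k (mor (u m)) (mor (u n)) = 0" if "m \<in> ?R" "n \<in> ?R" "m \<noteq> n" for m n
    using u that herm_T[OF v v, of m n] by (simp add: orth_family_def)
  have a: "herm i j k (mor (u n)) (mor (u n)) \<noteq> 0" if "n \<in> ?R" for n
    using u that herm_T[OF v v, of n n] by (simp add: orth_family_def)
  have o': "herm i j k (mor (u m)) (mor (u n)) = 0"
    if "m \<in> ?R" "n \<in> ?R" "mor (u m) \<noteq> mor (u n)" for m n
    using o[of m n] that by (cases "m = n") auto
  have inj: "inj_on (\<lambda>n. mor (u n)) ?R"
  proof (rule inj_onI)
    fix m n assume mn: "m \<in> ?R" "n \<in> ?R" "mor (u m) = mor (u n)"
    show "m = n" using o[OF mn(1,2)] a[OF mn(1)] mn(3) by auto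
  qed
  have ind: "vs.independent ?B"
    by (rule vs.orthogonal_independent[OF H BH herm_add[OF ijk] herm_scale[OF ijk]])
      (use o' a in auto)
  obtain B where B: "?B \<subseteq> B" "B \<subseteq> ?H" "vs.independent B" "?H \<subseteq> vs.span B"
    using vs.maximal_independent_subset_extend[OF BH ind] by blast
  obtain U where U: "finite U" "?H \<subseteq> vs.span U" by (rule mult_space_finite[OF ijk])
  have "finite B" using vs.independent_span_bound[OF U(1) B(3)] B(2) U(2) by auto
  moreover have "card B = \<delta> i j k" using vs.basis_card_eq_dim[OF B(2,4,3)] by (simp add: mult_dim_def)
  moreover have "card ?B = \<delta> i j k" using card_image[OF inj] by simp
  ultimately have "?B = B" using B(1) by (intro card_subset_eq) auto
  then have "vs.span ?B = ?H"
    using B(4) vs.span_minimal[OF BH H] by auto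
  then show ?thesis unfolding basis_family_def using inj ind by blast
qed

lemma T_arot:
  assumes "i \<in> I" "j \<in> I" "k \<in> I" and x: "vec i j k x" and z: "vec i j k z"
  shows "T (arot i j k z \<bullet> adag (arot i j k x)) = T (z \<bullet> adag x)"
proof -
  let ?B = "V j \<odot> V k"
  have "\<beta> i * T (arot i j k z \<bullet> adag (arot i j k x)) =
      T (rb i ?B (arot i j k z) \<bullet> adag (rb i ?B (arot i j k x)))"
    using T_rb_adag[OF assms(1) projective_V2[OF assms(2,3)], of "arot i j k z" \<I> "arot i j k x"]
      arot_arr[OF assms(1-3) x] arot_arr[OF assms(1-3) z] by simp
  also have "\<dots> = \<beta> i * T (z \<bullet> adag x)"
    unfolding rb_arot[OF assms(1-3) x] rb_arot[OF assms(1-3) z]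
    using T_lb_adag[OF assms(1) projective_V2[OF assms(2,3)], of z \<I> x] x z by simp
  finally show ?thesis using beta_nonzero[OF assms(1)] by simp
qed

lemma orth_family_arot:
  assumes ijk: "i \<in> I" "j \<in> I" "k \<in> I" and u: "orth_family i j k u"
  shows "orth_family j k i (\<lambda>n. arot i j k (u n))"
proof -
  have v: "vec i j k (u n)" for n using u by (simp add: orth_family_def)
  then show ?thesis
    using u T_arot[OF ijk v v] arot_arr[OF ijk v] mult_dim_rot[OF ijk]
    unfolding orth_family_def by simp
qed

text \<open>
  The vector whose functional is \<open>adag v\<close>. In the \<open>\<Theta>\<close>-dual basis of an orthogonal basis the element dual to \<open>v\<close> is
  a multiple of it.
\<close>
definition conj_vec :: "'i \<Rightarrow> 'i \<Rightarrow> 'i \<Rightarrow> ('o, 'm) arrow \<Rightarrow> ('o, 'm) arrow" where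
  "conj_vec i j k v = ru (i\<^sup>\<star>) \<I> (ru (j\<^sup>\<star>) (V i) (ru (k\<^sup>\<star>) (V i \<odot> V j) (adag v)))"

lemma conj_vec:
  assumes ijk: "i \<in> I" "j \<in> I" "k \<in> I" and v: "vec i j k v"
  shows conj_vec_arr: "vec (k\<^sup>\<star>) (j\<^sup>\<star>) (i\<^sup>\<star>) (conj_vec i j k v)"
    and functional3_conj_vec: "functional3 (k\<^sup>\<star>) (j\<^sup>\<star>) (i\<^sup>\<star>) (conj_vec i j k v) = adag v"
    and fuse_conj_vec: "fuse i j (k\<^sup>\<star>) (conj_vec i j k v) = ru (k\<^sup>\<star>) (V i \<odot> V j) (adag v)"
proof -
  let ?v1 = "ru (k\<^sup>\<star>) (V i \<odot> V j) (adag v)"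
  let ?v2 = "ru (j\<^sup>\<star>) (V i) ?v1"
  have s: "i\<^sup>\<star> \<in> I" "j\<^sup>\<star> \<in> I" "k\<^sup>\<star> \<in> I" "(i\<^sup>\<star>)\<^sup>\<star> = i" "(j\<^sup>\<star>)\<^sup>\<star> = j" "(k\<^sup>\<star>)\<^sup>\<star> = k" using ijk by auto
  have av: "\<guillemotleft>adag v : (V i \<odot> V j) \<odot> V ((k\<^sup>\<star>)\<^sup>\<star>) \<rightarrow> \<I>\<guillemotright>" using v s by simp
  have v1: "\<guillemotleft>?v1 : V i \<odot> V j \<rightarrow> \<I> \<odot> V (k\<^sup>\<star>)\<guillemotright>" by (rule ru_arr[OF s(3) av])
  then have v1': "\<guillemotleft>?v1 : V i \<odot> V ((j\<^sup>\<star>)\<^sup>\<star>) \<rightarrow> V (k\<^sup>\<star>)\<guillemotright>" using s by simp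
  have v2: "\<guillemotleft>?v2 : V i \<rightarrow> V (k\<^sup>\<star>) \<odot> V (j\<^sup>\<star>)\<guillemotright>" by (rule ru_arr[OF s(2) v1'])
  then have v2': "\<guillemotleft>?v2 : \<I> \<odot> V ((i\<^sup>\<star>)\<^sup>\<star>) \<rightarrow> V (k\<^sup>\<star>) \<odot> V (j\<^sup>\<star>)\<guillemotright>" using s by simp
  show "vec (k\<^sup>\<star>) (j\<^sup>\<star>) (i\<^sup>\<star>) (conj_vec i j k v)"
    using ru_arr[OF s(1) v2'] by (simp add: conj_vec_def)
  show f: "fuse i j (k\<^sup>\<star>) (conj_vec i j k v) = ?v1"
    using rb_ru[OF s(1) v2'] rb_ru[OF s(2) v1'] by (simp add: fuse_def conj_vec_def)
  show "functional3 (k\<^sup>\<star>) (j\<^sup>\<star>) (i\<^sup>\<star>) (conj_vec i j k v) = adag v"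
    using functional3_fuse[OF ijk(1,2), of "k\<^sup>\<star>"] rb_ru[OF s(3) av] by (simp add: f)
qed

text \<open>The dagger is antiunitary and three legs are bent.\<close>
lemma T_conj_vec:
  assumes ijk: "i \<in> I" "j \<in> I" "k \<in> I" and v: "vec i j k v" and z: "vec i j k z"
  shows "\<beta> i * \<beta> j * \<beta> k * T (conj_vec i j k z \<bullet> adag (conj_vec i j k v)) = T (v \<bullet> adag z)"
proof -
  have s: "i\<^sup>\<star> \<in> I" "j\<^sup>\<star> \<in> I" "k\<^sup>\<star> \<in> I" "(i\<^sup>\<star>)\<^sup>\<star> = i" "(j\<^sup>\<star>)\<^sup>\<star> = j" "(k\<^sup>\<star>)\<^sup>\<star> = k" using ijk by auto
  let ?c = "\<lambda>v. conj_vec i j k v" and ?X = "V i \<odot> V j"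
  let ?r = "\<lambda>v. rb (i\<^sup>\<star>) (V (k\<^sup>\<star>) \<odot> V (j\<^sup>\<star>)) (?c v)" and ?f = "\<lambda>v. fuse i j (k\<^sup>\<star>) (?c v)"
  have c: "vec (k\<^sup>\<star>) (j\<^sup>\<star>) (i\<^sup>\<star>) (?c x)" if "vec i j k x" for x by (rule conj_vec_arr[OF ijk that])
  have r: "\<guillemotleft>?r x : V i \<rightarrow> V (k\<^sup>\<star>) \<odot> V (j\<^sup>\<star>)\<guillemotright>" if "vec i j k x" for x
    using rb_arr[OF s(1), of "?c x" \<I> "V (k\<^sup>\<star>) \<odot> V (j\<^sup>\<star>)"] c[OF that] s by simp
  have f: "\<guillemotleft>?f x : ?X \<rightarrow> V (k\<^sup>\<star>)\<guillemotright>" if "vec i j k x" for x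
    using fuse_arr[OF ijk(1,2) s(3), of "?c x"] c[OF that] s by simp
  have rk: "\<guillemotleft>rb k ?X x : V (k\<^sup>\<star>) \<rightarrow> ?X\<guillemotright>" if "vec i j k x" for x
    using rb_arr[OF ijk(3), of x \<I> ?X] that by simp
  have fk: "\<beta> k *\<^sub>a ?f x = adag (rb k ?X x)" if "vec i j k x" for x
    using adag_rb[OF ijk(3), of x \<I> ?X] that by (simp add: fuse_conj_vec[OF ijk that])
  have bk: "bar (\<beta> k) = \<beta> k" by (rule beta_real[OF ijk(3)])
  have t1: "T (?f z \<bullet> adag (?f v)) = \<beta> j * (\<beta> i * T (?c z \<bullet> adag (?c v)))"
  proof -
    have "T (?f z \<bullet> adag (?f v)) = \<beta> (j\<^sup>\<star>) * T (?r z \<bullet> adag (?r v))"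
      unfolding fuse_def using r[OF v] r[OF z] s projective_V by (intro T_rb_adag) auto
    also have "T (?r z \<bullet> adag (?r v)) = \<beta> (i\<^sup>\<star>) * T (?c z \<bullet> adag (?c v))"
      using c[OF v] c[OF z] s projective_V2 by (intro T_rb_adag) auto
    finally show ?thesis using ijk by (simp add: beta_star)
  qed
  have "(\<beta> k * \<beta> k) * T (?f z \<bullet> adag (?f v)) = T ((\<beta> k * \<beta> k) *\<^sub>a (?f z \<bullet> adag (?f v)))"
    using f[OF z] f[OF v] by (intro T_scale[symmetric, OF projective_V[OF s(3)]]) auto
  also have "(\<beta> k * \<beta> k) *\<^sub>a (?f z \<bullet> adag (?f v)) = (\<beta> k *\<^sub>a ?f z) \<bullet> adag (\<beta> k *\<^sub>a ?f v)"
    using f[OF z] f[OF v] bk by simp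
  also have "\<dots> = adag (rb k ?X z) \<bullet> rb k ?X v"
    unfolding fk[OF z] fk[OF v] using rk[OF v] by simp
  also have "T \<dots> = T (rb k ?X v \<bullet> adag (rb k ?X z))"
    using rk[OF v] rk[OF z] s ijk projective_V projective_V2 by (intro T_cyclic) auto
  also have "\<dots> = \<beta> k * T (v \<bullet> adag z)"
    using ijk v z projective_V2 by (intro T_rb_adag) auto
  finally have "\<beta> k * T (?f z \<bullet> adag (?f v)) = T (v \<bullet> adag z)"
    using beta_nonzero[OF ijk(3)] by simp
  then show ?thesis unfolding t1 by (simp add: mult_ac)
qed

text \<open>Cyclicity of the trace of a fusion and a splitting, whose roles are exchanged by bending a leg.\<close>
lemma Theta_sym:
  assumes ijk: "i \<in> I" "j \<in> I" "k \<in> I" and y': "vec (k\<^sup>\<star>) (j\<^sup>\<star>) (i\<^sup>\<star>) y'" and y: "vec i j k y"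
  shows "Theta C I V w (k\<^sup>\<star>) (j\<^sup>\<star>) (i\<^sup>\<star>) (mor y) (mor y') = Theta C I V w i j k (mor y') (mor y)"
proof -
  have s: "i\<^sup>\<star> \<in> I" "j\<^sup>\<star> \<in> I" "k\<^sup>\<star> \<in> I" "(i\<^sup>\<star>)\<^sup>\<star> = i" "(j\<^sup>\<star>)\<^sup>\<star> = j" "(k\<^sup>\<star>)\<^sup>\<star> = k" using ijk by auto
  let ?s' = "split (k\<^sup>\<star>) (j\<^sup>\<star>) i y'" and ?g = "fuse (k\<^sup>\<star>) (j\<^sup>\<star>) i y"
  have s': "\<guillemotleft>?s' : V i \<rightarrow> V (k\<^sup>\<star>) \<odot> V (j\<^sup>\<star>)\<guillemotright>" using y' s ijk by (intro split_arr) auto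
  have g: "\<guillemotleft>?g : V (k\<^sup>\<star>) \<odot> V (j\<^sup>\<star>) \<rightarrow> V i\<guillemotright>" using y s ijk by (intro fuse_arr) auto
  have sp: "\<guillemotleft>split i j (k\<^sup>\<star>) y : V (k\<^sup>\<star>) \<rightarrow> V i \<odot> V j\<guillemotright>" using y s ijk by (intro split_arr) auto
  have "Theta C I V w (k\<^sup>\<star>) (j\<^sup>\<star>) (i\<^sup>\<star>) (mor y) (mor y') = T (?g \<bullet> ?s')"
    using Theta_fuse_split[OF s(3,2) ijk(1), of y y'] y y' s by simp
  also have "\<dots> = T (?s' \<bullet> ?g)"
    using s' g s ijk projective_V projective_V2 by (intro T_cyclic) auto
  also have "\<dots> = T (rb (j\<^sup>\<star>) (V (k\<^sup>\<star>)) ?s' \<bullet> ru j (V (k\<^sup>\<star>)) ?g)"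
    using T_bend_right[OF s(2) projective_V[OF s(3)] s' g] s by simp
  also have "rb (j\<^sup>\<star>) (V (k\<^sup>\<star>)) ?s' = fuse i j (k\<^sup>\<star>) y'"
    by (simp add: split_def fuse_def)
  also have "ru j (V (k\<^sup>\<star>)) ?g = split i j (k\<^sup>\<star>) y"
  proof -
    have "?g = rb j (V i) (split i j (k\<^sup>\<star>) y)" using s by (simp add: fuse_def split_def)
    then show ?thesis using ru_rb[OF ijk(2) sp] by simp
  qed
  also have "T (fuse i j (k\<^sup>\<star>) y' \<bullet> split i j (k\<^sup>\<star>) y) = Theta C I V w i j k (mor y') (mor y)"
    using Theta_fuse_split[OF ijk(1,2) s(3), of y' y] y y' s by simp
  finally show ?thesis .
qed

text \<open>Bending the first leg of \<open>y\<close> in the trace and the last leg of its rotation gives the same trace.\<close>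
lemma Theta_arot:
  assumes ijk: "i \<in> I" "j \<in> I" "k \<in> I" and y': "vec (i\<^sup>\<star>) (k\<^sup>\<star>) (j\<^sup>\<star>) y'" and y: "vec i j k y"
  shows "Theta C I V w j k i (mor y') (mor (arot i j k y)) =
    Theta C I V w i j k (mor (arot (i\<^sup>\<star>) (k\<^sup>\<star>) (j\<^sup>\<star>) y')) (mor y)"
proof -
  have s: "i\<^sup>\<star> \<in> I" "j\<^sup>\<star> \<in> I" "k\<^sup>\<star> \<in> I" "(i\<^sup>\<star>)\<^sup>\<star> = i" "(j\<^sup>\<star>)\<^sup>\<star> = j" "(k\<^sup>\<star>)\<^sup>\<star> = k" using ijk by auto
  let ?B = "V j \<odot> V k"
  define Z where "Z = fuse j k (i\<^sup>\<star>) y'"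
  have Z: "\<guillemotleft>Z : ?B \<rightarrow> V (i\<^sup>\<star>) \<odot> \<I>\<guillemotright>"
    using fuse_arr[OF ijk(2,3) s(1), of y'] y' by (simp add: Z_def)
  have Z_eq: "Z = rb (k\<^sup>\<star>) (V (i\<^sup>\<star>)) (rb (j\<^sup>\<star>) (V (i\<^sup>\<star>) \<odot> V (k\<^sup>\<star>)) y')" by (simp add: Z_def fuse_def)
  have rZ: "\<guillemotleft>rb (i\<^sup>\<star>) \<I> Z : ?B \<odot> V i \<rightarrow> \<I>\<guillemotright>"
    using rb_arr[OF s(1), of Z ?B \<I>] Z s by simp
  have lZ: "\<guillemotleft>lb (i\<^sup>\<star>) \<I> Z : V i \<odot> ?B \<rightarrow> \<I>\<guillemotright>"
    using lb_arr[OF s(1) Z] s by simp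
  note ry = arot_arr[OF ijk y]
  have "Theta C I V w j k i (mor y') (mor (arot i j k y)) = T (arot i j k y \<bullet> rb (i\<^sup>\<star>) \<I> Z)"
    using Theta_eq[OF ijk(2,3,1) y' ry] functional3_fuse[OF ijk(2,3), of "i\<^sup>\<star>" y'] by (simp add: Z_def)
  also have "\<dots> = T (rb i ?B (arot i j k y) \<bullet> ru (i\<^sup>\<star>) ?B (rb (i\<^sup>\<star>) \<I> Z))"
    using T_bend_right[OF ijk(1) projective_V2[OF ijk(2,3)], of "arot i j k y" \<I> "rb (i\<^sup>\<star>) \<I> Z"] ry rZ by simp
  also have "ru (i\<^sup>\<star>) ?B (rb (i\<^sup>\<star>) \<I> Z) = Z" using ru_rb[OF s(1), of Z ?B \<I>] Z by simp
  also have "rb i ?B (arot i j k y) = lb i ?B y" by (rule rb_arot[OF ijk y])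
  finally have 1: "Theta C I V w j k i (mor y') (mor (arot i j k y)) = T (lb i ?B y \<bullet> Z)" .
  have "Theta C I V w i j k (mor (arot (i\<^sup>\<star>) (k\<^sup>\<star>) (j\<^sup>\<star>) y')) (mor y) = T (y \<bullet> lb (i\<^sup>\<star>) \<I> Z)"
    using Theta_eq[OF ijk arot_arr[OF s(1,3,2) y'] y] functional3_arot[OF s(1,3,2) y'] by (simp add: Z_eq)
  also have "\<dots> = T (lb i ?B y \<bullet> lu (i\<^sup>\<star>) ?B (lb (i\<^sup>\<star>) \<I> Z))"
    using T_bend_left[OF ijk(1) projective_V2[OF ijk(2,3)], of y \<I> "lb (i\<^sup>\<star>) \<I> Z"] y lZ by simp
  also have "lu (i\<^sup>\<star>) ?B (lb (i\<^sup>\<star>) \<I> Z) = Z" by (rule lu_lb[OF s(1) Z])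
  finally show ?thesis using 1 by simp
qed

lemma orth_family_vec: "orth_family i j k u \<Longrightarrow> vec i j k (u n)"
  by (simp add: orth_family_def)

definition dual_vec :: "'i \<Rightarrow> 'i \<Rightarrow> 'i \<Rightarrow> ('o, 'm) arrow \<Rightarrow> ('o, 'm) arrow" where
  "dual_vec i j k v = (1 / T (v \<bullet> adag v)) *\<^sub>a conj_vec i j k v"

lemma dual_vec_arr:
  "\<lbrakk>i \<in> I; j \<in> I; k \<in> I; vec i j k v\<rbrakk> \<Longrightarrow> vec (k\<^sup>\<star>) (j\<^sup>\<star>) (i\<^sup>\<star>) (dual_vec i j k v)"
  using conj_vec_arr by (simp add: dual_vec_def)

lemma orth_family_dual_vec:
  assumes ijk: "i \<in> I" "j \<in> I" "k \<in> I" and u: "orth_family i j k u"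
  shows "orth_family (k\<^sup>\<star>) (j\<^sup>\<star>) (i\<^sup>\<star>) (\<lambda>n. dual_vec i j k (u n))"
proof -
  have v: "vec i j k (u n)" for n using u by (simp add: orth_family_def)
  have s: "i\<^sup>\<star> \<in> I" "j\<^sup>\<star> \<in> I" "k\<^sup>\<star> \<in> I" using ijk by auto
  have dim: "\<delta> (k\<^sup>\<star>) (j\<^sup>\<star>) (i\<^sup>\<star>) = \<delta> i j k" by (rule mult_dim_star[OF ijk, symmetric])
  define b where "b = \<beta> i * \<beta> j * \<beta> k"
  have b: "b \<noteq> 0" using beta_nonzero ijk by (simp add: b_def)
  define c where "c n = 1 / T (u n \<bullet> adag (u n))" for n
  have c: "bar (c n) \<noteq> 0 \<and> c n \<noteq> 0" if "n \<in> {1..\<delta> i j k}" for n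
    using u that by (auto simp: orth_family_def c_def bar_eq_zero_iff)
  have T: "b * T (dual_vec i j k (u n) \<bullet> adag (dual_vec i j k (u m))) =
      c n * bar (c m) * T (u m \<bullet> adag (u n))" for m n
  proof -
    let ?x = "conj_vec i j k (u n)" and ?y = "conj_vec i j k (u m)"
    have x: "vec (k\<^sup>\<star>) (j\<^sup>\<star>) (i\<^sup>\<star>) ?x" and y: "vec (k\<^sup>\<star>) (j\<^sup>\<star>) (i\<^sup>\<star>) ?y" using conj_vec_arr[OF ijk v] by auto
    have "(c n *\<^sub>a ?x) \<bullet> adag (c m *\<^sub>a ?y) = (c n * bar (c m)) *\<^sub>a (?x \<bullet> adag ?y)"
      using x y by (simp add: mult.commute)
    then have e: "T (dual_vec i j k (u n) \<bullet> adag (dual_vec i j k (u m))) = c n * bar (c m) * T (?x \<bullet> adag ?y)"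
      using x y T_scale[OF projective_V3[OF s(3,2,1)], of "?x \<bullet> adag ?y" "c n * bar (c m)"]
      by (simp add: dual_vec_def c_def)
    have "b * (c n * bar (c m) * T (?x \<bullet> adag ?y)) = c n * bar (c m) * (b * T (?x \<bullet> adag ?y))"
      by (simp only: ac_simps)
    then show ?thesis unfolding e using T_conj_vec[OF ijk v v, of n m] unfolding b_def by (simp only:)
  qed
  have "T (dual_vec i j k (u n) \<bullet> adag (dual_vec i j k (u m))) = 0"
    if "m \<in> {1..\<delta> i j k}" "n \<in> {1..\<delta> i j k}" "m \<noteq> n" for m n
  proof -
    have "\<forall>m\<in>{1..\<delta> i j k}. \<forall>n\<in>{1..\<delta> i j k}. m \<noteq> n \<longrightarrow> T (u n \<bullet> adag (u m)) = 0"
      using u unfolding orth_family_def by (elim conjE)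
    then have "T (u m \<bullet> adag (u n)) = 0" using that by simp
    then show ?thesis using T[of n m] b by simp
  qed
  moreover have "T (dual_vec i j k (u n) \<bullet> adag (dual_vec i j k (u n))) \<noteq> 0" if n: "n \<in> {1..\<delta> i j k}" for n
  proof -
    have "T (u n \<bullet> adag (u n)) \<noteq> 0" using u n unfolding orth_family_def by blast
    then show ?thesis using T[of n n] c[OF n] by auto
  qed
  ultimately show ?thesis
    unfolding orth_family_def dim using dual_vec_arr[OF ijk v] by blast
qed

lemma Theta_dual_vec:
  assumes ijk: "i \<in> I" "j \<in> I" "k \<in> I" and u: "orth_family i j k u"
    and mn: "m \<in> {1..\<delta> i j k}" "n \<in> {1..\<delta> i j k}"
  shows "Theta C I V w i j k (mor (dual_vec i j k (u m))) (mor (u n)) = (if m = n then 1 else 0)"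
proof -
  have v: "vec i j k (u n)" for n using u by (simp add: orth_family_def)
  let ?x = "conj_vec i j k (u m)" and ?c = "1 / T (u m \<bullet> adag (u m))"
  have x: "vec (k\<^sup>\<star>) (j\<^sup>\<star>) (i\<^sup>\<star>) ?x" by (rule conj_vec_arr[OF ijk v])
  have f: "functional3 (k\<^sup>\<star>) (j\<^sup>\<star>) (i\<^sup>\<star>) (?c *\<^sub>a ?x) = ?c *\<^sub>a adag (u m)"
    unfolding functional3_conj_vec[OF ijk v, symmetric]
    using x ijk by (simp add: functional3_def rb_def bend_right_def)
  have "Theta C I V w i j k (mor (dual_vec i j k (u m))) (mor (u n)) = T (u n \<bullet> (?c *\<^sub>a adag (u m)))"
    using Theta_eq[OF ijk dual_vec_arr[OF ijk v[of m]] v[of n]] unfolding dual_vec_def f .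
  also have "\<dots> = ?c * T (u n \<bullet> adag (u m))"
    using v[of n] v[of m] T_scale[OF projective_V3[OF ijk], of "u n \<bullet> adag (u m)" ?c] by simp
  also have "\<dots> = (if m = n then 1 else 0)"
    using u mn unfolding orth_family_def by (cases "m = n") simp_all
  finally show ?thesis .
qed

text \<open>The conditions on the bases that involve the triple \<open>(i, j, k)\<close>.\<close>
definition admissible :: "('i \<times> 'i \<times> 'i \<Rightarrow> nat \<Rightarrow> 'm) \<Rightarrow> 'i \<Rightarrow> 'i \<Rightarrow> 'i \<Rightarrow> bool" where
  "admissible Y i j k \<longleftrightarrow>
     basis_family C (mult_space C V i j k) (\<delta> i j k) (Y (i, j, k)) \<and>
     (\<forall>m\<in>{1..\<delta> (k\<^sup>\<star>) (j\<^sup>\<star>) (i\<^sup>\<star>)}. \<forall>n\<in>{1..\<delta> i j k}.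
        Theta C I V w i j k (Y (k\<^sup>\<star>, j\<^sup>\<star>, i\<^sup>\<star>) m) (Y (i, j, k) n) = (if m = n then 1 else 0)) \<and>
     (\<forall>m\<in>{1..\<delta> i j k}. \<forall>n\<in>{1..\<delta> i j k}.
        m \<noteq> n \<longrightarrow> herm i j k (Y (i, j, k) m) (Y (i, j, k) n) = 0) \<and>
     (\<forall>n\<in>{1..\<delta> i j k}. herm i j k (Y (i, j, k) n) (Y (i, j, k) n) \<noteq> 0) \<and>
     (\<forall>n\<in>{1..\<delta> i j k}. rot C V i j k (Y (i, j, k) n) = Y (j, k, i) n)"

lemma admissibleI:
  assumes ijk: "i \<in> I" "j \<in> I" "k \<in> I" and u: "orth_family i j k (A (i, j, k))"
    and th: "\<And>m n. \<lbrakk>m \<in> {1..\<delta> i j k}; n \<in> {1..\<delta> i j k}\<rbrakk> \<Longrightarrow>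
      Theta C I V w i j k (mor (A (k\<^sup>\<star>, j\<^sup>\<star>, i\<^sup>\<star>) m)) (mor (A (i, j, k) n)) = (if m = n then 1 else 0)"
    and r: "\<And>n. n \<in> {1..\<delta> i j k} \<Longrightarrow> arot i j k (A (i, j, k) n) = A (j, k, i) n"
  shows "admissible (\<lambda>t n. mor (A t n)) i j k"
proof -
  have v: "vec i j k (A (i, j, k) n)" for n using u by (simp add: orth_family_def)
  have "rot C V i j k (mor (A (i, j, k) n)) = mor (A (j, k, i) n)" if "n \<in> {1..\<delta> i j k}" for n
    using arg_cong[OF r[OF that], of mor] by (simp add: arot_def)
  then show ?thesis
    unfolding admissible_def mult_dim_star[OF ijk, symmetric]
    using orth_family_basis[OF ijk u] th herm_T[OF v v] u[unfolded orth_family_def] by simp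
qed

definition orbit :: "'i \<Rightarrow> 'i \<Rightarrow> 'i \<Rightarrow> ('i \<times> 'i \<times> 'i) set" where
  "orbit i j k = {(i, j, k), (j, k, i), (k, i, j), (k\<^sup>\<star>, j\<^sup>\<star>, i\<^sup>\<star>), (j\<^sup>\<star>, i\<^sup>\<star>, k\<^sup>\<star>), (i\<^sup>\<star>, k\<^sup>\<star>, j\<^sup>\<star>)}"

text \<open>
  On a free orbit an orthogonal basis is transported by rotation, and its \<open>\<Theta>\<close>-dual is used on the other
  half of the orbit.
\<close>
lemma admissible_on_orbit:
  assumes ijk: "i \<in> I" "j \<in> I" "k \<in> I" and free: "i\<^sup>\<star> \<noteq> i" "j\<^sup>\<star> \<noteq> j" "k\<^sup>\<star> \<noteq> k" "\<not> (i = j \<and> j = k)"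
    and u: "orth_family i j k u"
  shows "\<exists>Y. \<forall>(a, b, c)\<in>orbit i j k. admissible Y a b c"
proof -
  have s: "i\<^sup>\<star> \<in> I" "j\<^sup>\<star> \<in> I" "k\<^sup>\<star> \<in> I" using ijk by auto
  have ss: "(i\<^sup>\<star>)\<^sup>\<star> = i" "(j\<^sup>\<star>)\<^sup>\<star> = j" "(k\<^sup>\<star>)\<^sup>\<star> = k" using ijk by auto
  have free': "\<not> (k\<^sup>\<star> = j\<^sup>\<star> \<and> j\<^sup>\<star> = i\<^sup>\<star>)" using free(4) ss by metis
  define u1 where "u1 n = arot i j k (u n)" for n
  define u2 where "u2 n = arot j k i (u1 n)" for n
  define v where "v n = dual_vec i j k (u n)" for n
  define v1 where "v1 n = arot (k\<^sup>\<star>) (j\<^sup>\<star>) (i\<^sup>\<star>) (v n)" for n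
  define v2 where "v2 n = arot (j\<^sup>\<star>) (i\<^sup>\<star>) (k\<^sup>\<star>) (v1 n)" for n
  have ou1: "orth_family j k i u1" unfolding u1_def by (rule orth_family_arot[OF ijk u])
  have ou2: "orth_family k i j u2" unfolding u2_def by (rule orth_family_arot[OF ijk(2,3,1) ou1])
  have ov: "orth_family (k\<^sup>\<star>) (j\<^sup>\<star>) (i\<^sup>\<star>) v" unfolding v_def by (rule orth_family_dual_vec[OF ijk u])
  have ov1: "orth_family (j\<^sup>\<star>) (i\<^sup>\<star>) (k\<^sup>\<star>) v1" unfolding v1_def by (rule orth_family_arot[OF s(3,2,1) ov])
  have ov2: "orth_family (i\<^sup>\<star>) (k\<^sup>\<star>) (j\<^sup>\<star>) v2" unfolding v2_def by (rule orth_family_arot[OF s(2,1,3) ov1])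
  have vu: "vec i j k (u n)" and vu1: "vec j k i (u1 n)" and vu2: "vec k i j (u2 n)"
    and vv: "vec (k\<^sup>\<star>) (j\<^sup>\<star>) (i\<^sup>\<star>) (v n)" and vv1: "vec (j\<^sup>\<star>) (i\<^sup>\<star>) (k\<^sup>\<star>) (v1 n)"
    and vv2: "vec (i\<^sup>\<star>) (k\<^sup>\<star>) (j\<^sup>\<star>) (v2 n)" for n
    by (rule orth_family_vec[OF u] orth_family_vec[OF ou1] orth_family_vec[OF ou2]
        orth_family_vec[OF ov] orth_family_vec[OF ov1] orth_family_vec[OF ov2])+
  have ru2: "arot k i j (u2 n) = u n" for n unfolding u2_def u1_def by (rule arot_cubed[OF ijk vu])
  have rv2: "arot (i\<^sup>\<star>) (k\<^sup>\<star>) (j\<^sup>\<star>) (v2 n) = v n" for n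
    unfolding v2_def v1_def by (rule arot_cubed[OF s(3,2,1) vv])
  let ?R = "{1..\<delta> i j k}" and ?\<Theta> = "Theta C I V w" and ?e = "\<lambda>m n. if m = n then 1 else (0::'k)"
  have dim: "\<delta> j k i = \<delta> i j k" "\<delta> k i j = \<delta> i j k" "\<delta> (k\<^sup>\<star>) (j\<^sup>\<star>) (i\<^sup>\<star>) = \<delta> i j k"
    "\<delta> (j\<^sup>\<star>) (i\<^sup>\<star>) (k\<^sup>\<star>) = \<delta> i j k" "\<delta> (i\<^sup>\<star>) (k\<^sup>\<star>) (j\<^sup>\<star>) = \<delta> i j k"
    using mult_dim_rot[OF ijk] mult_dim_rot[OF ijk(2,3,1)] mult_dim_star[OF ijk]
      mult_dim_rot[OF s(3,2,1)] mult_dim_rot[OF s(2,1,3)] by simp_all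
  have th0: "?\<Theta> i j k (mor (v m)) (mor (u n)) = ?e m n" if "m \<in> ?R" "n \<in> ?R" for m n
    unfolding v_def by (rule Theta_dual_vec[OF ijk u that])
  have th1: "?\<Theta> j k i (mor (v2 m)) (mor (u1 n)) = ?e m n" if "m \<in> ?R" "n \<in> ?R" for m n
    unfolding u1_def Theta_arot[OF ijk vv2 vu] rv2 by (rule th0[OF that])
  have th2: "?\<Theta> k i j (mor (v1 m)) (mor (u2 n)) = ?e m n" if "m \<in> ?R" "n \<in> ?R" for m n
    unfolding u2_def Theta_arot[OF ijk(2,3,1) vv1 vu1] v2_def[symmetric] by (rule th1[OF that])
  have th3: "?\<Theta> (k\<^sup>\<star>) (j\<^sup>\<star>) (i\<^sup>\<star>) (mor (u m)) (mor (v n)) = ?e m n" if "m \<in> ?R" "n \<in> ?R" for m n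
    using Theta_sym[OF ijk vv vu] th0[OF that(2,1)] by auto
  have th4: "?\<Theta> (j\<^sup>\<star>) (i\<^sup>\<star>) (k\<^sup>\<star>) (mor (u2 m)) (mor (v1 n)) = ?e m n" if "m \<in> ?R" "n \<in> ?R" for m n
    unfolding v1_def using Theta_arot[OF s(3,2,1), unfolded ss, OF vu2 vv] ru2 th3[OF that] by simp
  have th5: "?\<Theta> (i\<^sup>\<star>) (k\<^sup>\<star>) (j\<^sup>\<star>) (mor (u1 m)) (mor (v2 n)) = ?e m n" if "m \<in> ?R" "n \<in> ?R" for m n
    unfolding v2_def using Theta_arot[OF s(2,1,3), unfolded ss, OF vu1 vv1] th4[OF that]
    by (simp add: u2_def[symmetric])
  have triple: "(a, b, c) \<noteq> (a', b', c')" if "a \<noteq> a' \<or> b \<noteq> b' \<or> c \<noteq> c'" for a b c a' b' c' :: 'i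
    using that by auto
  have cyclic: "(a, b, c) \<noteq> (b, c, a) \<and> (a, b, c) \<noteq> (c, a, b) \<and> (b, c, a) \<noteq> (c, a, b)"
    if "\<not> (a = b \<and> b = c)" for a b c :: 'i
    using that by auto
  have distinct: "(i, j, k) \<noteq> (k\<^sup>\<star>, j\<^sup>\<star>, i\<^sup>\<star>)" "(i, j, k) \<noteq> (j\<^sup>\<star>, i\<^sup>\<star>, k\<^sup>\<star>)" "(i, j, k) \<noteq> (i\<^sup>\<star>, k\<^sup>\<star>, j\<^sup>\<star>)"
    "(j, k, i) \<noteq> (k\<^sup>\<star>, j\<^sup>\<star>, i\<^sup>\<star>)" "(j, k, i) \<noteq> (j\<^sup>\<star>, i\<^sup>\<star>, k\<^sup>\<star>)" "(j, k, i) \<noteq> (i\<^sup>\<star>, k\<^sup>\<star>, j\<^sup>\<star>)"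
    "(k, i, j) \<noteq> (k\<^sup>\<star>, j\<^sup>\<star>, i\<^sup>\<star>)" "(k, i, j) \<noteq> (j\<^sup>\<star>, i\<^sup>\<star>, k\<^sup>\<star>)" "(k, i, j) \<noteq> (i\<^sup>\<star>, k\<^sup>\<star>, j\<^sup>\<star>)"
    by (rule triple, use free(1-3) free(1-3)[symmetric] in blast)+
  note distinct = distinct cyclic[OF free(4)] cyclic[OF free']
  define A where "A = (\<lambda>t (n::nat). Arrow \<I> (0::'m) \<I>)((i, j, k) := u, (j, k, i) := u1, (k, i, j) := u2,
    (k\<^sup>\<star>, j\<^sup>\<star>, i\<^sup>\<star>) := v, (j\<^sup>\<star>, i\<^sup>\<star>, k\<^sup>\<star>) := v1, (i\<^sup>\<star>, k\<^sup>\<star>, j\<^sup>\<star>) := v2)"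
  have A: "A (i, j, k) = u" "A (j, k, i) = u1" "A (k, i, j) = u2"
    "A (k\<^sup>\<star>, j\<^sup>\<star>, i\<^sup>\<star>) = v" "A (j\<^sup>\<star>, i\<^sup>\<star>, k\<^sup>\<star>) = v1" "A (i\<^sup>\<star>, k\<^sup>\<star>, j\<^sup>\<star>) = v2"
    unfolding A_def by (simp_all only: fun_upd_apply distinct simp_thms if_True if_False)
  let ?Y = "\<lambda>t n. mor (A t n)"
  have "admissible ?Y i j k"
    by (rule admissibleI[OF ijk]) (use u th0 in \<open>simp_all add: A dim u1_def[symmetric]\<close>)
  moreover have "admissible ?Y j k i"
    by (rule admissibleI[OF ijk(2,3,1)]) (use ou1 th1 in \<open>simp_all add: A dim u2_def[symmetric]\<close>)
  moreover have "admissible ?Y k i j"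
    by (rule admissibleI[OF ijk(3,1,2)]) (use ou2 th2 ru2 in \<open>simp_all add: A dim\<close>)
  moreover have "admissible ?Y (k\<^sup>\<star>) (j\<^sup>\<star>) (i\<^sup>\<star>)"
    by (rule admissibleI[OF s(3,2,1)]) (use ov th3 in \<open>simp_all add: A ss dim v1_def[symmetric]\<close>)
  moreover have "admissible ?Y (j\<^sup>\<star>) (i\<^sup>\<star>) (k\<^sup>\<star>)"
    by (rule admissibleI[OF s(2,1,3)]) (use ov1 th4 in \<open>simp_all add: A ss dim v2_def[symmetric]\<close>)
  moreover have "admissible ?Y (i\<^sup>\<star>) (k\<^sup>\<star>) (j\<^sup>\<star>)"
    by (rule admissibleI[OF s(1,3,2)]) (use ov2 th5 rv2 in \<open>simp_all add: A ss dim\<close>)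
  ultimately have "\<forall>(a, b, c)\<in>orbit i j k. admissible ?Y a b c" by (simp add: orbit_def)
  then show ?thesis by blast
qed

lemma admissible_on_empty_orbit:
  assumes ijk: "i \<in> I" "j \<in> I" "k \<in> I" and z: "\<delta> i j k = 0"
  shows "\<exists>Y. \<forall>(a, b, c)\<in>orbit i j k. admissible Y a b c"
proof -
  have s: "i\<^sup>\<star> \<in> I" "j\<^sup>\<star> \<in> I" "k\<^sup>\<star> \<in> I" using ijk by auto
  have dim: "\<delta> j k i = 0" "\<delta> k i j = 0" "\<delta> (k\<^sup>\<star>) (j\<^sup>\<star>) (i\<^sup>\<star>) = 0"
    "\<delta> (j\<^sup>\<star>) (i\<^sup>\<star>) (k\<^sup>\<star>) = 0" "\<delta> (i\<^sup>\<star>) (k\<^sup>\<star>) (j\<^sup>\<star>) = 0"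
    using z mult_dim_rot[OF ijk] mult_dim_rot[OF ijk(2,3,1)] mult_dim_star[OF ijk]
      mult_dim_rot[OF s(3,2,1)] mult_dim_rot[OF s(2,1,3)] by simp_all
  define A where "A = (\<lambda>(a, b, c) (n::nat). Arrow \<I> (0::'m) (V a \<odot> V b \<odot> V c))"
  have ad: "admissible (\<lambda>t n. mor (A t n)) a b c" if "a \<in> I" "b \<in> I" "c \<in> I" "\<delta> a b c = 0" for a b c
    using that(4) by (intro admissibleI[OF that(1-3)]) (simp_all add: A_def orth_family_def Hom_zero)
  show ?thesis
    by (rule exI[of _ "\<lambda>t n. mor (A t n)"]) (use ad ijk s z dim in \<open>simp add: orbit_def\<close>)
qed

text \<open>The conditions only connect triples of the same orbit, so a solution is chosen for each orbit separately.\<close>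
lemma exists_hermitian_basis:
  assumes zero: "0 \<in> Sing C" and order: "\<And>g. g \<noteq> 0 \<Longrightarrow> g + g = 0 \<or> g + g + g = 0 \<Longrightarrow> g \<in> Sing C"
    and c: "c + bar c \<noteq> 0"
  shows "\<exists>y. hermitian_basic_data C I V dag w y"
proof -
  have ord: "deg i + deg i \<noteq> 0" "deg i + deg i + deg i \<noteq> 0" if "i \<in> I" for i
    using order[of "deg i"] zero deg_generic[OF that] by metis+
  have free: "i\<^sup>\<star> \<noteq> i" if "i \<in> I" for i
    using ord(1)[OF that] deg_star[OF that] by (metis right_minus)
  define P where "P R Y \<longleftrightarrow> (\<forall>(a, b, c)\<in>R. admissible Y a b c)" for R Y
  have ex: "\<exists>Y. P (orbit i j k) Y" if ijk: "i \<in> I" "j \<in> I" "k \<in> I" for i j k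
  proof (cases "\<delta> i j k = 0")
    case True
    then show ?thesis unfolding P_def by (rule admissible_on_empty_orbit[OF ijk])
  next
    case False
    then have "deg i + deg j + deg k = 0" using mult_dim_degree[OF ijk] by metis
    then have "\<not> (i = j \<and> j = k)" using ord(2)[OF ijk(1)] by auto
    moreover obtain u where "orth_family i j k u" by (rule orth_family_exists[OF ijk c])
    ultimately show ?thesis
      unfolding P_def by (intro admissible_on_orbit[OF ijk] free ijk)
  qed
  define G where "G R = (SOME Y. P R Y)" for R
  have G: "P (orbit i j k) (G (orbit i j k))" if "i \<in> I" "j \<in> I" "k \<in> I" for i j k
    unfolding G_def by (rule someI_ex[OF ex[OF that]])
  define y where "y i j k = G (orbit i j k) (i, j, k)" for i j k
  have o: "orbit j k i = orbit i j k" "orbit (k\<^sup>\<star>) (j\<^sup>\<star>) (i\<^sup>\<star>) = orbit i j k"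
    if "i \<in> I" "j \<in> I" "k \<in> I" for i j k
    using that unfolding orbit_def by auto
  have "admissible (\<lambda>(i, j, k). y i j k) i j k" if ijk: "i \<in> I" "j \<in> I" "k \<in> I" for i j k
  proof -
    have "admissible (G (orbit i j k)) i j k" using G[OF ijk] by (simp add: P_def orbit_def)
    then show ?thesis unfolding admissible_def y_def by (simp add: o[OF ijk])
  qed
  then have "hermitian_basic_data C I V dag w y"
    using basic_data unfolding hermitian_basic_data_def admissible_def by simp
  then show ?thesis by blast
qed

end

theorem theorem5p5:
  fixes bar :: "'k::field \<Rightarrow> 'k"
    and C :: "('k, 'o, 'm::ab_group_add, 'g::ab_group_add) relative_cat"
    and dag :: "'m \<Rightarrow> 'm"
    and I :: "'i set"
    and V :: "'i \<Rightarrow> 'o"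
  assumes "relative_hermitian_spherical_category bar C dag"
    and "\<And>g. g \<noteq> 0 \<Longrightarrow> g + g = 0 \<or> g + g + g = 0 \<Longrightarrow> g \<in> Sing C"
    and "\<And>U. generic C U \<Longrightarrow> bar (bmap C U) = bmap C U"
    and "generic_representatives C I V"
  shows "(0 \<in> Sing C \<and> (\<exists>c. c + bar c \<noteq> 0) \<longrightarrow> (\<exists>w y. hermitian_basic_data C I V dag w y)) \<and>
    (\<forall>w y. hermitian_basic_data C I V dag w y \<longrightarrow>
      LW_data bar (Sing C) (\<lambda>g. {i \<in> I. V i \<in> Deg C g}) (dual_label C I V) (mult_dim C V)
        (\<lambda>i. bmap C (V i)) (\<lambda>i. mdim C (V i)) (sixj C I V w y)
        (beta C I V dag w) (gamma C V dag y) \<and>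
      (\<forall>i\<in>I. dag (w i) =
        smult C (beta C I V dag w i) (inv_mor C (V i) (dual C (V (dual_label C I V i))) (w i))))"
proof -
  interpret relative_hermitian_spherical_category bar C dag by (rule assms(1))
  interpret represented_hermitian_category bar C dag I V
    by unfold_locales (rule assms(4))
  have based: "based_category bar C dag I V w" if "basic_data C I V w" for w
    by unfold_locales (rule that)
  show ?thesis
  proof (intro conjI impI allI)
    assume "0 \<in> Sing C \<and> (\<exists>c. c + bar c \<noteq> 0)"
    then obtain c where zero: "0 \<in> Sing C" and c: "c + bar c \<noteq> 0" by blast
    have "dual_label C I V i \<noteq> i" if i: "i \<in> I" for i
    proof
      assume e: "dual_label C I V i = i"
      have "deg i + deg i = 0" using deg_star[OF i] unfolding e by (metis right_minus)
      moreover have "deg i \<noteq> 0" using zero deg_generic[OF i] by auto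
      ultimately show False using assms(2) deg_generic[OF i] by blast
    qed
    then obtain w where "basic_data C I V w" using exists_basic_data by blast
    then interpret based_category bar C dag I V w by (rule based)
    show "\<exists>w y. hermitian_basic_data C I V dag w y"
      using exists_hermitian_basis[OF zero assms(2) c] by blast
  next
    fix w y assume h: "hermitian_basic_data C I V dag w y"
    then have "basic_data C I V w" by (simp add: hermitian_basic_data_def)
    then interpret based_category bar C dag I V w by (rule based)
    interpret hermitian_based_category bar C dag I V w y by unfold_locales (rule h)
    show "LW_data bar (Sing C) (\<lambda>g. {i \<in> I. V i \<in> Deg C g}) (dual_label C I V) (mult_dim C V)
        (\<lambda>i. bmap C (V i)) (\<lambda>i. mdim C (V i)) (sixj C I V w y)
        (beta C I V dag w) (gamma C V dag y)"
      by (rule LW_data[OF assms(3)])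
    show "\<forall>i\<in>I. dag (w i) =
        smult C (beta C I V dag w i) (inv_mor C (V i) (dual C (V (dual_label C I V i))) (w i))"
      using dag_w by blast
  qed
qed

end
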